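(* Consider a sequence, indexed by $p\to\infty$, of rank-one tensor PCA models $\mathcal A=\mathcal T+\mathcal Z\in\mathbb R^{p_1\times p_2\times p_3}$, $\mathcal T=\lambda\,u\otimes v\otimes w$ with unit vectors $u\in\mathbb R^{p_1},v\in\mathbb R^{p_2},w\in\mathbb R^{p_3}$, $\lambda>0$, $\mathcal Z$ with i.i.d. $N(0,\sigma^2)$ entries, and $p_j\asymp p$ for $j=1,2,3$. Let $\hat\lambda,\hat u,\hat v,\hat w,\hat{\mathcal T}$ be the output of Algorithm 4 with $t_{\max}\ge C_1\log p$ for a suitable constant $C_1>0$, with signs chosen so that $\langle\hat u,u\rangle,\langle\hat v,v\rangle,\langle\hat w,w\rangle\ge0$. Suppose $\lambda/\sigma\gg p^{3/4}$. (i) For any deterministic unit vectors $q_1\in\mathbb R^{p_1},q_2\in\mathbb R^{p_2},q_3\in\mathbb R^{p_3}$ (possibly depending on $p$), writing $\tau=\lambda/\sigma$, $$\left(\frac{\langle q_1,\hat u-u\rangle+\frac{p_1\langle q_1,u\rangle}{2\tau^2}}{\sqrt{\frac{p_1\langle q_1,u\rangle^2}{2\tau^4}+\frac{1-\langle q_1,u\rangle^2}{\tau^2}}},\ \frac{\langle q_2,\hat v-v\rangle+\frac{p_2\langle q_2,v\rangle}{2\tau^2}}{\sqrt{\frac{p_2\langle q_2,v\rangle^2}{2\tau^4}+\frac{1-\langle q_2,v\rangle^2}{\tau^2}}},\ \frac{\langle q_3,\hat w-w\rangle+\frac{p_3\langle q_3,w\rangle}{2\tau^2}}{\sqrt{\frac{p_3\langle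 q_3,w\rangle^2}{2\tau^4}+\frac{1-\langle q_3,w\rangle^2}{\tau^2}}}\right)^\top\xrightarrow{d}N(0,I_3).$$ (ii) If for indices $i\in[p_1],j\in[p_2],k\in[p_3]$ we have $|u_i|,|v_j|,|w_k|\ll\min\{\lambda/(\sigma p),1\}$, then $\big(\tfrac{\lambda}{\sigma}(\hat u_i-u_i),\tfrac{\lambda}{\sigma}(\hat v_j-v_j),\tfrac{\lambda}{\sigma}(\hat w_k-w_k)\big)^\top\xrightarrow{d}N(0,I_3)$. (iii) If furthermore $\sigma/\lambda\ll|u_i|,|v_j|,|w_k|\ll\min\{\lambda/(\sigma p),1/\sqrt{\log p}\}$, then $$\frac{\hat{\mathcal T}_{ijk}-\mathcal T_{ijk}}{\sigma\sqrt{\hat u_i^2\hat v_j^2+\hat v_j^2\hat w_k^2+\hat w_k^2\hat u_i^2}}\xrightarrow{d}N(0,1).$$ All convergences are as $p\to\infty$.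
   Context: $u\otimes v\otimes w$ has entries $u_iv_jw_k$; $u_i$ denotes the $i$th entry of $u$. $\mathcal M_j$ is mode-$j$ matricization, and $\mathcal A\times_jx^\top$ contracts mode $j$ with vector $x$. $p=\max_jp_j$, $p_j\asymp p$ means comparable up to constant factors; $a\ll b$ means $a/b\to0$ and $a\gg b$ means $a/b\to\infty$ as $p\to\infty$; the indices $i,j,k$, vectors and $\lambda,\sigma$ may depend on $p$. Algorithm 4: $\hat u^{(0)},\hat v^{(0)},\hat w^{(0)}$ are the leading left singular vectors of $\mathcal M_1(\mathcal A),\mathcal M_2(\mathcal A),\mathcal M_3(\mathcal A)$; for $t=0,1,\dots,t_{\max}-1$, $\hat u^{(t+1)}$ is the normalization of $\mathcal A\times_2\hat v^{(t)\top}\times_3\hat w^{(t)\top}$, $\hat v^{(t+1)}$ of $\mathcal A\times_1\hat u^{(t)\top}\times_3\hat w^{(t)\top}$, $\hat w^{(t+1)}$ of $\mathcal A\times_1\hat u^{(t)\top}\times_2\hat v^{(t)\top}$; then $\hat u=\hat u^{(t_{\max})}$, etc., $\hat\lambda=\mathcal A\times_1\hat u^\top\times_2\hat v^\top\times_3\hat w^\top$ and $\hat{\mathcal T}=\hat\lambda\,\hat u\otimes\hat v\otimes\hat w$ (sign flips of $\hat u,\hat v,\hat w$ do not change $\hat{\mathcal T}$). *)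

theory Defs
  imports "HOL-Probability.Probability"
begin

text \<open>Vectors in R^d are represented as functions nat => real (only entries i < d matter);
  order-3 tensors in R^(d1 x d2 x d3) as functions nat => nat => nat => real
  (only entries i < d1, j < d2, k < d3 matter).\<close>

type_synonym vec = "nat \<Rightarrow> real"
type_synonym tensor3 = "nat \<Rightarrow> nat \<Rightarrow> nat \<Rightarrow> real"

definition inner_d :: "nat \<Rightarrow> vec \<Rightarrow> vec \<Rightarrow> real" where
  "inner_d d x y = (\<Sum>i<d. x i * y i)"

definition vnorm :: "nat \<Rightarrow> vec \<Rightarrow> real" where
  "vnorm d x = sqrt (\<Sum>i<d. (x i)^2)"

definition normalize_d :: "nat \<Rightarrow> vec \<Rightarrow> vec" where
  "normalize_d d x = (\<lambda>i. x i / vnorm d x)"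

text \<open>Mode-1 matricization M_1(A) is the d1 x (d2 d3) matrix with entries A i j k.
  x is a leading left singular vector of it iff x is a unit vector maximizing
  the Euclidean norm of M_1(A)^T x (i.e. attaining the top singular value).\<close>
definition lead_lsv1 :: "nat \<Rightarrow> nat \<Rightarrow> nat \<Rightarrow> tensor3 \<Rightarrow> vec \<Rightarrow> bool" where
  "lead_lsv1 d1 d2 d3 A x \<longleftrightarrow> vnorm d1 x = 1 \<and>
     (\<forall>y. vnorm d1 y = 1 \<longrightarrow>
        (\<Sum>j<d2. \<Sum>k<d3. (\<Sum>i<d1. y i * A i j k)^2) \<le> (\<Sum>j<d2. \<Sum>k<d3. (\<Sum>i<d1. x i * A i j k)^2))"

definition lead_lsv_mode1 :: "nat \<Rightarrow> nat \<Rightarrow> nat \<Rightarrow> tensor3 \<Rightarrow> vec \<Rightarrow> bool" where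
  "lead_lsv_mode1 d1 d2 d3 A x = lead_lsv1 d1 d2 d3 A x"
definition lead_lsv_mode2 :: "nat \<Rightarrow> nat \<Rightarrow> nat \<Rightarrow> tensor3 \<Rightarrow> vec \<Rightarrow> bool" where
  "lead_lsv_mode2 d1 d2 d3 A x = lead_lsv1 d2 d1 d3 (\<lambda>j i k. A i j k) x"
definition lead_lsv_mode3 :: "nat \<Rightarrow> nat \<Rightarrow> nat \<Rightarrow> tensor3 \<Rightarrow> vec \<Rightarrow> bool" where
  "lead_lsv_mode3 d1 d2 d3 A x = lead_lsv1 d3 d1 d2 (\<lambda>k i j. A i j k) x"

definition contr1 :: "nat \<Rightarrow> nat \<Rightarrow> nat \<Rightarrow> tensor3 \<Rightarrow> vec \<Rightarrow> vec \<Rightarrow> vec" where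
  "contr1 d1 d2 d3 A v w = (\<lambda>i. \<Sum>j<d2. \<Sum>k<d3. A i j k * v j * w k)"
definition contr2 :: "nat \<Rightarrow> nat \<Rightarrow> nat \<Rightarrow> tensor3 \<Rightarrow> vec \<Rightarrow> vec \<Rightarrow> vec" where
  "contr2 d1 d2 d3 A u w = (\<lambda>j. \<Sum>i<d1. \<Sum>k<d3. A i j k * u i * w k)"
definition contr3 :: "nat \<Rightarrow> nat \<Rightarrow> nat \<Rightarrow> tensor3 \<Rightarrow> vec \<Rightarrow> vec \<Rightarrow> vec" where
  "contr3 d1 d2 d3 A u v = (\<lambda>k. \<Sum>i<d1. \<Sum>j<d2. A i j k * u i * v j)"

fun power_iter :: "nat \<Rightarrow> nat \<Rightarrow> nat \<Rightarrow> tensor3 \<Rightarrow> vec \<Rightarrow> vec \<Rightarrow> vec \<Rightarrow> nat \<Rightarrow> vec \<times> vec \<times> vec" where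
  "power_iter d1 d2 d3 A u0 v0 w0 0 = (u0, v0, w0)"
| "power_iter d1 d2 d3 A u0 v0 w0 (Suc t) =
     (case power_iter d1 d2 d3 A u0 v0 w0 t of (u, v, w) \<Rightarrow>
        (normalize_d d1 (contr1 d1 d2 d3 A v w),
         normalize_d d2 (contr2 d1 d2 d3 A u w),
         normalize_d d3 (contr3 d1 d2 d3 A u v)))"

definition sign_align :: "nat \<Rightarrow> vec \<Rightarrow> vec \<Rightarrow> vec" where
  "sign_align d x r = (if inner_d d x r < 0 then (\<lambda>i. - x i) else x)"

definition alg4_uvw :: "nat \<Rightarrow> nat \<Rightarrow> nat \<Rightarrow> tensor3 \<Rightarrow> vec \<Rightarrow> vec \<Rightarrow> vec \<Rightarrow> nat
    \<Rightarrow> vec \<Rightarrow> vec \<Rightarrow> vec \<Rightarrow> vec \<times> vec \<times> vec" where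
  "alg4_uvw d1 d2 d3 A u0 v0 w0 tmax u v w =
     (case power_iter d1 d2 d3 A u0 v0 w0 tmax of (a, b, c) \<Rightarrow>
        (sign_align d1 a u, sign_align d2 b v, sign_align d3 c w))"

definition lam_hat :: "nat \<Rightarrow> nat \<Rightarrow> nat \<Rightarrow> tensor3 \<Rightarrow> vec \<Rightarrow> vec \<Rightarrow> vec \<Rightarrow> real" where
  "lam_hat d1 d2 d3 A a b c = (\<Sum>i<d1. \<Sum>j<d2. \<Sum>k<d3. A i j k * a i * b j * c k)"

definition obs :: "real \<Rightarrow> vec \<Rightarrow> vec \<Rightarrow> vec \<Rightarrow> tensor3 \<Rightarrow> tensor3" where
  "obs lam u v w Z = (\<lambda>i j k. lam * u i * v j * w k + Z i j k)"

definition conv_distr :: "(nat \<Rightarrow> 'a measure) \<Rightarrow> (nat \<Rightarrow> 'a \<Rightarrow> 'b::topological_space) \<Rightarrow> 'b measure \<Rightarrow> bool" where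
  "conv_distr M X mu \<longleftrightarrow> (\<forall>n. X n \<in> borel_measurable (M n)) \<and>
     (\<forall>f :: 'b \<Rightarrow> real. continuous_on UNIV f \<longrightarrow> bounded (range f) \<longrightarrow>
        (\<lambda>n. integral\<^sup>L (M n) (\<lambda>\<omega>. f (X n \<omega>))) \<longlonglongrightarrow> integral\<^sup>L mu f)"

definition N01 :: "real measure" where
  "N01 = density lborel (\<lambda>x. ennreal (std_normal_density x))"

definition N3 :: "(real \<times> real \<times> real) measure" where
  "N3 = N01 \<Otimes>\<^sub>M (N01 \<Otimes>\<^sub>M N01)"

definition clt_stat :: "nat \<Rightarrow> real \<Rightarrow> vec \<Rightarrow> vec \<Rightarrow> vec \<Rightarrow> real" where
  "clt_stat d tau q x xhat =
     (inner_d d q (\<lambda>i. xhat i - x i) + real d * inner_d d q x / (2 * tau^2)) /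
     sqrt (real d * (inner_d d q x)^2 / (2 * tau^4) + (1 - (inner_d d q x)^2) / tau^2)"

definition pmax :: "nat \<Rightarrow> nat \<Rightarrow> nat \<Rightarrow> real" where
  "pmax d1 d2 d3 = real (max d1 (max d2 d3))"

text \<open>Standing assumptions of the rank-one tensor PCA model sequence (indexed by n, with
  p = p(n) -> infinity), together with a (measurable) choice of the leading singular vectors
  used to initialise Algorithm 4.\<close>
definition tpca_setting ::
  "real \<Rightarrow> (nat \<Rightarrow> nat) \<Rightarrow> (nat \<Rightarrow> nat) \<Rightarrow> (nat \<Rightarrow> nat) \<Rightarrow> (nat \<Rightarrow> real) \<Rightarrow> (nat \<Rightarrow> real)
   \<Rightarrow> (nat \<Rightarrow> vec) \<Rightarrow> (nat \<Rightarrow> vec) \<Rightarrow> (nat \<Rightarrow> vec) \<Rightarrow> (nat \<Rightarrow> 'a measure) \<Rightarrow> (nat \<Rightarrow> 'a \<Rightarrow> tensor3)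
   \<Rightarrow> (nat \<Rightarrow> tensor3 \<Rightarrow> vec) \<Rightarrow> (nat \<Rightarrow> tensor3 \<Rightarrow> vec) \<Rightarrow> (nat \<Rightarrow> tensor3 \<Rightarrow> vec) \<Rightarrow> bool" where
  "tpca_setting c0 p1 p2 p3 lam sig u v w M Z g1 g2 g3 \<longleftrightarrow>
     (\<forall>n. 0 < p1 n \<and> 0 < p2 n \<and> 0 < p3 n) \<and>
     (\<forall>n. c0 * pmax (p1 n) (p2 n) (p3 n) \<le> real (p1 n) \<and>
          c0 * pmax (p1 n) (p2 n) (p3 n) \<le> real (p2 n) \<and>
          c0 * pmax (p1 n) (p2 n) (p3 n) \<le> real (p3 n)) \<and>
     filterlim (\<lambda>n. pmax (p1 n) (p2 n) (p3 n)) at_top sequentially \<and>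
     (\<forall>n. 0 < lam n \<and> 0 < sig n) \<and>
     (\<forall>n. vnorm (p1 n) (u n) = 1 \<and> vnorm (p2 n) (v n) = 1 \<and> vnorm (p3 n) (w n) = 1) \<and>
     (\<forall>n. prob_space (M n)) \<and>
     (\<forall>n. prob_space.indep_vars (M n) (\<lambda>_. borel) (\<lambda>(i, j, k) \<omega>. Z n \<omega> i j k)
             ({..<p1 n} \<times> {..<p2 n} \<times> {..<p3 n})) \<and>
     (\<forall>n i j k. i < p1 n \<longrightarrow> j < p2 n \<longrightarrow> k < p3 n \<longrightarrow>
        distributed (M n) lborel (\<lambda>\<omega>. Z n \<omega> i j k) (\<lambda>x. ennreal (normal_density 0 (sig n) x))) \<and>
     (\<forall>n A. lead_lsv_mode1 (p1 n) (p2 n) (p3 n) A (g1 n A) \<and>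
            lead_lsv_mode2 (p1 n) (p2 n) (p3 n) A (g2 n A) \<and>
            lead_lsv_mode3 (p1 n) (p2 n) (p3 n) A (g3 n A)) \<and>
     (\<forall>n i. (i < p1 n \<longrightarrow> (\<lambda>\<omega>. g1 n (obs (lam n) (u n) (v n) (w n) (Z n \<omega>)) i) \<in> borel_measurable (M n)) \<and>
            (i < p2 n \<longrightarrow> (\<lambda>\<omega>. g2 n (obs (lam n) (u n) (v n) (w n) (Z n \<omega>)) i) \<in> borel_measurable (M n)) \<and>
            (i < p3 n \<longrightarrow> (\<lambda>\<omega>. g3 n (obs (lam n) (u n) (v n) (w n) (Z n \<omega>)) i) \<in> borel_measurable (M n)))"

definition est :: "(nat \<Rightarrow> nat) \<Rightarrow> (nat \<Rightarrow> nat) \<Rightarrow> (nat \<Rightarrow> nat) \<Rightarrow> (nat \<Rightarrow> real)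
   \<Rightarrow> (nat \<Rightarrow> vec) \<Rightarrow> (nat \<Rightarrow> vec) \<Rightarrow> (nat \<Rightarrow> vec) \<Rightarrow> (nat \<Rightarrow> 'a \<Rightarrow> tensor3)
   \<Rightarrow> (nat \<Rightarrow> tensor3 \<Rightarrow> vec) \<Rightarrow> (nat \<Rightarrow> tensor3 \<Rightarrow> vec) \<Rightarrow> (nat \<Rightarrow> tensor3 \<Rightarrow> vec)
   \<Rightarrow> (nat \<Rightarrow> nat) \<Rightarrow> nat \<Rightarrow> 'a \<Rightarrow> vec \<times> vec \<times> vec" where
  "est p1 p2 p3 lam u v w Z g1 g2 g3 tmax n \<omega> =
     (let A = obs (lam n) (u n) (v n) (w n) (Z n \<omega>) in
      alg4_uvw (p1 n) (p2 n) (p3 n) A (g1 n A) (g2 n A) (g3 n A) (tmax n) (u n) (v n) (w n))"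

end

theory Submission
  imports Defs
begin

text \<open>
  Write the observation as \<open>\<lambda> (u \<otimes> v \<otimes> w + E)\<close> with \<open>E = Z / \<lambda>\<close>.  With high probability the injective
  norm of \<open>E\<close> is at most \<open>e = 48 \<surd>p / \<tau>\<close> (union bound over lattice points in a ball), and the
  matricizations of the noise satisfy \<open>\<bar>E E\<^sup>T - c I\<bar> = O(p\<^sup>3\<^sup>/\<^sup>2 / \<tau>\<^sup>2) = o(1)\<close>, so the spectral
  initialization is correlated with the truth.  One sweep of the power iteration makes the errors
  \<open>O(e)\<close>, the second determines them up to \<open>O(e\<^sup>2)\<close> and the third up to \<open>O(e\<^sup>3)\<close>, which is negligible in
  the limit theorems because \<open>p\<^sup>3\<^sup>/\<^sup>2 / \<tau>\<^sup>2 \<longlonglongrightarrow> 0\<close>.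

  Rotate the noise to orthonormal bases starting with \<open>u\<close>, \<open>v\<close>, \<open>w\<close>; the coordinates
  \<open>\<zeta>\<close> are again i.i.d. standard normal.  Then \<open>\<tau> \<langle>f\<^sub>1, uh\<rangle> \<approx> \<zeta>(1,0,0)\<close> and
  \<open>\<langle>u, uh\<rangle> - 1 \<approx> - \<Sum>\<^sub>s \<zeta>(s,0,0)\<^sup>2 / (2 \<tau>\<^sup>2)\<close>.  The three modes thus depend on disjoint
  blocks of \<open>\<zeta>\<close>, and each standardized functional is a normalized mixture of one normal and an
  independent centred chi-square variable, whose characteristic function converges to the Gaussian one.
  The entries of the tensor estimate follow by linearizing the product.
\<close>

section \<open>Multilinear forms and sweeps of the power iteration\<close>

text \<open>Norm bounds alone cannot finish: rescaled by \<tau>, the quadratic term is of order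
  p/\<tau>, which may diverge when \<tau> only exceeds p^(3/4). It is therefore kept explicitly, as
  \<open>second_order\<close>, and estimated by its variance: in rotated coordinates it is a sum of
  squarefree monomials, about p of them for a fixed direction and p^2 for the radial part. Norms
  control only the remainder, of order e^3 tangentially and e^4 radially; multiplied by \<tau> and
  by \<tau>^2/sqrt p respectively, both are multiples of p^(3/2)/\<tau>^2. That quantity is also the
  fluctuation of the noise covariance, whose mean, of order p^2/\<tau>^2, may be unbounded but
  cancels, being the same in every direction. An iterate is written as a multiple of u + x with x
  orthogonal to u. Each sweep is then an exact rational map of the noise, and neither normalization
  nor sign has to be expanded before the end. Failure events are only required to lie in small
  measurable sets, so predicates quantified over all vectors can be used without discussing their
  measurability.\<close>

lemma inner_d_commute: "inner_d d x y = inner_d d y x"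
  by (simp add: inner_d_def mult.commute)

lemma inner_d_add_left: "inner_d d (\<lambda>i. x i + y i) z = inner_d d x z + inner_d d y z"
  by (simp add: inner_d_def sum.distrib algebra_simps)
lemma inner_d_add_right: "inner_d d z (\<lambda>i. x i + y i) = inner_d d z x + inner_d d z y"
  by (simp add: inner_d_def sum.distrib algebra_simps)
lemma inner_d_diff_left: "inner_d d (\<lambda>i. x i - y i) z = inner_d d x z - inner_d d y z"
  by (simp add: inner_d_def sum_subtractf algebra_simps)
lemma inner_d_diff_right: "inner_d d z (\<lambda>i. x i - y i) = inner_d d z x - inner_d d z y"
  by (simp add: inner_d_def sum_subtractf algebra_simps)
lemma inner_d_scale_left: "inner_d d (\<lambda>i. c * x i) z = c * inner_d d x z"
  by (simp add: inner_d_def sum_distrib_left algebra_simps)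
lemma inner_d_scale_right: "inner_d d z (\<lambda>i. c * x i) = c * inner_d d z x"
  by (simp add: inner_d_def sum_distrib_left algebra_simps)
lemma inner_d_divide_right: "inner_d d z (\<lambda>i. x i / c) = inner_d d z x / c"
  by (simp add: inner_d_def sum_divide_distrib algebra_simps)
lemmas inner_d_linear = inner_d_add_left inner_d_add_right inner_d_diff_left inner_d_diff_right
  inner_d_scale_left inner_d_scale_right inner_d_divide_right

lemma inner_d_cong: "(\<And>i. i < d \<Longrightarrow> x i = x' i) \<Longrightarrow> (\<And>i. i < d \<Longrightarrow> y i = y' i) \<Longrightarrow> inner_d d x y = inner_d d x' y'"
  by (simp add: inner_d_def)

lemma vnorm_L2: "vnorm d x = L2_set x {..<d}"
  by (simp add: vnorm_def L2_set_def)
lemma vnorm_nonneg [simp]: "0 \<le> vnorm d x"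
  by (simp add: vnorm_L2)
lemma vnorm_square: "(vnorm d x)\<^sup>2 = inner_d d x x"
  by (simp add: vnorm_def inner_d_def power2_eq_square sum_nonneg)
lemma inner_d_self_nonneg [simp]: "0 \<le> inner_d d x x"
  by (simp flip: vnorm_square)
lemma vnorm_cong: "(\<And>i. i < d \<Longrightarrow> x i = x' i) \<Longrightarrow> vnorm d x = vnorm d x'"
  by (simp add: vnorm_def)
lemma inner_d_CS: "\<bar>inner_d d x y\<bar> \<le> vnorm d x * vnorm d y"
proof -
  have "\<bar>inner_d d x y\<bar> \<le> (\<Sum>i<d. \<bar>x i\<bar> * \<bar>y i\<bar>)"
    unfolding inner_d_def by (rule order_trans[OF sum_abs]) (simp add: abs_mult)
  also have "\<dots> \<le> vnorm d x * vnorm d y"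
    unfolding vnorm_L2 by (rule L2_set_mult_ineq)
  finally show ?thesis .
qed
lemma vnorm_triangle: "vnorm d (\<lambda>i. x i + y i) \<le> vnorm d x + vnorm d y"
  unfolding vnorm_L2 by (rule L2_set_triangle_ineq)
lemma vnorm_scale: "vnorm d (\<lambda>i. c * x i) = \<bar>c\<bar> * vnorm d x"
  by (simp add: vnorm_def power_mult_distrib real_sqrt_mult flip: sum_distrib_left)
text \<open>The supremum over q is attained at q = x, which is all the proof uses. Estimates of
  vectors below are reduced in this way to estimates of scalars, which are values of a trilinear
  form.\<close>

lemma vnorm_le_dualI:
  assumes "\<And>q. inner_d d q x \<le> K * vnorm d q" "0 \<le> K"
  shows "vnorm d x \<le> K"
proof (cases "vnorm d x = 0")
  case False
  have "(vnorm d x)\<^sup>2 \<le> K * vnorm d x"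
    using assms(1)[of x] by (simp add: vnorm_square)
  with False show ?thesis
    by (metis mult_right_le_imp_le power2_eq_square vnorm_nonneg less_le)
qed (use assms in simp)

lemma vnorm_orthogonal_sum:
  assumes "inner_d d u x = 0" "vnorm d u = 1"
  shows "vnorm d (\<lambda>i. u i + x i) = sqrt (1 + (vnorm d x)\<^sup>2)"
proof -
  have "(vnorm d (\<lambda>i. u i + x i))\<^sup>2 = 1 + (vnorm d x)\<^sup>2"
    using assms vnorm_square[of d u]
    by (simp add: vnorm_square inner_d_linear inner_d_commute[of d x u])
  then show ?thesis by (metis real_sqrt_unique vnorm_nonneg)
qed

lemma vnorm_project_le:
  assumes "vnorm d u = 1"
  shows "vnorm d (\<lambda>i. q i - inner_d d q u * u i) \<le> vnorm d q"
proof -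
  have "(vnorm d (\<lambda>i. q i - inner_d d q u * u i))\<^sup>2 = (vnorm d q)\<^sup>2 - (inner_d d q u)\<^sup>2"
    using assms vnorm_square[of d u]
    by (simp add: vnorm_square inner_d_linear inner_d_commute[of d u q]) (simp add: power2_eq_square)
  then have "(vnorm d (\<lambda>i. q i - inner_d d q u * u i))\<^sup>2 \<le> (vnorm d q)\<^sup>2" by simp
  then show ?thesis by (rule power2_le_imp_le) simp
qed

section \<open>The trilinear form of a tensor and its injective norm\<close>

lemma lam_hat_add1: "lam_hat d1 d2 d3 A (\<lambda>i. a i + a' i) b c = lam_hat d1 d2 d3 A a b c + lam_hat d1 d2 d3 A a' b c"
  by (simp add: lam_hat_def sum.distrib algebra_simps)
lemma lam_hat_add2: "lam_hat d1 d2 d3 A a (\<lambda>i. b i + b' i) c = lam_hat d1 d2 d3 A a b c + lam_hat d1 d2 d3 A a b' c"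
  by (simp add: lam_hat_def sum.distrib algebra_simps)
lemma lam_hat_add3: "lam_hat d1 d2 d3 A a b (\<lambda>i. c i + c' i) = lam_hat d1 d2 d3 A a b c + lam_hat d1 d2 d3 A a b c'"
  by (simp add: lam_hat_def sum.distrib algebra_simps)
lemma lam_hat_diff1: "lam_hat d1 d2 d3 A (\<lambda>i. a i - a' i) b c = lam_hat d1 d2 d3 A a b c - lam_hat d1 d2 d3 A a' b c"
  by (simp add: lam_hat_def sum_subtractf algebra_simps)
lemma lam_hat_diff2: "lam_hat d1 d2 d3 A a (\<lambda>i. b i - b' i) c = lam_hat d1 d2 d3 A a b c - lam_hat d1 d2 d3 A a b' c"
  by (simp add: lam_hat_def sum_subtractf algebra_simps)
lemma lam_hat_diff3: "lam_hat d1 d2 d3 A a b (\<lambda>i. c i - c' i) = lam_hat d1 d2 d3 A a b c - lam_hat d1 d2 d3 A a b c'"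
  by (simp add: lam_hat_def sum_subtractf algebra_simps)
lemma lam_hat_scale1: "lam_hat d1 d2 d3 A (\<lambda>i. r * a i) b c = r * lam_hat d1 d2 d3 A a b c"
  by (simp add: lam_hat_def sum_distrib_left algebra_simps)
lemma lam_hat_scale2: "lam_hat d1 d2 d3 A a (\<lambda>i. r * b i) c = r * lam_hat d1 d2 d3 A a b c"
  by (simp add: lam_hat_def sum_distrib_left algebra_simps)
lemma lam_hat_scale3: "lam_hat d1 d2 d3 A a b (\<lambda>i. r * c i) = r * lam_hat d1 d2 d3 A a b c"
  by (simp add: lam_hat_def sum_distrib_left algebra_simps)
lemmas lam_hat_linear = lam_hat_add1 lam_hat_add2 lam_hat_add3 lam_hat_diff1 lam_hat_diff2 lam_hat_diff3
  lam_hat_scale1 lam_hat_scale2 lam_hat_scale3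

text \<open>A power step enters only through \<open>contr1\<close>; this identity turns each inner
  product with it into a value of \<open>lam_hat\<close>, for which multilinearity and one norm
  bound suffice.\<close>

lemma inner_d_contr1: "inner_d d1 a (contr1 d1 d2 d3 A b c) = lam_hat d1 d2 d3 A a b c"
  by (simp add: inner_d_def contr1_def lam_hat_def sum_distrib_left algebra_simps)

lemma lam_hat_cong:
  assumes "\<And>i. i < d1 \<Longrightarrow> a i = a' i" "\<And>i. i < d2 \<Longrightarrow> b i = b' i" "\<And>i. i < d3 \<Longrightarrow> c i = c' i"
  shows "lam_hat d1 d2 d3 A a b c = lam_hat d1 d2 d3 A a' b' c'"
  unfolding lam_hat_def by (intro sum.cong) (auto simp: assms)

lemma lam_hat_swap12: "lam_hat d2 d1 d3 (\<lambda>j i k. A i j k) b a c = lam_hat d1 d2 d3 A a b c"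
  unfolding lam_hat_def by (subst sum.swap) (simp add: algebra_simps)

lemma lam_hat_swap23: "lam_hat d1 d3 d2 (\<lambda>i k j. A i j k) a c b = lam_hat d1 d2 d3 A a b c"
  unfolding lam_hat_def by (rule sum.cong[OF refl], subst sum.swap) (simp add: algebra_simps)

lemma lam_hat_rotate: "lam_hat d3 d1 d2 (\<lambda>k i j. A i j k) c a b = lam_hat d1 d2 d3 A a b c"
  using lam_hat_swap12[of d3 d1 d2 "\<lambda>i k j. A i j k" c a b] lam_hat_swap23[of d1 d3 d2 A a c b]
  by simp

lemma contr1_swap23: "contr1 d1 d3 d2 (\<lambda>i k j. A i j k) c b = contr1 d1 d2 d3 A b c"
  unfolding contr1_def by (rule ext, subst sum.swap) (simp add: algebra_simps)

text \<open>An upper bound \<open>e\<close> for the injective norm. Quantifying over all vectors,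
  not only unit ones, allows differences of approximations to be inserted directly.\<close>

definition tri_bound :: "nat \<Rightarrow> nat \<Rightarrow> nat \<Rightarrow> tensor3 \<Rightarrow> real \<Rightarrow> bool" where
  "tri_bound d1 d2 d3 E e \<longleftrightarrow>
     (\<forall>a b c. \<bar>lam_hat d1 d2 d3 E a b c\<bar> \<le> e * (vnorm d1 a * vnorm d2 b * vnorm d3 c))"

lemma tri_boundD: "tri_bound d1 d2 d3 E e \<Longrightarrow> \<bar>lam_hat d1 d2 d3 E a b c\<bar> \<le> e * (vnorm d1 a * vnorm d2 b * vnorm d3 c)"
  by (simp add: tri_bound_def)

lemma tri_bound_leD:
  assumes "tri_bound d1 d2 d3 E e" "0 \<le> e" "vnorm d1 a \<le> ra" "vnorm d2 b \<le> rb" "vnorm d3 c \<le> rc"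
  shows "\<bar>lam_hat d1 d2 d3 E a b c\<bar> \<le> e * (ra * rb * rc)"
proof -
  have "0 \<le> ra" "0 \<le> rb" "0 \<le> rc"
    by (rule order_trans[OF vnorm_nonneg], rule assms)+
  then have "e * (vnorm d1 a * vnorm d2 b * vnorm d3 c) \<le> e * (ra * rb * rc)"
    using assms by (intro mult_left_mono mult_mono) auto
  then show ?thesis using tri_boundD[OF assms(1), of a b c] by linarith
qed

lemma tri_bound_swap12: "tri_bound d1 d2 d3 E e \<Longrightarrow> tri_bound d2 d1 d3 (\<lambda>j i k. E i j k) e"
  by (auto simp: tri_bound_def lam_hat_swap12[of d2 d1 d3 E] mult.commute mult.left_commute)

lemma tri_bound_rotate: "tri_bound d1 d2 d3 E e \<Longrightarrow> tri_bound d3 d1 d2 (\<lambda>k i j. E i j k) e"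
  by (auto simp: tri_bound_def lam_hat_rotate[of d3 d1 d2 E] mult.commute mult.left_commute)

text \<open>A chart of projective space around the line of \<open>u\<close>: \<open>x\<close> is the
  slope of the line spanned by \<open>y\<close>. The nonzero scale \<open>s\<close> stays free and
  absorbs both the normalization and the sign, which is undetermined for singular vectors.\<close>

definition tang :: "nat \<Rightarrow> vec \<Rightarrow> vec \<Rightarrow> vec \<Rightarrow> bool" where
  "tang d u x y \<longleftrightarrow> inner_d d u x = 0 \<and> (\<exists>s. s \<noteq> 0 \<and> (\<forall>i<d. y i = s * (u i + x i)))"

text \<open>If \<open>b\<close> and \<open>c\<close> have unit components along the true vectors v
  and w, the contraction of the signal is exactly \<open>u\<close>, and the noise adds E(b, c) to
  it. Splitting off the component \<open>1 + lam_hat d1 d2 d3 E u b c\<close> along \<open>u\<close>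
  and dividing by it yields the new slope.\<close>

definition tan_step :: "nat \<Rightarrow> nat \<Rightarrow> nat \<Rightarrow> tensor3 \<Rightarrow> vec \<Rightarrow> vec \<Rightarrow> vec \<Rightarrow> vec" where
  "tan_step d1 d2 d3 E u b c = (\<lambda>i. (contr1 d1 d2 d3 E b c i - lam_hat d1 d2 d3 E u b c * u i)
      / (1 + lam_hat d1 d2 d3 E u b c))"

text \<open>The slope after a step taken at the true vectors, with the denominator 1 + E(u, v, w)
  dropped: the part of first order in E.\<close>

definition tan0 :: "nat \<Rightarrow> nat \<Rightarrow> nat \<Rightarrow> tensor3 \<Rightarrow> vec \<Rightarrow> vec \<Rightarrow> vec \<Rightarrow> vec" where
  "tan0 d1 d2 d3 E u v w = (\<lambda>i. contr1 d1 d2 d3 E v w i - lam_hat d1 d2 d3 E u v w * u i)"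

lemma tan0_swap23: "tan0 d1 d3 d2 (\<lambda>i k j. E i j k) u w v = tan0 d1 d2 d3 E u v w"
  by (simp add: tan0_def contr1_swap23[of d1 d3 d2 E] lam_hat_swap23[of d1 d3 d2 E])

lemma inner_tan_step:
  "1 + lam_hat d1 d2 d3 E u b c \<noteq> 0 \<Longrightarrow>
   (1 + lam_hat d1 d2 d3 E u b c) * inner_d d1 q (tan_step d1 d2 d3 E u b c)
     = lam_hat d1 d2 d3 E q b c - lam_hat d1 d2 d3 E u b c * inner_d d1 q u"
  by (simp add: tan_step_def inner_d_linear inner_d_contr1)

lemma inner_tan0: "inner_d d1 q (tan0 d1 d2 d3 E u v w) = lam_hat d1 d2 d3 E q v w - lam_hat d1 d2 d3 E u v w * inner_d d1 q u"
  by (simp add: tan0_def inner_d_linear inner_d_contr1)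

lemma tan0_orthogonal: "vnorm d1 u = 1 \<Longrightarrow> inner_d d1 u (tan0 d1 d2 d3 E u v w) = 0"
  using vnorm_square[of d1 u] by (simp add: inner_tan0)

text \<open>Since \<open>tan0\<close> is an orthogonal projection of the contracted noise, pairing
  it with that contraction returns its own square. Testing with \<open>tan0\<close> therefore
  reveals the radial loss.\<close>

lemma tan0_norm_sq:
  assumes "vnorm d1 u = 1"
  shows "lam_hat d1 d2 d3 E (tan0 d1 d2 d3 E u v w) v w = (vnorm d1 (tan0 d1 d2 d3 E u v w))\<^sup>2"
  using inner_tan0[of d1 "tan0 d1 d2 d3 E u v w" d2 d3 E u v w] tan0_orthogonal[OF assms, of d2 d3 E v w]
  by (simp add: vnorm_square inner_d_commute[of d1 _ u])

lemma tan0_norm_le: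
  assumes "tri_bound d1 d2 d3 E e" "0 \<le> e" "vnorm d1 u = 1" "vnorm d2 v = 1" "vnorm d3 w = 1"
  shows "vnorm d1 (tan0 d1 d2 d3 E u v w) \<le> e"
proof (cases "vnorm d1 (tan0 d1 d2 d3 E u v w) = 0")
  case False
  then have p: "0 < vnorm d1 (tan0 d1 d2 d3 E u v w)" by (simp add: less_le)
  have "(vnorm d1 (tan0 d1 d2 d3 E u v w))\<^sup>2 \<le> e * vnorm d1 (tan0 d1 d2 d3 E u v w)"
    using tri_boundD[OF assms(1), of "tan0 d1 d2 d3 E u v w" v w] assms by (simp add: tan0_norm_sq)
  then show ?thesis using p by (simp add: power2_eq_square)
qed (use assms in simp)

text \<open>The signal has rank one and y, z are orthogonal to v, w, so it is contracted to exactly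
  \<open>u\<close>; the step formula is an identity and not a linearization. Positivity of the
  component along \<open>u\<close> permits the division and keeps the new scale nonzero.\<close>

lemma tang_step:
  assumes A: "\<And>i j k. A i j k = lam * (u i * v j * w k + E i j k)" and lam: "lam > 0"
    and units: "vnorm d1 u = 1" "vnorm d2 v = 1" "vnorm d3 w = 1"
    and y: "tang d2 v y vh" and z: "tang d3 w z wh"
    and pos: "1 + lam_hat d1 d2 d3 E u (\<lambda>j. v j + y j) (\<lambda>k. w k + z k) > 0"
  shows "tang d1 u (tan_step d1 d2 d3 E u (\<lambda>j. v j + y j) (\<lambda>k. w k + z k))
           (normalize_d d1 (contr1 d1 d2 d3 A vh wh))"
proof -
  define b where "b = (\<lambda>j. v j + y j)"
  define c where "c = (\<lambda>k. w k + z k)"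
  define x where "x = tan_step d1 d2 d3 E u b c"
  define \<delta> where "\<delta> = lam_hat d1 d2 d3 E u b c"
  have \<delta>: "1 + \<delta> > 0" using pos by (simp add: \<delta>_def b_def c_def)
  obtain s where s: "s \<noteq> 0" "\<And>j. j < d2 \<Longrightarrow> vh j = s * b j" using y by (auto simp: tang_def b_def)
  obtain t where t: "t \<noteq> 0" "\<And>k. k < d3 \<Longrightarrow> wh k = t * c k" using z by (auto simp: tang_def c_def)
  have vb: "(\<Sum>j<d2. v j * b j) = 1"
    using y units(2) vnorm_square[of d2 v] by (simp add: tang_def b_def inner_d_linear flip: inner_d_def)
  have wc: "(\<Sum>k<d3. w k * c k) = 1"
    using z units(3) vnorm_square[of d3 w] by (simp add: tang_def c_def inner_d_linear flip: inner_d_def)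
  have ux: "inner_d d1 u x = 0"
    using inner_tan_step[of d1 d2 d3 E u b c u] \<delta> units(1) vnorm_square[of d1 u]
    by (auto simp: x_def \<delta>_def)
  \<comment> \<open>The scale of the contracted vector. Its sign is that of s t, because
    \<open>lam\<close> and 1 + \<delta> are positive, and it remains hidden inside
    \<open>tang\<close>.\<close>
  define k where "k = s * t * lam * (1 + \<delta>)"
  have k0: "k \<noteq> 0" using s t lam \<delta> by (simp add: k_def)
  have *: "contr1 d1 d2 d3 A vh wh i = k * (u i + x i)" if "i < d1" for i
  proof -
    have "contr1 d1 d2 d3 A vh wh i = (\<Sum>j<d2. \<Sum>k<d3. A i j k * (s * b j) * (t * c k))"
      unfolding contr1_def by (intro sum.cong) (auto simp: s t)
    also have "\<dots> = (\<Sum>j<d2. \<Sum>k<d3. s * t * lam * (u i * (v j * b j) * (w k * c k) + E i j k * b j * c k))"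
      by (simp add: A algebra_simps)
    also have "\<dots> = s * t * lam * ((\<Sum>j<d2. \<Sum>k<d3. u i * (v j * b j) * (w k * c k)) + contr1 d1 d2 d3 E b c i)"
      by (simp add: contr1_def sum.distrib flip: sum_distrib_left)
    also have "(\<Sum>j<d2. \<Sum>k<d3. u i * (v j * b j) * (w k * c k)) = u i"
      using vb wc by (simp flip: sum_distrib_left sum_distrib_right)
    also have "u i + contr1 d1 d2 d3 E b c i = (1 + \<delta>) * (u i + x i)"
      using \<delta> by (simp add: x_def tan_step_def \<delta>_def field_simps)
    finally show ?thesis by (simp add: k_def)
  qed
  have "vnorm d1 (contr1 d1 d2 d3 A vh wh) = vnorm d1 (\<lambda>i. k * (u i + x i))"
    by (rule vnorm_cong) (rule *)
  also have "\<dots> = \<bar>k\<bar> * sqrt (1 + (vnorm d1 x)\<^sup>2)"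
    using vnorm_orthogonal_sum[OF ux units(1)] by (simp add: vnorm_scale)
  finally have n: "vnorm d1 (contr1 d1 d2 d3 A vh wh) \<noteq> 0" using k0
    by (smt (verit) mult_eq_0_iff real_sqrt_eq_zero_cancel_iff zero_le_power2 abs_eq_0)
  have "tang d1 u x (normalize_d d1 (contr1 d1 d2 d3 A vh wh))"
    unfolding tang_def
    using ux n k0 * by (auto simp: normalize_d_def intro!: exI[of _ "k / vnorm d1 (contr1 d1 d2 d3 A vh wh)"])
  then show ?thesis by (simp add: x_def b_def c_def)
qed

text \<open>\<open>stage1\<close> to \<open>stage3\<close> record what is known about a mode after that many sweeps: first that its tangential error is
  \<open>O(e)\<close>, then that \<open>tan0\<close> is its leading term, finally that \<open>second_order\<close> is the next one.\<close>

definition stage1 :: "nat \<Rightarrow> vec \<Rightarrow> real \<Rightarrow> vec \<Rightarrow> bool" where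
  "stage1 d u e uh \<longleftrightarrow> (\<exists>x. tang d u x uh \<and> vnorm d x \<le> 10 * e)"

definition stage2 :: "nat \<Rightarrow> nat \<Rightarrow> nat \<Rightarrow> tensor3 \<Rightarrow> vec \<Rightarrow> vec \<Rightarrow> vec \<Rightarrow> real \<Rightarrow> vec \<Rightarrow> bool" where
  "stage2 d1 d2 d3 E u v w e uh \<longleftrightarrow> (\<exists>x. tang d1 u x uh \<and> vnorm d1 x \<le> 10 * e \<and>
     vnorm d1 (\<lambda>i. x i - tan0 d1 d2 d3 E u v w i) \<le> 111 * e\<^sup>2)"

text \<open>The first variation of E(q, v, w) when v and w are shifted by the leading errors of
  their own modes. It is quadratic in E, and its size on the scale of the limit theorems is found
  through a variance, the norm bound being too weak.\<close>

definition second_order :: "nat \<Rightarrow> nat \<Rightarrow> nat \<Rightarrow> tensor3 \<Rightarrow> vec \<Rightarrow> vec \<Rightarrow> vec \<Rightarrow> vec \<Rightarrow> real" where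
  "second_order d1 d2 d3 E u v w q =
     lam_hat d1 d2 d3 E q (tan0 d2 d1 d3 (\<lambda>j i k. E i j k) v u w) w
   + lam_hat d1 d2 d3 E q v (tan0 d3 d1 d2 (\<lambda>k i j. E i j k) w u v)"

definition stage3 :: "nat \<Rightarrow> nat \<Rightarrow> nat \<Rightarrow> tensor3 \<Rightarrow> vec \<Rightarrow> vec \<Rightarrow> vec \<Rightarrow> real \<Rightarrow> vec \<Rightarrow> bool" where
  "stage3 d1 d2 d3 E u v w e uh \<longleftrightarrow> (\<exists>x \<delta>. tang d1 u x uh \<and> vnorm d1 x \<le> 10 * e \<and>
     vnorm d1 (\<lambda>i. x i - tan0 d1 d2 d3 E u v w i) \<le> 111 * e\<^sup>2 \<and>
     \<bar>\<delta>\<bar> \<le> 9 * e \<and> \<bar>\<delta> - lam_hat d1 d2 d3 E u v w\<bar> \<le> 30 * e\<^sup>2 \<and>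
     (\<forall>q. inner_d d1 q u = 0 \<longrightarrow> \<bar>(1 + \<delta>) * inner_d d1 q x - lam_hat d1 d2 d3 E q v w
          - second_order d1 d2 d3 E u v w q\<bar> \<le> 400 * e^3 * vnorm d1 q))"

text \<open>Slopes of size 2 give |b|, |c| \<le> 3 and hence 9 e; dividing by 1 - 9 e \<ge> 91/100
  gives 10 e after rounding. The bound does not involve how good y and z are, so one sweep erases
  the error of the initialization.\<close>

lemma tan_step_bounds:
  assumes tb: "tri_bound d1 d2 d3 E e" and e: "0 \<le> e" "e \<le> 1/100"
    and units: "vnorm d1 u = 1" "vnorm d2 v = 1" "vnorm d3 w = 1"
    and y: "vnorm d2 y \<le> 2" and z: "vnorm d3 z \<le> 2"
  defines "b \<equiv> (\<lambda>j. v j + y j)" and "c \<equiv> (\<lambda>k. w k + z k)"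
  shows "\<bar>lam_hat d1 d2 d3 E u b c\<bar> \<le> 9 * e" "vnorm d1 (tan_step d1 d2 d3 E u b c) \<le> 10 * e"
proof -
  have nb: "vnorm d2 b \<le> 3" "vnorm d3 c \<le> 3"
    using vnorm_triangle[of d2 v y] vnorm_triangle[of d3 w z] units y z by (auto simp: b_def c_def)
  show d: "\<bar>lam_hat d1 d2 d3 E u b c\<bar> \<le> 9 * e"
    using tri_bound_leD[OF tb e(1) _ nb, of u 1] units by simp
  have d': "1 + lam_hat d1 d2 d3 E u b c \<ge> 91/100" using d e by linarith
  let ?x = "tan_step d1 d2 d3 E u b c"
  show "vnorm d1 ?x \<le> 10 * e"
  proof (rule vnorm_le_dualI)
    fix q
    \<comment> \<open>Replacing q by its part orthogonal to u absorbs the term of the step formula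
      along u and does not increase the norm.\<close>
    define q' where "q' = (\<lambda>i. q i - inner_d d1 q u * u i)"
    have "(1 + lam_hat d1 d2 d3 E u b c) * inner_d d1 q ?x = lam_hat d1 d2 d3 E q' b c"
      using inner_tan_step[of d1 d2 d3 E u b c q] d' by (simp add: q'_def lam_hat_linear)
    also have "\<dots> \<le> e * (vnorm d1 q * 3 * 3)"
      using tri_bound_leD[OF tb e(1) vnorm_project_le[OF units(1), of q] nb] by (simp add: q'_def)
    finally have *: "(1 + lam_hat d1 d2 d3 E u b c) * inner_d d1 q ?x \<le> 9 * (e * vnorm d1 q)" by simp
    have p: "0 \<le> e * vnorm d1 q" using e by simp
    show "inner_d d1 q ?x \<le> 10 * e * vnorm d1 q"
    proof (rule ccontr)
      assume "\<not> ?thesis"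
      then have i: "inner_d d1 q ?x > 10 * (e * vnorm d1 q)" by simp
      then have "inner_d d1 q ?x > 0" using p by linarith
      then have "(91/100) * inner_d d1 q ?x \<le> (1 + lam_hat d1 d2 d3 E u b c) * inner_d d1 q ?x"
        using d' by (intro mult_right_mono) auto
      with * i p show False by linarith
    qed
  qed (use e in simp)
qed

lemma stage1_step:
  assumes A: "\<And>i j k. A i j k = lam * (u i * v j * w k + E i j k)" and lam: "lam > 0"
    and tb: "tri_bound d1 d2 d3 E e" and e: "0 \<le> e" "e \<le> 1/100"
    and units: "vnorm d1 u = 1" "vnorm d2 v = 1" "vnorm d3 w = 1"
    and y: "tang d2 v y vh" "vnorm d2 y \<le> 2" and z: "tang d3 w z wh" "vnorm d3 z \<le> 2"
  shows "stage1 d1 u e (normalize_d d1 (contr1 d1 d2 d3 A vh wh))"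
proof -
  note B = tan_step_bounds[OF tb e units y(2) z(2)]
  have pos: "1 + lam_hat d1 d2 d3 E u (\<lambda>j. v j + y j) (\<lambda>k. w k + z k) > 0" using B(1) e by linarith
  show ?thesis unfolding stage1_def
    using tang_step[OF A lam units y(1) z(1) pos] B(2) by blast
qed

text \<open>The constant is 11 + 10 + 90: E(q', y, c) with |c| \<le> 11/10, then E(q', v, z), and
  the correction by the denominator, a product of 9 e and 10 e.\<close>

lemma tan_step_close:
  assumes tb: "tri_bound d1 d2 d3 E e" and e: "0 \<le> e" "e \<le> 1/100"
    and units: "vnorm d1 u = 1" "vnorm d2 v = 1" "vnorm d3 w = 1"
    and y: "vnorm d2 y \<le> 10 * e" and z: "vnorm d3 z \<le> 10 * e"
  shows "vnorm d1 (\<lambda>i. tan_step d1 d2 d3 E u (\<lambda>j. v j + y j) (\<lambda>k. w k + z k) i - tan0 d1 d2 d3 E u v w i) \<le> 111 * e\<^sup>2"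
proof -
  have y2: "vnorm d2 y \<le> 2" "vnorm d3 z \<le> 2" using y z e by auto
  define b where "b = (\<lambda>j. v j + y j)"
  define c where "c = (\<lambda>k. w k + z k)"
  define x where "x = tan_step d1 d2 d3 E u b c"
  define \<delta> where "\<delta> = lam_hat d1 d2 d3 E u b c"
  have d: "\<bar>\<delta>\<bar> \<le> 9 * e" and nx: "vnorm d1 x \<le> 10 * e"
    using tan_step_bounds[OF tb e units y2] by (simp_all add: \<delta>_def x_def b_def c_def)
  have pos: "1 + \<delta> > 0" using d e by linarith
  have nc: "vnorm d3 c \<le> 11/10" using vnorm_triangle[of d3 w z] units z e by (simp add: c_def)
  have "vnorm d1 (\<lambda>i. x i - tan0 d1 d2 d3 E u v w i) \<le> 111 * e\<^sup>2"
  proof (rule vnorm_le_dualI)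
    fix q
    define q' where "q' = (\<lambda>i. q i - inner_d d1 q u * u i)"
    have nq: "vnorm d1 q' \<le> vnorm d1 q" using vnorm_project_le[OF units(1)] by (simp add: q'_def)
    have "(1 + \<delta>) * inner_d d1 q x = lam_hat d1 d2 d3 E q' b c"
      using inner_tan_step[of d1 d2 d3 E u b c q] pos by (simp add: x_def \<delta>_def q'_def lam_hat_linear)
    moreover have "inner_d d1 q (tan0 d1 d2 d3 E u v w) = lam_hat d1 d2 d3 E q' v w"
      by (simp add: inner_tan0 q'_def lam_hat_linear)
    moreover have "lam_hat d1 d2 d3 E q' b c = lam_hat d1 d2 d3 E q' v w + lam_hat d1 d2 d3 E q' y c + lam_hat d1 d2 d3 E q' v z"
      by (simp add: b_def c_def lam_hat_linear)
    ultimately have eq: "inner_d d1 q (\<lambda>i. x i - tan0 d1 d2 d3 E u v w i)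
        = lam_hat d1 d2 d3 E q' y c + lam_hat d1 d2 d3 E q' v z - \<delta> * inner_d d1 q x"
      by (simp add: inner_d_linear algebra_simps)
    have 1: "\<bar>lam_hat d1 d2 d3 E q' y c\<bar> \<le> e * (vnorm d1 q * (10 * e) * (11/10))"
      by (rule tri_bound_leD[OF tb e(1) nq y nc])
    have 2: "\<bar>lam_hat d1 d2 d3 E q' v z\<bar> \<le> e * (vnorm d1 q * 1 * (10 * e))"
      by (rule tri_bound_leD[OF tb e(1) nq _ z]) (use units in simp)
    have "\<bar>inner_d d1 q x\<bar> \<le> vnorm d1 q * (10 * e)"
      using inner_d_CS[of d1 q x] nx mult_left_mono[OF nx vnorm_nonneg[of d1 q]] by linarith
    then have 3: "\<bar>\<delta> * inner_d d1 q x\<bar> \<le> (9 * e) * (vnorm d1 q * (10 * e))"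
      unfolding abs_mult using d e by (intro mult_mono) auto
    show "inner_d d1 q (\<lambda>i. x i - tan0 d1 d2 d3 E u v w i) \<le> 111 * e\<^sup>2 * vnorm d1 q"
      unfolding eq using 1 2 3 by (simp add: power2_eq_square algebra_simps)
  qed simp
  then show ?thesis by (simp add: x_def b_def c_def)
qed

lemma stage2_step:
  assumes A: "\<And>i j k. A i j k = lam * (u i * v j * w k + E i j k)" and lam: "lam > 0"
    and tb: "tri_bound d1 d2 d3 E e" and e: "0 \<le> e" "e \<le> 1/100"
    and units: "vnorm d1 u = 1" "vnorm d2 v = 1" "vnorm d3 w = 1"
    and v: "stage1 d2 v e vh" and w: "stage1 d3 w e wh"
  shows "stage2 d1 d2 d3 E u v w e (normalize_d d1 (contr1 d1 d2 d3 A vh wh))"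
proof -
  obtain y where y: "tang d2 v y vh" "vnorm d2 y \<le> 10 * e" using v by (auto simp: stage1_def)
  obtain z where z: "tang d3 w z wh" "vnorm d3 z \<le> 10 * e" using w by (auto simp: stage1_def)
  have y2: "vnorm d2 y \<le> 2" "vnorm d3 z \<le> 2" using y z e by auto
  note B = tan_step_bounds[OF tb e units y2]
  have pos: "1 + lam_hat d1 d2 d3 E u (\<lambda>j. v j + y j) (\<lambda>k. w k + z k) > 0" using B(1) e by linarith
  show ?thesis unfolding stage2_def
    using tang_step[OF A lam units y(1) z(1) pos] B(2) tan_step_close[OF tb e units y(2) z(2)] by blast
qed

text \<open>Multilinearity splits E(q, v + y, w + z). Replacing y and z by their leading terms costs
  111 e^3 each and the joint term 100 e^3, together 322 \<le> 400. The factor 1 + \<delta> stays on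
  the left so that no quotient has to be expanded; \<delta> itself is compared with E(u, v, w),
  which is a single normal variable over \<tau> and thus of smaller order than e.\<close>

lemma stage3_step:
  assumes A: "\<And>i j k. A i j k = lam * (u i * v j * w k + E i j k)" and lam: "lam > 0"
    and tb: "tri_bound d1 d2 d3 E e" and e: "0 \<le> e" "e \<le> 1/100"
    and units: "vnorm d1 u = 1" "vnorm d2 v = 1" "vnorm d3 w = 1"
    and v: "stage2 d2 d1 d3 (\<lambda>j i k. E i j k) v u w e vh" and w: "stage2 d3 d1 d2 (\<lambda>k i j. E i j k) w u v e wh"
  shows "stage3 d1 d2 d3 E u v w e (normalize_d d1 (contr1 d1 d2 d3 A vh wh))"
proof -
  define y0 where "y0 = tan0 d2 d1 d3 (\<lambda>j i k. E i j k) v u w"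
  define z0 where "z0 = tan0 d3 d1 d2 (\<lambda>k i j. E i j k) w u v"
  obtain y where y: "tang d2 v y vh" "vnorm d2 y \<le> 10 * e" and yy: "vnorm d2 (\<lambda>i. y i - y0 i) \<le> 111 * e\<^sup>2"
    using v by (auto simp: stage2_def y0_def)
  obtain z where z: "tang d3 w z wh" "vnorm d3 z \<le> 10 * e" and zz: "vnorm d3 (\<lambda>i. z i - z0 i) \<le> 111 * e\<^sup>2"
    using w by (auto simp: stage2_def z0_def)
  have y2: "vnorm d2 y \<le> 2" "vnorm d3 z \<le> 2" using y z e by auto
  define b where "b = (\<lambda>j. v j + y j)"
  define c where "c = (\<lambda>k. w k + z k)"
  define \<delta> where "\<delta> = lam_hat d1 d2 d3 E u b c"
  define x where "x = tan_step d1 d2 d3 E u b c"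
  have d: "\<bar>\<delta>\<bar> \<le> 9 * e" and nx: "vnorm d1 x \<le> 10 * e"
    using tan_step_bounds[OF tb e units y2] by (simp_all add: \<delta>_def x_def b_def c_def)
  have pos: "1 + \<delta> > 0" using d e by linarith
  have tg: "tang d1 u x (normalize_d d1 (contr1 d1 d2 d3 A vh wh))"
    using tang_step[OF A lam units y(1) z(1)] pos by (simp add: \<delta>_def x_def b_def c_def)
  have cl: "vnorm d1 (\<lambda>i. x i - tan0 d1 d2 d3 E u v w i) \<le> 111 * e\<^sup>2"
    using tan_step_close[OF tb e units y(2) z(2)] by (simp add: x_def b_def c_def)
  have e2: "e * e \<le> e * (1/100)" using e by (intro mult_left_mono) auto
  have d2: "\<bar>\<delta> - lam_hat d1 d2 d3 E u v w\<bar> \<le> 30 * e\<^sup>2"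
  proof -
    have eq: "\<delta> - lam_hat d1 d2 d3 E u v w = lam_hat d1 d2 d3 E u y w + lam_hat d1 d2 d3 E u v z + lam_hat d1 d2 d3 E u y z"
      by (simp add: \<delta>_def b_def c_def lam_hat_linear)
    have "\<bar>lam_hat d1 d2 d3 E u y w\<bar> \<le> e * (1 * (10 * e) * 1)"
      by (rule tri_bound_leD[OF tb e(1) _ y(2)]) (use units in simp_all)
    moreover have "\<bar>lam_hat d1 d2 d3 E u v z\<bar> \<le> e * (1 * 1 * (10 * e))"
      by (rule tri_bound_leD[OF tb e(1) _ _ z(2)]) (use units in simp_all)
    moreover have "\<bar>lam_hat d1 d2 d3 E u y z\<bar> \<le> e * (1 * (10 * e) * (1/10))"
      by (rule tri_bound_leD[OF tb e(1) _ y(2)]) (use units z e in simp_all)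
    ultimately show ?thesis unfolding eq by (simp add: power2_eq_square)
  qed
  have ex: "\<bar>(1 + \<delta>) * inner_d d1 q x - lam_hat d1 d2 d3 E q v w
          - second_order d1 d2 d3 E u v w q\<bar> \<le> 400 * e^3 * vnorm d1 q" if q: "inner_d d1 q u = 0" for q
  proof -
    have "(1 + \<delta>) * inner_d d1 q x = lam_hat d1 d2 d3 E q b c"
      using inner_tan_step[of d1 d2 d3 E u b c q] pos q by (simp add: x_def \<delta>_def)
    then have eq: "(1 + \<delta>) * inner_d d1 q x - lam_hat d1 d2 d3 E q v w - second_order d1 d2 d3 E u v w q
       = lam_hat d1 d2 d3 E q (\<lambda>i. y i - y0 i) w + lam_hat d1 d2 d3 E q v (\<lambda>i. z i - z0 i) + lam_hat d1 d2 d3 E q y z"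
      by (simp add: second_order_def b_def c_def y0_def z0_def lam_hat_linear)
    have n: "vnorm d1 q \<le> vnorm d1 q" by simp
    have "\<bar>lam_hat d1 d2 d3 E q (\<lambda>i. y i - y0 i) w\<bar> \<le> e * (vnorm d1 q * (111 * e\<^sup>2) * 1)"
      by (rule tri_bound_leD[OF tb e(1) n yy]) (use units in simp)
    moreover have "\<bar>lam_hat d1 d2 d3 E q v (\<lambda>i. z i - z0 i)\<bar> \<le> e * (vnorm d1 q * 1 * (111 * e\<^sup>2))"
      by (rule tri_bound_leD[OF tb e(1) n _ zz]) (use units in simp)
    moreover have "\<bar>lam_hat d1 d2 d3 E q y z\<bar> \<le> e * (vnorm d1 q * (10 * e) * (10 * e))"
      by (rule tri_bound_leD[OF tb e(1) n y(2) z(2)])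
    moreover have "0 \<le> e ^ 3 * vnorm d1 q" using e by simp
    ultimately show ?thesis unfolding eq by (simp add: power2_eq_square power3_eq_cube algebra_simps)
  qed
  show ?thesis unfolding stage3_def using tg nx cl d d2 ex by blast
qed

section \<open>Initialization, normalization and the refined expansion\<close>

definition stage0 :: "nat \<Rightarrow> vec \<Rightarrow> vec \<Rightarrow> bool" where
  "stage0 d u uh \<longleftrightarrow> (\<exists>x. tang d u x uh \<and> vnorm d x \<le> 2)"

text \<open>With s the correlation, the slope a/s - u has squared norm 1/s^2 - 1, at most 3 when s^2
  \<ge> 1/4; this is the origin of the radius 2 in \<open>stage0\<close>.\<close>

lemma stage0_init:
  assumes "vnorm d a = 1" "vnorm d u = 1" "1/4 \<le> (inner_d d a u)\<^sup>2"
  shows "stage0 d u a"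
proof -
  define s where "s = inner_d d a u"
  define r where "r = 1 / s"
  define x where "x = (\<lambda>i. r * a i - u i)"
  have s: "s \<noteq> 0" using assms(3) by (auto simp: s_def)
  have r: "r * s = 1" using s by (simp add: r_def)
  have uu: "inner_d d u u = 1" and aa: "inner_d d a a = 1" using assms vnorm_square[of d] by (metis one_power2)+
  have ux: "inner_d d u x = 0"
    using r uu by (simp add: x_def inner_d_diff_right inner_d_scale_right inner_d_commute[of d u a] flip: s_def)
  have "(vnorm d x)\<^sup>2 = r * r - 1"
    using r uu aa by (simp add: vnorm_square x_def inner_d_diff_left inner_d_diff_right inner_d_scale_left inner_d_scale_right
        inner_d_commute[of d u a] flip: s_def)
  also have "\<dots> = 1 / s\<^sup>2 - 1" by (simp add: r_def power2_eq_square)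
  also have "\<dots> \<le> 2\<^sup>2" using assms(3) s by (simp add: s_def field_simps)
  finally have "vnorm d x \<le> 2" by (rule power2_le_imp_le) simp
  moreover have "tang d u x a" unfolding tang_def using ux s by (auto intro!: exI[of _ s] simp: x_def r_def field_simps)
  ultimately show ?thesis by (auto simp: stage0_def)
qed

lemma stage1_imp_stage0: "stage1 d u e a \<Longrightarrow> e \<le> 1/100 \<Longrightarrow> stage0 d u a"
  unfolding stage0_def stage1_def by force

text \<open>Normalizing a vector of norm zero gives zero, because division by zero is zero, whereas
  \<open>tang\<close> makes the inner product with \<open>u\<close> a nonzero scale. So the norm was
  nonzero and the division genuine.\<close>

lemma tang_normalize_unit:
  assumes "tang d u x (normalize_d d y)" "vnorm d u = 1"
  shows "vnorm d (normalize_d d y) = 1"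
proof -
  obtain s where s: "s \<noteq> 0" "\<And>i. i < d \<Longrightarrow> normalize_d d y i = s * (u i + x i)" "inner_d d u x = 0"
    using assms(1) by (auto simp: tang_def)
  have "inner_d d u (normalize_d d y) = inner_d d u (\<lambda>i. s * (u i + x i))"
    by (rule inner_d_cong) (auto simp: s)
  also have "\<dots> = s" using s(3) assms(2) vnorm_square[of d u] by (simp add: inner_d_linear)
  finally have "vnorm d y \<noteq> 0" using s(1) by (auto simp: normalize_d_def inner_d_def)
  moreover have "vnorm d (normalize_d d y) = \<bar>1 / vnorm d y\<bar> * vnorm d y"
    using vnorm_scale[of d "1 / vnorm d y" y] by (simp add: normalize_d_def)
  ultimately show ?thesis by simp
qed

text \<open>The form in which a unit vector with aligned sign enters the limit theorems: \<alpha> (u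
  + x) with \<alpha> near 1. Both expansions carry the quadratic term through
  \<open>second_order\<close> instead of a power of e, because a power of e would be too coarse for
  it.\<close>

definition refined :: "nat \<Rightarrow> nat \<Rightarrow> nat \<Rightarrow> tensor3 \<Rightarrow> vec \<Rightarrow> vec \<Rightarrow> vec \<Rightarrow> real \<Rightarrow> vec \<Rightarrow> bool" where
  "refined d1 d2 d3 E u v w e uh \<longleftrightarrow> (\<exists>x \<alpha>. inner_d d1 u x = 0 \<and> vnorm d1 x \<le> 10 * e \<and>
     (\<forall>i<d1. uh i = \<alpha> * (u i + x i)) \<and> \<bar>\<alpha> - 1\<bar> \<le> 50 * e\<^sup>2 \<and>
     \<bar>\<alpha> - 1 + (vnorm d1 (tan0 d1 d2 d3 E u v w))\<^sup>2 / 2\<bar>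
       \<le> 2 * \<bar>second_order d1 d2 d3 E u v w (tan0 d1 d2 d3 E u v w)\<bar> + 20000 * e^4
         + 105 * e\<^sup>2 * \<bar>lam_hat d1 d2 d3 E u v w\<bar> \<and>
     (\<forall>q. inner_d d1 q u = 0 \<longrightarrow> vnorm d1 q = 1 \<longrightarrow>
        \<bar>\<alpha> * inner_d d1 q x - lam_hat d1 d2 d3 E q v w\<bar>
          \<le> 11 * e * \<bar>lam_hat d1 d2 d3 E q v w\<bar> + 2 * \<bar>second_order d1 d2 d3 E u v w q\<bar> + 800 * e^3))"

lemma second_order_diff:
  "second_order d1 d2 d3 E u v w (\<lambda>i. q i - q' i) = second_order d1 d2 d3 E u v w q - second_order d1 d2 d3 E u v w q'"
  by (simp add: second_order_def lam_hat_diff1)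

text \<open>Applied to the difference between a slope and its leading term: there r = 111 e^2, and
  the resulting 222 e^4 is affordable.\<close>

lemma second_order_le:
  assumes tb: "tri_bound d1 d2 d3 E e" and e: "0 \<le> e"
    and units: "vnorm d1 u = 1" "vnorm d2 v = 1" "vnorm d3 w = 1" and q: "vnorm d1 q \<le> r"
  shows "\<bar>second_order d1 d2 d3 E u v w q\<bar> \<le> 2 * e\<^sup>2 * r"
proof -
  have y: "vnorm d2 (tan0 d2 d1 d3 (\<lambda>j i k. E i j k) v u w) \<le> e"
    by (rule tan0_norm_le[OF tri_bound_swap12[OF tb]]) (use e units in simp_all)
  have z: "vnorm d3 (tan0 d3 d1 d2 (\<lambda>k i j. E i j k) w u v) \<le> e"
    by (rule tan0_norm_le[OF tri_bound_rotate[OF tb]]) (use e units in simp_all)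
  have "\<bar>lam_hat d1 d2 d3 E q (tan0 d2 d1 d3 (\<lambda>j i k. E i j k) v u w) w\<bar> \<le> e * (r * e * 1)"
    by (rule tri_bound_leD[OF tb e q y]) (use units in simp)
  moreover have "\<bar>lam_hat d1 d2 d3 E q v (tan0 d3 d1 d2 (\<lambda>k i j. E i j k) w u v)\<bar> \<le> e * (r * 1 * e)"
    by (rule tri_bound_leD[OF tb e q _ z]) (use units in simp)
  ultimately show ?thesis by (simp add: second_order_def power2_eq_square algebra_simps)
qed

text \<open>Put s = sqrt (1 + X). Then 1 - 1/s - X/2 = - (s - 1)^2 (s + 2) / (2 s), and X = (s -
  1)(s + 1) bounds its absolute value by X^2.\<close>

lemma inv_sqrt_bounds:
  fixes X :: real assumes "0 \<le> X"
  shows "\<bar>1 / sqrt (1 + X) - 1\<bar> \<le> X / 2" "\<bar>1 / sqrt (1 + X) - 1 + X / 2\<bar> \<le> X\<^sup>2"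
proof -
  define s where "s = sqrt (1 + X)"
  have s: "1 \<le> s" and X: "X = s\<^sup>2 - 1" using assms by (auto simp: s_def)
  have 1: "1 - 1/s - X/2 = - (s-1)\<^sup>2 * (s + 2) / (2 * s)"
    using s by (simp add: X field_simps power2_eq_square)
  have le: "1 - 1/s \<le> X / 2" using 1 s
    by (smt (verit, best) divide_nonpos_nonneg mult_nonneg_nonneg zero_le_power2 mult_minus_left)
  have "1 / s \<le> 1" using s by simp
  with le show "\<bar>1 / sqrt (1 + X) - 1\<bar> \<le> X / 2" by (simp flip: s_def)
  have "(s-1)\<^sup>2 * (s + 2) / (2 * s) \<le> (s-1)\<^sup>2 * (s+1)\<^sup>2"
  proof -
    have "(s + 2) / (2 * s) \<le> (s+1)\<^sup>2"
    proof -
      have "s + 2 \<le> 2 * s * (s+1)\<^sup>2"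
      proof -
        have "1 * 1 \<le> s * s" using s by (intro mult_mono) auto
        then have ss: "1 \<le> s * s" by simp
        then have "1 * 1 \<le> s * (s * s)" using s by (intro mult_mono) auto
        then have "1 \<le> s * (s * s)" by simp
        with ss show ?thesis using s by (simp add: power2_eq_square algebra_simps)
      qed
      then show ?thesis using s by (simp add: divide_le_eq mult.commute)
    qed
    then have "(s-1)\<^sup>2 * ((s + 2) / (2 * s)) \<le> (s-1)\<^sup>2 * (s+1)\<^sup>2" by (intro mult_left_mono) auto
    then show ?thesis by simp
  qed
  also have "\<dots> = X\<^sup>2" by (simp add: X power2_eq_square algebra_simps)
  finally show "\<bar>1 / sqrt (1 + X) - 1 + X / 2\<bar> \<le> X\<^sup>2" using 1 le by (simp add: abs_if flip: s_def)
qed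

text \<open>The unit norm forces |s| = 1 / sqrt (1 + |x|^2), so the radial loss is governed by X =
  |x|^2. Testing the expansion with x and with the leading term b0 gives two relations, one for (1 +
  \<delta>) X and one for 1 + \<delta> times the inner product of b0 and x; eliminating that inner
  product compares X with B = |b0|^2.\<close>

lemma stage3_refined:
  assumes st: "stage3 d1 d2 d3 E u v w e uh" and nu: "vnorm d1 uh = 1"
    and tb: "tri_bound d1 d2 d3 E e" and e: "0 \<le> e" "e \<le> 1/100"
    and units: "vnorm d1 u = 1" "vnorm d2 v = 1" "vnorm d3 w = 1"
  shows "refined d1 d2 d3 E u v w e (sign_align d1 uh u)"
proof -
  obtain x \<delta> where tg: "tang d1 u x uh" and nx: "vnorm d1 x \<le> 10 * e"
    and cl: "vnorm d1 (\<lambda>i. x i - tan0 d1 d2 d3 E u v w i) \<le> 111 * e\<^sup>2"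
    and d: "\<bar>\<delta>\<bar> \<le> 9 * e" and d2: "\<bar>\<delta> - lam_hat d1 d2 d3 E u v w\<bar> \<le> 30 * e\<^sup>2"
    and ex: "\<And>q. inner_d d1 q u = 0 \<Longrightarrow> \<bar>(1 + \<delta>) * inner_d d1 q x - lam_hat d1 d2 d3 E q v w
          - second_order d1 d2 d3 E u v w q\<bar> \<le> 400 * e^3 * vnorm d1 q"
    using st unfolding stage3_def by blast
  have ux: "inner_d d1 u x = 0" using tg by (simp add: tang_def)
  have uu: "inner_d d1 u u = 1" using units(1) vnorm_square[of d1 u] by simp
  obtain s where s: "s \<noteq> 0" "\<And>i. i < d1 \<Longrightarrow> uh i = s * (u i + x i)" using tg by (auto simp: tang_def)
  define X where "X = (vnorm d1 x)\<^sup>2"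
  define \<alpha> where "\<alpha> = 1 / sqrt (1 + X)"
  have X0: "0 \<le> X" by (simp add: X_def)
  have "X \<le> (10 * e)\<^sup>2" unfolding X_def by (rule power_mono[OF nx]) simp
  then have X1: "X \<le> 100 * e\<^sup>2" by (simp add: power_mult_distrib)
  have "1 = vnorm d1 (\<lambda>i. s * (u i + x i))" using vnorm_cong[of d1 uh, OF s(2)] nu by simp
  also have "\<dots> = \<bar>s\<bar> * sqrt (1 + X)"
    by (simp add: vnorm_scale vnorm_orthogonal_sum[OF ux units(1)] X_def)
  finally have sa: "\<bar>s\<bar> = \<alpha>" using X0 by (simp add: \<alpha>_def field_simps)
  have "inner_d d1 uh u = inner_d d1 (\<lambda>i. s * (u i + x i)) u" by (rule inner_d_cong) (auto simp: s)
  then have "inner_d d1 uh u = s" using ux uu by (simp add: inner_d_linear inner_d_commute[of d1 x])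
  \<comment> \<open>The norm determines only |s|; aligning the sign replaces s by |s| =
    \<alpha>.\<close>
  then have hat: "\<forall>i<d1. sign_align d1 uh u i = \<alpha> * (u i + x i)"
    using s(2) sa by (auto simp: sign_align_def)
  have a1: "\<bar>\<alpha> - 1\<bar> \<le> X / 2" and a2: "\<bar>\<alpha> - 1 + X / 2\<bar> \<le> X\<^sup>2"
    using inv_sqrt_bounds[OF X0] by (simp_all add: \<alpha>_def)
  have a3: "\<bar>\<alpha> - 1\<bar> \<le> 50 * e\<^sup>2" using a1 X1 by linarith
  define b0 where "b0 = tan0 d1 d2 d3 E u v w"
  define B where "B = (vnorm d1 b0)\<^sup>2"
  define T where "T = second_order d1 d2 d3 E u v w"
  define f where "f = \<bar>lam_hat d1 d2 d3 E u v w\<bar>"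
  have b0u: "inner_d d1 b0 u = 0" using tan0_orthogonal[OF units(1)] by (simp add: b0_def inner_d_commute[of d1 _ u])
  have b0e: "vnorm d1 b0 \<le> e" unfolding b0_def by (rule tan0_norm_le[OF tb e(1) units])
  have xu: "inner_d d1 x u = 0" using ux by (simp add: inner_d_commute)
  have e3: "0 \<le> e^3" using e by simp
  \<comment> \<open>Test with q = x: as x is orthogonal to u, E(x, v, w) is the inner product of x
    and b0.\<close>
  have r1: "\<bar>(1 + \<delta>) * X - inner_d d1 b0 x - T x\<bar> \<le> 4000 * e^4"
  proof -
    have "inner_d d1 x b0 = lam_hat d1 d2 d3 E x v w" by (simp add: b0_def inner_tan0 xu)
    then have "\<bar>(1 + \<delta>) * X - inner_d d1 b0 x - T x\<bar> \<le> 400 * e^3 * vnorm d1 x"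
      using ex[OF xu] by (simp add: X_def vnorm_square T_def inner_d_commute[of d1 b0])
    also have "\<dots> \<le> 400 * e^3 * (10 * e)" using nx e3 by (intro mult_left_mono) auto
    finally show ?thesis by (simp add: power_numeral_reduce)
  qed
  \<comment> \<open>Test with q = b0, where E(b0, v, w) equals |b0|^2.\<close>
  have r2: "\<bar>(1 + \<delta>) * inner_d d1 b0 x - B - T b0\<bar> \<le> 400 * e^4"
  proof -
    have "lam_hat d1 d2 d3 E b0 v w = B" using tan0_norm_sq[OF units(1)] by (simp add: b0_def B_def)
    then have "\<bar>(1 + \<delta>) * inner_d d1 b0 x - B - T b0\<bar> \<le> 400 * e^3 * vnorm d1 b0"
      using ex[OF b0u] by (simp add: T_def)
    also have "\<dots> \<le> 400 * e^3 * e" using b0e e3 by (intro mult_left_mono) auto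
    finally show ?thesis by (simp add: power_numeral_reduce)
  qed
  have r3: "\<bar>T x - T b0\<bar> \<le> 222 * e^4"
    using second_order_le[OF tb e(1) units cl]
    by (simp add: T_def b0_def second_order_diff power_numeral_reduce)
  have r4: "\<bar>(1+\<delta>) * (T x - T b0)\<bar> \<le> (109/100) * (222 * e^4)"
    unfolding abs_mult using r3 d e by (intro mult_mono) auto
  have r5: "\<bar>(1+\<delta>) * ((1 + \<delta>) * X - inner_d d1 b0 x - T x)\<bar> \<le> (109/100) * (4000 * e^4)"
    unfolding abs_mult using r1 d e by (intro mult_mono) auto
  have r6: "\<bar>(1+\<delta>) * T b0\<bar> \<le> (109/100) * \<bar>T b0\<bar>"
    unfolding abs_mult using d e by (intro mult_right_mono) auto
  \<comment> \<open>The relation tested with x is multiplied by 1 + \<delta> and the one tested with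
    b0 is added. \<open>T x\<close> is traded for \<open>T b0\<close>, since only the latter is an
    explicit polynomial of the noise.\<close>
  have id: "(1+\<delta>)\<^sup>2 * X - B = (1+\<delta>) * ((1 + \<delta>) * X - inner_d d1 b0 x - T x) + (1+\<delta>) * (T x - T b0)
     + (1+\<delta>) * T b0 + T b0 + ((1 + \<delta>) * inner_d d1 b0 x - B - T b0)"
    by (simp add: power2_eq_square algebra_simps)
  have m1: "\<bar>(1+\<delta>)\<^sup>2 * X - B\<bar> \<le> (21/10) * \<bar>T b0\<bar> + 5100 * e^4"
    unfolding id using r2 r4 r5 r6 zero_le_power[OF e(1), of 4] by linarith
  \<comment> \<open>Passing from (1 + \<delta>)^2 X to X must not cost e^3, which would be of order
    p/\<tau> on the scale \<tau>^2/sqrt p. Hence \<delta> is bounded by |E(u, v, w)| + 30 e^2 and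
    not by 9 e.\<close>
  have m2: "\<bar>(2 * \<delta> + \<delta>\<^sup>2) * X\<bar> \<le> ((209/100) * (f + 30 * e\<^sup>2)) * (100 * e\<^sup>2)"
  proof -
    have "\<bar>2 * \<delta> + \<delta>\<^sup>2\<bar> = \<bar>\<delta>\<bar> * \<bar>2 + \<delta>\<bar>" by (simp add: power2_eq_square algebra_simps flip: abs_mult)
    also have "\<dots> \<le> (f + 30 * e\<^sup>2) * (209/100)" using d d2 e by (intro mult_mono) (auto simp: f_def)
    finally show ?thesis unfolding abs_mult using X0 X1 by (intro mult_mono) (auto simp: f_def)
  qed
  have ee: "e\<^sup>2 * e\<^sup>2 = e^4" by (simp flip: power_add)
  have "X - B = ((1+\<delta>)\<^sup>2 * X - B) - (2 * \<delta> + \<delta>\<^sup>2) * X" by (simp add: power2_eq_square algebra_simps)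
  have m3: "\<bar>X - B\<bar> \<le> (21/10) * \<bar>T b0\<bar> + 5100 * e^4 + (209 * (f * e\<^sup>2) + 6270 * e^4)"
  proof -
    have "(209/100) * (f + 30 * e\<^sup>2) * (100 * e\<^sup>2) = 209 * (f * e\<^sup>2) + 6270 * e^4"
      by (simp add: algebra_simps ee)
    with m1 m2 \<open>X - B = _\<close> show ?thesis by linarith
  qed
  have "X\<^sup>2 \<le> (100 * e\<^sup>2)\<^sup>2" by (rule power_mono[OF X1 X0])
  then have "X\<^sup>2 \<le> 10000 * e^4" by (simp add: power_mult_distrib)
  with a2 have m4: "\<bar>\<alpha> - 1 + X / 2\<bar> \<le> 10000 * e^4" by linarith
  \<comment> \<open>20000 covers (5100 + 6270)/2 from \<open>m3\<close> and 10000 from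
    \<open>m4\<close>; 105 covers 209/2.\<close>
  have A: "\<bar>\<alpha> - 1 + B / 2\<bar> \<le> 2 * \<bar>T b0\<bar> + 20000 * e^4 + 105 * e\<^sup>2 * f"
  proof -
    have "0 \<le> f * e\<^sup>2" "0 \<le> e^4" by (auto simp: f_def)
    then have "\<bar>\<alpha> - 1 + B / 2\<bar> \<le> 2 * \<bar>T b0\<bar> + 20000 * e^4 + 105 * (f * e\<^sup>2)" using m3 m4 by linarith
    then show ?thesis by (simp add: mult_ac)
  qed
  have C: "\<bar>\<alpha> * inner_d d1 q x - lam_hat d1 d2 d3 E q v w\<bar>
          \<le> 11 * e * \<bar>lam_hat d1 d2 d3 E q v w\<bar> + 2 * \<bar>T q\<bar> + 800 * e^3"
    if q: "inner_d d1 q u = 0" "vnorm d1 q = 1" for q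
  proof -
    define F where "F = lam_hat d1 d2 d3 E q v w"
    define r where "r = (1 + \<delta>) * inner_d d1 q x - F - T q"
    have r: "\<bar>r\<bar> \<le> 400 * e^3" using ex[OF q(1)] q(2) by (simp add: r_def F_def T_def)
    \<comment> \<open>The ratio between the scale of the unit vector and the denominator of the
      step. It satisfies |g - 1| \<le> 11 e because 9 e + 50 e^2 \<le> 9.5 e, which is below 91/100
      of 11 e.\<close>
    define g where "g = \<alpha> / (1 + \<delta>)"
    have dp: "1 + \<delta> \<ge> 91/100" using d e by linarith
    have e2: "e\<^sup>2 \<le> e / 100" using mult_left_mono[OF e(2) e(1)] by (simp add: power2_eq_square)
    have "\<bar>\<alpha> - 1 - \<delta>\<bar> \<le> 11 * e * (91/100)" using a3 d e2 e by linarith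
    also have "\<dots> \<le> 11 * e * (1 + \<delta>)" using dp e by (intro mult_left_mono) auto
    finally have g1: "\<bar>g - 1\<bar> \<le> 11 * e" using dp by (simp add: g_def abs_if field_simps split: if_splits)
    then have g2: "\<bar>g\<bar> \<le> 2" using e by linarith
    have "\<alpha> * inner_d d1 q x = g * (F + T q + r)" using dp by (simp add: g_def r_def)
    then have eq: "\<alpha> * inner_d d1 q x - F = (g - 1) * F + g * T q + g * r" by (simp add: algebra_simps)
    have "\<bar>(g - 1) * F\<bar> \<le> 11 * e * \<bar>F\<bar>" unfolding abs_mult using g1 by (intro mult_right_mono) auto
    moreover have "\<bar>g * T q\<bar> \<le> 2 * \<bar>T q\<bar>" unfolding abs_mult using g2 by (intro mult_right_mono) auto
    moreover have "\<bar>g * r\<bar> \<le> 2 * (400 * e^3)" unfolding abs_mult using g2 r by (intro mult_mono) auto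
    ultimately show ?thesis unfolding F_def[symmetric] eq by linarith
  qed
  show ?thesis unfolding refined_def
    using ux nx hat a3 A C unfolding B_def b0_def T_def f_def by blast
qed

text \<open>Since the errors after three sweeps are already of the order needed for the limit theorems,
  the logarithmic number of iterations only enters through \<open>t \<ge> 3\<close>.\<close>
lemma power_iter_refined:
  fixes u v w :: vec
  assumes A: "\<And>i j k. A i j k = lam * (u i * v j * w k + E i j k)" and lam: "lam > 0"
    and tb: "tri_bound d1 d2 d3 E e" and e: "0 \<le> e" "e \<le> 1/100"
    and units: "vnorm d1 u = 1" "vnorm d2 v = 1" "vnorm d3 w = 1"
    and init: "stage0 d1 u u0" "stage0 d2 v v0" "stage0 d3 w w0"
    and T: "3 \<le> T" and out: "alg4_uvw d1 d2 d3 A u0 v0 w0 T u v w = (uh, vh, wh)"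
  shows "refined d1 d2 d3 E u v w e uh"
    "refined d2 d1 d3 (\<lambda>j i k. E i j k) v u w e vh"
    "refined d3 d1 d2 (\<lambda>k i j. E i j k) w u v e wh"
proof -
  define E2 where "E2 = (\<lambda>j i k. E i j k)"
  define E3 where "E3 = (\<lambda>k i j. E i j k)"
  define A2 where "A2 = (\<lambda>j i k. A i j k)"
  define A3 where "A3 = (\<lambda>k i j. A i j k)"
  have A2: "A2 j i k = lam * (v j * u i * w k + E2 j i k)" for i j k by (simp add: A2_def E2_def A)
  have A3: "A3 k i j = lam * (w k * u i * v j + E3 k i j)" for i j k by (simp add: A3_def E3_def A)
  have tb2: "tri_bound d2 d1 d3 E2 e" using tri_bound_swap12[OF tb] by (simp add: E2_def)
  have tb3: "tri_bound d3 d1 d2 E3 e" using tri_bound_rotate[OF tb] by (simp add: E3_def)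
  define PI where "PI = power_iter d1 d2 d3 A u0 v0 w0"
  define a where "a t = fst (PI t)" for t
  define b where "b t = fst (snd (PI t))" for t
  define c where "c t = snd (snd (PI t))" for t
  have PI: "PI t = (a t, b t, c t)" for t by (simp add: a_def b_def c_def)
  have aS: "a (Suc t) = normalize_d d1 (contr1 d1 d2 d3 A (b t) (c t))" for t
    using PI[of t] by (simp add: a_def[of "Suc t"] PI_def)
  have bS: "b (Suc t) = normalize_d d2 (contr1 d2 d1 d3 A2 (a t) (c t))" for t
    using PI[of t] by (simp add: b_def[of "Suc t"] PI_def contr2_def contr1_def A2_def)
  have cS: "c (Suc t) = normalize_d d3 (contr1 d3 d1 d2 A3 (a t) (b t))" for t
    using PI[of t] by (simp add: c_def[of "Suc t"] PI_def contr3_def contr1_def A3_def)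
  define S0 where "S0 t \<longleftrightarrow> stage0 d1 u (a t) \<and> stage0 d2 v (b t) \<and> stage0 d3 w (c t)" for t
  define S1 where "S1 t \<longleftrightarrow> stage1 d1 u e (a t) \<and> stage1 d2 v e (b t) \<and> stage1 d3 w e (c t)" for t
  define S2 where "S2 t \<longleftrightarrow> stage2 d1 d2 d3 E u v w e (a t) \<and> stage2 d2 d1 d3 E2 v u w e (b t) \<and> stage2 d3 d1 d2 E3 w u v e (c t)" for t
  have 01: "S1 (Suc t)" if "S0 t" for t
  proof -
    obtain x y z where h: "tang d1 u x (a t)" "vnorm d1 x \<le> 2" "tang d2 v y (b t)" "vnorm d2 y \<le> 2" "tang d3 w z (c t)" "vnorm d3 z \<le> 2"
      using \<open>S0 t\<close> by (auto simp: S0_def stage0_def)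
    show ?thesis unfolding S1_def aS bS cS
      using stage1_step[OF A lam tb e units h(3-6)] stage1_step[OF A2 lam tb2 e units(2,1,3) h(1,2,5,6)]
        stage1_step[OF A3 lam tb3 e units(3,1,2) h(1-4)] by blast
  qed
  have 12: "S2 (Suc t)" if "S1 t" for t
  proof -
    have h: "stage1 d1 u e (a t)" "stage1 d2 v e (b t)" "stage1 d3 w e (c t)" using that by (auto simp: S1_def)
    show ?thesis unfolding S2_def aS bS cS
      using stage2_step[OF A lam tb e units h(2,3)] stage2_step[OF A2 lam tb2 e units(2,1,3) h(1,3)]
        stage2_step[OF A3 lam tb3 e units(3,1,2) h(1,2)] by blast
  qed
  have S0: "S0 t" for t
  proof (induction t)
    case 0
    then show ?case using init by (simp add: S0_def a_def b_def c_def PI_def)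
  next
    case (Suc t)
    then show ?case using 01[of t] stage1_imp_stage0 e(2) by (auto simp: S1_def S0_def)
  qed
  \<comment> \<open>\<open>S0\<close> holds after every sweep, so the three refining steps can be
    taken to be the last three.\<close>
  obtain t where t: "T = Suc (Suc (Suc t))" using T by (metis numeral_3_eq_3 Suc_le_D Suc_le_mono)
  have S2: "S2 (Suc (Suc t))" using 01 12 S0 by blast
  define s where "s = Suc (Suc t)"
  have h: "stage2 d1 d2 d3 E u v w e (a s)" "stage2 d2 d1 d3 E2 v u w e (b s)" "stage2 d3 d1 d2 E3 w u v e (c s)"
    using S2 by (auto simp: S2_def s_def)
  have p1: "stage3 d1 d2 d3 E u v w e (a T)"
    using stage3_step[OF A lam tb e units, of "b s" "c s"] h by (simp add: t s_def aS E2_def E3_def)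
  \<comment> \<open>Seen from mode 2, the other two modes appear in the opposite order in the
    statement about the third factor; \<open>tan0_swap23\<close> identifies the two readings. The
    same happens in \<open>st3\<close> and \<open>st1\<close>.\<close>
  have st2: "stage2 d3 d2 d1 (\<lambda>k j i. E2 j i k) w v u e (c s)"
    using h(3) tan0_swap23[of d3 d2 d1 E3 w v u] by (simp add: stage2_def E2_def E3_def)
  have p2: "stage3 d2 d1 d3 E2 v u w e (b T)"
    using stage3_step[OF A2 lam tb2 e units(2,1,3), of "a s" "c s"] h(1) st2 by (simp add: t s_def bS E2_def)
  have st3: "stage2 d2 d3 d1 (\<lambda>j k i. E3 k i j) v w u e (b s)"
    using h(2) tan0_swap23[of d2 d3 d1 E2 v w u] by (simp add: stage2_def E2_def E3_def)
  have st1: "stage2 d1 d3 d2 (\<lambda>i k j. E3 k i j) u w v e (a s)"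
    using h(1) tan0_swap23[of d1 d3 d2 E u w v] by (simp add: stage2_def E3_def)
  have p3: "stage3 d3 d1 d2 E3 w u v e (c T)"
    using stage3_step[OF A3 lam tb3 e units(3,1,2), of "a s" "b s"] st1 st3 by (simp add: t s_def cS E3_def)
  have n: "vnorm d1 (a T) = 1" "vnorm d2 (b T) = 1" "vnorm d3 (c T) = 1"
    using p1 p2 p3 tang_normalize_unit units unfolding stage3_def t aS bS cS by blast+
  have o: "uh = sign_align d1 (a T) u" "vh = sign_align d2 (b T) v" "wh = sign_align d3 (c T) w"
    using out PI[of T] by (auto simp: alg4_uvw_def PI_def)
  show "refined d1 d2 d3 E u v w e uh" "refined d2 d1 d3 (\<lambda>j i k. E i j k) v u w e vh"
    "refined d3 d1 d2 (\<lambda>k i j. E i j k) w u v e wh"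
    using stage3_refined[OF p1 n(1) tb e units] stage3_refined[OF p2 n(2) tb2 e units(2,1,3)]
      stage3_refined[OF p3 n(3) tb3 e units(3,1,2)] by (simp_all add: o E2_def E3_def)
qed

text \<open>Orthogonality of x, y, z makes the signal contract to exactly \<alpha> \<beta> \<gamma>,
  so the relative error is controlled by E(u, v, w) up to a multiple of e^2. That value is kept
  apart because it is one normal variable over \<tau>, of smaller order than e. The constant 1000
  leaves room over 155 + 68.\<close>

lemma lam_hat_error:
  assumes A: "\<And>i j k. A i j k = lam * (u i * v j * w k + E i j k)" and lam: "lam > 0"
    and tb: "tri_bound d1 d2 d3 E e" and e: "0 \<le> e" "e \<le> 1/100"
    and units: "vnorm d1 u = 1" "vnorm d2 v = 1" "vnorm d3 w = 1"
    and x: "inner_d d1 u x = 0" "vnorm d1 x \<le> 10 * e" "\<forall>i<d1. uh i = \<alpha> * (u i + x i)" "\<bar>\<alpha> - 1\<bar> \<le> 50 * e\<^sup>2"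
    and y: "inner_d d2 v y = 0" "vnorm d2 y \<le> 10 * e" "\<forall>i<d2. vh i = \<beta> * (v i + y i)" "\<bar>\<beta> - 1\<bar> \<le> 50 * e\<^sup>2"
    and z: "inner_d d3 w z = 0" "vnorm d3 z \<le> 10 * e" "\<forall>i<d3. wh i = \<gamma> * (w i + z i)" "\<bar>\<gamma> - 1\<bar> \<le> 50 * e\<^sup>2"
  shows "\<bar>lam_hat d1 d2 d3 A uh vh wh / lam - 1\<bar> \<le> 2 * \<bar>lam_hat d1 d2 d3 E u v w\<bar> + 1000 * e\<^sup>2"
proof -
  define a where "a = (\<lambda>i. u i + x i)"
  define b where "b = (\<lambda>i. v i + y i)"
  define c where "c = (\<lambda>i. w i + z i)"
  have uu: "inner_d d1 u u = 1" "inner_d d2 v v = 1" "inner_d d3 w w = 1"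
    using units vnorm_square[of d1 u] vnorm_square[of d2 v] vnorm_square[of d3 w] by auto
  have ua: "(\<Sum>i<d1. u i * a i) = 1" "(\<Sum>i<d2. v i * b i) = 1" "(\<Sum>i<d3. w i * c i) = 1"
    using x(1) y(1) z(1) uu by (simp_all add: a_def b_def c_def inner_d_add_right flip: inner_d_def)
  have "lam_hat d1 d2 d3 A uh vh wh = lam_hat d1 d2 d3 A (\<lambda>i. \<alpha> * a i) (\<lambda>i. \<beta> * b i) (\<lambda>i. \<gamma> * c i)"
    by (rule lam_hat_cong) (use x y z in \<open>auto simp: a_def b_def c_def\<close>)
  also have "\<dots> = \<alpha> * \<beta> * \<gamma> * lam_hat d1 d2 d3 A a b c" by (simp add: lam_hat_linear)
  also have "lam_hat d1 d2 d3 A a b c = (\<Sum>i<d1. \<Sum>j<d2. \<Sum>k<d3. lam * ((u i * a i) * (v j * b j) * (w k * c k) + E i j k * a i * b j * c k))"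
    by (simp add: lam_hat_def A algebra_simps)
  also have "\<dots> = lam * ((\<Sum>i<d1. \<Sum>j<d2. \<Sum>k<d3. (u i * a i) * (v j * b j) * (w k * c k)) + lam_hat d1 d2 d3 E a b c)"
    by (simp add: lam_hat_def sum.distrib flip: sum_distrib_left)
  also have "(\<Sum>i<d1. \<Sum>j<d2. \<Sum>k<d3. (u i * a i) * (v j * b j) * (w k * c k)) = 1"
    using ua by (simp flip: sum_distrib_left sum_distrib_right)
  finally have eq: "lam_hat d1 d2 d3 A uh vh wh / lam = \<alpha> * \<beta> * \<gamma> * (1 + lam_hat d1 d2 d3 E a b c)" using lam by simp
  define F where "F = lam_hat d1 d2 d3 E a b c"
  have "F - lam_hat d1 d2 d3 E u v w = lam_hat d1 d2 d3 E x v w + lam_hat d1 d2 d3 E a y w + lam_hat d1 d2 d3 E a b z"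
    by (simp add: F_def a_def b_def c_def lam_hat_linear)
  moreover have na: "vnorm d1 a \<le> (11/10)" "vnorm d2 b \<le> (11/10)"
    using vnorm_triangle[of d1 u x] vnorm_triangle[of d2 v y] units x(2) y(2) e by (auto simp: a_def b_def)
  moreover have "\<bar>lam_hat d1 d2 d3 E x v w\<bar> \<le> e * (10 * e * 1 * 1)"
    by (rule tri_bound_leD[OF tb e(1) x(2)]) (use units in simp_all)
  moreover have "\<bar>lam_hat d1 d2 d3 E a y w\<bar> \<le> e * ((11/10) * (10 * e) * 1)"
    by (rule tri_bound_leD[OF tb e(1) na(1) y(2)]) (use units in simp_all)
  moreover have "\<bar>lam_hat d1 d2 d3 E a b z\<bar> \<le> e * ((11/10) * (11/10) * (10 * e))"
    by (rule tri_bound_leD[OF tb e(1) na z(2)])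
  ultimately have F: "\<bar>F - lam_hat d1 d2 d3 E u v w\<bar> \<le> 34 * e\<^sup>2" by (simp add: power2_eq_square)
  have e2: "e\<^sup>2 \<le> 1/10000" using power_mono[OF e(2) e(1), of 2] by (simp add: power2_eq_square)
  have ab: "\<bar>\<alpha> * \<beta> - 1\<bar> \<le> 101 * e\<^sup>2"
  proof -
    have "\<alpha> * \<beta> - 1 = (\<alpha> - 1) * \<beta> + (\<beta> - 1)" by (simp add: algebra_simps)
    moreover have "\<bar>(\<alpha> - 1) * \<beta>\<bar> \<le> (50 * e\<^sup>2) * (101/100)" unfolding abs_mult using x(4) y(4) e2 by (intro mult_mono) auto
    ultimately show ?thesis using y(4) by linarith
  qed
  have abc: "\<bar>\<alpha> * \<beta> * \<gamma> - 1\<bar> \<le> 155 * e\<^sup>2"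
  proof -
    have "\<alpha> * \<beta> * \<gamma> - 1 = (\<alpha> * \<beta> - 1) * \<gamma> + (\<gamma> - 1)" by (simp add: algebra_simps)
    moreover have "\<bar>(\<alpha> * \<beta> - 1) * \<gamma>\<bar> \<le> (101 * e\<^sup>2) * (101/100)" unfolding abs_mult using z(4) ab e2 by (intro mult_mono) auto
    ultimately show ?thesis using z(4) e2 by linarith
  qed
  have "\<bar>\<alpha> * \<beta> * \<gamma> * F\<bar> \<le> 2 * (\<bar>lam_hat d1 d2 d3 E u v w\<bar> + 34 * e\<^sup>2)"
    unfolding abs_mult[of _ F] using abc F e2 by (intro mult_mono) auto
  then show ?thesis unfolding eq F_def[symmetric] using abc by (simp add: algebra_simps abs_if split: if_splits)
qed

section \<open>Lattice points and operator norms\<close>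

text \<open>These integer points replace a net of the ball of radius sqrt d: an explicit set that
  contains every coordinatewise rounding of a point of the ball, since rounding turns squared norm d
  into at most 2 d + 2 d. Extensional functions make it finite.\<close>

definition lattice_ball :: "nat \<Rightarrow> (nat \<Rightarrow> int) set" where
  "lattice_ball d = {m \<in> PiE {..<d} (\<lambda>_. UNIV). (\<Sum>i<d. (m i)\<^sup>2) \<le> 4 * int d}"

lemma abs_le_square_int: "\<bar>k\<bar> \<le> (k::int)\<^sup>2"
proof (cases "k = 0")
  case False
  then have "\<bar>k\<bar> * 1 \<le> \<bar>k\<bar> * \<bar>k\<bar>" by (intro mult_left_mono) auto
  then show ?thesis by (simp add: power2_eq_square)
qed simp

lemma lattice_ball_subset: "lattice_ball d \<subseteq> PiE {..<d} (\<lambda>_. {- int (4 * d)..int (4 * d)})"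
proof
  fix m assume m: "m \<in> lattice_ball d"
  have "\<bar>m i\<bar> \<le> 4 * int d" if "i < d" for i
  proof -
    have "\<bar>m i\<bar> \<le> (m i)\<^sup>2" by (rule abs_le_square_int)
    also have "\<dots> \<le> (\<Sum>i<d. (m i)\<^sup>2)" using that by (intro member_le_sum) auto
    finally show ?thesis using m by (auto simp: lattice_ball_def)
  qed
  with m show "m \<in> PiE {..<d} (\<lambda>_. {- int (4 * d)..int (4 * d)})"
    by (force simp: lattice_ball_def PiE_def Pi_def)
qed

lemma finite_lattice_ball [simp]: "finite (lattice_ball d)"
  by (rule finite_subset[OF lattice_ball_subset]) (auto intro: finite_PiE)

lemma sum_half_powers: "(\<Sum>k\<in>{- int N..int N}. (1/2::real) ^ nat \<bar>k\<bar>) = 3 - 2 * (1/2) ^ N"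
proof (induction N)
  case (Suc N)
  have "{- int (Suc N)..int (Suc N)} = insert (int (Suc N)) (insert (- int (Suc N)) {- int N..int N})" by auto
  moreover have "nat (1 + int N) = Suc N" "nat (int N + 1) = Suc N" by auto
  ultimately show ?case using Suc by simp
qed simp

text \<open>The generating function of the 1-norm, evaluated at 1/2, counts the integer points.\<close>
lemma card_lattice_ball: "card (lattice_ball d) \<le> 48 ^ d"
proof -
  \<comment> \<open>An integer satisfies |k| \<le> k^2, so every point of the set has 1-norm at most
    4 d. Markov's argument with the weights (1/2)^|k|, whose sum stays below 3, gives 3^d * 2^(4 d)
    = 48^d.\<close>
  define N where "N = 4 * d"
  let ?P = "PiE {..<d} (\<lambda>_. {- int N..int N})"
  have sub: "lattice_ball d \<subseteq> ?P" using lattice_ball_subset by (simp add: N_def)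
  have fin: "finite ?P" by (auto intro: finite_PiE)
  have "real (card (lattice_ball d)) * (1/2) ^ N = (\<Sum>m\<in>lattice_ball d. (1/2) ^ N)" by simp
  also have "\<dots> \<le> (\<Sum>m\<in>lattice_ball d. \<Prod>i<d. (1/2::real) ^ nat \<bar>m i\<bar>)"
  proof (rule sum_mono)
    fix m assume m: "m \<in> lattice_ball d"
    have "(\<Sum>i<d. \<bar>m i\<bar>) \<le> (\<Sum>i<d. (m i)\<^sup>2)" by (intro sum_mono abs_le_square_int)
    also have "\<dots> \<le> int N" using m by (simp add: lattice_ball_def N_def)
    finally have "int (\<Sum>i<d. nat \<bar>m i\<bar>) \<le> int N" by simp
    then have "(\<Sum>i<d. nat \<bar>m i\<bar>) \<le> N" by (simp only: of_nat_le_iff)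
    then have "(1/2::real) ^ N \<le> (1/2) ^ (\<Sum>i<d. nat \<bar>m i\<bar>)" by (intro power_decreasing) auto
    then show "(1/2) ^ N \<le> (\<Prod>i<d. (1/2::real) ^ nat \<bar>m i\<bar>)" by (simp add: power_sum)
  qed
  also have "\<dots> \<le> (\<Sum>m\<in>?P. \<Prod>i<d. (1/2::real) ^ nat \<bar>m i\<bar>)"
    by (rule sum_mono2[OF fin sub]) (rule prod_nonneg, simp)
  also have "\<dots> = (\<Prod>i<d. \<Sum>k\<in>{- int N..int N}. (1/2::real) ^ nat \<bar>k\<bar>)"
    by (rule prod_sum_PiE[symmetric]) auto
  also have "\<dots> \<le> (\<Prod>i<d. 3)"
  proof (rule prod_mono, rule conjI)
    have "(1/2::real) ^ N \<le> 1" "0 \<le> (1/2::real) ^ N" by (rule power_le_one) auto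
    then show "0 \<le> (\<Sum>k\<in>{- int N..int N}. (1/2::real) ^ nat \<bar>k\<bar>)" "(\<Sum>k\<in>{- int N..int N}. (1/2::real) ^ nat \<bar>k\<bar>) \<le> 3"
      unfolding sum_half_powers by linarith+
  qed
  also have "(\<Prod>i<d. 3::real) = 3 ^ d" by simp
  finally have "real (card (lattice_ball d)) * (1/2) ^ N * 2 ^ N \<le> 3 ^ d * 2 ^ N" by (rule mult_right_mono) simp
  moreover have "(1/2::real) ^ N * 2 ^ N = 1" unfolding power_mult_distrib[symmetric] by simp
  ultimately have "real (card (lattice_ball d)) \<le> 3 ^ d * 2 ^ N" by (simp only: mult.assoc mult_1_right)
  also have "(2::real) ^ N = 16 ^ d" by (simp add: N_def power_mult)
  also have "(3::real) ^ d * 16 ^ d = 48 ^ d" unfolding power_mult_distrib[symmetric] by simp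
  also have "(48::real) ^ d = real (48 ^ d)" by simp
  finally show ?thesis by (simp only: of_nat_le_iff)
qed

lemma lattice_ball_vnorm: "m \<in> lattice_ball d \<Longrightarrow> (vnorm d (\<lambda>i. real_of_int (m i)))\<^sup>2 \<le> 4 * d"
proof -
  assume "m \<in> lattice_ball d"
  then have "real_of_int (\<Sum>i<d. (m i)\<^sup>2) \<le> real_of_int (4 * int d)"
    by (simp only: of_int_le_iff) (simp add: lattice_ball_def)
  then show ?thesis by (simp add: vnorm_square inner_d_def flip: power2_eq_square)
qed

text \<open>A linear form on a box is maximal at a vertex, so each coordinate may be rounded in the
  direction of its coefficient.\<close>
lemma lattice_round:
  assumes "(vnorm d a)\<^sup>2 \<le> d"
  obtains m where "m \<in> lattice_ball d" "inner_d d c a \<le> inner_d d c (\<lambda>i. real_of_int (m i))"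
proof
  define m where "m = (\<lambda>i\<in>{..<d}. if 0 \<le> c i then \<lceil>a i\<rceil> else \<lfloor>a i\<rfloor>)"
  have "real_of_int (\<Sum>i<d. (m i)\<^sup>2) \<le> (\<Sum>i<d. 2 * (a i)\<^sup>2 + 2)"
    unfolding of_int_sum
  proof (rule sum_mono)
    fix i assume "i \<in> {..<d}"
    then have "\<bar>real_of_int (m i) - a i\<bar> \<le> 1" by (simp add: m_def) linarith
    then have "(real_of_int (m i) - a i)\<^sup>2 \<le> 1" by (simp add: abs_square_le_1)
    moreover have "2 * (a i)\<^sup>2 + 2 * (real_of_int (m i) - a i)\<^sup>2 - (real_of_int (m i))\<^sup>2 = (real_of_int (m i) - 2 * a i)\<^sup>2"
      by (simp add: power2_eq_square algebra_simps)
    ultimately show "real_of_int ((m i)\<^sup>2) \<le> 2 * (a i)\<^sup>2 + 2"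
      using zero_le_power2[of "real_of_int (m i) - 2 * a i"] by (simp only: of_int_power)
  qed
  also have "\<dots> = 2 * (vnorm d a)\<^sup>2 + 2 * d"
    by (simp add: vnorm_square inner_d_def sum.distrib flip: sum_distrib_left power2_eq_square)
  also have "\<dots> \<le> real_of_int (4 * int d)" using assms by simp
  finally show "m \<in> lattice_ball d" by (simp only: of_int_le_iff) (simp add: lattice_ball_def m_def)
  show "inner_d d c a \<le> inner_d d c (\<lambda>i. real_of_int (m i))"
    unfolding inner_d_def
  proof (rule sum_mono)
    fix i assume "i \<in> {..<d}"
    then show "c i * a i \<le> c i * real_of_int (m i)"
      by (cases "0 \<le> c i") (simp_all add: m_def mult_left_mono mult_left_mono_neg)
  qed
qed

text \<open>With two arguments fixed the form is linear in the third, so the arguments can be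
  rounded one after another without decreasing the value; no constant is lost to approximation.
  Rescaling the arguments to norm sqrt d produces the denominator.\<close>

lemma tri_bound_lattice:
  assumes K: "0 \<le> K" and d: "0 < d1" "0 < d2" "0 < d3"
    and L: "\<And>m1 m2 m3. m1 \<in> lattice_ball d1 \<Longrightarrow> m2 \<in> lattice_ball d2 \<Longrightarrow> m3 \<in> lattice_ball d3 \<Longrightarrow>
        lam_hat d1 d2 d3 Z (\<lambda>i. real_of_int (m1 i)) (\<lambda>i. real_of_int (m2 i)) (\<lambda>i. real_of_int (m3 i)) \<le> K"
  shows "tri_bound d1 d2 d3 Z (K / sqrt (real (d1 * d2 * d3)))"
proof -
  have 1: "lam_hat d1 d2 d3 Z a b c \<le> K"
    if a: "(vnorm d1 a)\<^sup>2 \<le> d1" and b: "(vnorm d2 b)\<^sup>2 \<le> d2" and c: "(vnorm d3 c)\<^sup>2 \<le> d3" for a b c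
  proof -
    obtain m1 where m1: "m1 \<in> lattice_ball d1" and
      "inner_d d1 (contr1 d1 d2 d3 Z b c) a \<le> inner_d d1 (contr1 d1 d2 d3 Z b c) (\<lambda>i. real_of_int (m1 i))"
      using lattice_round[OF a] .
    then have "lam_hat d1 d2 d3 Z a b c \<le> lam_hat d1 d2 d3 Z (\<lambda>i. real_of_int (m1 i)) b c"
      by (simp add: inner_d_commute[of d1 "contr1 _ _ _ _ _ _"] inner_d_contr1)
    moreover
    let ?c2 = "contr1 d2 d1 d3 (\<lambda>j i k. Z i j k) (\<lambda>i. real_of_int (m1 i)) c"
    obtain m2 where m2: "m2 \<in> lattice_ball d2" and
      "inner_d d2 ?c2 b \<le> inner_d d2 ?c2 (\<lambda>i. real_of_int (m2 i))"
      using lattice_round[OF b] .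
    then have "lam_hat d1 d2 d3 Z (\<lambda>i. real_of_int (m1 i)) b c \<le> lam_hat d1 d2 d3 Z (\<lambda>i. real_of_int (m1 i)) (\<lambda>i. real_of_int (m2 i)) c"
      by (simp add: inner_d_commute[of d2 ?c2] inner_d_contr1 lam_hat_swap12[of d2 d1 d3 Z])
    moreover
    let ?c3 = "contr1 d3 d1 d2 (\<lambda>k i j. Z i j k) (\<lambda>i. real_of_int (m1 i)) (\<lambda>i. real_of_int (m2 i))"
    obtain m3 where m3: "m3 \<in> lattice_ball d3" and
      "inner_d d3 ?c3 c \<le> inner_d d3 ?c3 (\<lambda>i. real_of_int (m3 i))"
      using lattice_round[OF c] .
    then have "lam_hat d1 d2 d3 Z (\<lambda>i. real_of_int (m1 i)) (\<lambda>i. real_of_int (m2 i)) c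
       \<le> lam_hat d1 d2 d3 Z (\<lambda>i. real_of_int (m1 i)) (\<lambda>i. real_of_int (m2 i)) (\<lambda>i. real_of_int (m3 i))"
      by (simp add: inner_d_commute[of d3 ?c3] inner_d_contr1 lam_hat_rotate[of d3 d1 d2 Z])
    ultimately show ?thesis using L[OF m1 m2 m3] by linarith
  qed
  have 2: "\<bar>lam_hat d1 d2 d3 Z a b c\<bar> \<le> K"
    if "(vnorm d1 a)\<^sup>2 \<le> d1" "(vnorm d2 b)\<^sup>2 \<le> d2" "(vnorm d3 c)\<^sup>2 \<le> d3" for a b c
  proof -
    have "(vnorm d1 (\<lambda>i. (-1) * a i))\<^sup>2 \<le> d1" using that(1) by (simp only: vnorm_scale) simp
    from 1[OF this that(2,3)] 1[OF that] show ?thesis by (simp only: lam_hat_scale1)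
  qed
  have z: "a i = 0" if "vnorm d a = 0" "i < d" for d a i
    using that by (auto simp: vnorm_def sum_nonneg_eq_0_iff)
  show ?thesis unfolding tri_bound_def
  proof (intro allI)
    fix a b c
    show "\<bar>lam_hat d1 d2 d3 Z a b c\<bar> \<le> K / sqrt (real (d1 * d2 * d3)) * (vnorm d1 a * vnorm d2 b * vnorm d3 c)"
    proof (cases "vnorm d1 a = 0 \<or> vnorm d2 b = 0 \<or> vnorm d3 c = 0")
      case True
      then have "lam_hat d1 d2 d3 Z a b c = 0"
        unfolding lam_hat_def by (intro sum.neutral ballI) (auto simp: z)
      then show ?thesis using K by simp
    next
      case False
      then have p: "vnorm d1 a > 0" "vnorm d2 b > 0" "vnorm d3 c > 0" by (simp_all add: less_le)
      define ra where "ra = sqrt d1 / vnorm d1 a"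
      define rb where "rb = sqrt d2 / vnorm d2 b"
      define rc where "rc = sqrt d3 / vnorm d3 c"
      have r: "ra > 0" "rb > 0" "rc > 0" using p d by (auto simp: ra_def rb_def rc_def)
      have n: "(vnorm d1 (\<lambda>i. ra * a i))\<^sup>2 \<le> d1" "(vnorm d2 (\<lambda>i. rb * b i))\<^sup>2 \<le> d2" "(vnorm d3 (\<lambda>i. rc * c i))\<^sup>2 \<le> d3"
        using p by (simp_all only: vnorm_scale) (simp_all add: ra_def rb_def rc_def)
      have "\<bar>lam_hat d1 d2 d3 Z a b c\<bar> * (ra * rb * rc) \<le> K"
        using 2[OF n] r by (simp add: lam_hat_linear abs_mult mult_ac)
      then show ?thesis using p d by (simp add: ra_def rb_def rc_def field_simps real_sqrt_mult)
    qed
  qed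
qed

section \<open>Quadratic forms on the sphere and the spectral initialization\<close>

definition quad :: "nat \<Rightarrow> (nat \<Rightarrow> nat \<Rightarrow> real) \<Rightarrow> vec \<Rightarrow> real" where
  "quad d H a = (\<Sum>i<d. \<Sum>j<d. a i * a j * H i j)"

text \<open>Round both arguments of the bilinear form separately, then polarize.\<close>
lemma quad_bound_lattice:
  assumes sym: "\<And>i j. H i j = H j i" and d: "0 < d" and a: "vnorm d a = 1"
    and L: "\<And>m m'. m \<in> lattice_ball d \<Longrightarrow> m' \<in> lattice_ball d \<Longrightarrow>
        \<bar>quad d H (\<lambda>i. real_of_int (m i) + real_of_int (m' i))\<bar> \<le> R \<and>
        \<bar>quad d H (\<lambda>i. real_of_int (m i) - real_of_int (m' i))\<bar> \<le> R"
  shows "\<bar>quad d H a\<bar> \<le> R / (2 * d)"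
proof -
  \<comment> \<open>The sign t reduces the absolute value to upper bounds for H and for - H.
    Symmetry of the bilinear form lets the second argument be rounded after the first.\<close>
  have main: "quad d H' a \<le> R / (2 * d)" if H': "H' = (\<lambda>i j. t * H i j)" and t: "\<bar>t\<bar> = 1" for H' t
  proof -
    define B where "B a b = (\<Sum>i<d. \<Sum>j<d. a i * b j * H' i j)" for a b
    have sym': "B a b = B b a" for a b
      unfolding B_def by (subst sum.swap) (simp add: H' sym mult_ac)
    have lin: "B a b = inner_d d (\<lambda>j. \<Sum>i<d. a i * H' i j) b" for a b
      unfolding B_def inner_d_def by (subst sum.swap) (simp add: sum_distrib_left sum_distrib_right mult_ac)
    define a' where "a' = (\<lambda>i. sqrt d * a i)"
    have n: "(vnorm d a')\<^sup>2 \<le> d" using a by (simp add: a'_def vnorm_scale)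
    obtain m where m: "m \<in> lattice_ball d" "B a' a' \<le> B a' (\<lambda>i. real_of_int (m i))"
      using lattice_round[OF n, of "\<lambda>j. \<Sum>i<d. a' i * H' i j"] unfolding lin by blast
    obtain m' where m': "m' \<in> lattice_ball d" "B (\<lambda>i. real_of_int (m i)) a' \<le> B (\<lambda>i. real_of_int (m i)) (\<lambda>i. real_of_int (m' i))"
      using lattice_round[OF n, of "\<lambda>j. \<Sum>i<d. real_of_int (m i) * H' i j"] unfolding lin by blast
    \<comment> \<open>Polarization: two values bounded by R give B \<le> R/2, and scaling the unit
      vector by sqrt d divides this by d.\<close>
    have pol: "4 * B x y = t * quad d H (\<lambda>i. x i + y i) - t * quad d H (\<lambda>i. x i - y i)" for x y
    proof -
      have "t * quad d H (\<lambda>i. x i + y i) = B x x + B x y + B y x + B y y"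
        unfolding B_def quad_def H' sum_distrib_left by (simp add: algebra_simps sum.distrib)
      moreover have "t * quad d H (\<lambda>i. x i - y i) = B x x - B x y - B y x + B y y"
        unfolding B_def quad_def H' sum_distrib_left by (simp add: algebra_simps sum.distrib sum_subtractf)
      ultimately show ?thesis using sym'[of x y] by simp
    qed
    have t_le: "t * z \<le> R" "- (t * z) \<le> R" if "\<bar>z\<bar> \<le> R" for z
    proof -
      have "\<bar>t * z\<bar> \<le> R" using t that by (simp add: abs_mult)
      then show "t * z \<le> R" "- (t * z) \<le> R" by linarith+
    qed
    have "4 * B (\<lambda>i. real_of_int (m i)) (\<lambda>i. real_of_int (m' i)) \<le> R + R"
      unfolding pol using t_le(1)[OF conjunct1[OF L[OF m(1) m'(1)]]] t_le(2)[OF conjunct2[OF L[OF m(1) m'(1)]]]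
      by linarith
    then have "B a' a' \<le> R / 2" using m m' sym'[of a' "\<lambda>i. real_of_int (m i)"] by linarith
    moreover have "B a' a' = d * quad d H' a"
    proof -
      have "B a' a' = (\<Sum>i<d. \<Sum>j<d. (sqrt d * sqrt d) * (a i * a j * H' i j))"
        by (simp add: B_def a'_def mult_ac)
      then show ?thesis by (simp add: quad_def flip: sum_distrib_left)
    qed
    ultimately show ?thesis using d by (simp add: field_simps)
  qed
  have "quad d H a \<le> R / (2 * d)" using main[of H 1] by simp
  moreover have "- quad d H a \<le> R / (2 * d)" using main[of "\<lambda>i j. - H i j" "-1"]
    by (simp add: quad_def sum_negf)
  ultimately show ?thesis by linarith
qed

text \<open>The leading vector beats \<open>u\<close> in the quadratic form of the matricization.
  There the noise contributes almost the same number N in every direction, so N drops out of the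
  comparison, and only its oscillation r, once for each vector, and two cross terms of size 2 e
  remain. N itself may be large; the cancellation is what makes the estimate useful.\<close>

lemma leading_alignment:
  assumes A: "\<And>i j k. A i j k = lam * (u i * v j * w k + E i j k)" and lam: "lam > 0"
    and units: "vnorm d1 u = 1" "vnorm d2 v = 1" "vnorm d3 w = 1"
    and tb: "tri_bound d1 d2 d3 E e" and e: "0 \<le> e"
    and cov: "\<And>y. vnorm d1 y = 1 \<Longrightarrow> \<bar>(\<Sum>j<d2. \<Sum>k<d3. (\<Sum>i<d1. y i * E i j k)\<^sup>2) - N\<bar> \<le> r"
    and x: "lead_lsv1 d1 d2 d3 A x"
  shows "1 - 4 * e - 2 * r \<le> (inner_d d1 x u)\<^sup>2"
proof -
  define C where "C y = (\<Sum>j<d2. \<Sum>k<d3. (\<Sum>i<d1. y i * E i j k)\<^sup>2)" for y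
  have vw: "(\<Sum>j<d2. (v j)\<^sup>2) = 1" "(\<Sum>k<d3. (w k)\<^sup>2) = 1"
    using units by (auto simp: vnorm_def)
  have ex: "(\<Sum>j<d2. \<Sum>k<d3. (\<Sum>i<d1. y i * A i j k)^2)
      = lam\<^sup>2 * ((inner_d d1 y u)\<^sup>2 + 2 * inner_d d1 y u * lam_hat d1 d2 d3 E y v w + C y)" for y
  proof -
    define s where "s = inner_d d1 y u"
    define g where "g j k = (\<Sum>i<d1. y i * E i j k)" for j k
    have "(\<Sum>i<d1. y i * A i j k) = lam * (s * (v j * w k) + g j k)" for j k
      by (simp add: A s_def inner_d_def g_def sum_distrib_left sum_distrib_right sum.distrib algebra_simps)
    then have "(\<Sum>j<d2. \<Sum>k<d3. (\<Sum>i<d1. y i * A i j k)^2)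
      = (\<Sum>j<d2. \<Sum>k<d3. lam\<^sup>2 * (s\<^sup>2 * ((v j)\<^sup>2 * (w k)\<^sup>2) + 2 * s * (g j k * v j * w k) + (g j k)\<^sup>2))"
      by (simp add: power_mult_distrib) (simp add: power2_eq_square algebra_simps)
    also have "\<dots> = lam\<^sup>2 * (s\<^sup>2 * (\<Sum>j<d2. \<Sum>k<d3. (v j)\<^sup>2 * (w k)\<^sup>2) + 2 * s * (\<Sum>j<d2. \<Sum>k<d3. g j k * v j * w k) + (\<Sum>j<d2. \<Sum>k<d3. (g j k)\<^sup>2))"
      by (simp add: sum.distrib flip: sum_distrib_left)
    also have "(\<Sum>j<d2. \<Sum>k<d3. (v j)\<^sup>2 * (w k)\<^sup>2) = 1" using vw by (simp flip: sum_distrib_left sum_distrib_right)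
    also have "(\<Sum>j<d2. \<Sum>k<d3. g j k * v j * w k) = lam_hat d1 d2 d3 E y v w"
    proof -
      have "(\<Sum>j<d2. \<Sum>k<d3. g j k * v j * w k) = (\<Sum>j<d2. \<Sum>k<d3. \<Sum>i<d1. E i j k * y i * v j * w k)"
        by (simp add: g_def sum_distrib_left mult_ac)
      also have "\<dots> = (\<Sum>j<d2. \<Sum>i<d1. \<Sum>k<d3. E i j k * y i * v j * w k)"
        by (rule sum.cong[OF refl], rule sum.swap)
      also have "\<dots> = lam_hat d1 d2 d3 E y v w" unfolding lam_hat_def by (rule sum.swap)
      finally show ?thesis .
    qed
    finally show ?thesis by (simp add: s_def C_def g_def)
  qed
  have nx: "vnorm d1 x = 1" using x by (simp add: lead_lsv1_def)
  have uu: "inner_d d1 u u = 1" using units(1) vnorm_square[of d1 u] by simp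
  have "lam\<^sup>2 * ((inner_d d1 u u)\<^sup>2 + 2 * inner_d d1 u u * lam_hat d1 d2 d3 E u v w + C u)
     \<le> lam\<^sup>2 * ((inner_d d1 x u)\<^sup>2 + 2 * inner_d d1 x u * lam_hat d1 d2 d3 E x v w + C x)"
    using x units(1) by (simp only: lead_lsv1_def flip: ex)
  then have le: "1 + 2 * lam_hat d1 d2 d3 E u v w + C u \<le> (inner_d d1 x u)\<^sup>2 + 2 * (inner_d d1 x u * lam_hat d1 d2 d3 E x v w) + C x"
    using lam by (simp add: uu)
  have "\<bar>lam_hat d1 d2 d3 E u v w\<bar> \<le> e" using tri_boundD[OF tb, of u v w] units by simp
  moreover have "\<bar>inner_d d1 x u * lam_hat d1 d2 d3 E x v w\<bar> \<le> 1 * e"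
    unfolding abs_mult using tri_boundD[OF tb, of x v w] units nx inner_d_CS[of d1 x u] by (intro mult_mono) auto
  moreover have "\<bar>C u - N\<bar> \<le> r" "\<bar>C x - N\<bar> \<le> r" using cov units(1) nx by (auto simp: C_def)
  ultimately show ?thesis using le by linarith
qed

section \<open>Orthonormal bases\<close>

definition orthonormal :: "nat \<Rightarrow> nat \<Rightarrow> (nat \<Rightarrow> vec) \<Rightarrow> bool" where
  "orthonormal d k f \<longleftrightarrow> (\<forall>s<k. \<forall>t<k. inner_d d (f s) (f t) = (if s = t then 1 else 0))"

lemma sum_kronecker:
  fixes x :: "nat \<Rightarrow> real"
  assumes "i < d"
  shows "(\<Sum>j<d. (if j = i then 1 else 0) * x j) = x i" "(\<Sum>j<d. x j * (if j = i then 1 else 0)) = x i"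
    "(\<Sum>j<d. x j * (if i = j then 1 else 0)) = x i"
  using assms sum.delta[of "{..<d}" i x] by (simp_all add: if_distrib[of "\<lambda>t. t * _"] if_distrib[of "\<lambda>t. _ * t"] cong: if_cong)

text \<open>The vectors \<open>g i\<close> are the rows of the projection onto the orthogonal
  complement of the span. Their squared norms are its diagonal entries and add up to its trace d -
  k, from which both extension and completeness follow.\<close>

lemma orthonormal_defect:
  assumes f: "orthonormal d k f"
  defines "g \<equiv> (\<lambda>i j. (if j = i then 1 else 0) - (\<Sum>s<k. f s i * f s j))"
  shows "(\<Sum>i<d. (vnorm d (g i))\<^sup>2) = real d - real k"
    and "s < k \<Longrightarrow> i < d \<Longrightarrow> inner_d d (f s) (g i) = 0"
proof -
  have fg: "inner_d d (f s) (g i) = 0" if "s < k" "i < d" for s i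
  proof -
    have "inner_d d (f s) (g i) = (\<Sum>j<d. f s j * (if j = i then 1 else 0)) - (\<Sum>j<d. \<Sum>t<k. f t i * (f s j * f t j))"
      by (simp add: inner_d_def g_def algebra_simps sum_subtractf sum_distrib_left sum_distrib_right)
    also have "(\<Sum>j<d. f s j * (if j = i then 1 else 0)) = f s i" using that by (simp add: sum_kronecker)
    also have "(\<Sum>j<d. \<Sum>t<k. f t i * (f s j * f t j)) = (\<Sum>t<k. f t i * inner_d d (f s) (f t))"
      by (subst sum.swap) (simp add: inner_d_def sum_distrib_left)
    also have "\<dots> = (\<Sum>t<k. f t i * (if s = t then 1 else 0))"
      using f that by (intro sum.cong) (auto simp: orthonormal_def)
    also have "\<dots> = f s i" using that by (simp add: sum_kronecker)
    finally show ?thesis by simp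
  qed
  then show "s < k \<Longrightarrow> i < d \<Longrightarrow> inner_d d (f s) (g i) = 0" .
  have "(vnorm d (g i))\<^sup>2 = 1 - (\<Sum>s<k. (f s i)\<^sup>2)" if i: "i < d" for i
  proof -
    have "(vnorm d (g i))\<^sup>2 = (\<Sum>j<d. g i j * g i j)" by (simp add: vnorm_square inner_d_def)
    also have "\<dots> = (\<Sum>j<d. (if j = i then 1 else 0) * g i j) - (\<Sum>j<d. \<Sum>s<k. f s i * (f s j * g i j))"
      by (subst (1) g_def) (simp add: algebra_simps sum_subtractf sum_distrib_left sum_distrib_right)
    also have "(\<Sum>j<d. \<Sum>s<k. f s i * (f s j * g i j)) = (\<Sum>s<k. f s i * inner_d d (f s) (g i))"
      by (subst sum.swap) (simp add: inner_d_def sum_distrib_left)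
    also have "\<dots> = 0" using fg i by simp
    also have "(\<Sum>j<d. (if j = i then 1 else 0) * g i j) = g i i" using i by (simp add: sum_kronecker)
    finally show ?thesis by (simp add: g_def power2_eq_square)
  qed
  then have "(\<Sum>i<d. (vnorm d (g i))\<^sup>2) = (\<Sum>i<d. 1 - (\<Sum>s<k. (f s i)\<^sup>2))" by simp
  also have "\<dots> = real d - (\<Sum>i<d. \<Sum>s<k. (f s i)\<^sup>2)" by (simp add: sum_subtractf)
  also have "(\<Sum>i<d. \<Sum>s<k. (f s i)\<^sup>2) = (\<Sum>s<k. inner_d d (f s) (f s))"
    by (subst sum.swap) (simp add: inner_d_def power2_eq_square)
  also have "\<dots> = real k" using f by (simp add: orthonormal_def)
  finally show "(\<Sum>i<d. (vnorm d (g i))\<^sup>2) = real d - real k" .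
qed

text \<open>A positive trace d - k forces some row of the complementary projection to be nonzero;
  normalized, that row is the new vector.\<close>

lemma orthonormal_extend:
  assumes f: "orthonormal d k f" and k: "k < d"
  obtains x where "vnorm d x = 1" "\<And>s. s < k \<Longrightarrow> inner_d d (f s) x = 0"
proof -
  define g where "g = (\<lambda>i j. (if j = i then 1 else 0) - (\<Sum>s<k. f s i * f s j))"
  have "\<exists>i<d. vnorm d (g i) \<noteq> 0"
  proof (rule ccontr)
    assume "\<not> ?thesis"
    then have "(\<Sum>i<d. (vnorm d (g i))\<^sup>2) = 0" by simp
    then show False using orthonormal_defect(1)[OF f] k by (simp add: g_def)
  qed
  then obtain i where i: "i < d" "vnorm d (g i) \<noteq> 0" by blast
  show ?thesis
  proof
    show "vnorm d (\<lambda>j. (1 / vnorm d (g i)) * g i j) = 1" using i by (simp only: vnorm_scale) simp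
    show "inner_d d (f s) (\<lambda>j. (1 / vnorm d (g i)) * g i j) = 0" if "s < k" for s
      using orthonormal_defect(2)[OF f that i(1)] by (simp only: inner_d_scale_right) (simp add: g_def)
  qed
qed

lemma orthonormal_basis_extend:
  assumes "orthonormal d k f" "k \<le> d"
  obtains f' where "orthonormal d d f'" "\<And>s. s < k \<Longrightarrow> f' s = f s"
proof -
  have "\<exists>f'. orthonormal d d f' \<and> (\<forall>s<k. f' s = f s)" using assms
  proof (induction "d - k" arbitrary: k f)
    case 0
    then show ?case by auto
  next
    case (Suc n)
    then have k: "k < d" by simp
    obtain x where x: "vnorm d x = 1" "\<And>s. s < k \<Longrightarrow> inner_d d (f s) x = 0"
      using orthonormal_extend[OF Suc.prems(1) k] by blast
    have "orthonormal d (Suc k) (f(k := x))"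
      unfolding orthonormal_def
    proof (intro allI impI)
      fix s t assume st: "s < Suc k" "t < Suc k"
      have "inner_d d x (f s) = 0" if "s < k" for s using x(2)[OF that] by (simp add: inner_d_commute)
      moreover have "inner_d d x x = 1" using x(1) vnorm_square[of d x] by simp
      moreover have "inner_d d (f s) (f t) = (if s = t then 1 else 0)" if "s < k" "t < k"
        using Suc.prems(1) that by (simp add: orthonormal_def)
      ultimately show "inner_d d ((f(k := x)) s) ((f(k := x)) t) = (if s = t then 1 else 0)"
        using st x(2) by (cases "s = k"; cases "t = k") (simp_all add: less_Suc_eq)
    qed
    moreover have "n = d - Suc k" "Suc k \<le> d" using Suc.hyps(2) k by auto
    ultimately obtain f' where f': "orthonormal d d f'" "\<forall>s<Suc k. f' s = (f(k := x)) s"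
      using Suc.hyps(1) by blast
    have "f' s = f s" if "s < k" for s using f'(2)[rule_format, of s] that by simp
    with f'(1) show ?case by blast
  qed
  then show ?thesis using that by blast
qed

text \<open>Index 0 carries the true vector and index 1 the tangential direction of interest. The
  index conventions of all noise coordinates rest on this placement.\<close>

lemma orthonormal_basis_pair:
  assumes "vnorm d u = 1" "vnorm d q = 1" "inner_d d q u = 0" "2 \<le> d"
  obtains f where "orthonormal d d f" "f 0 = u" "f 1 = q"
proof -
  have "orthonormal d 2 (\<lambda>s. if s = 0 then u else q)"
    using assms vnorm_square[of d u] vnorm_square[of d q]
    by (auto simp: orthonormal_def less_2_cases_iff inner_d_commute[of d u q])
  from orthonormal_basis_extend[OF this assms(4)] obtain f' where
    f': "orthonormal d d f'" "\<And>s. s < 2 \<Longrightarrow> f' s = (if s = 0 then u else q)" by blast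
  show ?thesis using that[of f'] f'(1) f'(2)[of 0] f'(2)[of 1] by simp
qed

lemma exists_orthogonal_unit:
  assumes "vnorm d u = 1" "2 \<le> d"
  obtains q where "vnorm d q = 1" "inner_d d q u = 0"
proof -
  have o: "orthonormal d 1 (\<lambda>s. u)" using assms vnorm_square[of d u] by (simp add: orthonormal_def)
  have d: "1 < d" using assms(2) by simp
  show ?thesis
  proof (rule orthonormal_extend[OF o d])
    fix q assume q: "vnorm d q = 1" "\<And>s::nat. s < 1 \<Longrightarrow> inner_d d u q = 0"
    have "inner_d d q u = 0" using q(2)[of 0] by (simp add: inner_d_commute)
    then show thesis by (rule that[OF q(1)])
  qed
qed

text \<open>For k = d the complementary projection has trace zero, hence vanishes row by row; this
  is completeness of the system.\<close>

lemma parseval: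
  assumes f: "orthonormal d d f" and i: "i < d"
  shows "x i = (\<Sum>s<d. inner_d d (f s) x * f s i)"
proof -
  define g where "g = (\<lambda>i j. (if j = i then 1 else 0) - (\<Sum>s<d. f s i * f s j))"
  have "(\<Sum>i<d. (vnorm d (g i))\<^sup>2) = 0" using orthonormal_defect(1)[OF f] by (simp add: g_def)
  then have "vnorm d (g i) = 0" using i by (simp add: sum_nonneg_eq_0_iff)
  then have g0: "g i j = 0" if "j < d" for j using that by (auto simp: vnorm_def sum_nonneg_eq_0_iff)
  have "0 = (\<Sum>j<d. g i j * x j)" using g0 by simp
  also have "\<dots> = (\<Sum>j<d. (if j = i then 1 else 0) * x j) - (\<Sum>j<d. \<Sum>s<d. f s i * (f s j * x j))"
    by (simp add: g_def algebra_simps sum_subtractf sum_distrib_left sum_distrib_right)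
  also have "(\<Sum>j<d. (if j = i then 1 else 0) * x j) = x i" using i by (simp add: sum_kronecker)
  also have "(\<Sum>j<d. \<Sum>s<d. f s i * (f s j * x j)) = (\<Sum>s<d. inner_d d (f s) x * f s i)"
    by (subst sum.swap) (simp add: inner_d_def sum_distrib_left mult_ac)
  finally show ?thesis by simp
qed

lemma inner_d_parseval:
  assumes "orthonormal d d f"
  shows "inner_d d y x = (\<Sum>s<d. inner_d d (f s) y * inner_d d (f s) x)"
proof -
  have "inner_d d y x = (\<Sum>i<d. y i * (\<Sum>s<d. inner_d d (f s) x * f s i))"
    unfolding inner_d_def[of d y x] using parseval[OF assms] by (intro sum.cong) auto
  also have "\<dots> = (\<Sum>s<d. inner_d d (f s) x * (\<Sum>i<d. f s i * y i))"
    unfolding sum_distrib_left by (subst sum.swap) (simp add: mult_ac)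
  finally show ?thesis by (simp add: inner_d_def mult.commute)
qed

section \<open>Expansions in bases adapted to the true vectors\<close>

lemma lam_hat_parseval:
  assumes "orthonormal d1 d1 f"
  shows "lam_hat d1 d2 d3 E x b c = (\<Sum>s<d1. inner_d d1 (f s) x * lam_hat d1 d2 d3 E (f s) b c)"
  using inner_d_parseval[OF assms, of x "contr1 d1 d2 d3 E b c"] by (simp add: inner_d_contr1)

lemma tan0_coord:
  assumes f: "orthonormal d1 d1 f" "f 0 = u" and s: "s < d1"
  shows "inner_d d1 (f s) (tan0 d1 d2 d3 E u v w) = (if s = 0 then 0 else lam_hat d1 d2 d3 E (f s) v w)"
  using f s by (auto simp: inner_tan0 orthonormal_def)

lemma sum_drop_first: "(\<Sum>s<d::nat. (if s = 0 then 0 else h s) :: real) = (\<Sum>s\<in>{1..<d}. h s)"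
  by (rule sum.mono_neutral_cong_right) auto

text \<open>Index 0 drops out because \<open>tan0\<close> is orthogonal to u = f 0; its remaining
  coordinates are the noise values at f s, v, w.\<close>

lemma lam_hat_tan0:
  assumes f: "orthonormal d1 d1 f" "f 0 = u"
  shows "lam_hat d1 d2 d3 E (tan0 d1 d2' d3' E' u v w) b c
    = (\<Sum>s\<in>{1..<d1}. lam_hat d1 d2' d3' E' (f s) v w * lam_hat d1 d2 d3 E (f s) b c)"
proof -
  have "lam_hat d1 d2 d3 E (tan0 d1 d2' d3' E' u v w) b c
     = (\<Sum>s<d1. if s = 0 then 0 else lam_hat d1 d2' d3' E' (f s) v w * lam_hat d1 d2 d3 E (f s) b c)"
    unfolding lam_hat_parseval[OF f(1), of _ _ _ "tan0 d1 d2' d3' E' u v w"]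
    by (intro sum.cong refl) (simp add: tan0_coord[OF f])
  then show ?thesis by (simp only: sum_drop_first)
qed

lemma tan0_norm_coords:
  assumes f: "orthonormal d1 d1 f" "f 0 = u"
  shows "(vnorm d1 (tan0 d1 d2 d3 E u v w))\<^sup>2 = (\<Sum>s\<in>{1..<d1}. (lam_hat d1 d2 d3 E (f s) v w)\<^sup>2)"
proof -
  have "(vnorm d1 (tan0 d1 d2 d3 E u v w))\<^sup>2 = (\<Sum>s<d1. if s = 0 then 0 else (lam_hat d1 d2 d3 E (f s) v w)\<^sup>2)"
    unfolding vnorm_square inner_d_parseval[OF f(1), of "tan0 d1 d2 d3 E u v w"]
    by (intro sum.cong refl) (simp add: tan0_coord[OF f] power2_eq_square)
  then show ?thesis by (simp only: sum_drop_first)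
qed

text \<open>For q = f s with s \<ge> 1 every summand is a product of two different noise
  coordinates, (0, t, 0) with (s, t, 0) or (0, 0, t) with (s, 0, t). This squarefree form is what
  makes the variance computable.\<close>

lemma second_order_coords:
  assumes f: "orthonormal d1 d1 f" "f 0 = u" and g: "orthonormal d2 d2 g" "g 0 = v"
    and h: "orthonormal d3 d3 h" "h 0 = w"
  shows "second_order d1 d2 d3 E u v w q
    = (\<Sum>t\<in>{1..<d2}. lam_hat d1 d2 d3 E u (g t) w * lam_hat d1 d2 d3 E q (g t) w)
    + (\<Sum>t\<in>{1..<d3}. lam_hat d1 d2 d3 E u v (h t) * lam_hat d1 d2 d3 E q v (h t))"
proof -
  have "lam_hat d1 d2 d3 E q (tan0 d2 d1 d3 (\<lambda>j i k. E i j k) v u w) w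
     = (\<Sum>t\<in>{1..<d2}. lam_hat d1 d2 d3 E u (g t) w * lam_hat d1 d2 d3 E q (g t) w)"
    using lam_hat_tan0[OF g, of d1 d3 "\<lambda>j i k. E i j k" d1 d3 "\<lambda>j i k. E i j k" u w q w]
    by (simp add: lam_hat_swap12[of d2 d1 d3 E])
  moreover have "lam_hat d1 d2 d3 E q v (tan0 d3 d1 d2 (\<lambda>k i j. E i j k) w u v)
     = (\<Sum>t\<in>{1..<d3}. lam_hat d1 d2 d3 E u v (h t) * lam_hat d1 d2 d3 E q v (h t))"
    using lam_hat_tan0[OF h, of d1 d2 "\<lambda>k i j. E i j k" d1 d2 "\<lambda>k i j. E i j k" u v q v]
    by (simp add: lam_hat_rotate[of d3 d1 d2 E])
  ultimately show ?thesis by (simp add: second_order_def)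
qed

lemma second_order_tan0_coords:
  assumes f: "orthonormal d1 d1 f" "f 0 = u"
  shows "second_order d1 d2 d3 E u v w (tan0 d1 d2 d3 E u v w)
    = (\<Sum>s\<in>{1..<d1}. lam_hat d1 d2 d3 E (f s) v w * second_order d1 d2 d3 E u v w (f s))"
  by (simp add: second_order_def lam_hat_tan0[OF f] distrib_left sum.distrib)

section \<open>Independent standard normal variables\<close>

lemma N01_eq: "N01 = std_normal_distribution"
  by (simp add: N01_def)

lemma prob_space_N01 [simp]: "prob_space N01"
  unfolding N01_eq by (rule prob_space_normal_density) simp
lemma sets_N01 [simp, measurable_cong]: "sets N01 = sets borel" by (simp add: N01_def)
lemma space_N01 [simp]: "space N01 = UNIV" by (simp add: N01_def)
lemma real_distribution_N01 [simp]: "real_distribution N01"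
  unfolding N01_eq by (rule real_dist_normal_dist)
lemma char_N01: "char N01 t = complex_of_real (exp (- t\<^sup>2 / 2))"
  unfolding N01_eq char_std_normal_distribution by simp

lemma integral_N01:
  fixes f :: "real \<Rightarrow> real"
  assumes [measurable]: "f \<in> borel_measurable borel"
  shows "integral\<^sup>L N01 f = (LINT x|lborel. std_normal_density x * f x)"
    "integrable N01 f \<longleftrightarrow> integrable lborel (\<lambda>x. std_normal_density x * f x)"
  unfolding N01_def by (subst integral_density; simp) (subst integrable_density; simp)

lemma N01_moment:
  shows "integrable N01 (\<lambda>x. x ^ k)" "integrable N01 (\<lambda>x. \<bar>x\<bar> ^ k)"
    "(LINT x|N01. x) = 0" "(LINT x|N01. x\<^sup>2) = 1" "(LINT x|N01. x^4) = 3"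
proof -
  show "integrable N01 (\<lambda>x. x ^ k)" "integrable N01 (\<lambda>x. \<bar>x\<bar> ^ k)"
    using integrable_std_normal_moment[of k] integrable_std_normal_moment_abs[of k]
    by (subst integral_N01(2); simp)+
  show "(LINT x|N01. x) = 0"
    using has_bochner_integral_integral_eq[OF std_normal_moment_odd[of 0]] by (subst integral_N01(1)) simp_all
  show "(LINT x|N01. x\<^sup>2) = 1"
    using has_bochner_integral_integral_eq[OF std_normal_moment_even[of 1]] by (subst integral_N01(1)) simp_all
  show "(LINT x|N01. x^4) = 3"
    using has_bochner_integral_integral_eq[OF std_normal_moment_even[of 2]] by (subst integral_N01(1)) (simp_all add: fact_numeral)
qed

text \<open>Completing the square: the tilted density is a multiple of the density of N(s,
  1).\<close>

lemma N01_exp_linear: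
  "integrable N01 (\<lambda>x. exp (s * x))" "(LINT x|N01. exp (s * x)) = exp (s\<^sup>2 / 2)"
proof -
  have eq: "std_normal_density x * exp (s * x) = exp (s\<^sup>2 / 2) * normal_density s 1 x" for x
  proof -
    have "- x\<^sup>2 / 2 + s * x = s\<^sup>2 / 2 + (- (x - s)\<^sup>2 / 2)" by (simp add: power2_eq_square field_simps)
    then have "exp (- x\<^sup>2 / 2) * exp (s * x) = exp (s\<^sup>2 / 2) * exp (- (x - s)\<^sup>2 / 2)" by (metis exp_add)
    then show ?thesis by (simp add: normal_density_def)
  qed
  show "integrable N01 (\<lambda>x. exp (s * x))" by (subst integral_N01(2)) (simp_all add: eq)
  show "(LINT x|N01. exp (s * x)) = exp (s\<^sup>2 / 2)" by (subst integral_N01(1)) (simp_all add: eq)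
qed

text \<open>For s < 1/2 the tilted density is a multiple of the centred normal density with variance
  1/(1 - 2 s).\<close>

lemma N01_exp_square:
  assumes s: "s < 1/2"
  shows "integrable N01 (\<lambda>x. exp (s * x\<^sup>2))" "(LINT x|N01. exp (s * x\<^sup>2)) = 1 / sqrt (1 - 2 * s)"
proof -
  define r where "r = 1 / sqrt (1 - 2 * s)"
  have r: "r > 0" "r\<^sup>2 = 1 / (1 - 2 * s)" using s by (auto simp: r_def power_divide)
  have eq: "std_normal_density x * exp (s * x\<^sup>2) = r * normal_density 0 r x" for x
  proof -
    have "- x\<^sup>2 / 2 + s * x\<^sup>2 = - x\<^sup>2 / (2 * r\<^sup>2)" using s by (simp add: r(2) field_simps)
    then have "exp (- x\<^sup>2 / 2) * exp (s * x\<^sup>2) = exp (- x\<^sup>2 / (2 * r\<^sup>2))" by (metis exp_add)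
    then show ?thesis using r(1) by (simp add: normal_density_def real_sqrt_mult)
  qed
  show "integrable N01 (\<lambda>x. exp (s * x\<^sup>2))" using r by (subst integral_N01(2)) (simp_all add: eq)
  show "(LINT x|N01. exp (s * x\<^sup>2)) = 1 / sqrt (1 - 2 * s)" using r by (subst integral_N01(1)) (simp_all add: eq r_def)
qed

text \<open>The exact value is exp (- s) / sqrt (1 - 2 s), so the claim is a lower bound for ln (1 -
  2 s). The two signs of s use different logarithm estimates, and |s| \<le> 1/4 keeps the argument
  in their range.\<close>

lemma N01_exp_chi2:
  assumes s: "\<bar>s\<bar> \<le> 1/4"
  shows "integrable N01 (\<lambda>x. exp (s * (x\<^sup>2 - 1)))" "(LINT x|N01. exp (s * (x\<^sup>2 - 1))) \<le> exp (4 * s\<^sup>2)"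
proof -
  have eq: "exp (s * (x\<^sup>2 - 1)) = exp (- s) * exp (s * x\<^sup>2)" for x
    by (simp add: algebra_simps flip: exp_add)
  have s2: "s < 1/2" using s by linarith
  show "integrable N01 (\<lambda>x. exp (s * (x\<^sup>2 - 1)))" unfolding eq using N01_exp_square(1)[OF s2] by simp
  have "- 2 * s - 8 * s\<^sup>2 \<le> ln (1 - 2 * s)"
  proof (cases "s \<ge> 0")
    case True
    then show ?thesis using ln_one_minus_pos_lower_bound[of "2 * s"] s by (simp add: power2_eq_square)
  next
    case False
    have "- 2 * s - (- 2 * s)\<^sup>2 \<le> ln (1 + - 2 * s)"
      by (rule ln_one_plus_pos_lower_bound) (use s False in auto)
    then have "- 2 * s - 4 * s\<^sup>2 \<le> ln (1 - 2 * s)" by (simp add: power2_eq_square)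
    then show ?thesis using zero_le_power2[of s] by linarith
  qed
  then have "- s - 1/2 * ln (1 - 2 * s) \<le> 4 * s\<^sup>2" by linarith
  then have "exp (- s - 1/2 * ln (1 - 2 * s)) \<le> exp (4 * s\<^sup>2)" by simp
  moreover have "exp (- s - 1/2 * ln (1 - 2 * s)) = exp (- s) / sqrt (1 - 2 * s)"
    using s2 by (simp add: exp_diff sqrt_def flip: ln_sqrt)
  moreover have "(LINT x|N01. exp (s * (x\<^sup>2 - 1))) = exp (- s) / sqrt (1 - 2 * s)"
    unfolding eq using N01_exp_square(2)[OF s2] by simp
  ultimately show "(LINT x|N01. exp (s * (x\<^sup>2 - 1))) \<le> exp (4 * s\<^sup>2)" by linarith
qed

section \<open>Families of independent standard normals and their rotations\<close>

definition iid_N01 :: "'a measure \<Rightarrow> 'i set \<Rightarrow> ('i \<Rightarrow> 'a \<Rightarrow> real) \<Rightarrow> bool" where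
  "iid_N01 M I X \<longleftrightarrow> prob_space M \<and> prob_space.indep_vars M (\<lambda>_. borel) X I \<and>
     (\<forall>i\<in>I. distr M borel (X i) = N01)"

lemma iid_N01_measurable: "iid_N01 M I X \<Longrightarrow> i \<in> I \<Longrightarrow> X i \<in> borel_measurable M"
  by (auto simp: iid_N01_def prob_space.indep_vars_def)

lemma iid_N01_integral:
  fixes g :: "real \<Rightarrow> 'b::{banach, second_countable_topology}"
  assumes X: "iid_N01 M I X" "i \<in> I" and g: "g \<in> borel_measurable borel"
  shows "integral\<^sup>L M (\<lambda>\<omega>. g (X i \<omega>)) = integral\<^sup>L N01 g"
    "integrable M (\<lambda>\<omega>. g (X i \<omega>)) \<longleftrightarrow> integrable N01 g"
proof -
  have d: "distr M borel (X i) = N01" using X by (auto simp: iid_N01_def)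
  show "integral\<^sup>L M (\<lambda>\<omega>. g (X i \<omega>)) = integral\<^sup>L N01 g"
    unfolding d[symmetric] by (rule integral_distr[symmetric, OF iid_N01_measurable[OF X] g])
  show "integrable M (\<lambda>\<omega>. g (X i \<omega>)) \<longleftrightarrow> integrable N01 g"
    unfolding d[symmetric] by (rule integrable_distr_eq[symmetric, OF iid_N01_measurable[OF X] g])
qed

lemma iid_N01_prod:
  assumes X: "iid_N01 M I X" and I: "finite I" and g: "\<And>i. i \<in> I \<Longrightarrow> g i \<in> borel_measurable borel"
    and int: "\<And>i. i \<in> I \<Longrightarrow> integrable N01 (g i)"
  shows "integrable M (\<lambda>\<omega>. \<Prod>i\<in>I. g i (X i \<omega>) :: real)"
    "integral\<^sup>L M (\<lambda>\<omega>. \<Prod>i\<in>I. g i (X i \<omega>)) = (\<Prod>i\<in>I. integral\<^sup>L N01 (g i))"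
proof -
  interpret prob_space M using X by (simp add: iid_N01_def)
  have ind: "indep_vars (\<lambda>_. borel) (\<lambda>i \<omega>. g i (X i \<omega>)) I"
    by (rule indep_vars_compose2[of "\<lambda>_. borel"]) (use X g in \<open>auto simp: iid_N01_def\<close>)
  have i: "integrable M (\<lambda>\<omega>. g i (X i \<omega>))" if "i \<in> I" for i
    using int[OF that] iid_N01_integral(2)[OF X that g[OF that]] by simp
  show "integrable M (\<lambda>\<omega>. \<Prod>i\<in>I. g i (X i \<omega>))" by (rule indep_vars_integrable[OF I ind i])
  show "integral\<^sup>L M (\<lambda>\<omega>. \<Prod>i\<in>I. g i (X i \<omega>)) = (\<Prod>i\<in>I. integral\<^sup>L N01 (g i))"
    using indep_vars_lebesgue_integral[OF I ind i] iid_N01_integral(1)[OF X _ g] by simp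
qed

lemma iid_N01_subset: "iid_N01 M I X \<Longrightarrow> J \<subseteq> I \<Longrightarrow> iid_N01 M J X"
  unfolding iid_N01_def by (auto intro: prob_space.indep_vars_subset)

text \<open>Dividing the weight by its mass c turns it into a density. Under the tilted measure Y
  has the standard normal characteristic function, hence the standard normal law, and undoing the
  tilt gives the formula. If c = 0 the weight vanishes almost surely.\<close>

lemma N01_law_of_weighted_char:
  fixes g Y :: "'a \<Rightarrow> real"
  assumes M: "prob_space M" and [measurable]: "g \<in> borel_measurable M" "Y \<in> borel_measurable M"
    and g: "\<And>\<omega>. 0 \<le> g \<omega>" "\<And>\<omega>. g \<omega> \<le> b" and c: "0 \<le> c"
    and ch: "\<And>r. (CLINT \<omega>|M. g \<omega> *\<^sub>R iexp (r * Y \<omega>)) = complex_of_real (c * exp (- r\<^sup>2 / 2))"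
    and B: "B \<in> sets borel"
  shows "(LINT \<omega>|M. g \<omega> * indicator B (Y \<omega>)) = c * measure N01 B"
proof -
  interpret prob_space M by fact
  have gi: "integrable M g" by (rule integrable_const_bound[of _ b]) (use g in auto)
  \<comment> \<open>Frequency 0 identifies c as the total mass of the weight.\<close>
  have "complex_of_real (LINT \<omega>|M. g \<omega>) = complex_of_real c"
    using ch[of 0] by (simp add: scaleR_conv_of_real)
  then have gc: "(LINT \<omega>|M. g \<omega>) = c" by (simp only: of_real_eq_iff)
  show ?thesis
  proof (cases "c = 0")
    case True
    then have "AE \<omega> in M. g \<omega> = 0" using integral_nonneg_eq_0_iff_AE[OF gi] g gc by simp
    then have "(LINT \<omega>|M. g \<omega> * indicator B (Y \<omega>)) = (LINT \<omega>|M. 0)"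
      using B by (intro integral_cong_AE) auto
    then show ?thesis using True by simp
  next
    case False
    with c have c0: "c > 0" by simp
    define h where "h \<omega> = g \<omega> / c" for \<omega>
    have [measurable]: "h \<in> borel_measurable M" unfolding h_def by measurable
    have h0: "0 \<le> h \<omega>" for \<omega> using g c0 by (simp add: h_def)
    define N where "N = density M (\<lambda>\<omega>. ennreal (h \<omega>))"
    have "(\<integral>\<^sup>+\<omega>. ennreal (h \<omega>) \<partial>M) = ennreal (LINT \<omega>|M. h \<omega>)"
      by (rule nn_integral_eq_integral) (use gi h0 in \<open>auto simp: h_def\<close>)
    also have "\<dots> = 1" using gc c0 by (simp add: h_def)
    finally have "emeasure N (space N) = 1" by (simp add: N_def emeasure_density cong: nn_integral_cong)
    then interpret N: prob_space N by (rule prob_spaceI)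
    have [measurable]: "Y \<in> borel_measurable N" by (simp add: N_def)
    have rd: "real_distribution (distr N borel Y)" by (rule N.real_distribution_distr) simp
    have "char (distr N borel Y) = char N01"
    proof
      fix r
      have "char (distr N borel Y) r = (CLINT \<omega>|N. iexp (r * Y \<omega>))"
        unfolding char_def by (rule integral_distr) auto
      also have "\<dots> = (CLINT \<omega>|M. h \<omega> *\<^sub>R iexp (r * Y \<omega>))"
        unfolding N_def by (rule integral_density) (use h0 in auto)
      also have "\<dots> = (CLINT \<omega>|M. (1 / c) *\<^sub>R (g \<omega> *\<^sub>R iexp (r * Y \<omega>)))" by (simp add: h_def)
      also have "\<dots> = (1 / c) *\<^sub>R complex_of_real (c * exp (- r\<^sup>2 / 2))" by (simp only: integral_scaleR_right ch)
      also have "\<dots> = char N01 r" using c0 by (simp add: char_N01 scaleR_conv_of_real)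
      finally show "char (distr N borel Y) r = char N01 r" .
    qed
    then have eq: "distr N borel Y = N01" by (rule Levy_uniqueness[OF rd real_distribution_N01])
    have "measure N01 B = (LINT x|N01. indicator B x)" using B by simp
    also have "\<dots> = (LINT \<omega>|N. indicator B (Y \<omega>))"
      unfolding eq[symmetric] by (rule integral_distr) (use B in auto)
    also have "\<dots> = (LINT \<omega>|M. h \<omega> *\<^sub>R indicator B (Y \<omega>))"
      unfolding N_def by (rule integral_density) (use B h0 in auto)
    also have "\<dots> = (LINT \<omega>|M. (1 / c) * (g \<omega> * indicator B (Y \<omega>)))" by (simp add: h_def)
    also have "\<dots> = (LINT \<omega>|M. g \<omega> * indicator B (Y \<omega>)) / c" by (subst integral_mult_right_zero) simp
    finally show ?thesis using c0 by (simp add: field_simps)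
  qed
qed

text \<open>Kac's theorem: a factorizing joint characteristic function forces independence.  The
  exponentials are exchanged for indicators one coordinate at a time; the positive weights
  \<open>1 + cos\<close> and \<open>1 + sin\<close> of the remaining coordinates reduce each exchange to
  one-dimensional uniqueness.\<close>
lemma iid_N01_of_char:
  fixes Y :: "'i \<Rightarrow> 'a \<Rightarrow> real"
  assumes M: "prob_space M" and J: "finite J" and Y: "\<And>s. s \<in> J \<Longrightarrow> Y s \<in> borel_measurable M"
    and ch: "\<And>t. (CLINT \<omega>|M. iexp (\<Sum>s\<in>J. t s * Y s \<omega>)) = complex_of_real (exp (- (\<Sum>s\<in>J. (t s)\<^sup>2) / 2))"
  shows "iid_N01 M J Y"
proof -
  interpret prob_space M by fact
  \<comment> \<open>Coordinates in \<open>K\<close> already carry indicators, those in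
    \<open>J - K\<close> still carry exponentials. The claim is made for all t because the induction
    step changes the remaining frequencies.\<close>
  have main: "(CLINT \<omega>|M. (\<Prod>s\<in>K. indicator (B s) (Y s \<omega>)) *\<^sub>R iexp (\<Sum>s\<in>J-K. t s * Y s \<omega>))
      = complex_of_real ((\<Prod>s\<in>K. measure N01 (B s)) * exp (- (\<Sum>s\<in>J-K. (t s)\<^sup>2) / 2))"
    if "K \<subseteq> J" and B: "\<And>s. B s \<in> sets borel" for K t and B :: "'i \<Rightarrow> real set"
    using finite_subset[OF \<open>K \<subseteq> J\<close> J] \<open>K \<subseteq> J\<close>
  proof (induction K arbitrary: t rule: finite_induct)
    case empty
    then show ?case using ch[of t] by simp
  next
    case (insert a K)
    have aJ: "a \<in> J" and KJ: "K \<subseteq> J" using insert.prems by auto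
    define L where "L = J - insert a K"
    have JK: "J - K = insert a L" and aL: "a \<notin> L" and fL: "finite L"
      using insert.hyps aJ J by (auto simp: L_def)
    define H where "H \<omega> = (\<Prod>s\<in>K. indicator (B s) (Y s \<omega>) :: real)" for \<omega>
    define W where "W \<omega> = (\<Sum>s\<in>L. t s * Y s \<omega>)" for \<omega>
    define cK where "cK = (\<Prod>s\<in>K. measure N01 (B s))"
    define \<kappa> where "\<kappa> = exp (- (\<Sum>s\<in>L. (t s)\<^sup>2) / 2)"
    have [measurable]: "Y a \<in> borel_measurable M" using Y aJ by simp
    have [measurable]: "H \<in> borel_measurable M" unfolding H_def
      using Y KJ B by (intro borel_measurable_prod) (auto intro!: measurable_compose[OF Y])
    have [measurable]: "W \<in> borel_measurable M" unfolding W_def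
      using Y by (intro borel_measurable_sum borel_measurable_times) (auto simp: L_def)
    have H01: "0 \<le> H \<omega>" "H \<omega> \<le> 1" for \<omega>
      unfolding H_def by (auto intro!: prod_nonneg prod_le_1 simp: indicator_def)
    have c0: "0 \<le> cK" unfolding cK_def by (intro prod_nonneg) auto
    have H_int: "integrable M (\<lambda>\<omega>. H \<omega> *\<^sub>R iexp (r * Y a \<omega> + q * W \<omega>))" for r q
      by (rule integrable_const_bound[of _ 1]) (use H01 in auto)
    \<comment> \<open>The hypothesis is used with frequency r at \<open>a\<close> and q times the
      given frequencies elsewhere; q = 1, -1 and 0 supply the ingredients of the cosine, the sine
      and the constant part.\<close>
    have IH: "(CLINT \<omega>|M. H \<omega> *\<^sub>R iexp (r * Y a \<omega> + q * W \<omega>))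
        = complex_of_real (cK * exp (- (r\<^sup>2 + q\<^sup>2 * (\<Sum>s\<in>L. (t s)\<^sup>2)) / 2))" for r q
    proof -
      have "(\<Sum>s\<in>J-K. ((\<lambda>s. q * t s)(a := r)) s * Y s \<omega>) = r * Y a \<omega> + q * W \<omega>" for \<omega>
        using aL fL by (auto simp: JK W_def sum_distrib_left mult_ac intro!: sum.cong)
      moreover have "(\<Sum>s\<in>J-K. (((\<lambda>s. q * t s)(a := r)) s)\<^sup>2) = r\<^sup>2 + q\<^sup>2 * (\<Sum>s\<in>L. (t s)\<^sup>2)"
        using aL fL by (auto simp: JK sum_distrib_left power_mult_distrib intro!: sum.cong)
      ultimately show ?thesis
        using insert.IH[OF KJ, of "(\<lambda>s. q * t s)(a := r)"] by (simp add: H_def cK_def)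
    qed
    have IH1: "(CLINT \<omega>|M. H \<omega> *\<^sub>R iexp (r * Y a \<omega> + W \<omega>)) = complex_of_real (cK * exp (- r\<^sup>2 / 2) * \<kappa>)"
      and IH2: "(CLINT \<omega>|M. H \<omega> *\<^sub>R iexp (r * Y a \<omega> - W \<omega>)) = complex_of_real (cK * exp (- r\<^sup>2 / 2) * \<kappa>)"
      and IH0: "(CLINT \<omega>|M. H \<omega> *\<^sub>R iexp (r * Y a \<omega>)) = complex_of_real (cK * exp (- r\<^sup>2 / 2))" for r
      using IH[of r 1] IH[of r "-1"] IH[of r 0]
      by (simp_all add: \<kappa>_def exp_add[symmetric] add_divide_distrib diff_divide_distrib mult.assoc)
    have I1: "integrable M (\<lambda>\<omega>. H \<omega> *\<^sub>R iexp (r * Y a \<omega> + W \<omega>))"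
      and I2: "integrable M (\<lambda>\<omega>. H \<omega> *\<^sub>R iexp (r * Y a \<omega> - W \<omega>))"
      and I0: "integrable M (\<lambda>\<omega>. H \<omega> *\<^sub>R iexp (r * Y a \<omega>))" for r
      using H_int[of r 1] H_int[of r "-1"] H_int[of r 0] by simp_all
    have Wc: "complex_of_real (cos (W \<omega>)) = (iexp (W \<omega>) + iexp (- W \<omega>)) / 2"
      and Ws: "complex_of_real (sin (W \<omega>)) = (iexp (W \<omega>) - iexp (- W \<omega>)) / (2 * \<i>)" for \<omega>
      by (simp_all add: cos_of_real[symmetric] sin_of_real[symmetric] cos_exp_eq sin_exp_eq)
    have combo: "(CLINT \<omega>|M. F0 \<omega> + (F1 \<omega> + F2 \<omega>) / 2) = integral\<^sup>L M F0 + (integral\<^sup>L M F1 + integral\<^sup>L M F2) / 2"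
      "(CLINT \<omega>|M. F0 \<omega> + (F1 \<omega> - F2 \<omega>) / (2 * \<i>)) = integral\<^sup>L M F0 + (integral\<^sup>L M F1 - integral\<^sup>L M F2) / (2 * \<i>)"
      if "integrable M F0" "integrable M F1" "integrable M F2" for F0 F1 F2 :: "'a \<Rightarrow> complex"
      using that by simp_all
    have e1: "iexp (r * Y a \<omega> + W \<omega>) = iexp (r * Y a \<omega>) * iexp (W \<omega>)"
      "iexp (r * Y a \<omega> - W \<omega>) = iexp (r * Y a \<omega>) * iexp (- W \<omega>)" for r \<omega>
      by (simp_all add: exp_add[symmetric] distrib_left right_diff_distrib)
    \<comment> \<open>The weight must be nonnegative to become a density, which is why 1 is added to
      the cosine; its total mass is \<open>cK * (1 + \<kappa>)\<close>.\<close>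
    have "(CLINT \<omega>|M. (H \<omega> * (1 + cos (W \<omega>))) *\<^sub>R iexp (r * Y a \<omega>)) = complex_of_real ((cK * (1 + \<kappa>)) * exp (- r\<^sup>2 / 2))" for r
    proof -
      have "(CLINT \<omega>|M. (H \<omega> * (1 + cos (W \<omega>))) *\<^sub>R iexp (r * Y a \<omega>))
          = (CLINT \<omega>|M. H \<omega> *\<^sub>R iexp (r * Y a \<omega>) + (H \<omega> *\<^sub>R iexp (r * Y a \<omega> + W \<omega>) + H \<omega> *\<^sub>R iexp (r * Y a \<omega> - W \<omega>)) / 2)"
        by (intro Bochner_Integration.integral_cong refl) (simp only: e1, simp only: scaleR_conv_of_real of_real_mult of_real_add of_real_1 Wc, simp add: field_simps)
      also have "\<dots> = complex_of_real ((cK * (1 + \<kappa>)) * exp (- r\<^sup>2 / 2))"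
        unfolding combo(1)[OF I0 I1 I2] IH0 IH1 IH2 by (simp add: algebra_simps)
      finally show ?thesis .
    qed
    note weighted = this
    have nonneg: "0 \<le> H \<omega> * (1 + cos (W \<omega>))" for \<omega>
    proof -
      have "0 \<le> 1 + cos (W \<omega>)" using cos_ge_minus_one[of "W \<omega>"] by linarith
      then show ?thesis using H01(1) by simp
    qed
    have le2: "H \<omega> * (1 + cos (W \<omega>)) \<le> 1 * 2" for \<omega>
    proof (rule mult_mono)
      show "1 + cos (W \<omega>) \<le> 2" "0 \<le> 1 + cos (W \<omega>)"
        using cos_ge_minus_one[of "W \<omega>"] cos_le_one[of "W \<omega>"] by linarith+
    qed (simp_all add: H01)
    have R1: "(LINT \<omega>|M. H \<omega> * (1 + cos (W \<omega>)) * indicator (B a) (Y a \<omega>)) = cK * (1 + \<kappa>) * measure N01 (B a)"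
      by (rule N01_law_of_weighted_char[OF M _ _ nonneg le2 _ weighted B]) (simp_all add: c0 \<kappa>_def)
    have "(CLINT \<omega>|M. (H \<omega> * (1 + sin (W \<omega>))) *\<^sub>R iexp (r * Y a \<omega>)) = complex_of_real (cK * exp (- r\<^sup>2 / 2))" for r
    proof -
      have "(CLINT \<omega>|M. (H \<omega> * (1 + sin (W \<omega>))) *\<^sub>R iexp (r * Y a \<omega>))
          = (CLINT \<omega>|M. H \<omega> *\<^sub>R iexp (r * Y a \<omega>) + (H \<omega> *\<^sub>R iexp (r * Y a \<omega> + W \<omega>) - H \<omega> *\<^sub>R iexp (r * Y a \<omega> - W \<omega>)) / (2 * \<i>))"
        by (intro Bochner_Integration.integral_cong refl) (simp only: e1, simp only: scaleR_conv_of_real of_real_mult of_real_add of_real_1 Ws, simp add: field_simps)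
      also have "\<dots> = complex_of_real (cK * exp (- r\<^sup>2 / 2))"
        unfolding combo(2)[OF I0 I1 I2] IH0 IH1 IH2 by simp
      finally show ?thesis .
    qed
    note weighted = this
    have nonneg: "0 \<le> H \<omega> * (1 + sin (W \<omega>))" for \<omega>
    proof -
      have "0 \<le> 1 + sin (W \<omega>)" using sin_ge_minus_one[of "W \<omega>"] by linarith
      then show ?thesis using H01(1) by simp
    qed
    have le2: "H \<omega> * (1 + sin (W \<omega>)) \<le> 1 * 2" for \<omega>
    proof (rule mult_mono)
      show "1 + sin (W \<omega>) \<le> 2" "0 \<le> 1 + sin (W \<omega>)"
        using sin_ge_minus_one[of "W \<omega>"] sin_le_one[of "W \<omega>"] by linarith+
    qed (simp_all add: H01)
    have R2: "(LINT \<omega>|M. H \<omega> * (1 + sin (W \<omega>)) * indicator (B a) (Y a \<omega>)) = cK * measure N01 (B a)"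
      by (rule N01_law_of_weighted_char[OF M _ _ nonneg le2 _ weighted B]) (simp_all add: c0 \<kappa>_def)
    have R0: "(LINT \<omega>|M. H \<omega> * indicator (B a) (Y a \<omega>)) = cK * measure N01 (B a)"
      by (rule N01_law_of_weighted_char[OF M _ _ H01 c0 IH0 B]) simp_all
    \<comment> \<open>Subtracting the identity for the weight \<open>H\<close> alone removes the
      added constant from both weights and leaves the integrals against the cosine and the
      sine.\<close>
    define G where "G \<omega> = H \<omega> * indicator (B a) (Y a \<omega>)" for \<omega>
    have [measurable]: "G \<in> borel_measurable M" unfolding G_def using B[of a] by measurable
    have G01: "0 \<le> G \<omega>" "G \<omega> \<le> 1" for \<omega> using H01[of \<omega>] by (auto simp: G_def indicator_def)
    have Gi: "integrable M G" by (rule integrable_const_bound[of _ 1]) (use G01 in auto)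
    have Gc: "integrable M (\<lambda>\<omega>. G \<omega> * cos (W \<omega>))" "integrable M (\<lambda>\<omega>. G \<omega> * sin (W \<omega>))"
      by (rule integrable_const_bound[of _ 1]; use G01 in \<open>auto simp: abs_mult intro!: mult_le_one\<close>)+
    have "(LINT \<omega>|M. G \<omega> + G \<omega> * cos (W \<omega>)) = cK * (1 + \<kappa>) * measure N01 (B a)"
      using R1 by (simp add: G_def algebra_simps)
    then have C: "(LINT \<omega>|M. G \<omega> * cos (W \<omega>)) = cK * measure N01 (B a) * \<kappa>"
      using R0 Gi Gc by (simp add: G_def[abs_def] algebra_simps)
    have "(LINT \<omega>|M. G \<omega> + G \<omega> * sin (W \<omega>)) = cK * measure N01 (B a)"
      using R2 by (simp add: G_def algebra_simps)
    then have S: "(LINT \<omega>|M. G \<omega> * sin (W \<omega>)) = 0"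
      using R0 Gi Gc by (simp add: G_def[abs_def] algebra_simps)
    have euler: "iexp x = complex_of_real (cos x) + \<i> * complex_of_real (sin x)" for x
      by (simp add: complex_eq_iff flip: cis_conv_exp)
    have G: "(\<Prod>s\<in>insert a K. indicator (B s) (Y s \<omega>)) = G \<omega>" for \<omega>
      using insert.hyps by (simp add: G_def H_def mult.commute)
    have "(CLINT \<omega>|M. (\<Prod>s\<in>insert a K. indicator (B s) (Y s \<omega>)) *\<^sub>R iexp (\<Sum>s\<in>L. t s * Y s \<omega>))
       = (CLINT \<omega>|M. complex_of_real (G \<omega> * cos (W \<omega>)) + \<i> * complex_of_real (G \<omega> * sin (W \<omega>)))"
      unfolding G W_def[symmetric] euler
      by (intro Bochner_Integration.integral_cong refl) (simp add: scaleR_conv_of_real algebra_simps)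
    also have "\<dots> = complex_of_real (cK * measure N01 (B a) * \<kappa>)"
    proof -
      have "(CLINT \<omega>|M. complex_of_real (f \<omega>) + \<i> * complex_of_real (g \<omega>))
          = complex_of_real (integral\<^sup>L M f) + \<i> * complex_of_real (integral\<^sup>L M g)"
        if "integrable M f" "integrable M g" for f g :: "'a \<Rightarrow> real" using that by simp
      from this[OF Gc] show ?thesis unfolding C S by simp
    qed
    finally show ?case using insert.hyps by (simp add: L_def cK_def \<kappa>_def mult_ac)
  qed
  \<comment> \<open>At K = J no exponential is left, and the formula becomes the product rule for
    probabilities.\<close>
  have prod: "(LINT \<omega>|M. (\<Prod>s\<in>J. indicator (B s) (Y s \<omega>))) = (\<Prod>s\<in>J. measure N01 (B s))"
    if B: "\<And>s. B s \<in> sets borel" for B :: "'i \<Rightarrow> real set"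
  proof -
    have "(CLINT \<omega>|M. (\<Prod>s\<in>J. indicator (B s) (Y s \<omega>)) *\<^sub>R iexp (\<Sum>s\<in>J-J. 0 * Y s \<omega>))
      = complex_of_real ((\<Prod>s\<in>J. measure N01 (B s)) * exp (- (\<Sum>s\<in>J-J. 0\<^sup>2) / 2))"
      by (rule main) (simp_all add: B)
    then have "(CLINT \<omega>|M. complex_of_real (\<Prod>s\<in>J. indicator (B s) (Y s \<omega>))) = complex_of_real (\<Prod>s\<in>J. measure N01 (B s))"
      by (simp add: scaleR_conv_of_real)
    then show ?thesis by (simp only: integral_complex_of_real of_real_eq_iff)
  qed
  have meas: "measure M (\<Inter>s\<in>J. Y s -` B s \<inter> space M) = (\<Prod>s\<in>J. measure N01 (B s))"
    if J0: "J \<noteq> {}" and B: "\<And>s. B s \<in> sets borel" for B :: "'i \<Rightarrow> real set"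
  proof -
    have "measure M (\<Inter>s\<in>J. Y s -` B s \<inter> space M) = (LINT \<omega>|M. indicator (\<Inter>s\<in>J. Y s -` B s \<inter> space M) \<omega>)"
    proof -
      have "(\<Inter>s\<in>J. Y s -` B s \<inter> space M) \<subseteq> space M" using J0 by auto
      then show ?thesis by (simp add: Int_absorb2)
    qed
    also have "\<dots> = (LINT \<omega>|M. (\<Prod>s\<in>J. indicator (B s) (Y s \<omega>)))"
      using J J0 by (intro Bochner_Integration.integral_cong refl) (auto simp: indicator_def prod_zero_iff)
    finally show ?thesis using prod[OF B] by simp
  qed
  \<comment> \<open>The product rule with the whole line at all other coordinates.\<close>
  have dist: "distr M borel (Y s) = N01" if s: "s \<in> J" for s
  proof (rule measure_eqI)
    fix A assume "A \<in> sets (distr M borel (Y s))"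
    then have A: "A \<in> sets borel" by simp
    define B where "B t = (if t = s then A else UNIV)" for t
    have INT: "(\<Inter>t\<in>J. Y t -` B t \<inter> space M) = Y s -` A \<inter> space M" using s by (auto simp: B_def split: if_splits)
    have PR: "(\<Prod>t\<in>J. measure N01 (B t)) = measure N01 A"
    proof -
      have "(\<Prod>t\<in>J. measure N01 (B t)) = (\<Prod>t\<in>J. if t = s then measure N01 A else 1)"
        using prob_space.prob_space[OF prob_space_N01] by (intro prod.cong) (auto simp: B_def)
      then show ?thesis using s J by simp
    qed
    have "measure M (\<Inter>t\<in>J. Y t -` B t \<inter> space M) = (\<Prod>t\<in>J. measure N01 (B t))"
      by (rule meas) (use s A in \<open>auto simp: B_def\<close>)
    then have "measure M (Y s -` A \<inter> space M) = measure N01 A" unfolding INT PR .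
    moreover have "finite_measure N01" using prob_space_N01 by (rule prob_space.finite_measure)
    ultimately show "emeasure (distr M borel (Y s)) A = emeasure N01 A"
      using Y[OF s] A by (simp add: emeasure_distr emeasure_eq_measure finite_measure.emeasure_eq_measure)
  qed simp
  have "indep_vars (\<lambda>_. borel) Y J"
  \<comment> \<open>\<open>meas\<close> assumes J nonempty, since only then does the intersection
    lie in \<open>space M\<close>.\<close>
  proof (cases "J = {}")
    case True
    then show ?thesis by (simp add: indep_vars_def indep_sets_def)
  next
    case False
    have "\<forall>A\<in>Pi J (\<lambda>_. sets borel). measure M (\<Inter>j\<in>J. Y j -` A j \<inter> space M) = (\<Prod>j\<in>J. measure M (Y j -` A j \<inter> space M))"
    proof
      fix A assume A: "A \<in> Pi J (\<lambda>_. sets (borel::real measure))"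
      define B where "B s = (if s \<in> J then A s else UNIV)" for s
      have B: "B s \<in> sets borel" for s using A by (auto simp: B_def Pi_def)
      have "measure M (\<Inter>j\<in>J. Y j -` A j \<inter> space M) = measure M (\<Inter>j\<in>J. Y j -` B j \<inter> space M)"
        by (intro arg_cong[of _ _ "measure M"] INF_cong) (auto simp: B_def)
      also have "\<dots> = (\<Prod>j\<in>J. measure N01 (B j))" by (rule meas[OF False B])
      also have "\<dots> = (\<Prod>j\<in>J. measure M (Y j -` A j \<inter> space M))"
      proof (rule prod.cong[OF refl])
        fix j assume j: "j \<in> J"
        have "measure N01 (B j) = measure (distr M borel (Y j)) (A j)" using dist[OF j] j by (simp add: B_def)
        also have "\<dots> = measure M (Y j -` A j \<inter> space M)" using Y[OF j] A j by (intro measure_distr) auto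
        finally show "measure N01 (B j) = measure M (Y j -` A j \<inter> space M)" .
      qed
      finally show "measure M (\<Inter>j\<in>J. Y j -` A j \<inter> space M) = (\<Prod>j\<in>J. measure M (Y j -` A j \<inter> space M))" .
    qed
    then show ?thesis
      using J Y False by (subst indep_vars_finite[of J "\<lambda>_. borel" "\<lambda>_. sets borel"])
        (auto simp: sets.Int_stable sets.sigma_sets_eq[of borel, simplified])
  qed
  with dist M show ?thesis by (simp add: iid_N01_def)
qed

lemma iid_N01_char_linear:
  assumes X: "iid_N01 M I X" and I: "finite I"
  shows "(CLINT \<omega>|M. iexp (\<Sum>i\<in>I. a i * X i \<omega>)) = complex_of_real (exp (- (\<Sum>i\<in>I. (a i)\<^sup>2) / 2))"
proof -
  interpret prob_space M using X by (simp add: iid_N01_def)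
  note [measurable] = iid_N01_measurable[OF X]
  have ind: "indep_vars (\<lambda>_. borel) (\<lambda>i \<omega>. a i * X i \<omega>) I"
    by (rule indep_vars_compose2[of "\<lambda>_. borel"]) (use X in \<open>auto simp: iid_N01_def\<close>)
  have 2: "char (distr M borel (\<lambda>\<omega>. a i * X i \<omega>)) 1 = complex_of_real (exp (- (a i)\<^sup>2 / 2))" if i: "i \<in> I" for i
  proof -
    have "char (distr M borel (\<lambda>\<omega>. a i * X i \<omega>)) 1 = (CLINT \<omega>|M. iexp (1 * (a i * X i \<omega>)))"
      unfolding char_def using i by (intro integral_distr) auto
    also have "\<dots> = (CLINT x|N01. iexp (a i * x))"
      using iid_N01_integral(1)[OF X i, of "\<lambda>x. iexp (a i * x)"] by simp
    also have "\<dots> = char N01 (a i)" by (simp add: char_def)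
    finally show ?thesis by (simp add: char_N01)
  qed
  have "(CLINT \<omega>|M. iexp (\<Sum>i\<in>I. a i * X i \<omega>)) = char (distr M borel (\<lambda>\<omega>. \<Sum>i\<in>I. a i * X i \<omega>)) 1"
    unfolding char_def by (subst integral_distr) auto
  also have "\<dots> = (\<Prod>i\<in>I. char (distr M borel (\<lambda>\<omega>. a i * X i \<omega>)) 1)"
    by (rule char_distr_sum[OF ind])
  also have "\<dots> = (\<Prod>i\<in>I. complex_of_real (exp (- (a i)\<^sup>2 / 2)))" by (rule prod.cong) (simp_all add: 2)
  also have "\<dots> = complex_of_real (exp (\<Sum>i\<in>I. - (a i)\<^sup>2 / 2))" by (simp only: exp_sum[OF I] of_real_prod)
  also have "(\<Sum>i\<in>I. - (a i)\<^sup>2 / 2) = - (\<Sum>i\<in>I. (a i)\<^sup>2) / 2" by (simp add: sum_negf sum_divide_distrib)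
  finally show ?thesis .
qed

text \<open>The characteristic function of a combination of the new variables depends only on the
  norm of its coefficient vector in the old ones, and orthonormal rows preserve that norm.
  \<open>J\<close> may be smaller than \<open>I\<close>, so projections, selections and single unit
  combinations are covered as well.\<close>

lemma iid_N01_orthonormal:
  assumes X: "iid_N01 M I X" and I: "finite I" and J: "finite J"
    and on: "\<And>s t. s \<in> J \<Longrightarrow> t \<in> J \<Longrightarrow> (\<Sum>i\<in>I. c s i * c t i) = (if s = t then 1 else 0)"
  shows "iid_N01 M J (\<lambda>s \<omega>. \<Sum>i\<in>I. c s i * X i \<omega>)"
proof (rule iid_N01_of_char[OF _ J])
  show "prob_space M" using X by (simp add: iid_N01_def)
  show "(\<lambda>\<omega>. \<Sum>i\<in>I. c s i * X i \<omega>) \<in> borel_measurable M" for s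
    using iid_N01_measurable[OF X] by (intro borel_measurable_sum borel_measurable_times) auto
  fix t
  define a where "a i = (\<Sum>s\<in>J. t s * c s i)" for i
  have eq: "(\<Sum>s\<in>J. t s * (\<Sum>i\<in>I. c s i * X i \<omega>)) = (\<Sum>i\<in>I. a i * X i \<omega>)" for \<omega>
    unfolding a_def sum_distrib_left sum_distrib_right by (subst sum.swap) (simp add: mult_ac)
  have "(\<Sum>i\<in>I. (a i)\<^sup>2) = (\<Sum>i\<in>I. \<Sum>s\<in>J. \<Sum>r\<in>J. t s * t r * (c s i * c r i))"
    by (simp add: a_def power2_eq_square sum_product mult_ac)
  also have "\<dots> = (\<Sum>s\<in>J. \<Sum>i\<in>I. \<Sum>r\<in>J. t s * t r * (c s i * c r i))" by (rule sum.swap)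
  also have "\<dots> = (\<Sum>s\<in>J. \<Sum>r\<in>J. \<Sum>i\<in>I. t s * t r * (c s i * c r i))"
    by (rule sum.cong[OF refl], rule sum.swap)
  also have "\<dots> = (\<Sum>s\<in>J. \<Sum>r\<in>J. if s = r then t s * t r else 0)"
    by (intro sum.cong refl) (auto simp: on simp flip: sum_distrib_left)
  also have "\<dots> = (\<Sum>s\<in>J. (t s)\<^sup>2)" using J by (simp add: power2_eq_square)
  finally have sq: "(\<Sum>i\<in>I. (a i)\<^sup>2) = (\<Sum>s\<in>J. (t s)\<^sup>2)" .
  show "(CLINT \<omega>|M. iexp (\<Sum>s\<in>J. t s * (\<Sum>i\<in>I. c s i * X i \<omega>))) = complex_of_real (exp (- (\<Sum>s\<in>J. (t s)\<^sup>2) / 2))"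
    unfolding eq iid_N01_char_linear[OF X I] sq ..
qed

lemma iid_N01_exp_sum:
  fixes g :: "'i \<Rightarrow> real \<Rightarrow> real"
  assumes X: "iid_N01 M I X" and I: "finite I" and g: "\<And>i. i \<in> I \<Longrightarrow> g i \<in> borel_measurable borel"
    and int: "\<And>i. i \<in> I \<Longrightarrow> integrable N01 (\<lambda>x. exp (g i x))"
  shows "integrable M (\<lambda>\<omega>. exp (\<Sum>i\<in>I. g i (X i \<omega>)))"
    "integral\<^sup>L M (\<lambda>\<omega>. exp (\<Sum>i\<in>I. g i (X i \<omega>))) = (\<Prod>i\<in>I. (LINT x|N01. exp (g i x)))"
  using iid_N01_prod[OF X I, of "\<lambda>i x. exp (g i x)"] g int by (simp_all add: exp_sum[OF I])

section \<open>Tail inequalities\<close>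

lemma exp_tail_bound:
  fixes f :: "'a \<Rightarrow> real"
  assumes M: "prob_space M" and s: "s > 0" and int: "integrable M (\<lambda>\<omega>. exp (s * f \<omega>))"
    and le: "(LINT \<omega>|M. exp (s * f \<omega>)) \<le> exp b"
  shows "measure M {\<omega>\<in>space M. x \<le> f \<omega>} \<le> exp (- s * x + b)"
proof -
  interpret prob_space M by fact
  have "measure M {\<omega>\<in>space M. x \<le> f \<omega>} \<le> exp (- s * x) * (LINT \<omega>:space M|M. exp (s * f \<omega>))"
  proof (rule Chernoff_ineq_ge[OF s])
    have "integrable M (\<lambda>\<omega>. indicat_real (space M) \<omega> *\<^sub>R exp (s * f \<omega>))"
      by (rule integrable_mult_indicator[OF sets.top int])
    then show "set_integrable M (space M) (\<lambda>\<omega>. exp (s * f \<omega>))" by (simp add: set_integrable_def)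
  qed simp
  also have "(LINT \<omega>:space M|M. exp (s * f \<omega>)) = (LINT \<omega>|M. exp (s * f \<omega>))" by (rule set_integral_space[OF int])
  also have "exp (- s * x) * \<dots> \<le> exp (- s * x) * exp b" using le by (intro mult_left_mono) auto
  finally show ?thesis by (simp only: exp_add)
qed

lemma iid_N01_linear_tail:
  assumes X: "iid_N01 M I X" and I: "finite I" and V: "0 < V" "(\<Sum>i\<in>I. (a i)\<^sup>2) \<le> V" and x: "0 < x"
  shows "measure M {\<omega>\<in>space M. x \<le> (\<Sum>i\<in>I. a i * X i \<omega>)} \<le> exp (- x\<^sup>2 / (2 * V))"
proof -
  \<comment> \<open>The minimizer of the Chernoff exponent - s x + s^2 V / 2.\<close>
  define s where "s = x / V"
  have s: "s > 0" using V x by (simp add: s_def)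
  have M: "prob_space M" using X by (simp add: iid_N01_def)
  have eq: "s * (\<Sum>i\<in>I. a i * X i \<omega>) = (\<Sum>i\<in>I. (s * a i) * X i \<omega>)" for \<omega>
    by (simp add: sum_distrib_left mult_ac)
  have int: "integrable M (\<lambda>\<omega>. exp (s * (\<Sum>i\<in>I. a i * X i \<omega>)))"
    unfolding eq by (rule iid_N01_exp_sum[OF X I]) (auto intro: N01_exp_linear)
  have "(LINT \<omega>|M. exp (s * (\<Sum>i\<in>I. a i * X i \<omega>))) = (\<Prod>i\<in>I. exp ((s * a i)\<^sup>2 / 2))"
    unfolding eq by (subst iid_N01_exp_sum(2)[OF X I]) (simp_all add: N01_exp_linear)
  also have "\<dots> = exp (\<Sum>i\<in>I. (s * a i)\<^sup>2 / 2)" by (simp only: exp_sum[OF I])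
  also have "(\<Sum>i\<in>I. (s * a i)\<^sup>2 / 2) = s\<^sup>2 / 2 * (\<Sum>i\<in>I. (a i)\<^sup>2)"
    by (simp add: sum_distrib_left power_mult_distrib)
  also have "exp \<dots> \<le> exp (s\<^sup>2 / 2 * V)" using V by (simp add: mult_left_mono)
  finally have le: "(LINT \<omega>|M. exp (s * (\<Sum>i\<in>I. a i * X i \<omega>))) \<le> exp (s\<^sup>2 / 2 * V)" .
  have "- s * x + s\<^sup>2 / 2 * V = - x\<^sup>2 / (2 * V)" using V(1) by (simp add: s_def power2_eq_square field_simps)
  with exp_tail_bound[OF M s int le, of x] show ?thesis by simp
qed

text \<open>Chernoff's bound for the sum and for its negative. The parameter \<theta> stays free so
  that it can be matched to the number of summands, which will be of order p^2.\<close>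

lemma iid_N01_chi2_tail:
  fixes \<theta> x :: real
  assumes X: "iid_N01 M J X" and J: "finite J" and \<theta>: "0 < \<theta>" "\<theta> \<le> 1/4"
  shows "measure M {\<omega>\<in>space M. x \<le> \<bar>\<Sum>j\<in>J. (X j \<omega>)\<^sup>2 - 1\<bar>} \<le> 2 * exp (- \<theta> * x + 4 * card J * \<theta>\<^sup>2)"
proof -
  interpret prob_space M using X by (simp add: iid_N01_def)
  have M: "prob_space M" by unfold_locales
  have 1: "measure M {\<omega>\<in>space M. x \<le> \<epsilon> * (\<Sum>j\<in>J. (X j \<omega>)\<^sup>2 - 1)} \<le> exp (- \<theta> * x + 4 * card J * \<theta>\<^sup>2)"
    if e: "\<bar>\<epsilon>\<bar> = 1" for \<epsilon> :: real
  proof (rule exp_tail_bound[OF M \<theta>(1)])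
    have b: "\<bar>\<theta> * \<epsilon>\<bar> \<le> 1/4" using e \<theta> by (simp add: abs_mult)
    have sq: "(\<theta> * \<epsilon>)\<^sup>2 = \<theta>\<^sup>2" using e by (metis abs_mult mult.right_neutral power2_abs)
    have eq: "\<theta> * (\<epsilon> * (\<Sum>j\<in>J. (X j \<omega>)\<^sup>2 - 1)) = (\<Sum>j\<in>J. (\<theta> * \<epsilon>) * ((X j \<omega>)\<^sup>2 - 1))" for \<omega>
      by (simp add: sum_distrib_left mult.assoc)
    show "integrable M (\<lambda>\<omega>. exp (\<theta> * (\<epsilon> * (\<Sum>j\<in>J. (X j \<omega>)\<^sup>2 - 1))))"
      unfolding eq by (rule iid_N01_exp_sum[OF X J]) (auto intro: N01_exp_chi2[OF b])
    have "(LINT \<omega>|M. exp (\<theta> * (\<epsilon> * (\<Sum>j\<in>J. (X j \<omega>)\<^sup>2 - 1)))) = (\<Prod>j\<in>J. (LINT x|N01. exp (\<theta> * \<epsilon> * (x\<^sup>2 - 1))))"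
      unfolding eq by (rule iid_N01_exp_sum(2)[OF X J]) (auto intro: N01_exp_chi2[OF b])
    also have "\<dots> \<le> (\<Prod>j\<in>J. exp (4 * \<theta>\<^sup>2))"
      using N01_exp_chi2(2)[OF b] by (intro prod_mono) (auto simp: sq)
    also have "\<dots> = exp (4 * card J * \<theta>\<^sup>2)" by (simp add: mult_ac flip: exp_of_nat_mult)
    finally show "(LINT \<omega>|M. exp (\<theta> * (\<epsilon> * (\<Sum>j\<in>J. (X j \<omega>)\<^sup>2 - 1)))) \<le> exp (4 * card J * \<theta>\<^sup>2)" .
  qed
  have [measurable]: "(\<lambda>\<omega>. \<Sum>j\<in>J. (X j \<omega>)\<^sup>2 - 1) \<in> borel_measurable M"
    using iid_N01_measurable[OF X] by (intro borel_measurable_sum borel_measurable_diff borel_measurable_power) auto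
  have "measure M {\<omega>\<in>space M. x \<le> \<bar>\<Sum>j\<in>J. (X j \<omega>)\<^sup>2 - 1\<bar>}
     \<le> measure M ({\<omega>\<in>space M. x \<le> 1 * (\<Sum>j\<in>J. (X j \<omega>)\<^sup>2 - 1)} \<union> {\<omega>\<in>space M. x \<le> (-1) * (\<Sum>j\<in>J. (X j \<omega>)\<^sup>2 - 1)})"
    by (rule finite_measure_mono) auto
  also have "\<dots> \<le> measure M {\<omega>\<in>space M. x \<le> 1 * (\<Sum>j\<in>J. (X j \<omega>)\<^sup>2 - 1)} + measure M {\<omega>\<in>space M. x \<le> (-1) * (\<Sum>j\<in>J. (X j \<omega>)\<^sup>2 - 1)}"
    by (rule measure_Un_le) auto
  also have "\<dots> \<le> 2 * exp (- \<theta> * x + 4 * card J * \<theta>\<^sup>2)" using 1[of 1] 1[of "-1"] by simp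
  finally show ?thesis .
qed

text \<open>A coordinate in both sets contributes a second moment 1, one in exactly one set a mean
  0, one in neither a factor 1; so only equal sets survive.\<close>

lemma iid_N01_monomials:
  assumes X: "iid_N01 M I X" and I: "finite I" and S: "S \<subseteq> I" "S' \<subseteq> I"
  shows "integrable M (\<lambda>\<omega>. (\<Prod>i\<in>S. X i \<omega>) * (\<Prod>i\<in>S'. X i \<omega>))"
    "(LINT \<omega>|M. (\<Prod>i\<in>S. X i \<omega>) * (\<Prod>i\<in>S'. X i \<omega>)) = (if S = S' then 1 else 0)"
proof -
  \<comment> \<open>Merges the two products into one product over \<open>I\<close> of functions of
    single coordinates, the form in which independence applies.\<close>
  define g where "g i x = (if i \<in> S then x else 1) * (if i \<in> S' then x else 1)" for i and x :: real
  have P: "(\<Prod>i\<in>S. x i) = (\<Prod>i\<in>I. if i \<in> S then x i else 1)" if "S \<subseteq> I" for S and x :: "_ \<Rightarrow> real"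
    using that I by (simp add: prod.If_cases Int_absorb1)
  have eq: "(\<Prod>i\<in>S. X i \<omega>) * (\<Prod>i\<in>S'. X i \<omega>) = (\<Prod>i\<in>I. g i (X i \<omega>))" for \<omega>
    unfolding P[OF S(1)] P[OF S(2)] prod.distrib[symmetric] by (rule prod.cong) (auto simp: g_def)
  have m: "g i \<in> borel_measurable borel" for i unfolding g_def by simp
  have gc: "g i = (if i \<in> S \<and> i \<in> S' then (\<lambda>x. x\<^sup>2) else if i \<in> S \<or> i \<in> S' then (\<lambda>x. x) else (\<lambda>x. 1))" for i
    by (auto simp: g_def fun_eq_iff power2_eq_square)
  interpret N: prob_space N01 by simp
  have int: "integrable N01 (g i)" for i
    using N01_moment(1)[of 2] N01_moment(1)[of 1] by (auto simp: gc)
  have val: "integral\<^sup>L N01 (g i) = (if i \<in> S \<longleftrightarrow> i \<in> S' then 1 else 0)" for i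
    using N01_moment(3,4) N.prob_space by (auto simp: gc)
  show "integrable M (\<lambda>\<omega>. (\<Prod>i\<in>S. X i \<omega>) * (\<Prod>i\<in>S'. X i \<omega>))"
    unfolding eq by (rule iid_N01_prod[OF X I m int])
  have "(LINT \<omega>|M. (\<Prod>i\<in>S. X i \<omega>) * (\<Prod>i\<in>S'. X i \<omega>)) = (\<Prod>i\<in>I. integral\<^sup>L N01 (g i))"
    unfolding eq by (rule iid_N01_prod(2)[OF X I m int])
  also have "\<dots> = (if S = S' then 1 else 0)"
    unfolding val using S I by (auto simp: prod_zero_iff)
  finally show "(LINT \<omega>|M. (\<Prod>i\<in>S. X i \<omega>) * (\<Prod>i\<in>S'. X i \<omega>)) = (if S = S' then 1 else 0)" .
qed

text \<open>Squarefree monomials with distinct supports are orthonormal in \<open>L\<^sup>2\<close>.\<close>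
lemma iid_N01_multilinear_tail:
  assumes X: "iid_N01 M I X" and I: "finite I" and T: "finite T" "inj_on S T"
    and S: "\<And>t. t \<in> T \<Longrightarrow> S t \<subseteq> I" and \<epsilon>: "0 < \<epsilon>"
  shows "measure M {\<omega>\<in>space M. \<epsilon> \<le> \<bar>\<Sum>t\<in>T. \<Prod>i\<in>S t. X i \<omega>\<bar>} \<le> card T / \<epsilon>\<^sup>2"
proof -
  interpret prob_space M using X by (simp add: iid_N01_def)
  define m where "m t \<omega> = (\<Prod>i\<in>S t. X i \<omega>)" for t \<omega>
  have eq: "(\<Sum>t\<in>T. m t \<omega>)\<^sup>2 = (\<Sum>t\<in>T. \<Sum>t'\<in>T. m t \<omega> * m t' \<omega>)" for \<omega>
    by (simp add: power2_eq_square sum_product)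
  have int: "integrable M (\<lambda>\<omega>. m t \<omega> * m t' \<omega>)" "(LINT \<omega>|M. m t \<omega> * m t' \<omega>) = (if t = t' then 1 else 0)"
    if "t \<in> T" "t' \<in> T" for t t'
    using iid_N01_monomials[OF X I S[OF that(1)] S[OF that(2)]] inj_onD[OF T(2) _ that] by (auto simp: m_def)
  have "integrable M (\<lambda>\<omega>. (\<Sum>t\<in>T. m t \<omega>)\<^sup>2)"
    unfolding eq by (intro Bochner_Integration.integrable_sum int)
  moreover have "(LINT \<omega>|M. (\<Sum>t\<in>T. m t \<omega>)\<^sup>2) = card T"
  proof -
    have "(LINT \<omega>|M. (\<Sum>t\<in>T. m t \<omega>)\<^sup>2) = (\<Sum>t\<in>T. \<Sum>t'\<in>T. (LINT \<omega>|M. m t \<omega> * m t' \<omega>))"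
      unfolding eq using int(1)
      by (subst Bochner_Integration.integral_sum, force intro!: Bochner_Integration.integrable_sum)
         (intro sum.cong refl Bochner_Integration.integral_sum)
    also have "\<dots> = (\<Sum>t\<in>T. \<Sum>t'\<in>T. if t = t' then 1 else 0)" by (intro sum.cong refl) (simp add: int(2))
    finally show ?thesis using T(1) by simp
  qed
  ultimately have "measure M {\<omega>\<in>space M. \<epsilon>\<^sup>2 \<le> (\<Sum>t\<in>T. m t \<omega>)\<^sup>2} \<le> card T / \<epsilon>\<^sup>2"
    using integral_Markov_inequality_measure[of M "\<lambda>\<omega>. (\<Sum>t\<in>T. m t \<omega>)\<^sup>2" "{}" "\<epsilon>\<^sup>2"] \<epsilon> by simp
  moreover have "\<epsilon>\<^sup>2 \<le> y\<^sup>2 \<longleftrightarrow> \<epsilon> \<le> \<bar>y\<bar>" for y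
    using \<epsilon> abs_le_square_iff[of \<epsilon> y] by simp
  ultimately show ?thesis by (simp add: m_def)
qed

section \<open>Stochastic order symbols and weak limits\<close>

text \<open>The failure of Q is only required to be contained in a measurable set of small measure.
  Predicates such as \<open>refined\<close> quantify over vectors, and no measurability is asked of
  them.\<close>

definition whp :: "(nat \<Rightarrow> 'a measure) \<Rightarrow> (nat \<Rightarrow> 'a \<Rightarrow> bool) \<Rightarrow> bool" where
  "whp M Q \<longleftrightarrow> (\<forall>\<eta>>0. \<forall>\<^sub>F n in sequentially.
     \<exists>A\<in>sets (M n). measure (M n) A \<le> \<eta> \<and> (\<forall>\<omega>\<in>space (M n) - A. Q n \<omega>))"

text \<open>The usual o_P(1); \<open>Op1\<close> is O_P(1), that is, tightness, with the bound K
  allowed to depend on \<eta>.\<close>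

definition op0 :: "(nat \<Rightarrow> 'a measure) \<Rightarrow> (nat \<Rightarrow> 'a \<Rightarrow> real) \<Rightarrow> bool" where
  "op0 M X \<longleftrightarrow> (\<forall>\<epsilon>>0. whp M (\<lambda>n \<omega>. \<bar>X n \<omega>\<bar> \<le> \<epsilon>))"

definition Op1 :: "(nat \<Rightarrow> 'a measure) \<Rightarrow> (nat \<Rightarrow> 'a \<Rightarrow> real) \<Rightarrow> bool" where
  "Op1 M X \<longleftrightarrow> (\<forall>\<eta>>0. \<exists>K. \<forall>\<^sub>F n in sequentially.
     \<exists>A\<in>sets (M n). measure (M n) A \<le> \<eta> \<and> (\<forall>\<omega>\<in>space (M n) - A. \<bar>X n \<omega>\<bar> \<le> K))"

section \<open>Calculus of stochastic order symbols\<close>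

lemma whp_mono:
  assumes "whp M Q" "\<forall>\<^sub>F n in sequentially. \<forall>\<omega>\<in>space (M n). Q n \<omega> \<longrightarrow> R n \<omega>"
  shows "whp M R"
  unfolding whp_def
proof (intro allI impI)
  fix \<eta> :: real assume "\<eta> > 0"
  then have "\<forall>\<^sub>F n in sequentially. \<exists>A\<in>sets (M n). measure (M n) A \<le> \<eta> \<and> (\<forall>\<omega>\<in>space (M n) - A. Q n \<omega>)"
    using assms(1) by (simp add: whp_def)
  with assms(2) show "\<forall>\<^sub>F n in sequentially. \<exists>A\<in>sets (M n). measure (M n) A \<le> \<eta> \<and> (\<forall>\<omega>\<in>space (M n) - A. R n \<omega>)"
    by eventually_elim blast
qed

lemma whp_always: "whp M (\<lambda>n \<omega>. True)"
  unfolding whp_def by (auto intro!: always_eventually bexI[of _ "{}"])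

lemma whp_eventually:
  assumes "\<forall>\<^sub>F n in sequentially. \<forall>\<omega>\<in>space (M n). R n \<omega>"
  shows "whp M R"
  by (rule whp_mono[OF whp_always]) (use assms in \<open>auto elim: eventually_mono\<close>)

lemma whp_conj:
  assumes "whp M Q" "whp M R"
  shows "whp M (\<lambda>n \<omega>. Q n \<omega> \<and> R n \<omega>)"
  unfolding whp_def
proof (intro allI impI)
  fix \<eta> :: real assume "\<eta> > 0"
  then have h: "\<eta> / 2 > 0" by simp
  have "\<forall>\<^sub>F n in sequentially. \<exists>A\<in>sets (M n). measure (M n) A \<le> \<eta>/2 \<and> (\<forall>\<omega>\<in>space (M n) - A. Q n \<omega>)"
    and "\<forall>\<^sub>F n in sequentially. \<exists>A\<in>sets (M n). measure (M n) A \<le> \<eta>/2 \<and> (\<forall>\<omega>\<in>space (M n) - A. R n \<omega>)"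
    using assms h unfolding whp_def by blast+
  then show "\<forall>\<^sub>F n in sequentially. \<exists>A\<in>sets (M n). measure (M n) A \<le> \<eta> \<and> (\<forall>\<omega>\<in>space (M n) - A. Q n \<omega> \<and> R n \<omega>)"
  proof eventually_elim
    case (elim n)
    then obtain A B where A: "A \<in> sets (M n)" "measure (M n) A \<le> \<eta>/2" "\<forall>\<omega>\<in>space (M n) - A. Q n \<omega>"
      and B: "B \<in> sets (M n)" "measure (M n) B \<le> \<eta>/2" "\<forall>\<omega>\<in>space (M n) - B. R n \<omega>" by blast
    have "measure (M n) (A \<union> B) \<le> \<eta>" using measure_Un_le[OF A(1) B(1)] A(2) B(2) by linarith
    then show ?case using A B by (intro bexI[of _ "A \<union> B"]) auto
  qed
qed

lemma whp_of_prob: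
  assumes "\<forall>\<^sub>F n in sequentially. A n \<in> sets (M n) \<and> measure (M n) (A n) \<le> b n" "b \<longlonglongrightarrow> 0"
    and "\<forall>\<^sub>F n in sequentially. \<forall>\<omega>\<in>space (M n) - A n. Q n \<omega>"
  shows "whp M Q"
  unfolding whp_def
proof (intro allI impI)
  fix \<eta> :: real assume "\<eta> > 0"
  then have "\<forall>\<^sub>F n in sequentially. b n < \<eta>" using assms(2) by (simp add: order_tendstoD)
  with assms(1,3) show "\<forall>\<^sub>F n in sequentially. \<exists>A\<in>sets (M n). measure (M n) A \<le> \<eta> \<and> (\<forall>\<omega>\<in>space (M n) - A. Q n \<omega>)"
  proof eventually_elim
    case (elim n)
    then show ?case by (intro bexI[of _ "A n"] conjI) auto
  qed
qed

lemma op0_dominated: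
  assumes "op0 M Y" "whp M (\<lambda>n \<omega>. \<bar>X n \<omega>\<bar> \<le> Y n \<omega>)"
  shows "op0 M X"
  unfolding op0_def
proof (intro allI impI)
  fix \<epsilon> :: real assume "\<epsilon> > 0"
  then have "whp M (\<lambda>n \<omega>. \<bar>Y n \<omega>\<bar> \<le> \<epsilon>)" using assms(1) by (simp add: op0_def)
  from whp_conj[OF this assms(2)] show "whp M (\<lambda>n \<omega>. \<bar>X n \<omega>\<bar> \<le> \<epsilon>)"
    by (rule whp_mono) (intro always_eventually allI ballI impI, linarith)
qed

lemma op0_whp_eq:
  assumes "op0 M Y" "whp M (\<lambda>n \<omega>. X n \<omega> = Y n \<omega>)"
  shows "op0 M X"
proof -
  have "op0 M (\<lambda>n \<omega>. \<bar>Y n \<omega>\<bar>)" using assms(1) by (simp add: op0_def)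
  then show ?thesis by (rule op0_dominated) (rule whp_mono[OF assms(2)], simp)
qed

lemma op0_add:
  assumes "op0 M X" "op0 M Y" shows "op0 M (\<lambda>n \<omega>. X n \<omega> + Y n \<omega>)"
  unfolding op0_def
proof (intro allI impI)
  fix \<epsilon> :: real assume e: "\<epsilon> > 0"
  have "whp M (\<lambda>n \<omega>. \<bar>X n \<omega>\<bar> \<le> \<epsilon>/2)" "whp M (\<lambda>n \<omega>. \<bar>Y n \<omega>\<bar> \<le> \<epsilon>/2)"
    using assms e half_gt_zero unfolding op0_def by blast+
  from whp_conj[OF this] show "whp M (\<lambda>n \<omega>. \<bar>X n \<omega> + Y n \<omega>\<bar> \<le> \<epsilon>)"
    by (rule whp_mono) (intro always_eventually allI ballI impI, linarith)
qed

lemma op0_tendsto: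
  assumes "a \<longlonglongrightarrow> 0" shows "op0 M (\<lambda>n \<omega>. a n)"
  unfolding op0_def
proof (intro allI impI whp_eventually)
  fix \<epsilon> :: real assume e: "\<epsilon> > 0"
  show "\<forall>\<^sub>F n in sequentially. \<forall>\<omega>\<in>space (M n). \<bar>a n\<bar> \<le> \<epsilon>"
    using tendstoD[OF assms e] by eventually_elim (simp add: dist_real_def)
qed

lemma op0_mult_Op1:
  assumes X: "op0 M X" and Y: "Op1 M Y" shows "op0 M (\<lambda>n \<omega>. X n \<omega> * Y n \<omega>)"
  unfolding op0_def whp_def
proof (intro allI impI)
  fix \<epsilon> \<eta> :: real assume e: "\<epsilon> > 0" "\<eta> > 0"
  then have h: "\<eta> / 2 > 0" by simp
  obtain K where K: "\<forall>\<^sub>F n in sequentially. \<exists>A\<in>sets (M n). measure (M n) A \<le> \<eta>/2 \<and> (\<forall>\<omega>\<in>space (M n) - A. \<bar>Y n \<omega>\<bar> \<le> K)"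
    using Y h unfolding Op1_def by blast
  define L where "L = \<bar>K\<bar> + 1"
  have "\<epsilon> / L > 0" using e by (simp add: L_def)
  then have "\<forall>\<^sub>F n in sequentially. \<exists>A\<in>sets (M n). measure (M n) A \<le> \<eta>/2 \<and> (\<forall>\<omega>\<in>space (M n) - A. \<bar>X n \<omega>\<bar> \<le> \<epsilon> / L)"
    using X h unfolding op0_def whp_def by blast
  with K show "\<forall>\<^sub>F n in sequentially. \<exists>A\<in>sets (M n). measure (M n) A \<le> \<eta> \<and> (\<forall>\<omega>\<in>space (M n) - A. \<bar>X n \<omega> * Y n \<omega>\<bar> \<le> \<epsilon>)"
  proof eventually_elim
    case (elim n)
    then obtain A B where A: "A \<in> sets (M n)" "measure (M n) A \<le> \<eta>/2" "\<forall>\<omega>\<in>space (M n) - A. \<bar>Y n \<omega>\<bar> \<le> K"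
      and B: "B \<in> sets (M n)" "measure (M n) B \<le> \<eta>/2" "\<forall>\<omega>\<in>space (M n) - B. \<bar>X n \<omega>\<bar> \<le> \<epsilon> / L" by blast
    have "measure (M n) (A \<union> B) \<le> \<eta>" using measure_Un_le[OF A(1) B(1)] A(2) B(2) by linarith
    moreover have "\<bar>X n \<omega> * Y n \<omega>\<bar> \<le> \<epsilon>" if w: "\<omega> \<in> space (M n) - (A \<union> B)" for \<omega>
    proof -
      have x: "\<bar>X n \<omega>\<bar> \<le> \<epsilon> / L" using B(3) w by blast
      have "\<bar>Y n \<omega>\<bar> \<le> K" using A(3) w by blast
      then have y: "\<bar>Y n \<omega>\<bar> \<le> L" by (simp add: L_def)
      have "\<bar>X n \<omega> * Y n \<omega>\<bar> \<le> \<epsilon> / L * L"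
        unfolding abs_mult using x y e by (intro mult_mono) (auto simp: L_def)
      then show ?thesis by (simp add: L_def)
    qed
    ultimately show ?case using A(1) B(1) by (intro bexI[of _ "A \<union> B"]) auto
  qed
qed

lemma Op1_of_bounded:
  assumes "whp M (\<lambda>n \<omega>. \<bar>X n \<omega>\<bar> \<le> K)" shows "Op1 M X"
  using assms unfolding Op1_def whp_def by blast

lemma Op1_const: "Op1 M (\<lambda>n \<omega>. c)"
  by (rule Op1_of_bounded[of _ _ "\<bar>c\<bar>"]) (rule whp_eventually, simp)

lemma op0_imp_Op1: "op0 M X \<Longrightarrow> Op1 M X"
  by (rule Op1_of_bounded[of _ _ 1]) (simp add: op0_def)

lemma op0_cmult: "op0 M X \<Longrightarrow> op0 M (\<lambda>n \<omega>. c * X n \<omega>)"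
  using op0_mult_Op1[OF _ Op1_const[of M c], of X] by (simp add: mult.commute)

lemma op0_diff: "op0 M X \<Longrightarrow> op0 M Y \<Longrightarrow> op0 M (\<lambda>n \<omega>. X n \<omega> - Y n \<omega>)"
  using op0_add[OF _ op0_cmult[of M Y "-1"], of X] by simp

lemma Op1_add:
  assumes X: "Op1 M X" and Y: "Op1 M Y" shows "Op1 M (\<lambda>n \<omega>. X n \<omega> + Y n \<omega>)"
  unfolding Op1_def
proof (intro allI impI)
  fix \<eta> :: real assume "\<eta> > 0"
  then have h: "\<eta> / 2 > 0" by simp
  obtain K where K: "\<forall>\<^sub>F n in sequentially. \<exists>A\<in>sets (M n). measure (M n) A \<le> \<eta>/2 \<and> (\<forall>\<omega>\<in>space (M n) - A. \<bar>X n \<omega>\<bar> \<le> K)"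
    using X h unfolding Op1_def by blast
  obtain L where L: "\<forall>\<^sub>F n in sequentially. \<exists>A\<in>sets (M n). measure (M n) A \<le> \<eta>/2 \<and> (\<forall>\<omega>\<in>space (M n) - A. \<bar>Y n \<omega>\<bar> \<le> L)"
    using Y h unfolding Op1_def by blast
  from K L show "\<exists>K. \<forall>\<^sub>F n in sequentially. \<exists>A\<in>sets (M n). measure (M n) A \<le> \<eta> \<and> (\<forall>\<omega>\<in>space (M n) - A. \<bar>X n \<omega> + Y n \<omega>\<bar> \<le> K)"
  proof (intro exI[of _ "K + L"], eventually_elim)
    case (elim n)
    then obtain A B where A: "A \<in> sets (M n)" "measure (M n) A \<le> \<eta>/2" "\<forall>\<omega>\<in>space (M n) - A. \<bar>X n \<omega>\<bar> \<le> K"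
      and B: "B \<in> sets (M n)" "measure (M n) B \<le> \<eta>/2" "\<forall>\<omega>\<in>space (M n) - B. \<bar>Y n \<omega>\<bar> \<le> L" by blast
    have "measure (M n) (A \<union> B) \<le> \<eta>" using measure_Un_le[OF A(1) B(1)] A(2) B(2) by linarith
    moreover have "\<bar>X n \<omega> + Y n \<omega>\<bar> \<le> K + L" if w: "\<omega> \<in> space (M n) - (A \<union> B)" for \<omega>
      using A(3)[rule_format, of \<omega>] B(3)[rule_format, of \<omega>] w by simp
    ultimately show ?case using A(1) B(1) by (intro bexI[of _ "A \<union> B"]) auto
  qed
qed

lemma op0_of_tail:
  assumes "\<forall>\<^sub>F n in sequentially. X n \<in> borel_measurable (M n) \<and>
      (\<forall>\<epsilon>>0. measure (M n) {\<omega>\<in>space (M n). \<epsilon> \<le> \<bar>X n \<omega>\<bar>} \<le> c n / \<epsilon>\<^sup>2)" and c: "c \<longlonglongrightarrow> 0"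
  shows "op0 M X"
  unfolding op0_def
proof (intro allI impI)
  fix \<epsilon> :: real assume e: "\<epsilon> > 0"
  show "whp M (\<lambda>n \<omega>. \<bar>X n \<omega>\<bar> \<le> \<epsilon>)"
  proof (rule whp_of_prob)
    show "\<forall>\<^sub>F n in sequentially. {\<omega>\<in>space (M n). \<epsilon> \<le> \<bar>X n \<omega>\<bar>} \<in> sets (M n) \<and> measure (M n) {\<omega>\<in>space (M n). \<epsilon> \<le> \<bar>X n \<omega>\<bar>} \<le> c n / \<epsilon>\<^sup>2"
      using assms(1)
    proof eventually_elim
      case (elim n)
      then have [measurable]: "X n \<in> borel_measurable (M n)" by simp
      show ?case using elim e by simp
    qed
    show "(\<lambda>n. c n / \<epsilon>\<^sup>2) \<longlonglongrightarrow> 0" by (rule tendsto_divide_zero[OF c])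
    show "\<forall>\<^sub>F n in sequentially. \<forall>\<omega>\<in>space (M n) - {\<omega> \<in> space (M n). \<epsilon> \<le> \<bar>X n \<omega>\<bar>}. \<bar>X n \<omega>\<bar> \<le> \<epsilon>"
      by (intro always_eventually) auto
  qed
qed

lemma Op1_of_tail:
  assumes "\<forall>\<^sub>F n in sequentially. X n \<in> borel_measurable (M n) \<and>
      (\<forall>\<epsilon>>0. measure (M n) {\<omega>\<in>space (M n). \<epsilon> \<le> \<bar>X n \<omega>\<bar>} \<le> c / \<epsilon>\<^sup>2)"
  shows "Op1 M X"
  unfolding Op1_def
proof (intro allI impI)
  fix \<eta> :: real assume e: "\<eta> > 0"
  \<comment> \<open>Chosen so that c / K^2 \<le> \<eta>; the added 1 keeps K positive.\<close>
  define K where "K = sqrt ((\<bar>c\<bar> + 1) / \<eta>)"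
  have K0: "K > 0" and K2: "K\<^sup>2 = (\<bar>c\<bar> + 1) / \<eta>" using e by (auto simp: K_def)
  have "c * \<eta> \<le> \<eta> * (\<bar>c\<bar> + 1)" using e by (subst mult.commute) (intro mult_left_mono, auto)
  then have K: "K > 0" "c / K\<^sup>2 \<le> \<eta>" using e K0 by (auto simp: K2 divide_le_eq)
  show "\<exists>K. \<forall>\<^sub>F n in sequentially. \<exists>A\<in>sets (M n). measure (M n) A \<le> \<eta> \<and> (\<forall>\<omega>\<in>space (M n) - A. \<bar>X n \<omega>\<bar> \<le> K)"
    using assms
  proof (intro exI[of _ K], eventually_elim)
    case (elim n)
    then have [measurable]: "X n \<in> borel_measurable (M n)" by simp
    have "measure (M n) {\<omega>\<in>space (M n). K \<le> \<bar>X n \<omega>\<bar>} \<le> \<eta>" using elim K by force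
    then show ?case by (intro bexI[of _ "{\<omega>\<in>space (M n). K \<le> \<bar>X n \<omega>\<bar>}"]) auto
  qed
qed

text \<open>Measurability is asked for only eventually: the approximating variables are built from
  orthonormal bases with two prescribed vectors, which exist once the dimension is at least
  2.\<close>

definition conv_ev :: "(nat \<Rightarrow> 'a measure) \<Rightarrow> (nat \<Rightarrow> 'a \<Rightarrow> 'b::topological_space) \<Rightarrow> 'b measure \<Rightarrow> bool" where
  "conv_ev M X mu \<longleftrightarrow> (\<forall>\<^sub>F n in sequentially. X n \<in> borel_measurable (M n)) \<and>
     (\<forall>f :: 'b \<Rightarrow> real. continuous_on UNIV f \<longrightarrow> bounded (range f) \<longrightarrow>
        (\<lambda>n. integral\<^sup>L (M n) (\<lambda>\<omega>. f (X n \<omega>))) \<longlonglongrightarrow> integral\<^sup>L mu f)"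

text \<open>Test functions are continuous and bounded but need not be uniformly continuous.
  Tightness, extracted from the limit law by a continuous cut-off, confines the argument to a
  compact ball, where uniform continuity transfers closeness of the variables to closeness of the
  values.\<close>

lemma slutsky:
  fixes X Y :: "nat \<Rightarrow> 'a \<Rightarrow> 'b::euclidean_space"
  assumes M: "\<And>n. prob_space (M n)" and X: "conv_ev M X mu"
    and mu: "prob_space mu" "sets mu = sets borel"
    and Y: "\<And>n. Y n \<in> borel_measurable (M n)"
    and close: "\<And>\<epsilon>. \<epsilon> > 0 \<Longrightarrow> whp M (\<lambda>n \<omega>. dist (X n \<omega>) (Y n \<omega>) \<le> \<epsilon>)"
  shows "conv_distr M Y mu"
  unfolding conv_distr_def
proof (intro conjI allI impI Y)
  fix f :: "'b \<Rightarrow> real" assume f: "continuous_on UNIV f" "bounded (range f)"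
  interpret mu: prob_space mu by fact
  obtain B where B: "B > 0" "\<And>x. \<bar>f x\<bar> \<le> B" using f(2) by (auto simp: bounded_pos)
  have [measurable]: "f \<in> borel_measurable borel" using f(1) by (rule borel_measurable_continuous_onI)
  \<comment> \<open>A ramp, 0 on the ball of radius K and 1 beyond radius K + 1. Being continuous,
    it is an admissible test function, unlike an indicator.\<close>
  define h where "h K x = min 1 (max 0 (norm x - K))" for K and x :: 'b
  have hc: "continuous_on UNIV (h K)" for K unfolding h_def by (intro continuous_intros)
  have [measurable]: "h K \<in> borel_measurable borel" for K using hc by (rule borel_measurable_continuous_onI)
  have h01: "0 \<le> h K x" "h K x \<le> 1" for K x by (auto simp: h_def)
  have hb: "bounded (range (h K))" for K using h01 by (intro boundedI[of _ 1]) auto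
  \<comment> \<open>Each point lies inside the ball from some radius on, so by dominated convergence
    the mass of the limit law outside large balls vanishes.\<close>
  have "(\<lambda>k. integral\<^sup>L mu (h (real k))) \<longlonglongrightarrow> integral\<^sup>L mu (\<lambda>_. 0::real)"
  proof (rule integral_dominated_convergence[where w="\<lambda>_. 1"])
    show "AE x in mu. (\<lambda>k. h (real k) x) \<longlonglongrightarrow> 0"
    proof (intro AE_I2 tendsto_eventually)
      fix x
      show "\<forall>\<^sub>F k in sequentially. h (real k) x = 0"
        using eventually_ge_at_top[of "nat \<lceil>norm x\<rceil>"]
      proof eventually_elim
        case (elim k)
        then have "norm x \<le> real k" by linarith
        then show ?case by (simp add: h_def)
      qed
    qed
    show "(\<lambda>_. 0::real) \<in> borel_measurable mu" "\<And>k. h (real k) \<in> borel_measurable mu"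
      using mu(2) by (auto cong: measurable_cong_sets)
  qed (use h01 in \<open>auto simp: abs_le_iff intro!: AE_I2\<close>)
  then have tight: "(\<lambda>k. integral\<^sup>L mu (h (real k))) \<longlonglongrightarrow> 0" by simp
  have lim: "(\<lambda>n. integral\<^sup>L (M n) (\<lambda>\<omega>. f (Y n \<omega>)) - integral\<^sup>L (M n) (\<lambda>\<omega>. f (X n \<omega>))) \<longlonglongrightarrow> 0"
  proof (rule tendstoI)
    fix \<epsilon>' :: real assume e': "\<epsilon>' > 0"
    \<comment> \<open>The final estimate is \<epsilon> + 2 B \<epsilon> + 2 B \<epsilon>, for
      uniform continuity, escape from the ball and the exceptional set.\<close>
    define \<epsilon> where "\<epsilon> = \<epsilon>' / (2 + 4 * B)"
    have e: "\<epsilon> > 0" using e' B(1) by (simp add: \<epsilon>_def)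
    obtain k where k: "integral\<^sup>L mu (h (real k)) < \<epsilon>"
      using order_tendstoD(2)[OF tight e] by (auto dest: eventually_happens)
    define K where "K = real k"
    have "(\<lambda>n. integral\<^sup>L (M n) (\<lambda>\<omega>. h K (X n \<omega>))) \<longlonglongrightarrow> integral\<^sup>L mu (h K)"
      using X hc hb unfolding conv_ev_def by blast
    then have hX: "\<forall>\<^sub>F n in sequentially. integral\<^sup>L (M n) (\<lambda>\<omega>. h K (X n \<omega>)) < \<epsilon>"
      using k by (intro order_tendstoD(2)) (auto simp: K_def)
    \<comment> \<open>Radius K + 2 because X stays below K + 1 and Y is at distance at most 1 from
      it.\<close>
    have "uniformly_continuous_on (cball 0 (K + 2)) f"
      by (intro compact_uniformly_continuous continuous_on_subset[OF f(1)]) auto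
    then obtain \<delta> where d: "\<delta> > 0" "\<And>x y. x \<in> cball 0 (K+2) \<Longrightarrow> y \<in> cball 0 (K+2) \<Longrightarrow> dist y x < \<delta> \<Longrightarrow> dist (f y) (f x) < \<epsilon>"
      using e unfolding uniformly_continuous_on_def by meson
    define \<delta>' where "\<delta>' = min 1 (\<delta> / 2)"
    have d': "\<delta>' > 0" "\<delta>' \<le> 1" "\<delta>' < \<delta>" using d(1) by (auto simp: \<delta>'_def)
    have cl: "\<forall>\<^sub>F n in sequentially. \<exists>A\<in>sets (M n). measure (M n) A \<le> \<epsilon> \<and> (\<forall>\<omega>\<in>space (M n) - A. dist (X n \<omega>) (Y n \<omega>) \<le> \<delta>')"
      using close[OF d'(1)] e unfolding whp_def by blast
    have mX: "\<forall>\<^sub>F n in sequentially. X n \<in> borel_measurable (M n)" using X by (simp add: conv_ev_def)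
    from hX cl mX show "\<forall>\<^sub>F n in sequentially. dist (integral\<^sup>L (M n) (\<lambda>\<omega>. f (Y n \<omega>)) - integral\<^sup>L (M n) (\<lambda>\<omega>. f (X n \<omega>))) 0 < \<epsilon>'"
    proof eventually_elim
      case (elim n)
      interpret prob_space "M n" by (rule M)
      obtain A where A: "A \<in> sets (M n)" "measure (M n) A \<le> \<epsilon>" "\<And>\<omega>. \<omega>\<in>space (M n) - A \<Longrightarrow> dist (X n \<omega>) (Y n \<omega>) \<le> \<delta>'"
        using elim(2) by blast
      note [measurable] = Y[of n] elim(3) A(1)
      have iY: "integrable (M n) (\<lambda>\<omega>. f (Y n \<omega>))" by (rule integrable_const_bound[of _ B]) (use B in auto)
      have iX: "integrable (M n) (\<lambda>\<omega>. f (X n \<omega>))" by (rule integrable_const_bound[of _ B]) (use B in auto)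
      have ih: "integrable (M n) (\<lambda>\<omega>. h K (X n \<omega>))" by (rule integrable_const_bound[of _ 1]) (use h01 in auto)
      have iA: "integrable (M n) (\<lambda>\<omega>. indicat_real A \<omega>)" using A(1) by (simp add: emeasure_eq_measure)
      have pw: "\<bar>f (Y n \<omega>) - f (X n \<omega>)\<bar> \<le> \<epsilon> + 2 * B * h K (X n \<omega>) + 2 * B * indicator A \<omega>"
        if w: "\<omega> \<in> space (M n)" for \<omega>
      proof -
        have trivial: "\<bar>f (Y n \<omega>) - f (X n \<omega>)\<bar> \<le> 2 * B" using B(2)[of "Y n \<omega>"] B(2)[of "X n \<omega>"] by linarith
        have p: "0 \<le> 2 * B * h K (X n \<omega>)" "0 \<le> 2 * B * indicat_real A \<omega>" using B(1) h01 by auto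
        consider "\<omega> \<in> A" | "norm (X n \<omega>) \<ge> K + 1" | "\<omega> \<notin> A" "norm (X n \<omega>) < K + 1" by linarith
        then show ?thesis
        proof cases
          case 1
          then have "2 * B * indicat_real A \<omega> = 2 * B" by simp
          with trivial p e show ?thesis by linarith
        next
          case 2
          then have "2 * B * h K (X n \<omega>) = 2 * B" by (simp add: h_def)
          with trivial p e show ?thesis by linarith
        next
          case 3
          have dd: "dist (X n \<omega>) (Y n \<omega>) \<le> \<delta>'" using A(3) 3 w by blast
          have "norm (Y n \<omega>) \<le> norm (X n \<omega>) + dist (X n \<omega>) (Y n \<omega>)"
            using norm_triangle_ineq2[of "Y n \<omega>" "X n \<omega>"] by (simp add: dist_norm norm_minus_commute)
          then have "norm (Y n \<omega>) \<le> K + 2" using dd d'(2) 3 by linarith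
          then have "dist (f (Y n \<omega>)) (f (X n \<omega>)) < \<epsilon>"
            using dd d'(3) 3 by (intro d(2)) (auto simp: dist_commute)
          then show ?thesis using p by (simp add: dist_real_def)
        qed
      qed
      have "\<bar>integral\<^sup>L (M n) (\<lambda>\<omega>. f (Y n \<omega>)) - integral\<^sup>L (M n) (\<lambda>\<omega>. f (X n \<omega>))\<bar>
          = \<bar>integral\<^sup>L (M n) (\<lambda>\<omega>. f (Y n \<omega>) - f (X n \<omega>))\<bar>" using iX iY by simp
      also have "\<dots> \<le> integral\<^sup>L (M n) (\<lambda>\<omega>. \<bar>f (Y n \<omega>) - f (X n \<omega>)\<bar>)" by (rule integral_abs_bound)
      also have "\<dots> \<le> integral\<^sup>L (M n) (\<lambda>\<omega>. \<epsilon> + 2 * B * h K (X n \<omega>) + 2 * B * indicator A \<omega>)"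
        by (rule integral_mono) (use iX iY ih iA pw in auto)
      also have "\<dots> = \<epsilon> + 2 * B * integral\<^sup>L (M n) (\<lambda>\<omega>. h K (X n \<omega>)) + 2 * B * measure (M n) A"
        using ih iA A(1) prob_space by (simp add: Int_absorb2[OF sets.sets_into_space])
      also have "\<dots> \<le> \<epsilon> + 2 * B * \<epsilon> + 2 * B * \<epsilon>"
        using elim(1) A(2) B(1) by (intro add_mono mult_left_mono) auto
      also have "\<dots> < (2 + 4 * B) * \<epsilon>" using e by (simp add: algebra_simps)
      also have "\<dots> = \<epsilon>'" using B(1) by (simp add: \<epsilon>_def)
      finally show ?case by (simp add: dist_real_def)
    qed
  qed
  have "(\<lambda>n. integral\<^sup>L (M n) (\<lambda>\<omega>. f (X n \<omega>))) \<longlonglongrightarrow> integral\<^sup>L mu f"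
    using X f unfolding conv_ev_def by blast
  from tendsto_add[OF lim this] show "(\<lambda>n. integral\<^sup>L (M n) (\<lambda>\<omega>. f (Y n \<omega>))) \<longlonglongrightarrow> integral\<^sup>L mu f" by simp
qed

section \<open>Convergence to the three-dimensional normal law\<close>

lemma sets_N3: "sets N3 = sets borel"
  unfolding N3_def by (simp add: borel_prod[symmetric] cong: sets_pair_measure_cong)

lemma prob_space_N3: "prob_space N3"
proof -
  interpret N: prob_space N01 by simp
  interpret P: pair_prob_space N01 N01 ..
  interpret Q: pair_prob_space N01 "N01 \<Otimes>\<^sub>M N01" ..
  show ?thesis unfolding N3_def by unfold_locales
qed

text \<open>Coordinatewise Skorohod representations on a product space.\<close>
lemma product_weak_convergence:
  fixes \<mu>1 \<mu>2 \<mu>3 :: "nat \<Rightarrow> real measure" and f :: "real \<times> real \<times> real \<Rightarrow> real"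
  assumes rd: "\<And>n. real_distribution (\<mu>1 n)" "\<And>n. real_distribution (\<mu>2 n)" "\<And>n. real_distribution (\<mu>3 n)"
    and ch: "\<And>t. (\<lambda>n. char (\<mu>1 n) t) \<longlonglongrightarrow> char N01 t" "\<And>t. (\<lambda>n. char (\<mu>2 n) t) \<longlonglongrightarrow> char N01 t"
      "\<And>t. (\<lambda>n. char (\<mu>3 n) t) \<longlonglongrightarrow> char N01 t"
    and f: "continuous_on UNIV f" "bounded (range f)"
  shows "(\<lambda>n. integral\<^sup>L (\<mu>1 n \<Otimes>\<^sub>M (\<mu>2 n \<Otimes>\<^sub>M \<mu>3 n)) f) \<longlonglongrightarrow> integral\<^sup>L N3 f"
proof -
  \<comment> \<open>Levy's continuity theorem gives weak convergence of each marginal; Skorohod's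
    theorem realizes it pointwise, on a separate space for each coordinate.\<close>
  have sk: "\<exists>\<Omega> (Y_seq :: nat \<Rightarrow> real \<Rightarrow> real) Y. prob_space \<Omega> \<and> (\<forall>n. Y_seq n \<in> borel_measurable \<Omega>) \<and>
      (\<forall>n. distr \<Omega> borel (Y_seq n) = \<mu> n) \<and> Y \<in> borel_measurable \<Omega> \<and> distr \<Omega> borel Y = N01 \<and>
      (\<forall>x\<in>space \<Omega>. (\<lambda>n. Y_seq n x) \<longlonglongrightarrow> Y x)"
    if "\<And>n. real_distribution (\<mu> n)" "\<And>t. (\<lambda>n. char (\<mu> n) t) \<longlonglongrightarrow> char N01 t" for \<mu>
    using Skorohod[OF that(1) real_distribution_N01 levy_continuity[OF that(1) real_distribution_N01 that(2)]]
    by (simp only: measurable_lborel1)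
  obtain \<Omega>1 :: "real measure" and Ys1 Y1 where 1: "prob_space \<Omega>1" "\<And>n. Ys1 n \<in> borel_measurable \<Omega>1"
      "\<And>n. distr \<Omega>1 borel (Ys1 n) = \<mu>1 n" "Y1 \<in> borel_measurable \<Omega>1" "distr \<Omega>1 borel Y1 = N01"
      "\<And>x. x \<in> space \<Omega>1 \<Longrightarrow> (\<lambda>n. Ys1 n x) \<longlonglongrightarrow> Y1 x"
    using sk[OF rd(1) ch(1)] by blast
  obtain \<Omega>2 :: "real measure" and Ys2 Y2 where 2: "prob_space \<Omega>2" "\<And>n. Ys2 n \<in> borel_measurable \<Omega>2"
      "\<And>n. distr \<Omega>2 borel (Ys2 n) = \<mu>2 n" "Y2 \<in> borel_measurable \<Omega>2" "distr \<Omega>2 borel Y2 = N01"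
      "\<And>x. x \<in> space \<Omega>2 \<Longrightarrow> (\<lambda>n. Ys2 n x) \<longlonglongrightarrow> Y2 x"
    using sk[OF rd(2) ch(2)] by blast
  obtain \<Omega>3 :: "real measure" and Ys3 Y3 where 3: "prob_space \<Omega>3" "\<And>n. Ys3 n \<in> borel_measurable \<Omega>3"
      "\<And>n. distr \<Omega>3 borel (Ys3 n) = \<mu>3 n" "Y3 \<in> borel_measurable \<Omega>3" "distr \<Omega>3 borel Y3 = N01"
      "\<And>x. x \<in> space \<Omega>3 \<Longrightarrow> (\<lambda>n. Ys3 n x) \<longlonglongrightarrow> Y3 x"
    using sk[OF rd(3) ch(3)] by blast
  interpret O1: prob_space \<Omega>1 by fact
  interpret O2: prob_space \<Omega>2 by fact
  interpret O3: prob_space \<Omega>3 by fact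
  interpret P23: pair_prob_space \<Omega>2 \<Omega>3 ..
  interpret P: pair_prob_space \<Omega>1 "\<Omega>2 \<Otimes>\<^sub>M \<Omega>3" ..
  let ?\<Omega> = "\<Omega>1 \<Otimes>\<^sub>M (\<Omega>2 \<Otimes>\<^sub>M \<Omega>3)"
  note [measurable] = 1(2) 1(4) 2(2) 2(4) 3(2) 3(4)
  have [measurable]: "f \<in> borel_measurable borel" using f(1) by (rule borel_measurable_continuous_onI)
  have fm: "f \<in> borel_measurable (borel \<Otimes>\<^sub>M (borel \<Otimes>\<^sub>M borel))" by (simp add: borel_prod)
  \<comment> \<open>A product of image measures is the image of the product measure, so the three
    separate representations combine on the product space.\<close>
  have rep: "integral\<^sup>L (distr \<Omega>1 borel a \<Otimes>\<^sub>M (distr \<Omega>2 borel b \<Otimes>\<^sub>M distr \<Omega>3 borel c)) f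
      = (\<integral>x. f (a (fst x), b (fst (snd x)), c (snd (snd x))) \<partial>?\<Omega>)"
    if [measurable]: "a \<in> borel_measurable \<Omega>1" "b \<in> borel_measurable \<Omega>2" "c \<in> borel_measurable \<Omega>3" for a b c
  proof -
    have s1: "sigma_finite_measure (distr \<Omega>3 borel c)"
      by (rule prob_space_imp_sigma_finite) (rule O3.prob_space_distr, simp)
    have e1: "distr \<Omega>2 borel b \<Otimes>\<^sub>M distr \<Omega>3 borel c = distr (\<Omega>2 \<Otimes>\<^sub>M \<Omega>3) (borel \<Otimes>\<^sub>M borel) (\<lambda>(x, y). (b x, c y))"
      by (rule pair_measure_distr[OF _ _ s1]) simp_all
    have s2: "sigma_finite_measure (distr (\<Omega>2 \<Otimes>\<^sub>M \<Omega>3) (borel \<Otimes>\<^sub>M borel) (\<lambda>(x, y). (b x, c y)))"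
      by (rule prob_space_imp_sigma_finite) (rule P23.prob_space_distr, simp)
    have e2: "distr \<Omega>1 borel a \<Otimes>\<^sub>M distr (\<Omega>2 \<Otimes>\<^sub>M \<Omega>3) (borel \<Otimes>\<^sub>M borel) (\<lambda>(x, y). (b x, c y))
        = distr ?\<Omega> (borel \<Otimes>\<^sub>M (borel \<Otimes>\<^sub>M borel)) (\<lambda>(x, y). (a x, (\<lambda>(x, y). (b x, c y)) y))"
      by (rule pair_measure_distr[OF _ _ s2]) simp_all
    show ?thesis unfolding e1 e2
      by (subst integral_distr[OF _ fm]) (auto simp: case_prod_beta)
  qed
  obtain B where B: "\<And>x. \<bar>f x\<bar> \<le> B" using f(2) by (auto simp: bounded_iff)
  have "(\<lambda>n. \<integral>x. f (Ys1 n (fst x), Ys2 n (fst (snd x)), Ys3 n (snd (snd x))) \<partial>?\<Omega>)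
      \<longlonglongrightarrow> (\<integral>x. f (Y1 (fst x), Y2 (fst (snd x)), Y3 (snd (snd x))) \<partial>?\<Omega>)"
  proof (rule integral_dominated_convergence[where w="\<lambda>_. B"])
    show "AE x in ?\<Omega>. (\<lambda>n. f (Ys1 n (fst x), Ys2 n (fst (snd x)), Ys3 n (snd (snd x)))) \<longlonglongrightarrow> f (Y1 (fst x), Y2 (fst (snd x)), Y3 (snd (snd x)))"
    proof (rule AE_I2)
      fix x assume "x \<in> space ?\<Omega>"
      then have "fst x \<in> space \<Omega>1" "fst (snd x) \<in> space \<Omega>2" "snd (snd x) \<in> space \<Omega>3"
        by (auto simp: space_pair_measure)
      then have "(\<lambda>n. (Ys1 n (fst x), Ys2 n (fst (snd x)), Ys3 n (snd (snd x)))) \<longlonglongrightarrow> (Y1 (fst x), Y2 (fst (snd x)), Y3 (snd (snd x)))"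
        using 1(6) 2(6) 3(6) by (intro tendsto_Pair) auto
      moreover have "isCont f y" for y using f(1) continuous_on_eq_continuous_at[OF open_UNIV] by blast
      ultimately show "(\<lambda>n. f (Ys1 n (fst x), Ys2 n (fst (snd x)), Ys3 n (snd (snd x)))) \<longlonglongrightarrow> f (Y1 (fst x), Y2 (fst (snd x)), Y3 (snd (snd x)))"
        using isCont_tendsto_compose by blast
    qed
    show "integrable ?\<Omega> (\<lambda>_. B)" by (rule P.integrable_const)
  qed (use B in auto)
  then show ?thesis
    using rep[OF 1(2) 2(2) 3(2)] rep[OF 1(4) 2(4) 3(4)] by (simp add: 1(3,5) 2(3,5) 3(3,5) N3_def)
qed

lemma conv_ev_independent:
  fixes X1 X2 X3 :: "nat \<Rightarrow> 'a \<Rightarrow> real"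
  assumes M: "\<And>n. prob_space (M n)"
    and ev: "\<forall>\<^sub>F n in sequentially. X1 n \<in> borel_measurable (M n) \<and> X2 n \<in> borel_measurable (M n) \<and> X3 n \<in> borel_measurable (M n) \<and>
      distr (M n) (borel \<Otimes>\<^sub>M (borel \<Otimes>\<^sub>M borel)) (\<lambda>\<omega>. (X1 n \<omega>, X2 n \<omega>, X3 n \<omega>))
        = distr (M n) borel (X1 n) \<Otimes>\<^sub>M (distr (M n) borel (X2 n) \<Otimes>\<^sub>M distr (M n) borel (X3 n))"
    and ch: "\<And>t. (\<lambda>n. char (distr (M n) borel (X1 n)) t) \<longlonglongrightarrow> char N01 t"
      "\<And>t. (\<lambda>n. char (distr (M n) borel (X2 n)) t) \<longlonglongrightarrow> char N01 t"
      "\<And>t. (\<lambda>n. char (distr (M n) borel (X3 n)) t) \<longlonglongrightarrow> char N01 t"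
  shows "conv_ev M (\<lambda>n \<omega>. (X1 n \<omega>, X2 n \<omega>, X3 n \<omega>)) N3"
proof -
  define G where "G n \<longleftrightarrow> X1 n \<in> borel_measurable (M n) \<and> X2 n \<in> borel_measurable (M n) \<and> X3 n \<in> borel_measurable (M n) \<and>
      distr (M n) (borel \<Otimes>\<^sub>M (borel \<Otimes>\<^sub>M borel)) (\<lambda>\<omega>. (X1 n \<omega>, X2 n \<omega>, X3 n \<omega>))
        = distr (M n) borel (X1 n) \<Otimes>\<^sub>M (distr (M n) borel (X2 n) \<Otimes>\<^sub>M distr (M n) borel (X3 n))" for n
  \<comment> \<open>Outside \<open>G n\<close> the variables need not be measurable.
    \<open>N01\<close> is a default real distribution there, so that the product theorem applies to
    the whole sequence.\<close>
  define \<mu> where "\<mu> X n = (if G n then distr (M n) borel (X n) else N01)" for X :: "nat \<Rightarrow> 'a \<Rightarrow> real" and n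
  have G: "\<forall>\<^sub>F n in sequentially. G n" using ev unfolding G_def .
  have rd: "real_distribution (\<mu> X n)" if "G n \<Longrightarrow> X n \<in> borel_measurable (M n)" for X n
    using that prob_space.real_distribution_distr[OF M[of n], of "X n"] by (simp add: \<mu>_def)
  have c: "(\<lambda>n. char (\<mu> X n) t) \<longlonglongrightarrow> char N01 t" if "(\<lambda>n. char (distr (M n) borel (X n)) t) \<longlonglongrightarrow> char N01 t" for X t
    using that by (rule Lim_transform_eventually) (use G in \<open>auto elim!: eventually_mono simp: \<mu>_def\<close>)
  show ?thesis unfolding conv_ev_def
  proof (intro conjI allI impI)
    show "\<forall>\<^sub>F n in sequentially. (\<lambda>\<omega>. (X1 n \<omega>, X2 n \<omega>, X3 n \<omega>)) \<in> borel_measurable (M n)"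
      using ev by eventually_elim (auto intro: borel_measurable_Pair)
    fix f :: "real \<times> real \<times> real \<Rightarrow> real" assume f: "continuous_on UNIV f" "bounded (range f)"
    have fm: "f \<in> borel_measurable (borel \<Otimes>\<^sub>M (borel \<Otimes>\<^sub>M borel))"
      using borel_measurable_continuous_onI[OF f(1)] by (simp add: borel_prod)
    have "(\<lambda>n. integral\<^sup>L (\<mu> X1 n \<Otimes>\<^sub>M (\<mu> X2 n \<Otimes>\<^sub>M \<mu> X3 n)) f) \<longlonglongrightarrow> integral\<^sup>L N3 f"
      by (rule product_weak_convergence[OF _ _ _ _ _ _ f]) (auto intro!: rd c ch simp: G_def)
    then show "(\<lambda>n. integral\<^sup>L (M n) (\<lambda>\<omega>. f (X1 n \<omega>, X2 n \<omega>, X3 n \<omega>))) \<longlonglongrightarrow> integral\<^sup>L N3 f"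
    proof (rule Lim_transform_eventually)
      show "\<forall>\<^sub>F n in sequentially. integral\<^sup>L (\<mu> X1 n \<Otimes>\<^sub>M (\<mu> X2 n \<Otimes>\<^sub>M \<mu> X3 n)) f = integral\<^sup>L (M n) (\<lambda>\<omega>. f (X1 n \<omega>, X2 n \<omega>, X3 n \<omega>))"
        using G
      proof eventually_elim
        case (elim n)
        then have [measurable]: "X1 n \<in> borel_measurable (M n)" "X2 n \<in> borel_measurable (M n)" "X3 n \<in> borel_measurable (M n)"
          by (auto simp: G_def)
        have "integral\<^sup>L (\<mu> X1 n \<Otimes>\<^sub>M (\<mu> X2 n \<Otimes>\<^sub>M \<mu> X3 n)) f
          = integral\<^sup>L (distr (M n) (borel \<Otimes>\<^sub>M (borel \<Otimes>\<^sub>M borel)) (\<lambda>\<omega>. (X1 n \<omega>, X2 n \<omega>, X3 n \<omega>))) f"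
          using elim by (simp add: \<mu>_def G_def)
        also have "\<dots> = integral\<^sup>L (M n) (\<lambda>\<omega>. f (X1 n \<omega>, X2 n \<omega>, X3 n \<omega>))"
          by (rule integral_distr[OF _ fm]) simp
        finally show ?case .
      qed
    qed
  qed
qed

section \<open>Characteristic functions of mixtures of normal and chi-square variables\<close>

definition chi2_law :: "real measure" where
  "chi2_law = distr N01 borel (\<lambda>x. x\<^sup>2 - 1)"

lemma exp_neg_quadratic:
  fixes x :: real assumes "0 \<le> x" shows "\<bar>exp (- x) - (1 - x)\<bar> \<le> x\<^sup>2"
proof -
  have "1 - x \<le> exp (- x)" using exp_ge_add_one_self[of "- x"] by simp
  moreover have "exp (- x) \<le> 1 - x + x\<^sup>2"
  proof -
    have e: "1 + x + x\<^sup>2 / 2 \<le> exp x" by (rule exp_lower_Taylor_quadratic[OF assms])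
    have p: "0 \<le> 1 - x + x\<^sup>2"
    proof -
      have "0 \<le> (x - 1/2)\<^sup>2 + 3/4" by simp
      then show ?thesis by (simp add: power2_eq_square algebra_simps)
    qed
    \<comment> \<open>The excess over 1 is (x^2 + x^3 + x^4)/2, nonnegative here. Combined with the
      Taylor bound for exp x it gives the upper bound for exp (- x).\<close>
    have "1 \<le> (1 - x + x\<^sup>2) * (1 + x + x\<^sup>2 / 2)"
    proof -
      have "(1 - x + x\<^sup>2) * (1 + x + x\<^sup>2 / 2) = 1 + x\<^sup>2 / 2 + x^3 / 2 + x^4 / 2"
        by (simp add: power2_eq_square power3_eq_cube power4_eq_xxxx algebra_simps) (simp add: field_simps)
      then show ?thesis using assms by simp
    qed
    also have "\<dots> \<le> (1 - x + x\<^sup>2) * exp x" by (rule mult_left_mono[OF e p])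
    finally show ?thesis by (simp add: exp_minus field_simps)
  qed
  ultimately show ?thesis by (simp add: abs_if)
qed

text \<open>A centred squared normal has mean 0, variance 2 and a finite third absolute moment C, so
  its characteristic function is 1 - h^2 up to C |h|^3 / 6; exchanging 1 - h^2 for exp (- h^2) adds
  h^4. Cubic accuracy lets about d such factors, at h of order 1/sqrt d, converge.\<close>

lemma chi2_char_bound:
  obtains K where "0 \<le> K" "\<And>h. cmod (char chi2_law h - complex_of_real (exp (- h\<^sup>2))) \<le> K * \<bar>h\<bar>^3 + h^4"
proof
  interpret N: prob_space N01 by simp
  define C where "C = (LINT x|N01. \<bar>x\<^sup>2 - 1\<bar> ^ 3)"
  have i2: "integrable N01 (\<lambda>x. x\<^sup>2)" and i4: "integrable N01 (\<lambda>x. x^4)" and i6: "integrable N01 (\<lambda>x. x^6)"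
    by (rule N01_moment)+
  have iC: "integrable N01 (\<lambda>x. \<bar>x\<^sup>2 - 1\<bar> ^ 3)"
  proof (rule Bochner_Integration.integrable_bound)
    show "integrable N01 (\<lambda>x. 4 * (x ^ 6 + 1))" using i6 by simp
    have "\<bar>x\<^sup>2 - 1\<bar> ^ 3 \<le> 4 * (x ^ 6 + 1)" for x :: real
    proof -
      have a: "\<bar>x\<^sup>2 - 1\<bar> \<le> x\<^sup>2 + 1" using zero_le_power2[of x] unfolding abs_le_iff by linarith
      have "\<bar>x\<^sup>2 - 1\<bar> ^ 3 \<le> (x\<^sup>2 + 1) ^ 3" by (rule power_mono[OF a]) simp
      also have "\<dots> \<le> 4 * ((x\<^sup>2) ^ 3 + 1)"
      proof -
        \<comment> \<open>Convexity of the cube for nonnegative y, as an explicit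
          factorization.\<close>
        have "4 * (y ^ 3 + 1) - (y + 1) ^ 3 = 3 * (y + 1) * (y - 1)\<^sup>2" for y :: real
          by (simp add: power2_eq_square power3_eq_cube algebra_simps)
        moreover have "0 \<le> 3 * (x\<^sup>2 + 1) * (x\<^sup>2 - 1)\<^sup>2" by simp
        ultimately show ?thesis by (metis diff_ge_0_iff_ge)
      qed
      finally show ?thesis by (simp flip: power_mult)
    qed
    then show "AE x in N01. norm (\<bar>x\<^sup>2 - 1\<bar> ^ 3) \<le> norm (4 * (x ^ 6 + 1))"
      by (intro AE_I2) (simp add: abs_mult)
  qed simp
  have iX: "integrable N01 (\<lambda>x. x\<^sup>2 - 1)" using i2 by simp
  have sq: "(x\<^sup>2 - 1)\<^sup>2 = x^4 - 2 * x\<^sup>2 + 1" for x :: real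
    by (simp add: power2_eq_square power4_eq_xxxx algebra_simps)
  have iX2: "integrable N01 (\<lambda>x. (x\<^sup>2 - 1)\<^sup>2)" unfolding sq using i2 i4 by simp
  have EX: "(LINT x|N01. x\<^sup>2 - 1) = 0" using i2 N01_moment(4) N.prob_space by simp
  have VX: "(LINT x|N01. (x\<^sup>2 - 1 - (LINT x|N01. x\<^sup>2 - 1))\<^sup>2) = 2"
    unfolding EX diff_zero sq using i2 i4 N01_moment(4,5) N.prob_space by simp
  have C0: "0 \<le> C" unfolding C_def by (intro integral_nonneg_AE AE_I2) simp
  then show "0 \<le> C / 6" by simp
  fix h :: real
  have "cmod (char chi2_law h - complex_of_real (1 - h\<^sup>2 * 2 / 2))
      \<le> h\<^sup>2 / 6 * (LINT x|N01. min (6 * (x\<^sup>2 - 1)\<^sup>2) (\<bar>h\<bar> * \<bar>x\<^sup>2 - 1\<bar> ^ 3))"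
    by (rule N.char_approx3'[OF _ iX iX2 EX VX]) (simp_all add: chi2_law_def)
  also have "\<dots> \<le> h\<^sup>2 / 6 * (LINT x|N01. \<bar>h\<bar> * \<bar>x\<^sup>2 - 1\<bar> ^ 3)"
  proof (intro mult_left_mono integral_mono)
    have m: "integrable N01 (\<lambda>x. \<bar>h\<bar> * \<bar>x\<^sup>2 - 1\<bar> ^ 3)" using iC by simp
    then show "integrable N01 (\<lambda>x. \<bar>h\<bar> * \<bar>x\<^sup>2 - 1\<bar> ^ 3)" .
    show "integrable N01 (\<lambda>x. min (6 * (x\<^sup>2 - 1)\<^sup>2) (\<bar>h\<bar> * \<bar>x\<^sup>2 - 1\<bar> ^ 3))"
      by (rule Bochner_Integration.integrable_bound[OF m]) (auto intro!: AE_I2)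
  qed auto
  also have "\<dots> = C / 6 * \<bar>h\<bar> ^ 3"
    using iC by (simp add: C_def power3_eq_cube power2_eq_square abs_mult_self_eq)
  finally have 1: "cmod (char chi2_law h - complex_of_real (1 - h\<^sup>2)) \<le> C / 6 * \<bar>h\<bar> ^ 3" by simp
  have "cmod (complex_of_real (1 - h\<^sup>2) - complex_of_real (exp (- h\<^sup>2))) = \<bar>exp (- h\<^sup>2) - (1 - h\<^sup>2)\<bar>"
    by (simp only: of_real_diff[symmetric] norm_of_real abs_minus_commute)
  also have "\<dots> \<le> (h\<^sup>2)\<^sup>2" by (rule exp_neg_quadratic) simp
  also have "\<dots> = h^4" by simp
  finally have 2: "cmod (complex_of_real (1 - h\<^sup>2) - complex_of_real (exp (- h\<^sup>2))) \<le> h^4" .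
  show "cmod (char chi2_law h - complex_of_real (exp (- h\<^sup>2))) \<le> C / 6 * \<bar>h\<bar>^3 + h^4"
    using norm_triangle_ineq[of "char chi2_law h - complex_of_real (1 - h\<^sup>2)" "complex_of_real (1 - h\<^sup>2) - complex_of_real (exp (- h\<^sup>2))"] 1 2
    by simp
qed

text \<open>Independence factorizes the characteristic function into one normal factor from
  \<open>j0\<close> and equal factors from the centred squares.\<close>

lemma iid_N01_mixed_char:
  assumes X: "iid_N01 M I X" and J: "finite J" "insert j0 J \<subseteq> I" "j0 \<notin> J"
  shows "char (distr M borel (\<lambda>\<omega>. c * X j0 \<omega> - a * (\<Sum>j\<in>J. (X j \<omega>)\<^sup>2 - 1))) t
    = complex_of_real (exp (- (t * c)\<^sup>2 / 2)) * char chi2_law (- a * t) ^ card J"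
proof -
  interpret prob_space M using X by (simp add: iid_N01_def)
  define Z where "Z j \<omega> = (if j = j0 then c * X j \<omega> else - a * ((X j \<omega>)\<^sup>2 - 1))" for j \<omega>
  have X': "iid_N01 M (insert j0 J) X" by (rule iid_N01_subset[OF X J(2)])
  have ind: "indep_vars (\<lambda>_. borel) (\<lambda>j \<omega>. (if j = j0 then (\<lambda>x. c * x) else (\<lambda>x. - a * (x\<^sup>2 - 1))) (X j \<omega>)) (insert j0 J)"
    by (rule indep_vars_compose2[of "\<lambda>_. borel"]) (use X' in \<open>auto simp: iid_N01_def\<close>)
  have Zeq: "(\<lambda>j \<omega>. (if j = j0 then (\<lambda>x. c * x) else (\<lambda>x. - a * (x\<^sup>2 - 1))) (X j \<omega>)) = Z"
    by (auto simp: Z_def fun_eq_iff)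
  have "(\<lambda>\<omega>. c * X j0 \<omega> - a * (\<Sum>j\<in>J. (X j \<omega>)\<^sup>2 - 1)) = (\<lambda>\<omega>. \<Sum>j\<in>insert j0 J. Z j \<omega>)"
  proof
    fix \<omega>
    have "(\<Sum>j\<in>J. Z j \<omega>) = (\<Sum>j\<in>J. - a * ((X j \<omega>)\<^sup>2 - 1))"
      by (rule sum.cong) (use J(3) in \<open>auto simp: Z_def\<close>)
    also have "\<dots> = - a * (\<Sum>j\<in>J. (X j \<omega>)\<^sup>2 - 1)" by (simp only: sum_distrib_left)
    finally show "c * X j0 \<omega> - a * (\<Sum>j\<in>J. (X j \<omega>)\<^sup>2 - 1) = (\<Sum>j\<in>insert j0 J. Z j \<omega>)"
      using J by (simp add: Z_def)
  qed
  then have "char (distr M borel (\<lambda>\<omega>. c * X j0 \<omega> - a * (\<Sum>j\<in>J. (X j \<omega>)\<^sup>2 - 1))) t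
      = (\<Prod>j\<in>insert j0 J. char (distr M borel (Z j)) t)"
    using char_distr_sum[OF ind[unfolded Zeq]] by simp
  also have "\<dots> = char (distr M borel (Z j0)) t * (\<Prod>j\<in>J. char (distr M borel (Z j)) t)" using J by simp
  also have "char (distr M borel (Z j0)) t = complex_of_real (exp (- (t * c)\<^sup>2 / 2))"
  proof -
    have m: "X j0 \<in> borel_measurable M" using iid_N01_measurable[OF X'] by simp
    have "char (distr M borel (Z j0)) t = (CLINT \<omega>|M. iexp (t * Z j0 \<omega>))"
      unfolding char_def by (rule integral_distr) (use m in \<open>simp_all add: Z_def[abs_def]\<close>)
    also have "\<dots> = (CLINT x|N01. iexp ((t * c) * x))"
      using iid_N01_integral(1)[OF X', of j0 "\<lambda>x. iexp ((t * c) * x)"] by (simp add: Z_def mult.assoc)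
    also have "\<dots> = char N01 (t * c)" by (simp add: char_def)
    finally show ?thesis by (simp add: char_N01)
  qed
  also have "(\<Prod>j\<in>J. char (distr M borel (Z j)) t) = (\<Prod>j\<in>J. char chi2_law (- a * t))"
  proof (rule prod.cong[OF refl])
    fix j assume j: "j \<in> J"
    have m: "X j \<in> borel_measurable M" using iid_N01_measurable[OF X'] j by simp
    have ne: "j \<noteq> j0" using j J(3) by auto
    have "char (distr M borel (Z j)) t = (CLINT \<omega>|M. iexp (t * Z j \<omega>))"
      unfolding char_def by (rule integral_distr) (use m ne in \<open>simp_all add: Z_def[abs_def]\<close>)
    also have "\<dots> = (CLINT \<omega>|M. iexp ((- a * t) * ((X j \<omega>)\<^sup>2 - 1)))" using ne by (simp add: Z_def mult_ac)
    also have "\<dots> = (CLINT x|N01. iexp ((- a * t) * (x\<^sup>2 - 1)))"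
      using j by (intro iid_N01_integral(1)[OF X', of j "\<lambda>x. iexp ((- a * t) * (x\<^sup>2 - 1))"]) auto
    also have "\<dots> = char chi2_law (- a * t)"
      unfolding char_def chi2_law_def by (rule integral_distr[symmetric]) simp_all
    finally show "char (distr M borel (Z j)) t = char chi2_law (- a * t)" .
  qed
  finally show ?thesis by simp
qed

lemma abs_exp_neg_diff:
  fixes x y :: real assumes "0 \<le> x" "0 \<le> y" shows "\<bar>exp (- x) - exp (- y)\<bar> \<le> \<bar>x - y\<bar>"
proof -
  have *: "exp (- x) - exp (- y) \<le> y - x" if "0 \<le> x" "x \<le> y" for x y :: real
  proof -
    have "exp (- x) - exp (- y) = exp (- x) * (1 - exp (- (y - x)))"
      by (simp add: algebra_simps flip: exp_add)
    also have "\<dots> \<le> 1 * (1 - exp (- (y - x)))"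
      using that by (intro mult_right_mono) auto
    also have "\<dots> = 1 - exp (- (y - x))" by simp
    also have "\<dots> \<le> y - x" using exp_ge_add_one_self[of "- (y - x)"] by linarith
    finally show ?thesis .
  qed
  show ?thesis
  proof (cases "x \<le> y")
    case True
    have "exp (- y) \<le> exp (- x)" using True by simp
    then show ?thesis using *[OF assms(1) True] by linarith
  next
    case False
    have "exp (- x) \<le> exp (- y)" using False by simp
    then show ?thesis using *[OF assms(2), of x] False by linarith
  qed
qed

text \<open>The summand \<open>c\<close> need not be small, so this is not a Lindeberg situation; only the chi-square part
  is replaced by its Gaussian limit.\<close>
lemma mixed_char_bound:
  obtains K where "0 \<le> K" "\<And>(M :: 'a measure) I X j0 J d c a t. iid_N01 M (I :: 'i set) X \<Longrightarrow> finite J \<Longrightarrow> insert j0 J \<subseteq> I \<Longrightarrow> j0 \<notin> J \<Longrightarrow>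
     card J + 2 = d \<Longrightarrow> c\<^sup>2 + a\<^sup>2 = 1 \<Longrightarrow>
     cmod (char (distr M borel (\<lambda>\<omega>. c * X j0 \<omega> - a / sqrt (2 * real d) * (\<Sum>j\<in>J. (X j \<omega>)\<^sup>2 - 1))) t
       - char N01 t) \<le> K * \<bar>t\<bar>^3 / sqrt (real d) + t^4 / real d + t\<^sup>2 / real d"
proof -
  obtain K where K: "0 \<le> K" "\<And>h. cmod (char chi2_law h - complex_of_real (exp (- h\<^sup>2))) \<le> K * \<bar>h\<bar>^3 + h^4"
    using chi2_char_bound by blast
  show thesis
  proof (rule that[of K], rule K(1))
    fix M :: "'a measure" and I :: "'i set" and X j0 J d and c a t :: real
    assume X: "iid_N01 M I X" and J: "finite J" "insert j0 J \<subseteq> I" "j0 \<notin> J" "card J + 2 = d" and ca: "c\<^sup>2 + a\<^sup>2 = 1"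
    define m where "m = card J"
    have d: "real d > 0" "real m \<le> real d" "real d = real m + 2" using J(4) by (auto simp: m_def)
    \<comment> \<open>The frequency seen by a single centred square; it is at most |t| / sqrt
      d.\<close>
    define h where "h = - (a / sqrt (2 * real d)) * t"
    have h2: "h\<^sup>2 = a\<^sup>2 * t\<^sup>2 / (2 * real d)" using d by (simp add: h_def power_mult_distrib power_divide)
    have a1: "a\<^sup>2 \<le> 1" using ca zero_le_power2[of c] by linarith
    then have "\<bar>a\<bar> \<le> 1" by (simp add: abs_square_le_1)
    have habs: "\<bar>h\<bar> \<le> \<bar>t\<bar> / sqrt (real d)"
    proof -
      have "\<bar>h\<bar> = \<bar>a\<bar> * \<bar>t\<bar> / sqrt (2 * real d)" using d by (simp add: h_def abs_mult)
      also have "\<dots> \<le> 1 * \<bar>t\<bar> / sqrt (real d)"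
        using \<open>\<bar>a\<bar> \<le> 1\<close> d by (intro frac_le mult_right_mono) auto
      finally show ?thesis by simp
    qed
    interpret N: prob_space N01 by simp
    interpret c2: real_distribution chi2_law
      unfolding chi2_law_def by (rule N.real_distribution_distr) simp
    let ?f = "char chi2_law h" and ?g = "complex_of_real (exp (- h\<^sup>2))"
    \<comment> \<open>For numbers in the unit disc a difference of m-th powers is at most m times
      the difference of the bases.\<close>
    have "cmod (?f ^ m - ?g ^ m) \<le> real m * cmod (?f - ?g)"
      by (rule norm_power_diff) (use c2.cmod_char_le_1 in auto)
    also have "\<dots> \<le> real d * (K * \<bar>h\<bar>^3 + h^4)"
      using K d by (intro mult_mono) auto
    also have "\<dots> \<le> real d * (K * (\<bar>t\<bar> / sqrt (real d))^3 + (\<bar>t\<bar> / sqrt (real d))^4)"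
    proof -
      have "\<bar>h\<bar> ^ 3 \<le> (\<bar>t\<bar> / sqrt (real d)) ^ 3" "\<bar>h\<bar> ^ 4 \<le> (\<bar>t\<bar> / sqrt (real d)) ^ 4"
        by (rule power_mono[OF habs], simp)+
      then show ?thesis using K(1) d by (intro mult_left_mono add_mono) simp_all
    qed
    also have "\<dots> = K * \<bar>t\<bar>^3 / sqrt (real d) + t^4 / real d"
    proof -
      define r where "r = sqrt (real d)"
      have r: "r > 0" "real d = r * r" using d by (auto simp: r_def)
      show ?thesis using r by (simp add: power_divide power3_eq_cube power4_eq_xxxx field_simps flip: r_def)
    qed
    finally have 1: "cmod (?f ^ m - ?g ^ m) \<le> K * \<bar>t\<bar>^3 / sqrt (real d) + t^4 / real d" .
    let ?e = "exp (- (t * c)\<^sup>2 / 2)"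
    have eq: "char (distr M borel (\<lambda>\<omega>. c * X j0 \<omega> - a / sqrt (2 * real d) * (\<Sum>j\<in>J. (X j \<omega>)\<^sup>2 - 1))) t
        = complex_of_real ?e * ?f ^ m"
      using iid_N01_mixed_char[OF X J(1-3), of c "a / sqrt (2 * real d)" t] by (simp add: h_def m_def)
    have g: "complex_of_real ?e * ?g ^ m = complex_of_real (exp (- (c\<^sup>2 * t\<^sup>2 / 2 + real m * h\<^sup>2)))"
    proof -
      have "exp (- h\<^sup>2) ^ m = exp (- (real m * h\<^sup>2))" by (simp flip: exp_of_nat_mult)
      then have "?e * exp (- h\<^sup>2) ^ m = exp (- (c\<^sup>2 * t\<^sup>2 / 2 + real m * h\<^sup>2))"
        by (simp add: power_mult_distrib mult.commute flip: exp_add)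
      then show ?thesis by (metis of_real_mult of_real_power)
    qed
    have "cmod (complex_of_real ?e * ?f ^ m - complex_of_real ?e * ?g ^ m) = ?e * cmod (?f ^ m - ?g ^ m)"
      by (simp flip: right_diff_distrib add: norm_mult)
    also have "\<dots> \<le> 1 * cmod (?f ^ m - ?g ^ m)" by (intro mult_right_mono) auto
    finally have 2: "cmod (complex_of_real ?e * ?f ^ m - complex_of_real ?e * ?g ^ m) \<le> K * \<bar>t\<bar>^3 / sqrt (real d) + t^4 / real d"
      using 1 by linarith
    have "cmod (complex_of_real ?e * ?g ^ m - char N01 t) = \<bar>exp (- (c\<^sup>2 * t\<^sup>2 / 2 + real m * h\<^sup>2)) - exp (- (t\<^sup>2 / 2))\<bar>"
      unfolding g char_N01 by (simp only: of_real_diff[symmetric] norm_of_real) simp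
    also have "\<dots> \<le> \<bar>(c\<^sup>2 * t\<^sup>2 / 2 + real m * h\<^sup>2) - t\<^sup>2 / 2\<bar>" by (rule abs_exp_neg_diff) auto
    \<comment> \<open>There are d - 2 squares but they are normalized by d; the two missing ones
      leave exactly a^2 t^2 / d.\<close>
    also have "(c\<^sup>2 * t\<^sup>2 / 2 + real m * h\<^sup>2) - t\<^sup>2 / 2 = - (a\<^sup>2 * t\<^sup>2 / real d)"
    proof -
      have c2: "c\<^sup>2 = 1 - a\<^sup>2" using ca by simp
      show ?thesis unfolding h2 c2 using d(1) by (simp add: field_simps d(3))
    qed
    also have "\<bar>- (a\<^sup>2 * t\<^sup>2 / real d)\<bar> \<le> t\<^sup>2 / real d"
      using a1 d(1) mult_right_mono[OF a1, of "t\<^sup>2"] by (simp add: divide_right_mono)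
    finally have 3: "cmod (complex_of_real ?e * ?g ^ m - char N01 t) \<le> t\<^sup>2 / real d" .
    show "cmod (char (distr M borel (\<lambda>\<omega>. c * X j0 \<omega> - a / sqrt (2 * real d) * (\<Sum>j\<in>J. (X j \<omega>)\<^sup>2 - 1))) t
       - char N01 t) \<le> K * \<bar>t\<bar>^3 / sqrt (real d) + t^4 / real d + t\<^sup>2 / real d"
      unfolding eq
      using norm_triangle_ineq[of "complex_of_real ?e * ?f ^ m - complex_of_real ?e * ?g ^ m" "complex_of_real ?e * ?g ^ m - char N01 t"] 2 3
      by simp
  qed
qed

text \<open>Independence is used twice, for block 1 against the union of the others and for block 2
  against block 3, to match the nested product underlying \<open>N3\<close>. Each function sees only
  the restriction to its own block.\<close>

lemma indep_blocks_product:
  assumes X: "iid_N01 M I X" and K: "K1 \<subseteq> I" "K2 \<subseteq> I" "K3 \<subseteq> I" "K1 \<inter> K2 = {}" "K1 \<inter> K3 = {}" "K2 \<inter> K3 = {}"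
    and g: "g1 \<in> borel_measurable (PiM K1 (\<lambda>_. borel))" "g2 \<in> borel_measurable (PiM K2 (\<lambda>_. borel))"
      "g3 \<in> borel_measurable (PiM K3 (\<lambda>_. borel))"
  defines "Y1 \<equiv> \<lambda>\<omega>. g1 (restrict (\<lambda>i. X i \<omega>) K1) :: real" and "Y2 \<equiv> \<lambda>\<omega>. g2 (restrict (\<lambda>i. X i \<omega>) K2) :: real"
    and "Y3 \<equiv> \<lambda>\<omega>. g3 (restrict (\<lambda>i. X i \<omega>) K3) :: real"
  shows "Y1 \<in> borel_measurable M" "Y2 \<in> borel_measurable M" "Y3 \<in> borel_measurable M"
    "distr M (borel \<Otimes>\<^sub>M (borel \<Otimes>\<^sub>M borel)) (\<lambda>\<omega>. (Y1 \<omega>, Y2 \<omega>, Y3 \<omega>))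
      = distr M borel Y1 \<Otimes>\<^sub>M (distr M borel Y2 \<Otimes>\<^sub>M distr M borel Y3)"
proof -
  interpret prob_space M using X by (simp add: iid_N01_def)
  have ind: "indep_vars (\<lambda>_. borel) X I" using X by (simp add: iid_N01_def)
  have Xm: "X i \<in> borel_measurable M" if "i \<in> I" for i using iid_N01_measurable[OF X that] .
  have r: "(\<lambda>\<omega>. restrict (\<lambda>i. X i \<omega>) K) \<in> measurable M (PiM K (\<lambda>_. borel))" if "K \<subseteq> I" for K
    using that Xm by (intro measurable_restrict) auto
  show m: "Y1 \<in> borel_measurable M" "Y2 \<in> borel_measurable M" "Y3 \<in> borel_measurable M"
    unfolding Y1_def Y2_def Y3_def
    by (rule measurable_compose[OF r g(1)] measurable_compose[OF r g(2)] measurable_compose[OF r g(3)], rule K)+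
  define G where "G x = (g2 (restrict x K2), g3 (restrict x K3))" for x
  have G: "G \<in> measurable (PiM (K2 \<union> K3) (\<lambda>_. borel)) (borel \<Otimes>\<^sub>M borel)"
    unfolding G_def
    by (intro measurable_Pair measurable_compose[OF measurable_restrict_subset g(2)] measurable_compose[OF measurable_restrict_subset g(3)]) auto
  have i23: "indep_var (PiM K2 (\<lambda>_. borel)) (\<lambda>\<omega>. restrict (\<lambda>i. X i \<omega>) K2) (PiM K3 (\<lambda>_. borel)) (\<lambda>\<omega>. restrict (\<lambda>i. X i \<omega>) K3)"
    by (rule indep_var_restrict[OF ind]) (use K in auto)
  have "indep_var borel (g2 \<circ> (\<lambda>\<omega>. restrict (\<lambda>i. X i \<omega>) K2)) borel (g3 \<circ> (\<lambda>\<omega>. restrict (\<lambda>i. X i \<omega>) K3))"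
    by (rule indep_var_compose[OF i23 g(2,3)])
  then have e23: "distr M borel Y2 \<Otimes>\<^sub>M distr M borel Y3 = distr M (borel \<Otimes>\<^sub>M borel) (\<lambda>\<omega>. (Y2 \<omega>, Y3 \<omega>))"
    unfolding indep_var_distribution_eq by (simp add: Y2_def Y3_def comp_def)
  have i1: "indep_var (PiM K1 (\<lambda>_. borel)) (\<lambda>\<omega>. restrict (\<lambda>i. X i \<omega>) K1) (PiM (K2 \<union> K3) (\<lambda>_. borel)) (\<lambda>\<omega>. restrict (\<lambda>i. X i \<omega>) (K2 \<union> K3))"
    by (rule indep_var_restrict[OF ind]) (use K in auto)
  define P1 where "P1 = distr M (PiM K1 (\<lambda>_. borel)) (\<lambda>\<omega>. restrict (\<lambda>i. X i \<omega>) K1)"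
  define P23 where "P23 = distr M (PiM (K2 \<union> K3) (\<lambda>_. borel)) (\<lambda>\<omega>. restrict (\<lambda>i. X i \<omega>) (K2 \<union> K3))"
  have r1: "(\<lambda>\<omega>. restrict (\<lambda>i. X i \<omega>) K1) \<in> measurable M (PiM K1 (\<lambda>_. borel))"
    and r23: "(\<lambda>\<omega>. restrict (\<lambda>i. X i \<omega>) (K2 \<union> K3)) \<in> measurable M (PiM (K2 \<union> K3) (\<lambda>_. borel))"
    by (rule r, use K in blast)+
  have GY: "(\<lambda>\<omega>. G (restrict (\<lambda>i. X i \<omega>) (K2 \<union> K3))) = (\<lambda>\<omega>. (Y2 \<omega>, Y3 \<omega>))"
    by (auto simp: G_def Y2_def Y3_def fun_eq_iff Int_absorb1)
  have D1: "distr M borel Y1 = distr P1 borel g1"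
    unfolding P1_def by (subst distr_distr[OF g(1) r1]) (simp add: Y1_def comp_def)
  have D2: "distr M (borel \<Otimes>\<^sub>M borel) (\<lambda>\<omega>. (Y2 \<omega>, Y3 \<omega>)) = distr P23 (borel \<Otimes>\<^sub>M borel) G"
    unfolding P23_def by (subst distr_distr[OF G r23]) (simp add: comp_def GY)
  have g1': "g1 \<in> borel_measurable P1" and G': "G \<in> measurable P23 (borel \<Otimes>\<^sub>M borel)"
    using g(1) G by (simp_all add: P1_def P23_def)
  interpret P23: prob_space P23 unfolding P23_def by (rule prob_space_distr[OF r23])
  have sf: "sigma_finite_measure (distr P23 (borel \<Otimes>\<^sub>M borel) G)"
    by (rule prob_space_imp_sigma_finite) (rule P23.prob_space_distr[OF G'])
  have "distr M borel Y1 \<Otimes>\<^sub>M distr M (borel \<Otimes>\<^sub>M borel) (\<lambda>\<omega>. (Y2 \<omega>, Y3 \<omega>))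
      = distr (P1 \<Otimes>\<^sub>M P23) (borel \<Otimes>\<^sub>M (borel \<Otimes>\<^sub>M borel)) (\<lambda>(x, y). (g1 x, G y))"
    unfolding D1 D2 by (rule pair_measure_distr[OF g1' G' sf])
  also have "P1 \<Otimes>\<^sub>M P23 = distr M (PiM K1 (\<lambda>_. borel) \<Otimes>\<^sub>M PiM (K2 \<union> K3) (\<lambda>_. borel))
      (\<lambda>\<omega>. (restrict (\<lambda>i. X i \<omega>) K1, restrict (\<lambda>i. X i \<omega>) (K2 \<union> K3)))"
    using i1 unfolding indep_var_distribution_eq P1_def P23_def by blast
  also have "distr \<dots> (borel \<Otimes>\<^sub>M (borel \<Otimes>\<^sub>M borel)) (\<lambda>(x, y). (g1 x, G y))
      = distr M (borel \<Otimes>\<^sub>M (borel \<Otimes>\<^sub>M borel)) ((\<lambda>(x, y). (g1 x, G y)) \<circ> (\<lambda>\<omega>. (restrict (\<lambda>i. X i \<omega>) K1, restrict (\<lambda>i. X i \<omega>) (K2 \<union> K3))))"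
  proof (rule distr_distr)
    note [measurable] = g(1) G
    show "(\<lambda>(x, y). (g1 x, G y)) \<in> PiM K1 (\<lambda>_. borel) \<Otimes>\<^sub>M PiM (K2 \<union> K3) (\<lambda>_. borel) \<rightarrow>\<^sub>M borel \<Otimes>\<^sub>M (borel \<Otimes>\<^sub>M borel)"
      by measurable
  qed (rule measurable_Pair[OF r1 r23])
  also have "(\<lambda>(x, y). (g1 x, G y)) \<circ> (\<lambda>\<omega>. (restrict (\<lambda>i. X i \<omega>) K1, restrict (\<lambda>i. X i \<omega>) (K2 \<union> K3)))
      = (\<lambda>\<omega>. (Y1 \<omega>, Y2 \<omega>, Y3 \<omega>))"
    using GY by (auto simp: Y1_def comp_def fun_eq_iff)
  finally have "distr M borel Y1 \<Otimes>\<^sub>M distr M (borel \<Otimes>\<^sub>M borel) (\<lambda>\<omega>. (Y2 \<omega>, Y3 \<omega>))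
      = distr M (borel \<Otimes>\<^sub>M (borel \<Otimes>\<^sub>M borel)) (\<lambda>\<omega>. (Y1 \<omega>, Y2 \<omega>, Y3 \<omega>))" .
  then show "distr M (borel \<Otimes>\<^sub>M (borel \<Otimes>\<^sub>M borel)) (\<lambda>\<omega>. (Y1 \<omega>, Y2 \<omega>, Y3 \<omega>))
      = distr M borel Y1 \<Otimes>\<^sub>M (distr M borel Y2 \<Otimes>\<^sub>M distr M borel Y3)"
    using e23 by simp
qed

section \<open>Gaussian tensors\<close>

definition box :: "nat \<Rightarrow> nat \<Rightarrow> nat \<Rightarrow> (nat \<times> nat \<times> nat) set" where
  "box d1 d2 d3 = {..<d1} \<times> {..<d2} \<times> {..<d3}"

definition tens :: "(nat \<times> nat \<times> nat \<Rightarrow> 'a \<Rightarrow> real) \<Rightarrow> 'a \<Rightarrow> tensor3" where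
  "tens X \<omega> = (\<lambda>i j k. X (i, j, k) \<omega>)"

definition outer :: "vec \<Rightarrow> vec \<Rightarrow> vec \<Rightarrow> nat \<times> nat \<times> nat \<Rightarrow> real" where
  "outer a b c = (\<lambda>(i, j, k). a i * b j * c k)"

lemma finite_box [simp]: "finite (box d1 d2 d3)" by (simp add: box_def)

lemma sum_box: "(\<Sum>x\<in>box d1 d2 d3. F x) = (\<Sum>i<d1. \<Sum>j<d2. \<Sum>k<d3. F (i, j, k))"
  by (simp add: box_def sum.cartesian_product split_def)

lemma lam_hat_tens: "lam_hat d1 d2 d3 (tens X \<omega>) a b c = (\<Sum>x\<in>box d1 d2 d3. outer a b c x * X x \<omega>)"
  by (simp add: sum_box lam_hat_def tens_def outer_def mult_ac)

lemma outer_inner: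
  "(\<Sum>x\<in>box d1 d2 d3. outer a b c x * outer a' b' c' x) = inner_d d1 a a' * inner_d d2 b b' * inner_d d3 c c'"
proof -
  have "(\<Sum>x\<in>box d1 d2 d3. outer a b c x * outer a' b' c' x)
      = (\<Sum>i<d1. \<Sum>j<d2. \<Sum>k<d3. (a i * a' i) * ((b j * b' j) * (c k * c' k)))"
    by (simp add: sum_box outer_def mult_ac)
  also have "\<dots> = (\<Sum>i<d1. a i * a' i) * ((\<Sum>j<d2. b j * b' j) * (\<Sum>k<d3. c k * c' k))"
    by (simp add: sum_distrib_left[symmetric] sum_distrib_right[symmetric])
  finally show ?thesis by (simp add: inner_d_def)
qed

text \<open>Outer products of orthonormal bases are orthonormal in the tensor space, by
  \<open>outer_inner\<close>; the rest is rotation invariance.\<close>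

lemma iid_N01_rotate:
  assumes X: "iid_N01 M (box d1 d2 d3) X"
    and f: "orthonormal d1 d1 f" "orthonormal d2 d2 g" "orthonormal d3 d3 h"
  shows "iid_N01 M (box d1 d2 d3) (\<lambda>(a, b, c) \<omega>. lam_hat d1 d2 d3 (tens X \<omega>) (f a) (g b) (h c))"
proof -
  have "iid_N01 M (box d1 d2 d3) (\<lambda>s \<omega>. \<Sum>x\<in>box d1 d2 d3. (case s of (a, b, c) \<Rightarrow> outer (f a) (g b) (h c)) x * X x \<omega>)"
  proof (rule iid_N01_orthonormal[OF X])
    fix s t assume st: "s \<in> box d1 d2 d3" "t \<in> box d1 d2 d3"
    obtain a b c where s: "s = (a, b, c)" by (cases s)
    obtain a' b' c' where t: "t = (a', b', c')" by (cases t)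
    have "a < d1" "b < d2" "c < d3" "a' < d1" "b' < d2" "c' < d3" using st by (auto simp: s t box_def)
    then show "(\<Sum>i\<in>box d1 d2 d3. (case s of (a, b, c) \<Rightarrow> outer (f a) (g b) (h c)) i * (case t of (a, b, c) \<Rightarrow> outer (f a) (g b) (h c)) i)
       = (if s = t then 1 else 0)"
      using f by (simp add: s t outer_inner orthonormal_def)
  qed simp_all
  moreover have "(\<lambda>s \<omega>. \<Sum>x\<in>box d1 d2 d3. (case s of (a, b, c) \<Rightarrow> outer (f a) (g b) (h c)) x * X x \<omega>)
      = (\<lambda>(a, b, c) \<omega>. lam_hat d1 d2 d3 (tens X \<omega>) (f a) (g b) (h c))"
    by (simp add: fun_eq_iff lam_hat_tens)
  ultimately show ?thesis by simp
qed

lemma iid_N01_cong: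
  assumes "iid_N01 M I X" "\<And>i. i \<in> I \<Longrightarrow> X i = Y i"
  shows "iid_N01 M I Y"
proof -
  interpret prob_space M using assms by (simp add: iid_N01_def)
  have "indep_vars (\<lambda>_. borel) X I \<longleftrightarrow> indep_vars (\<lambda>_. borel) Y I"
    by (rule indep_vars_cong) (simp_all add: assms)
  then show ?thesis using assms by (simp add: iid_N01_def)
qed

lemma sum_box': "(\<Sum>x\<in>box d1 d2 d3. F x) = (\<Sum>i<d1. \<Sum>jk\<in>{..<d2} \<times> {..<d3}. F (i, jk))"
  by (simp add: box_def sum.cartesian_product split_def)

text \<open>Selecting coordinates is a linear map with orthonormal 0-1 rows. It transports the noise
  to tensors with permuted modes, so that one analysis of mode 1 serves all three.\<close>

lemma iid_N01_reindex:
  assumes X: "iid_N01 M I X" and I: "finite I" and J: "finite J" and h: "inj_on h J" "h ` J \<subseteq> I"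
  shows "iid_N01 M J (\<lambda>s. X (h s))"
proof -
  have iid: "iid_N01 M J (\<lambda>s \<omega>. \<Sum>i\<in>I. (if i = h s then 1 else 0) * X i \<omega>)"
  proof (rule iid_N01_orthonormal[OF X I J])
    fix s t assume st: "s \<in> J" "t \<in> J"
    have "(\<Sum>i\<in>I. (if i = h s then 1 else 0) * (if i = h t then 1 else 0)) = (\<Sum>i\<in>I. if i = h s then (if h s = h t then 1 else 0) else (0::real))"
      by (intro sum.cong) auto
    also have "\<dots> = (if s = t then 1 else 0)" using st h I inj_onD[OF h(1)] by auto
    finally show "(\<Sum>i\<in>I. (if i = h s then 1 else 0) * (if i = h t then 1 else 0)) = (if s = t then 1 else (0::real))" .
  qed
  have eq: "(\<Sum>i\<in>I. (if i = h s then 1 else 0) * X i \<omega>) = X (h s) \<omega>" if "s \<in> J" for s \<omega>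
  proof -
    have "(\<Sum>i\<in>I. (if i = h s then 1 else 0) * X i \<omega>) = (\<Sum>i\<in>I. if i = h s then X i \<omega> else 0)"
      by (intro sum.cong) auto
    then show ?thesis using h(2) that I by auto
  qed
  show ?thesis by (rule iid_N01_cong[OF iid]) (simp add: fun_eq_iff eq)
qed

lemma iid_N01_swap12: "iid_N01 M (box d1 d2 d3) X \<Longrightarrow> iid_N01 M (box d2 d1 d3) (\<lambda>(j, i, k). X (i, j, k))"
proof -
  assume X: "iid_N01 M (box d1 d2 d3) X"
  have "iid_N01 M (box d2 d1 d3) (\<lambda>s. X ((\<lambda>(j, i, k). (i, j, k)) s))"
    by (rule iid_N01_reindex[OF X]) (auto simp: box_def inj_on_def)
  then show ?thesis by (simp add: split_def)
qed

lemma iid_N01_rotate_modes: "iid_N01 M (box d1 d2 d3) X \<Longrightarrow> iid_N01 M (box d3 d1 d2) (\<lambda>(k, i, j). X (i, j, k))"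
proof -
  assume X: "iid_N01 M (box d1 d2 d3) X"
  have "iid_N01 M (box d3 d1 d2) (\<lambda>s. X ((\<lambda>(k, i, j). (i, j, k)) s))"
    by (rule iid_N01_reindex[OF X]) (auto simp: box_def inj_on_def)
  then show ?thesis by (simp add: split_def)
qed

section \<open>Uniform noise bounds from lattice points\<close>

lemma power_48_le: "(48::real) ^ d \<le> exp (5 * real d)"
proof -
  have "(5/2::real) \<le> exp 1" using exp_lower_Taylor_quadratic[of 1] by simp
  then have "(5/2::real) ^ 5 \<le> exp 1 ^ 5" by (intro power_mono) auto
  moreover have "exp (1::real) ^ 5 = exp 5" by (simp flip: exp_of_nat_mult)
  moreover have "(48::real) \<le> (5/2) ^ 5" by (simp add: power_divide)
  ultimately have "(48::real) \<le> exp 5" by linarith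
  then have "(48::real) ^ d \<le> exp 5 ^ d" by (intro power_mono) auto
  then show ?thesis by (simp add: mult.commute flip: exp_of_nat_mult)
qed

text \<open>At a lattice triple the form is normal with variance at most 64 D, where D is the
  product of the dimensions. The level 48 sqrt P sqrt D has tail exp (- 18 P), because 48^2 / 128 =
  18. At most 48^(d1 + d2 + d3) \<le> exp (15 P) triples compete, which leaves exp (- 3 P).\<close>

lemma tensor_norm_tail:
  assumes X: "iid_N01 M (box d1 d2 d3) X" and d: "0 < d1" "0 < d2" "0 < d3"
    and P: "real d1 \<le> P" "real d2 \<le> P" "real d3 \<le> P"
  shows "\<exists>A\<in>sets M. measure M A \<le> exp (- 3 * P) \<and> (\<forall>\<omega>\<in>space M - A. tri_bound d1 d2 d3 (tens X \<omega>) (48 * sqrt P))"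
proof -
  interpret prob_space M using X by (simp add: iid_N01_def)
  define D where "D = real (d1 * d2 * d3)"
  have D: "D > 0" using d by (simp add: D_def)
  have P0: "P > 0" using P(1) d(1) by linarith
  define K where "K = 48 * sqrt P * sqrt D"
  have K: "K > 0" using P0 D by (simp add: K_def)
  define L where "L = lattice_ball d1 \<times> lattice_ball d2 \<times> lattice_ball d3"
  define r where "r m = (\<lambda>i. real_of_int (m i))" for m :: "nat \<Rightarrow> int"
  define B where "B x = (case x of (m1, m2, m3) \<Rightarrow> {\<omega>\<in>space M. K \<le> (\<Sum>x\<in>box d1 d2 d3. outer (r m1) (r m2) (r m3) x * X x \<omega>)})" for x
  have Bm: "B x \<in> sets M" for x
  proof -
    obtain m1 m2 m3 where x: "x = (m1, m2, m3)" by (cases x)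
    have [measurable]: "(\<lambda>\<omega>. \<Sum>x\<in>box d1 d2 d3. outer (r m1) (r m2) (r m3) x * X x \<omega>) \<in> borel_measurable M"
      using iid_N01_measurable[OF X] by (intro borel_measurable_sum borel_measurable_times) auto
    show ?thesis unfolding B_def x by simp
  qed
  have fin: "finite L" by (simp add: L_def)
  have Bp: "measure M (B x) \<le> exp (- 18 * P)" if x: "x \<in> L" for x
  proof -
    obtain m1 m2 m3 where m: "x = (m1, m2, m3)" "m1 \<in> lattice_ball d1" "m2 \<in> lattice_ball d2" "m3 \<in> lattice_ball d3"
      using x by (auto simp: L_def)
    have "(\<Sum>x\<in>box d1 d2 d3. (outer (r m1) (r m2) (r m3) x)\<^sup>2) = (vnorm d1 (r m1))\<^sup>2 * (vnorm d2 (r m2))\<^sup>2 * (vnorm d3 (r m3))\<^sup>2"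
      using outer_inner[where a="r m1" and b="r m2" and c="r m3" and a'="r m1" and b'="r m2" and c'="r m3" and ?d1.0=d1 and ?d2.0=d2 and ?d3.0=d3]
      by (simp add: vnorm_square flip: power2_eq_square)
    also have "\<dots> \<le> (4 * real d1) * (4 * real d2) * (4 * real d3)"
      using lattice_ball_vnorm[OF m(2)] lattice_ball_vnorm[OF m(3)] lattice_ball_vnorm[OF m(4)]
      unfolding r_def by (intro mult_mono) auto
    finally have V: "(\<Sum>x\<in>box d1 d2 d3. (outer (r m1) (r m2) (r m3) x)\<^sup>2) \<le> 64 * D" by (simp add: D_def)
    have "measure M (B x) \<le> exp (- K\<^sup>2 / (2 * (64 * D)))"
      unfolding m(1) B_def using iid_N01_linear_tail[OF X finite_box _ V K] D by simp
    also have "K\<^sup>2 = 2304 * P * D" using P0 D by (simp add: K_def power_mult_distrib)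
    also have "- (2304 * P * D) / (2 * (64 * D)) = - 18 * P" using D by simp
    finally show ?thesis .
  qed
  have "real (card L) \<le> 48 ^ (d1 + d2 + d3)"
  proof -
    have "card L \<le> 48 ^ d1 * (48 ^ d2 * 48 ^ d3)"
      unfolding L_def card_cartesian_product by (intro mult_le_mono card_lattice_ball)
    then have "real (card L) \<le> real (48 ^ d1 * (48 ^ d2 * 48 ^ d3))" by (simp only: of_nat_le_iff)
    then show ?thesis by (simp add: power_add)
  qed
  also have "\<dots> \<le> exp (5 * real (d1 + d2 + d3))" by (rule power_48_le)
  also have "\<dots> \<le> exp (15 * P)" using P by simp
  finally have card: "real (card L) \<le> exp (15 * P)" .
  have "measure M (\<Union>x\<in>L. B x) \<le> (\<Sum>x\<in>L. measure M (B x))" by (rule measure_UNION_le[OF fin]) (rule Bm)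
  also have "\<dots> \<le> (\<Sum>x\<in>L. exp (- 18 * P))" by (rule sum_mono) (rule Bp)
  also have "\<dots> = real (card L) * exp (- 18 * P)" by simp
  also have "\<dots> \<le> exp (15 * P) * exp (- 18 * P)" using card by (intro mult_right_mono) auto
  also have "\<dots> = exp (- 3 * P)" by (simp flip: exp_add)
  finally have meas: "measure M (\<Union>x\<in>L. B x) \<le> exp (- 3 * P)" .
  have tb: "tri_bound d1 d2 d3 (tens X \<omega>) (48 * sqrt P)" if w: "\<omega> \<in> space M - (\<Union>x\<in>L. B x)" for \<omega>
  proof -
    have "tri_bound d1 d2 d3 (tens X \<omega>) (K / sqrt (real (d1 * d2 * d3)))"
    proof (rule tri_bound_lattice[OF _ d])
      fix m1 m2 m3 assume "m1 \<in> lattice_ball d1" "m2 \<in> lattice_ball d2" "m3 \<in> lattice_ball d3"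
      then have "\<omega> \<notin> B (m1, m2, m3)" using w by (auto simp: L_def)
      then show "lam_hat d1 d2 d3 (tens X \<omega>) (\<lambda>i. real_of_int (m1 i)) (\<lambda>i. real_of_int (m2 i)) (\<lambda>i. real_of_int (m3 i)) \<le> K"
        using w by (simp add: B_def lam_hat_tens r_def)
    qed (use K in simp)
    moreover have "K / sqrt (real (d1 * d2 * d3)) = 48 * sqrt P"
      unfolding D_def[symmetric] using D by (simp add: K_def)
    ultimately show ?thesis by simp
  qed
  have "(\<Union>x\<in>L. B x) \<in> sets M" using fin Bm by (intro sets.finite_UN) auto
  with meas tb show ?thesis by blast
qed

text \<open>For fixed z the contractions against z over the pairs (j, k) are independent normals of
  variance |z|^2, so the centred form is |z|^2 times a chi-square sum with at most P^2 terms,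
  fluctuating by P^(3/2). Deviation 20 P sqrt P has probability of order exp (- 16 P) per vector,
  against at most exp (10 P) pairs of lattice points.\<close>

lemma covariance_tail:
  assumes X: "iid_N01 M (box d1 d2 d3) X" and d: "0 < d1" "0 < d2" "0 < d3"
    and P: "real d1 \<le> P" "real d2 \<le> P" "real d3 \<le> P" "16 \<le> P"
  shows "\<exists>A\<in>sets M. measure M A \<le> 4 * exp (- 6 * P) \<and> (\<forall>\<omega>\<in>space M - A. \<forall>y. vnorm d1 y = 1 \<longrightarrow>
    \<bar>(\<Sum>j<d2. \<Sum>k<d3. (\<Sum>i<d1. y i * X (i, j, k) \<omega>)\<^sup>2) - real (d2 * d3)\<bar> \<le> 160 * (P * sqrt P))"
proof -
  interpret prob_space M using X by (simp add: iid_N01_def)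
  note Xm = iid_N01_measurable[OF X]
  define N where "N = real (d2 * d3)"
  have P0: "P > 0" using P by linarith
  define H where "H \<omega> i i' = (\<Sum>j<d2. \<Sum>k<d3. X (i, j, k) \<omega> * X (i', j, k) \<omega>) - (if i = i' then N else 0)" for \<omega> i i'
  define Yz where "Yz z jk \<omega> = (\<Sum>i<d1. z i * X (i, jk) \<omega>)" for z :: vec and jk \<omega>
  \<comment> \<open>Subtracting N on the diagonal of the Gram matrix centres the form: what remains
    is a sum of squared contractions minus its mean N |z|^2.\<close>
  have quad_eq: "quad d1 (H \<omega>) z = (\<Sum>jk\<in>{..<d2} \<times> {..<d3}. (Yz z jk \<omega>)\<^sup>2) - N * (vnorm d1 z)\<^sup>2" for z \<omega>
  proof -
    have "(\<Sum>jk\<in>{..<d2} \<times> {..<d3}. (Yz z jk \<omega>)\<^sup>2) = (\<Sum>jk\<in>{..<d2} \<times> {..<d3}. \<Sum>i<d1. \<Sum>i'<d1. z i * z i' * (X (i, jk) \<omega> * X (i', jk) \<omega>))"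
      by (simp add: Yz_def power2_eq_square sum_product mult_ac)
    also have "\<dots> = (\<Sum>i<d1. \<Sum>jk\<in>{..<d2} \<times> {..<d3}. \<Sum>i'<d1. z i * z i' * (X (i, jk) \<omega> * X (i', jk) \<omega>))"
      by (rule sum.swap)
    also have "\<dots> = (\<Sum>i<d1. \<Sum>i'<d1. \<Sum>jk\<in>{..<d2} \<times> {..<d3}. z i * z i' * (X (i, jk) \<omega> * X (i', jk) \<omega>))"
      by (rule sum.cong[OF refl], rule sum.swap)
    also have "\<dots> = (\<Sum>i<d1. \<Sum>i'<d1. z i * z i' * (\<Sum>j<d2. \<Sum>k<d3. X (i, j, k) \<omega> * X (i', j, k) \<omega>))"
      by (simp add: sum.cartesian_product split_def flip: sum_distrib_left)
    finally have 1: "(\<Sum>jk\<in>{..<d2} \<times> {..<d3}. (Yz z jk \<omega>)\<^sup>2)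
       = (\<Sum>i<d1. \<Sum>i'<d1. z i * z i' * (\<Sum>j<d2. \<Sum>k<d3. X (i, j, k) \<omega> * X (i', j, k) \<omega>))" .
    have "(\<Sum>i<d1. \<Sum>i'<d1. z i * z i' * (if i = i' then N else 0)) = (\<Sum>i<d1. \<Sum>i'<d1. if i = i' then N * (z i * z i') else 0)"
      by (intro sum.cong refl) auto
    also have "\<dots> = N * (vnorm d1 z)\<^sup>2" by (simp add: vnorm_square inner_d_def sum_distrib_left)
    finally have 2: "(\<Sum>i<d1. \<Sum>i'<d1. z i * z i' * (if i = i' then N else 0)) = N * (vnorm d1 z)\<^sup>2" .
    show ?thesis unfolding 1 2[symmetric] quad_def H_def by (simp add: right_diff_distrib sum_subtractf)
  qed
  have Ym: "Yz z jk \<in> borel_measurable M" if "jk \<in> {..<d2} \<times> {..<d3}" for z jk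
    unfolding Yz_def[abs_def] using that by (intro borel_measurable_sum borel_measurable_times Xm) (auto simp: box_def)
  \<comment> \<open>320 = 16 * 20: sums and differences of lattice points have squared norm at most
    16 d1, and 20 P sqrt P is the deviation of the normalized sum. The lattice reduction divides by
    2 d1, leaving 160.\<close>
  define B where "B z = {\<omega>\<in>space M. 320 * real d1 * (P * sqrt P) \<le> \<bar>quad d1 (H \<omega>) z\<bar>}" for z
  have Bm: "B z \<in> sets M" for z
  proof -
    have [measurable]: "(\<lambda>\<omega>. \<Sum>jk\<in>{..<d2} \<times> {..<d3}. (Yz z jk \<omega>)\<^sup>2) \<in> borel_measurable M"
      by (intro borel_measurable_sum borel_measurable_power Ym)
    show ?thesis unfolding B_def quad_eq by measurable
  qed
  have Bp: "measure M (B z) \<le> 2 * exp (- 16 * P)" if V: "(vnorm d1 z)\<^sup>2 \<le> 16 * real d1" for z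
  proof (cases "vnorm d1 z = 0")
    case True
    then have "z i = 0" if "i < d1" for i using that by (auto simp: vnorm_def sum_nonneg_eq_0_iff)
    then have "quad d1 (H \<omega>) z = 0" for \<omega> by (simp add: quad_def)
    then have "B z = {}" using P0 d by (auto simp: B_def not_le)
    then show ?thesis by simp
  next
    case False
    define s where "s = vnorm d1 z"
    have s: "s > 0" using False by (simp add: s_def less_le)
    let ?J = "{..<d2} \<times> {..<d3}"
    \<comment> \<open>Each row is z/s placed in the fibre over jk; different fibres have disjoint
      supports, so the rows are orthonormal.\<close>
    have iid0: "iid_N01 M ?J (\<lambda>jk \<omega>. \<Sum>x\<in>box d1 d2 d3. (if snd x = jk then z (fst x) / s else 0) * X x \<omega>)"
    proof (rule iid_N01_orthonormal[OF X])
      fix a b assume ab: "a \<in> ?J" "b \<in> ?J"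
      have "(\<Sum>x\<in>box d1 d2 d3. (if snd x = a then z (fst x) / s else 0) * (if snd x = b then z (fst x) / s else 0))
         = (\<Sum>i<d1. \<Sum>jk\<in>?J. if jk = a then (if a = b then z i * z i / (s * s) else 0) else 0)"
        unfolding sum_box' by (intro sum.cong refl) auto
      also have "\<dots> = (\<Sum>i<d1. if a = b then z i * z i / (s * s) else 0)" using ab by simp
      also have "\<dots> = (if a = b then (\<Sum>i<d1. z i * z i) / (s * s) else 0)" by (simp add: sum_divide_distrib)
      also have "(\<Sum>i<d1. z i * z i) = s * s" using vnorm_square[of d1 z] by (simp add: s_def inner_d_def power2_eq_square)
      also have "(if a = b then s * s / (s * s) else 0) = (if a = b then 1 else 0)" using s by simp
      finally show "(\<Sum>x\<in>box d1 d2 d3. (if snd x = a then z (fst x) / s else 0) * (if snd x = b then z (fst x) / s else 0))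
         = (if a = b then 1 else 0)" .
    qed simp_all
    have Yz_eq: "(\<Sum>x\<in>box d1 d2 d3. (if snd x = jk then z (fst x) / s else 0) * X x \<omega>) = Yz z jk \<omega> / s"
      if "jk \<in> ?J" for jk \<omega>
    proof -
      have "(\<Sum>x\<in>box d1 d2 d3. (if snd x = jk then z (fst x) / s else 0) * X x \<omega>)
        = (\<Sum>i<d1. \<Sum>jk'\<in>?J. if jk' = jk then z i / s * X (i, jk) \<omega> else 0)"
        unfolding sum_box' by (intro sum.cong refl) auto
      also have "\<dots> = (\<Sum>i<d1. z i / s * X (i, jk) \<omega>)" using that by simp
      finally show ?thesis by (simp add: Yz_def sum_divide_distrib)
    qed
    have iid: "iid_N01 M ?J (\<lambda>jk \<omega>. Yz z jk \<omega> / s)"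
      by (rule iid_N01_cong[OF iid0]) (simp add: fun_eq_iff Yz_eq)
    \<comment> \<open>This choice gives the exponent - 20 P from the deviation and at most 4 P from
      the number of terms. The chi-square bound requires \<theta> \<le> 1/4, whence 16 \<le>
      P.\<close>
    define \<theta> where "\<theta> = 1 / sqrt P"
    have sP: "4 \<le> sqrt P" using P(4) real_le_rsqrt[of 4 P] by simp
    have \<theta>: "0 < \<theta>" "\<theta> \<le> 1/4" using sP P0 by (auto simp: \<theta>_def divide_simps)
    have PP: "sqrt P * sqrt P = P" using P0 by simp
    have q: "quad d1 (H \<omega>) z = s\<^sup>2 * (\<Sum>jk\<in>?J. (Yz z jk \<omega> / s)\<^sup>2 - 1)" for \<omega>
    proof -
      have "s\<^sup>2 * (\<Sum>jk\<in>?J. (Yz z jk \<omega> / s)\<^sup>2 - 1) = (\<Sum>jk\<in>?J. s\<^sup>2 * ((Yz z jk \<omega> / s)\<^sup>2 - 1))"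
        by (simp only: sum_distrib_left)
      also have "\<dots> = (\<Sum>jk\<in>?J. (Yz z jk \<omega>)\<^sup>2 - s\<^sup>2)"
        using s by (intro sum.cong refl) (simp add: power_divide right_diff_distrib)
      also have "\<dots> = (\<Sum>jk\<in>?J. (Yz z jk \<omega>)\<^sup>2) - N * s\<^sup>2" by (simp add: sum_subtractf N_def)
      finally show ?thesis by (simp add: quad_eq s_def)
    qed
    have "B z \<subseteq> {\<omega>\<in>space M. 20 * (P * sqrt P) \<le> \<bar>\<Sum>jk\<in>?J. (Yz z jk \<omega> / s)\<^sup>2 - 1\<bar>}"
    proof
      fix \<omega> assume w: "\<omega> \<in> B z"
      define S where "S = \<bar>\<Sum>jk\<in>?J. (Yz z jk \<omega> / s)\<^sup>2 - 1\<bar>"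
      have "320 * real d1 * (P * sqrt P) \<le> s\<^sup>2 * S" using w unfolding B_def q S_def by (simp add: abs_mult)
      also have "\<dots> \<le> 16 * real d1 * S" using V by (intro mult_right_mono) (auto simp: s_def S_def)
      finally have "20 * (P * sqrt P) \<le> S" using d(1) by simp
      then show "\<omega> \<in> {\<omega>\<in>space M. 20 * (P * sqrt P) \<le> \<bar>\<Sum>jk\<in>?J. (Yz z jk \<omega> / s)\<^sup>2 - 1\<bar>}"
        using w by (simp add: S_def B_def)
    qed
    then have "measure M (B z) \<le> measure M {\<omega>\<in>space M. 20 * (P * sqrt P) \<le> \<bar>\<Sum>jk\<in>?J. (Yz z jk \<omega> / s)\<^sup>2 - 1\<bar>}"
    proof (rule finite_measure_mono)
      have [measurable]: "(\<lambda>\<omega>. \<Sum>jk\<in>?J. (Yz z jk \<omega> / s)\<^sup>2 - 1) \<in> borel_measurable M"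
        by (intro borel_measurable_sum borel_measurable_power borel_measurable_diff borel_measurable_divide Ym) auto
      show "{\<omega>\<in>space M. 20 * (P * sqrt P) \<le> \<bar>\<Sum>jk\<in>?J. (Yz z jk \<omega> / s)\<^sup>2 - 1\<bar>} \<in> sets M" by measurable
    qed
    also have "\<dots> \<le> 2 * exp (- \<theta> * (20 * (P * sqrt P)) + 4 * card ?J * \<theta>\<^sup>2)"
      by (rule iid_N01_chi2_tail[OF iid _ \<theta>]) simp
    also have "\<dots> \<le> 2 * exp (- 16 * P)"
    proof -
      have "- \<theta> * (20 * (P * sqrt P)) = - 20 * P" using sP by (simp add: \<theta>_def)
      moreover have "4 * card ?J * \<theta>\<^sup>2 \<le> 4 * P"
      proof -
        have "real (card ?J) \<le> P * P" using P mult_mono[OF P(2) P(3)] P0 by simp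
        then have "real (card ?J) / P \<le> P" using P0 by (simp add: divide_le_eq)
        moreover have "\<theta>\<^sup>2 = 1 / P" using P0 by (simp add: \<theta>_def power_divide)
        ultimately show ?thesis by simp
      qed
      ultimately have "- \<theta> * (20 * (P * sqrt P)) + 4 * card ?J * \<theta>\<^sup>2 \<le> - 16 * P" by linarith
      then have "exp (- \<theta> * (20 * (P * sqrt P)) + 4 * card ?J * \<theta>\<^sup>2) \<le> exp (- 16 * P)" by (simp only: exp_le_cancel_iff)
      then show ?thesis by linarith
    qed
    finally show ?thesis .
  qed
  define L where "L = lattice_ball d1 \<times> lattice_ball d1"
  have fin: "finite L" by (simp add: L_def)
  define C where "C x = B (\<lambda>i. real_of_int (fst x i) + real_of_int (snd x i)) \<union> B (\<lambda>i. real_of_int (fst x i) - real_of_int (snd x i))" for x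
  have Cm: "C x \<in> sets M" for x using Bm by (auto simp: C_def)
  have Cp: "measure M (C x) \<le> 4 * exp (- 16 * P)" if x: "x \<in> L" for x
  proof -
    obtain m m' where m: "x = (m, m')" "m \<in> lattice_ball d1" "m' \<in> lattice_ball d1" using x by (auto simp: L_def)
    have "(vnorm d1 (\<lambda>i. real_of_int (m i) + real_of_int (m' i)))\<^sup>2 + (vnorm d1 (\<lambda>i. real_of_int (m i) - real_of_int (m' i)))\<^sup>2
      = 2 * (vnorm d1 (\<lambda>i. real_of_int (m i)))\<^sup>2 + 2 * (vnorm d1 (\<lambda>i. real_of_int (m' i)))\<^sup>2"
      by (simp add: vnorm_square inner_d_linear)
    then have "(vnorm d1 (\<lambda>i. real_of_int (m i) + real_of_int (m' i)))\<^sup>2 \<le> 16 * real d1"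
      "(vnorm d1 (\<lambda>i. real_of_int (m i) - real_of_int (m' i)))\<^sup>2 \<le> 16 * real d1"
      using lattice_ball_vnorm[OF m(2)] lattice_ball_vnorm[OF m(3)]
        zero_le_power2[of "vnorm d1 (\<lambda>i. real_of_int (m i) + real_of_int (m' i))"]
        zero_le_power2[of "vnorm d1 (\<lambda>i. real_of_int (m i) - real_of_int (m' i))"] by linarith+
    from Bp[OF this(1)] Bp[OF this(2)] show ?thesis
      unfolding C_def m(1) fst_conv snd_conv
      using measure_Un_le[OF Bm Bm, of "\<lambda>i. real_of_int (m i) + real_of_int (m' i)" "\<lambda>i. real_of_int (m i) - real_of_int (m' i)"] by linarith
  qed
  have "real (card L) \<le> 48 ^ (d1 + d1)"
  proof -
    have "card L \<le> 48 ^ d1 * 48 ^ d1"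
      unfolding L_def card_cartesian_product by (intro mult_le_mono card_lattice_ball)
    then have "real (card L) \<le> real (48 ^ d1 * 48 ^ d1)" by (simp only: of_nat_le_iff)
    then show ?thesis by (simp add: power_add)
  qed
  also have "\<dots> \<le> exp (5 * real (d1 + d1))" by (rule power_48_le)
  also have "\<dots> \<le> exp (10 * P)" using P by simp
  finally have card: "real (card L) \<le> exp (10 * P)" .
  have "measure M (\<Union>x\<in>L. C x) \<le> (\<Sum>x\<in>L. measure M (C x))" by (rule measure_UNION_le[OF fin]) (rule Cm)
  also have "\<dots> \<le> (\<Sum>x\<in>L. 4 * exp (- 16 * P))" by (rule sum_mono) (rule Cp)
  also have "\<dots> = real (card L) * (4 * exp (- 16 * P))" by simp
  also have "\<dots> \<le> exp (10 * P) * (4 * exp (- 16 * P))" using card by (intro mult_right_mono) auto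
  also have "\<dots> = 4 * exp (- 6 * P)" by (simp flip: exp_add)
  finally have meas: "measure M (\<Union>x\<in>L. C x) \<le> 4 * exp (- 6 * P)" .
  have bound: "\<bar>(\<Sum>j<d2. \<Sum>k<d3. (\<Sum>i<d1. y i * X (i, j, k) \<omega>)\<^sup>2) - real (d2 * d3)\<bar> \<le> 160 * (P * sqrt P)"
    if w: "\<omega> \<in> space M - (\<Union>x\<in>L. C x)" and y: "vnorm d1 y = 1" for \<omega> y
  proof -
    have "\<bar>quad d1 (H \<omega>) y\<bar> \<le> (320 * real d1 * (P * sqrt P)) / real (2 * d1)"
    proof (rule quad_bound_lattice[OF _ d(1) y])
      show "H \<omega> i j = H \<omega> j i" for i j by (simp add: H_def mult.commute)
      fix m m' assume "m \<in> lattice_ball d1" "m' \<in> lattice_ball d1"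
      then have "\<omega> \<notin> C (m, m')" using w by (auto simp: L_def)
      then show "\<bar>quad d1 (H \<omega>) (\<lambda>i. real_of_int (m i) + real_of_int (m' i))\<bar> \<le> 320 * real d1 * (P * sqrt P) \<and>
          \<bar>quad d1 (H \<omega>) (\<lambda>i. real_of_int (m i) - real_of_int (m' i))\<bar> \<le> 320 * real d1 * (P * sqrt P)"
        using w by (auto simp: C_def B_def)
    qed
    also have "\<dots> = 160 * (P * sqrt P)" using d(1) by simp
    finally have "\<bar>quad d1 (H \<omega>) y\<bar> \<le> 160 * (P * sqrt P)" .
    moreover have "quad d1 (H \<omega>) y = (\<Sum>j<d2. \<Sum>k<d3. (\<Sum>i<d1. y i * X (i, j, k) \<omega>)\<^sup>2) - real (d2 * d3)"
      unfolding quad_eq using y by (simp add: Yz_def N_def sum.cartesian_product split_def)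
    ultimately show ?thesis by simp
  qed
  have "(\<Union>x\<in>L. C x) \<in> sets M" using fin Cm by (intro sets.finite_UN) auto
  with meas bound show ?thesis by blast
qed

section \<open>Rotated noise coordinates and the expansion of one mode\<close>

lemma iid_N01_single_tail:
  assumes X: "iid_N01 M I X" and I: "finite I" and i: "i \<in> I" and e: "0 < \<epsilon>"
  shows "measure M {\<omega>\<in>space M. \<epsilon> \<le> \<bar>X i \<omega>\<bar>} \<le> 1 / \<epsilon>\<^sup>2"
  using iid_N01_multilinear_tail[OF X I, of "{()}" "\<lambda>_. {i}" \<epsilon>] i e by (simp add: inj_on_def)

lemma measure_scaled_tail:
  assumes "\<And>\<epsilon>. 0 < \<epsilon> \<Longrightarrow> measure M {\<omega>\<in>space M. \<epsilon> \<le> \<bar>Y \<omega>\<bar>} \<le> (C::real) / \<epsilon>\<^sup>2" and r: "0 < r" and e: "0 < \<epsilon>"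
  shows "measure M {\<omega>\<in>space M. \<epsilon> \<le> \<bar>Y \<omega> / r\<bar>} \<le> (C / r\<^sup>2) / \<epsilon>\<^sup>2"
proof -
  have "{\<omega>\<in>space M. \<epsilon> \<le> \<bar>Y \<omega> / r\<bar>} = {\<omega>\<in>space M. \<epsilon> * r \<le> \<bar>Y \<omega>\<bar>}"
    using r by (auto simp: field_simps)
  then show ?thesis using assms(1)[of "\<epsilon> * r"] r e by (simp add: power_mult_distrib mult.commute)
qed

lemma op0_divided_polynomial:
  fixes Y :: "nat \<Rightarrow> 'a \<Rightarrow> real"
  assumes ev: "\<forall>\<^sub>F n in sequentially. Y n \<in> borel_measurable (M n) \<and> 0 < r n \<and> C n / (r n)\<^sup>2 \<le> b n \<and>
      (\<forall>\<epsilon>>0. measure (M n) {\<omega>\<in>space (M n). \<epsilon> \<le> \<bar>Y n \<omega>\<bar>} \<le> C n / \<epsilon>\<^sup>2)"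
    and b: "b \<longlonglongrightarrow> 0"
  shows "op0 M (\<lambda>n \<omega>. Y n \<omega> / r n)"
proof (rule op0_of_tail[OF _ b])
  show "\<forall>\<^sub>F n in sequentially. (\<lambda>\<omega>. Y n \<omega> / r n) \<in> borel_measurable (M n) \<and>
      (\<forall>\<epsilon>>0. measure (M n) {\<omega> \<in> space (M n). \<epsilon> \<le> \<bar>Y n \<omega> / r n\<bar>} \<le> b n / \<epsilon>\<^sup>2)"
    using ev
  proof eventually_elim
    case (elim n)
    then have [measurable]: "Y n \<in> borel_measurable (M n)" by simp
    have "measure (M n) {\<omega> \<in> space (M n). \<epsilon> \<le> \<bar>Y n \<omega> / r n\<bar>} \<le> b n / \<epsilon>\<^sup>2" if e: "\<epsilon> > 0" for \<epsilon>
    proof -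
      have "measure (M n) {\<omega> \<in> space (M n). \<epsilon> \<le> \<bar>Y n \<omega> / r n\<bar>} \<le> (C n / (r n)\<^sup>2) / \<epsilon>\<^sup>2"
        by (rule measure_scaled_tail[OF _ _ e]) (use elim in auto)
      also have "\<dots> \<le> b n / \<epsilon>\<^sup>2" using elim by (intro divide_right_mono) auto
      finally show ?thesis .
    qed
    then show ?case by simp
  qed
qed

definition zeta :: "nat \<Rightarrow> nat \<Rightarrow> nat \<Rightarrow> (nat \<times> nat \<times> nat \<Rightarrow> 'a \<Rightarrow> real) \<Rightarrow> (nat \<Rightarrow> vec) \<Rightarrow> (nat \<Rightarrow> vec) \<Rightarrow> (nat \<Rightarrow> vec)
    \<Rightarrow> nat \<times> nat \<times> nat \<Rightarrow> 'a \<Rightarrow> real" where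
  "zeta d1 d2 d3 X f g h = (\<lambda>(a, b, c) \<omega>. lam_hat d1 d2 d3 (tens X \<omega>) (f a) (g b) (h c))"

lemma lam_hat_divide: "lam_hat d1 d2 d3 (\<lambda>i j k. Z i j k / t) a b c = lam_hat d1 d2 d3 Z a b c / t"
  by (simp add: lam_hat_def sum_divide_distrib)

definition noise :: "(nat \<times> nat \<times> nat \<Rightarrow> 'a \<Rightarrow> real) \<Rightarrow> real \<Rightarrow> 'a \<Rightarrow> tensor3" where
  "noise X t \<omega> = (\<lambda>i j k. X (i, j, k) \<omega> / t)"

lemma lam_hat_noise: "lam_hat d1 d2 d3 (noise X t \<omega>) (f a) (g b) (h c) = zeta d1 d2 d3 X f g h (a, b, c) \<omega> / t"
  using lam_hat_divide[of d1 d2 d3 "tens X \<omega>" t] by (simp add: noise_def zeta_def tens_def)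

text \<open>Each noise coordinate brings one factor 1/t, so the three quantities are homogeneous
  polynomials of degree 2, 3 and 2 in the rotated coordinates. The cubic one is squarefree because s
  and i start at 1.\<close>

lemma second_order_noise:
  fixes X :: "nat \<times> nat \<times> nat \<Rightarrow> 'a \<Rightarrow> real"
  assumes f: "orthonormal d1 d1 f" "f 0 = u" and g: "orthonormal d2 d2 g" "g 0 = v"
    and h: "orthonormal d3 d3 h" "h 0 = w"
  defines "\<zeta> \<equiv> zeta d1 d2 d3 X f g h"
  shows "second_order d1 d2 d3 (noise X t \<omega>) u v w (f s)
     = ((\<Sum>i\<in>{1..<d2}. \<zeta> (0, i, 0) \<omega> * \<zeta> (s, i, 0) \<omega>) + (\<Sum>i\<in>{1..<d3}. \<zeta> (0, 0, i) \<omega> * \<zeta> (s, 0, i) \<omega>)) / t\<^sup>2"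
    "second_order d1 d2 d3 (noise X t \<omega>) u v w (tan0 d1 d2 d3 (noise X t \<omega>) u v w)
     = ((\<Sum>(s,i)\<in>{1..<d1}\<times>{1..<d2}. \<zeta> (s, 0, 0) \<omega> * (\<zeta> (0, i, 0) \<omega> * \<zeta> (s, i, 0) \<omega>))
       + (\<Sum>(s,i)\<in>{1..<d1}\<times>{1..<d3}. \<zeta> (s, 0, 0) \<omega> * (\<zeta> (0, 0, i) \<omega> * \<zeta> (s, 0, i) \<omega>))) / t^3"
    "(vnorm d1 (tan0 d1 d2 d3 (noise X t \<omega>) u v w))\<^sup>2 = (\<Sum>s\<in>{1..<d1}. (\<zeta> (s, 0, 0) \<omega>)\<^sup>2) / t\<^sup>2"
proof -
  have z: "lam_hat d1 d2 d3 (noise X t \<omega>) (f a) (g b) (h c) = \<zeta> (a, b, c) \<omega> / t" for a b c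
    by (simp add: lam_hat_noise \<zeta>_def)
  have so: "second_order d1 d2 d3 (noise X t \<omega>) u v w (f s)
     = ((\<Sum>i\<in>{1..<d2}. \<zeta> (0, i, 0) \<omega> * \<zeta> (s, i, 0) \<omega>) + (\<Sum>i\<in>{1..<d3}. \<zeta> (0, 0, i) \<omega> * \<zeta> (s, 0, i) \<omega>)) / t\<^sup>2" for s
    unfolding second_order_coords[OF f g h] using z[of _ _ 0] z[of _ 0]
    by (simp add: f(2)[symmetric] g(2)[symmetric] h(2)[symmetric] power2_eq_square add_divide_distrib sum_divide_distrib)
  then show "second_order d1 d2 d3 (noise X t \<omega>) u v w (f s)
     = ((\<Sum>i\<in>{1..<d2}. \<zeta> (0, i, 0) \<omega> * \<zeta> (s, i, 0) \<omega>) + (\<Sum>i\<in>{1..<d3}. \<zeta> (0, 0, i) \<omega> * \<zeta> (s, 0, i) \<omega>)) / t\<^sup>2" .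
  have "lam_hat d1 d2 d3 (noise X t \<omega>) (f s) v w = \<zeta> (s, 0, 0) \<omega> / t" for s
    using z[of s 0 0] by (simp add: g(2) h(2))
  note zs = this
  show "second_order d1 d2 d3 (noise X t \<omega>) u v w (tan0 d1 d2 d3 (noise X t \<omega>) u v w)
     = ((\<Sum>(s,i)\<in>{1..<d1}\<times>{1..<d2}. \<zeta> (s, 0, 0) \<omega> * (\<zeta> (0, i, 0) \<omega> * \<zeta> (s, i, 0) \<omega>))
       + (\<Sum>(s,i)\<in>{1..<d1}\<times>{1..<d3}. \<zeta> (s, 0, 0) \<omega> * (\<zeta> (0, 0, i) \<omega> * \<zeta> (s, 0, i) \<omega>))) / t^3"
    unfolding second_order_tan0_coords[OF f] so zs sum.cartesian_product[symmetric]
    by (simp add: sum_distrib_left distrib_left sum.distrib add_divide_distrib sum_divide_distrib power2_eq_square power3_eq_cube mult_ac)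
  show "(vnorm d1 (tan0 d1 d2 d3 (noise X t \<omega>) u v w))\<^sup>2 = (\<Sum>s\<in>{1..<d1}. (\<zeta> (s, 0, 0) \<omega>)\<^sup>2) / t\<^sup>2"
    unfolding tan0_norm_coords[OF f] zs by (simp add: sum_divide_distrib power_divide)
qed

text \<open>The supports determine the summation index: in the cubic sums, (s, i, 0) or (s, 0, i) is
  the only element of its triple with two nonzero entries. Distinct supports make the monomials
  orthonormal, so the variance is the number of terms.\<close>

lemma multilinear_sum_tails:
  assumes Z: "iid_N01 M (box d1 d2 d3) \<zeta>" and d: "0 < d1" "0 < d2" "0 < d3" and e: "0 < \<epsilon>"
  shows "1 < d1 \<Longrightarrow> measure M {\<omega>\<in>space M. \<epsilon> \<le> \<bar>\<Sum>i\<in>{1..<d2}. \<zeta> (0, i, 0) \<omega> * \<zeta> (1, i, 0) \<omega>\<bar>} \<le> real d2 / \<epsilon>\<^sup>2"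
    "1 < d1 \<Longrightarrow> measure M {\<omega>\<in>space M. \<epsilon> \<le> \<bar>\<Sum>i\<in>{1..<d3}. \<zeta> (0, 0, i) \<omega> * \<zeta> (1, 0, i) \<omega>\<bar>} \<le> real d3 / \<epsilon>\<^sup>2"
    "measure M {\<omega>\<in>space M. \<epsilon> \<le> \<bar>\<Sum>(s,i)\<in>{1..<d1}\<times>{1..<d2}. \<zeta> (s, 0, 0) \<omega> * (\<zeta> (0, i, 0) \<omega> * \<zeta> (s, i, 0) \<omega>)\<bar>} \<le> real d1 * real d2 / \<epsilon>\<^sup>2"
    "measure M {\<omega>\<in>space M. \<epsilon> \<le> \<bar>\<Sum>(s,i)\<in>{1..<d1}\<times>{1..<d3}. \<zeta> (s, 0, 0) \<omega> * (\<zeta> (0, 0, i) \<omega> * \<zeta> (s, 0, i) \<omega>)\<bar>} \<le> real d1 * real d3 / \<epsilon>\<^sup>2"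
proof -
  have le: "real (card T) / \<epsilon>\<^sup>2 \<le> C / \<epsilon>\<^sup>2" if "real (card T) \<le> C" for T :: "'x set" and C using that by (intro divide_right_mono) auto
  note tail = order_trans[OF iid_N01_multilinear_tail[OF Z finite_box _ _ _ e] le]
  show "measure M {\<omega>\<in>space M. \<epsilon> \<le> \<bar>\<Sum>i\<in>{1..<d2}. \<zeta> (0, i, 0) \<omega> * \<zeta> (1, i, 0) \<omega>\<bar>} \<le> real d2 / \<epsilon>\<^sup>2" if "1 < d1"
    using tail[of "{1..<d2}" "\<lambda>i. {(0, i, 0), (1, i, 0)}" "real d2"] d that
    by (auto simp: inj_on_def box_def doubleton_eq_iff)
  show "measure M {\<omega>\<in>space M. \<epsilon> \<le> \<bar>\<Sum>i\<in>{1..<d3}. \<zeta> (0, 0, i) \<omega> * \<zeta> (1, 0, i) \<omega>\<bar>} \<le> real d3 / \<epsilon>\<^sup>2" if "1 < d1"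
    using tail[of "{1..<d3}" "\<lambda>i. {(0, 0, i), (1, 0, i)}" "real d3"] d that
    by (auto simp: inj_on_def box_def doubleton_eq_iff)
  have prod1: "(\<Prod>x\<in>{(s, 0, 0), (0, i, 0), (s, i, 0)}. \<zeta> x \<omega>) = \<zeta> (s, 0, 0) \<omega> * (\<zeta> (0, i, 0) \<omega> * \<zeta> (s, i, 0) \<omega>)"
    if "1 \<le> s" "1 \<le> i" for s i \<omega> using that by simp
  have prod2: "(\<Prod>x\<in>{(s, 0, 0), (0, 0, i), (s, 0, i)}. \<zeta> x \<omega>) = \<zeta> (s, 0, 0) \<omega> * (\<zeta> (0, 0, i) \<omega> * \<zeta> (s, 0, i) \<omega>)"
    if "1 \<le> s" "1 \<le> i" for s i \<omega> using that by simp
  have inj1: "inj_on (\<lambda>(s, i). {(s, 0, 0), (0, i, 0), (s, i, 0::nat)}) ({1..<d1}\<times>{1..<d2})"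
  proof (rule inj_onI, clarify)
    fix s i s' i' :: nat
    assume h: "s \<in> {1..<d1}" "i \<in> {1..<d2}" "s' \<in> {1..<d1}" "i' \<in> {1..<d2}"
      and eq: "{(s, 0, 0), (0, i, 0), (s, i, 0::nat)} = {(s', 0, 0), (0, i', 0), (s', i', 0)}"
    have "(s, i, 0::nat) \<in> {(s', 0, 0), (0, i', 0), (s', i', 0)}" unfolding eq[symmetric] by simp
    then show "s = s' \<and> i = i'" using h by auto
  qed
  have inj2: "inj_on (\<lambda>(s, i). {(s, 0, 0), (0, 0::nat, i), (s, 0, i)}) ({1..<d1}\<times>{1..<d3})"
  proof (rule inj_onI, clarify)
    fix s i s' i' :: nat
    assume h: "s \<in> {1..<d1}" "i \<in> {1..<d3}" "s' \<in> {1..<d1}" "i' \<in> {1..<d3}"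
      and eq: "{(s, 0, 0), (0, 0::nat, i), (s, 0, i)} = {(s', 0, 0), (0, 0, i'), (s', 0, i')}"
    have "(s, 0::nat, i) \<in> {(s', 0, 0), (0, 0, i'), (s', 0, i')}" unfolding eq[symmetric] by simp
    then show "s = s' \<and> i = i'" using h by auto
  qed
  have "(\<Sum>(s,i)\<in>{1..<d1}\<times>{1..<d2}. \<zeta> (s, 0, 0) \<omega> * (\<zeta> (0, i, 0) \<omega> * \<zeta> (s, i, 0) \<omega>))
      = (\<Sum>t\<in>{1..<d1}\<times>{1..<d2}. \<Prod>x\<in>(\<lambda>(s, i). {(s, 0, 0), (0, i, 0), (s, i, 0)}) t. \<zeta> x \<omega>)" for \<omega>
    by (rule sum.cong) (auto simp: prod1)
  moreover have "real (card ({1..<d1}\<times>{1..<d2})) \<le> real d1 * real d2"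
    unfolding card_cartesian_product of_nat_mult by (intro mult_mono) auto
  ultimately show "measure M {\<omega>\<in>space M. \<epsilon> \<le> \<bar>\<Sum>(s,i)\<in>{1..<d1}\<times>{1..<d2}. \<zeta> (s, 0, 0) \<omega> * (\<zeta> (0, i, 0) \<omega> * \<zeta> (s, i, 0) \<omega>)\<bar>} \<le> real d1 * real d2 / \<epsilon>\<^sup>2"
    using tail[OF _ inj1] d by (auto simp: box_def)
  have "(\<Sum>(s,i)\<in>{1..<d1}\<times>{1..<d3}. \<zeta> (s, 0, 0) \<omega> * (\<zeta> (0, 0, i) \<omega> * \<zeta> (s, 0, i) \<omega>))
      = (\<Sum>t\<in>{1..<d1}\<times>{1..<d3}. \<Prod>x\<in>(\<lambda>(s, i). {(s, 0, 0), (0, 0, i), (s, 0, i)}) t. \<zeta> x \<omega>)" for \<omega>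
    by (rule sum.cong) (auto simp: prod2)
  moreover have "real (card ({1..<d1}\<times>{1..<d3})) \<le> real d1 * real d3"
    unfolding card_cartesian_product of_nat_mult by (intro mult_mono) auto
  ultimately show "measure M {\<omega>\<in>space M. \<epsilon> \<le> \<bar>\<Sum>(s,i)\<in>{1..<d1}\<times>{1..<d3}. \<zeta> (s, 0, 0) \<omega> * (\<zeta> (0, 0, i) \<omega> * \<zeta> (s, 0, i) \<omega>)\<bar>} \<le> real d1 * real d3 / \<epsilon>\<^sup>2"
    using tail[OF _ inj2] d by (auto simp: box_def)
qed

text \<open>Errors are measured on the scales of the limit law: \<tau> for a tangential direction,
  \<tau>^2 / sqrt P for the radial loss. On these scales the quadratic and cubic polynomials have
  variance of order at most P/\<tau>^2, and the remainders e^3 and e^4 both become multiples of P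
  sqrt P / \<tau>^2.\<close>

lemma mode_expansion:
  fixes d1 d2 d3 :: "nat \<Rightarrow> nat" and P \<tau> :: "nat \<Rightarrow> real" and X :: "nat \<Rightarrow> nat \<times> nat \<times> nat \<Rightarrow> 'a \<Rightarrow> real"
  assumes iid: "\<And>n. iid_N01 (M n) (box (d1 n) (d2 n) (d3 n)) (X n)"
    and ev: "\<forall>\<^sub>F n in sequentially. orthonormal (d1 n) (d1 n) (f n) \<and> f n 0 = u n \<and> orthonormal (d2 n) (d2 n) (g n) \<and> g n 0 = v n \<and>
       orthonormal (d3 n) (d3 n) (h n) \<and> h n 0 = w n \<and> 2 \<le> d1 n"
    and d: "\<And>n. 0 < d1 n \<and> 0 < d2 n \<and> 0 < d3 n \<and> real (d1 n) \<le> P n \<and> real (d2 n) \<le> P n \<and> real (d3 n) \<le> P n"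
    and \<tau>: "\<And>n. 0 < \<tau> n"
    and rate: "(\<lambda>n. P n * sqrt (P n) / (\<tau> n)\<^sup>2) \<longlonglongrightarrow> 0" "(\<lambda>n. sqrt (P n) / \<tau> n) \<longlonglongrightarrow> 0"
    and ref: "whp M (\<lambda>n \<omega>. refined (d1 n) (d2 n) (d3 n) (noise (X n) (\<tau> n) \<omega>) (u n) (v n) (w n) (48 * sqrt (P n) / \<tau> n) (uh n \<omega>))"
  defines "\<zeta> \<equiv> \<lambda>n. zeta (d1 n) (d2 n) (d3 n) (X n) (f n) (g n) (h n)"
  shows "op0 M (\<lambda>n \<omega>. (\<tau> n)\<^sup>2 / sqrt (P n) * (inner_d (d1 n) (u n) (uh n \<omega>) - 1 + (\<Sum>s\<in>{1..<d1 n}. (\<zeta> n (s, 0, 0) \<omega>)\<^sup>2) / (2 * (\<tau> n)\<^sup>2)))"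
    "op0 M (\<lambda>n \<omega>. \<tau> n * inner_d (d1 n) (f n 1) (uh n \<omega>) - \<zeta> n (1, 0, 0) \<omega>)"
    "whp M (\<lambda>n \<omega>. \<bar>inner_d (d1 n) (u n) (uh n \<omega>) - 1\<bar> \<le> 50 * (48 * sqrt (P n) / \<tau> n)\<^sup>2)"
    "Op1 M (\<lambda>n. \<zeta> n (0, 0, 0))" "Op1 M (\<lambda>n. \<zeta> n (1, 0, 0))"
proof -
  have P1: "1 \<le> P n" for n using d[of n] by linarith
  have sP: "1 \<le> sqrt (P n)" for n using P1[of n] by simp
  have PP: "sqrt (P n) * sqrt (P n) = P n" for n using P1[of n] by simp
  define e where "e n = 48 * sqrt (P n) / \<tau> n" for n
  have e0: "0 \<le> e n" for n using sP[of n] \<tau>[of n] by (simp add: e_def)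
  have iz: "\<forall>\<^sub>F n in sequentially. iid_N01 (M n) (box (d1 n) (d2 n) (d3 n)) (\<zeta> n)"
    using ev by eventually_elim (use iid_N01_rotate[OF iid] in \<open>simp add: \<zeta>_def zeta_def\<close>)
  have b: "(\<lambda>n. (sqrt (P n) / \<tau> n)\<^sup>2) \<longlonglongrightarrow> 0" using tendsto_power[OF rate(2), of 2] by simp
  have zm: "\<forall>\<^sub>F n in sequentially. \<forall>x\<in>box (d1 n) (d2 n) (d3 n). \<zeta> n x \<in> borel_measurable (M n)"
    using iz by eventually_elim (auto intro: iid_N01_measurable)
  show O0: "Op1 M (\<lambda>n. \<zeta> n (0, 0, 0))"
  proof (rule Op1_of_tail[of _ _ 1])
    show "\<forall>\<^sub>F n in sequentially. \<zeta> n (0, 0, 0) \<in> borel_measurable (M n) \<and> (\<forall>\<epsilon>>0. measure (M n) {\<omega> \<in> space (M n). \<epsilon> \<le> \<bar>\<zeta> n (0, 0, 0) \<omega>\<bar>} \<le> 1 / \<epsilon>\<^sup>2)"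
      using iz zm
    proof eventually_elim
      case (elim n)
      have "(0, 0, 0) \<in> box (d1 n) (d2 n) (d3 n)" using d[of n] by (simp add: box_def)
      then show ?case using elim iid_N01_single_tail[OF elim(1) finite_box] by blast
    qed
  qed
  show O1: "Op1 M (\<lambda>n. \<zeta> n (1, 0, 0))"
  proof (rule Op1_of_tail[of _ _ 1])
    show "\<forall>\<^sub>F n in sequentially. \<zeta> n (1, 0, 0) \<in> borel_measurable (M n) \<and> (\<forall>\<epsilon>>0. measure (M n) {\<omega> \<in> space (M n). \<epsilon> \<le> \<bar>\<zeta> n (1, 0, 0) \<omega>\<bar>} \<le> 1 / \<epsilon>\<^sup>2)"
      using iz zm ev
    proof eventually_elim
      case (elim n)
      have "(1, 0, 0) \<in> box (d1 n) (d2 n) (d3 n)" using d[of n] elim(3) by (simp add: box_def)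
      then show ?case using elim iid_N01_single_tail[OF elim(1) finite_box] by blast
    qed
  qed
  define T2 where "T2 n \<omega> = (\<Sum>i\<in>{1..<d2 n}. \<zeta> n (0, i, 0) \<omega> * \<zeta> n (1, i, 0) \<omega>)" for n \<omega>
  define T2' where "T2' n \<omega> = (\<Sum>i\<in>{1..<d3 n}. \<zeta> n (0, 0, i) \<omega> * \<zeta> n (1, 0, i) \<omega>)" for n \<omega>
  define T3 where "T3 n \<omega> = (\<Sum>(s,i)\<in>{1..<d1 n}\<times>{1..<d2 n}. \<zeta> n (s, 0, 0) \<omega> * (\<zeta> n (0, i, 0) \<omega> * \<zeta> n (s, i, 0) \<omega>))" for n \<omega>
  define T3' where "T3' n \<omega> = (\<Sum>(s,i)\<in>{1..<d1 n}\<times>{1..<d3 n}. \<zeta> n (s, 0, 0) \<omega> * (\<zeta> n (0, 0, i) \<omega> * \<zeta> n (s, 0, i) \<omega>))" for n \<omega>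
  have b2: "real m / (\<tau> n)\<^sup>2 \<le> (sqrt (P n) / \<tau> n)\<^sup>2" if "real m \<le> P n" for m n
    using that P1[of n] \<tau>[of n] by (simp add: power_divide divide_right_mono)
  \<comment> \<open>The cubic sums have up to P^2 terms; dividing by \<tau> sqrt P brings the
    variance down to P/\<tau>^2.\<close>
  have b3: "real m * real m' / (\<tau> n * sqrt (P n))\<^sup>2 \<le> (sqrt (P n) / \<tau> n)\<^sup>2" if "real m \<le> P n" "real m' \<le> P n" for m m' n
  proof -
    have "real m * real m' \<le> P n * P n" using that P1[of n] by (intro mult_mono) auto
    then have "real m * real m' / ((\<tau> n)\<^sup>2 * P n) \<le> P n * P n / ((\<tau> n)\<^sup>2 * P n)" using P1[of n] by (intro divide_right_mono) auto
    then show ?thesis using P1[of n] by (simp add: power_mult_distrib power_divide)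
  qed
  have T2: "op0 M (\<lambda>n \<omega>. T2 n \<omega> / \<tau> n)"
  proof (rule op0_divided_polynomial[OF _ b, where C="\<lambda>n. real (d2 n)"])
    show "\<forall>\<^sub>F n in sequentially. T2 n \<in> borel_measurable (M n) \<and> 0 < \<tau> n \<and> real (d2 n) / (\<tau> n)\<^sup>2 \<le> (sqrt (P n) / \<tau> n)\<^sup>2 \<and>
      (\<forall>\<epsilon>>0. measure (M n) {\<omega> \<in> space (M n). \<epsilon> \<le> \<bar>T2 n \<omega>\<bar>} \<le> real (d2 n) / \<epsilon>\<^sup>2)"
      using iz zm ev
    proof eventually_elim
      case (elim n)
      have "T2 n \<in> borel_measurable (M n)" unfolding T2_def[abs_def]
        using elim(2,3) d[of n] by (intro borel_measurable_sum borel_measurable_times) (auto simp: box_def)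
      then show ?case using multilinear_sum_tails(1)[OF elim(1)] d[of n] elim(3) b2 \<tau> by (simp add: T2_def)
    qed
  qed
  have T2': "op0 M (\<lambda>n \<omega>. T2' n \<omega> / \<tau> n)"
  proof (rule op0_divided_polynomial[OF _ b, where C="\<lambda>n. real (d3 n)"])
    show "\<forall>\<^sub>F n in sequentially. T2' n \<in> borel_measurable (M n) \<and> 0 < \<tau> n \<and> real (d3 n) / (\<tau> n)\<^sup>2 \<le> (sqrt (P n) / \<tau> n)\<^sup>2 \<and>
      (\<forall>\<epsilon>>0. measure (M n) {\<omega> \<in> space (M n). \<epsilon> \<le> \<bar>T2' n \<omega>\<bar>} \<le> real (d3 n) / \<epsilon>\<^sup>2)"
      using iz zm ev
    proof eventually_elim
      case (elim n)
      have "T2' n \<in> borel_measurable (M n)" unfolding T2'_def[abs_def]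
        using elim(2,3) d[of n] by (intro borel_measurable_sum borel_measurable_times) (auto simp: box_def)
      then show ?case using multilinear_sum_tails(2)[OF elim(1)] d[of n] elim(3) b2 \<tau> by (simp add: T2'_def)
    qed
  qed
  have rpos: "0 < \<tau> n * sqrt (P n)" for n using \<tau>[of n] P1[of n] by simp
  have T3: "op0 M (\<lambda>n \<omega>. T3 n \<omega> / (\<tau> n * sqrt (P n)))"
  proof (rule op0_divided_polynomial[OF _ b, where C="\<lambda>n. real (d1 n) * real (d2 n)"])
    show "\<forall>\<^sub>F n in sequentially. T3 n \<in> borel_measurable (M n) \<and> 0 < \<tau> n * sqrt (P n) \<and> real (d1 n) * real (d2 n) / (\<tau> n * sqrt (P n))\<^sup>2 \<le> (sqrt (P n) / \<tau> n)\<^sup>2 \<and>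
      (\<forall>\<epsilon>>0. measure (M n) {\<omega> \<in> space (M n). \<epsilon> \<le> \<bar>T3 n \<omega>\<bar>} \<le> real (d1 n) * real (d2 n) / \<epsilon>\<^sup>2)"
      using iz zm
    proof eventually_elim
      case (elim n)
      have "T3 n \<in> borel_measurable (M n)" unfolding T3_def[abs_def] split_def
        using elim(2) d[of n] by (intro borel_measurable_sum borel_measurable_times) (auto simp: box_def)
      then show ?case using multilinear_sum_tails(3)[OF elim(1)] d[of n] b3 rpos by (simp add: T3_def)
    qed
  qed
  have T3': "op0 M (\<lambda>n \<omega>. T3' n \<omega> / (\<tau> n * sqrt (P n)))"
  proof (rule op0_divided_polynomial[OF _ b, where C="\<lambda>n. real (d1 n) * real (d3 n)"])
    show "\<forall>\<^sub>F n in sequentially. T3' n \<in> borel_measurable (M n) \<and> 0 < \<tau> n * sqrt (P n) \<and> real (d1 n) * real (d3 n) / (\<tau> n * sqrt (P n))\<^sup>2 \<le> (sqrt (P n) / \<tau> n)\<^sup>2 \<and>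
      (\<forall>\<epsilon>>0. measure (M n) {\<omega> \<in> space (M n). \<epsilon> \<le> \<bar>T3' n \<omega>\<bar>} \<le> real (d1 n) * real (d3 n) / \<epsilon>\<^sup>2)"
      using iz zm
    proof eventually_elim
      case (elim n)
      have "T3' n \<in> borel_measurable (M n)" unfolding T3'_def[abs_def] split_def
        using elim(2) d[of n] by (intro borel_measurable_sum borel_measurable_times) (auto simp: box_def)
      then show ?case using multilinear_sum_tails(4)[OF elim(1)] d[of n] b3 rpos by (simp add: T3'_def)
    qed
  qed
  have rf: "whp M (\<lambda>n \<omega>. refined (d1 n) (d2 n) (d3 n) (noise (X n) (\<tau> n) \<omega>) (u n) (v n) (w n) (e n) (uh n \<omega>))"
    using ref by (simp add: e_def)
  \<comment> \<open>The pointwise content of \<open>refined\<close> in rotated coordinates; the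
    scale \<alpha> is recovered as the inner product with \<open>u n\<close>.\<close>
  have key: "\<forall>\<^sub>F n in sequentially. \<forall>\<omega>\<in>space (M n). refined (d1 n) (d2 n) (d3 n) (noise (X n) (\<tau> n) \<omega>) (u n) (v n) (w n) (e n) (uh n \<omega>) \<longrightarrow>
      \<bar>inner_d (d1 n) (u n) (uh n \<omega>) - 1\<bar> \<le> 50 * (e n)\<^sup>2 \<and>
      \<bar>inner_d (d1 n) (u n) (uh n \<omega>) - 1 + (\<Sum>s\<in>{1..<d1 n}. (\<zeta> n (s, 0, 0) \<omega>)\<^sup>2) / (2 * (\<tau> n)\<^sup>2)\<bar>
        \<le> 2 * \<bar>(T3 n \<omega> + T3' n \<omega>) / (\<tau> n)^3\<bar> + 20000 * (e n)^4 + 105 * (e n)\<^sup>2 * \<bar>\<zeta> n (0, 0, 0) \<omega> / \<tau> n\<bar> \<and>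
      \<bar>inner_d (d1 n) (f n 1) (uh n \<omega>) - \<zeta> n (1, 0, 0) \<omega> / \<tau> n\<bar>
        \<le> 11 * e n * \<bar>\<zeta> n (1, 0, 0) \<omega> / \<tau> n\<bar> + 2 * \<bar>(T2 n \<omega> + T2' n \<omega>) / (\<tau> n)\<^sup>2\<bar> + 800 * (e n)^3"
    using ev
  proof eventually_elim
    case (elim n)
    have f: "orthonormal (d1 n) (d1 n) (f n)" "f n 0 = u n" and g: "orthonormal (d2 n) (d2 n) (g n)" "g n 0 = v n"
      and h: "orthonormal (d3 n) (d3 n) (h n)" "h n 0 = w n" and d2: "2 \<le> d1 n" using elim by auto
    show ?case
    proof (intro ballI impI)
      fix \<omega> assume "refined (d1 n) (d2 n) (d3 n) (noise (X n) (\<tau> n) \<omega>) (u n) (v n) (w n) (e n) (uh n \<omega>)"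
      then obtain x \<alpha> where x: "inner_d (d1 n) (u n) x = 0" "\<forall>i<d1 n. uh n \<omega> i = \<alpha> * (u n i + x i)" "\<bar>\<alpha> - 1\<bar> \<le> 50 * (e n)\<^sup>2"
        and A: "\<bar>\<alpha> - 1 + (vnorm (d1 n) (tan0 (d1 n) (d2 n) (d3 n) (noise (X n) (\<tau> n) \<omega>) (u n) (v n) (w n)))\<^sup>2 / 2\<bar>
       \<le> 2 * \<bar>second_order (d1 n) (d2 n) (d3 n) (noise (X n) (\<tau> n) \<omega>) (u n) (v n) (w n) (tan0 (d1 n) (d2 n) (d3 n) (noise (X n) (\<tau> n) \<omega>) (u n) (v n) (w n))\<bar> + 20000 * (e n)^4
         + 105 * (e n)\<^sup>2 * \<bar>lam_hat (d1 n) (d2 n) (d3 n) (noise (X n) (\<tau> n) \<omega>) (u n) (v n) (w n)\<bar>"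
        and B: "\<And>q. inner_d (d1 n) q (u n) = 0 \<Longrightarrow> vnorm (d1 n) q = 1 \<Longrightarrow>
        \<bar>\<alpha> * inner_d (d1 n) q x - lam_hat (d1 n) (d2 n) (d3 n) (noise (X n) (\<tau> n) \<omega>) q (v n) (w n)\<bar>
          \<le> 11 * e n * \<bar>lam_hat (d1 n) (d2 n) (d3 n) (noise (X n) (\<tau> n) \<omega>) q (v n) (w n)\<bar>
            + 2 * \<bar>second_order (d1 n) (d2 n) (d3 n) (noise (X n) (\<tau> n) \<omega>) (u n) (v n) (w n) q\<bar> + 800 * (e n)^3"
        unfolding refined_def by blast
      have uu: "inner_d (d1 n) (u n) (u n) = 1" "inner_d (d1 n) (f n 1) (f n 1) = 1" "inner_d (d1 n) (f n 1) (u n) = 0"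
        using f d2 by (auto simp: orthonormal_def f(2)[symmetric])
      have q1: "vnorm (d1 n) (f n 1) = 1" using vnorm_square[of "d1 n" "f n 1"] uu(2) by (metis real_sqrt_one real_sqrt_unique vnorm_nonneg)
      have hat: "inner_d (d1 n) q (uh n \<omega>) = \<alpha> * inner_d (d1 n) q (u n) + \<alpha> * inner_d (d1 n) q x" for q
      proof -
        have "inner_d (d1 n) q (uh n \<omega>) = inner_d (d1 n) q (\<lambda>i. \<alpha> * (u n i + x i))"
          by (rule inner_d_cong) (use x(2) in auto)
        then show ?thesis by (simp add: inner_d_linear distrib_left)
      qed
      have h1: "inner_d (d1 n) (u n) (uh n \<omega>) = \<alpha>" by (simp add: hat uu x(1))
      have h2: "inner_d (d1 n) (f n 1) (uh n \<omega>) = \<alpha> * inner_d (d1 n) (f n 1) x" unfolding hat uu(3) by simp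
      have z0: "lam_hat (d1 n) (d2 n) (d3 n) (noise (X n) (\<tau> n) \<omega>) (f n a) (v n) (w n) = \<zeta> n (a, 0, 0) \<omega> / \<tau> n" for a
        using lam_hat_noise[of "d1 n" "d2 n" "d3 n" "X n" "\<tau> n" \<omega> "f n" a "g n" 0 "h n" 0] by (simp add: g(2) h(2) \<zeta>_def)
      note so = second_order_noise[OF f g h, of "X n" "\<tau> n" \<omega>]
      show "\<bar>inner_d (d1 n) (u n) (uh n \<omega>) - 1\<bar> \<le> 50 * (e n)\<^sup>2 \<and>
      \<bar>inner_d (d1 n) (u n) (uh n \<omega>) - 1 + (\<Sum>s\<in>{1..<d1 n}. (\<zeta> n (s, 0, 0) \<omega>)\<^sup>2) / (2 * (\<tau> n)\<^sup>2)\<bar>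
        \<le> 2 * \<bar>(T3 n \<omega> + T3' n \<omega>) / (\<tau> n)^3\<bar> + 20000 * (e n)^4 + 105 * (e n)\<^sup>2 * \<bar>\<zeta> n (0, 0, 0) \<omega> / \<tau> n\<bar> \<and>
      \<bar>inner_d (d1 n) (f n 1) (uh n \<omega>) - \<zeta> n (1, 0, 0) \<omega> / \<tau> n\<bar>
        \<le> 11 * e n * \<bar>\<zeta> n (1, 0, 0) \<omega> / \<tau> n\<bar> + 2 * \<bar>(T2 n \<omega> + T2' n \<omega>) / (\<tau> n)\<^sup>2\<bar> + 800 * (e n)^3"
        unfolding h1 h2 using x(3) A[unfolded so(2,3) z0[of 0, unfolded f(2)]] B[OF uu(3) q1, unfolded so(1) z0]
        by (simp add: T2_def T2'_def T3_def T3'_def \<zeta>_def mult.commute)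
    qed
  qed
  show "whp M (\<lambda>n \<omega>. \<bar>inner_d (d1 n) (u n) (uh n \<omega>) - 1\<bar> \<le> 50 * (48 * sqrt (P n) / \<tau> n)\<^sup>2)"
    by (rule whp_mono[OF rf]) (use key in \<open>auto elim!: eventually_mono simp: e_def\<close>)
  have abs_op0: "op0 M (\<lambda>n \<omega>. \<bar>Y n \<omega>\<bar>)" if "op0 M Y" for Y using that by (simp add: op0_def)
  have abs_Op1: "Op1 M (\<lambda>n \<omega>. \<bar>Y n \<omega>\<bar>)" if "Op1 M Y" for Y using that by (simp add: Op1_def)
  have tau2: "e n * e n = 2304 * P n / (\<tau> n)\<^sup>2" for n
    using P1[of n] by (simp add: e_def power2_eq_square)
  show "op0 M (\<lambda>n \<omega>. (\<tau> n)\<^sup>2 / sqrt (P n) * (inner_d (d1 n) (u n) (uh n \<omega>) - 1 + (\<Sum>s\<in>{1..<d1 n}. (\<zeta> n (s, 0, 0) \<omega>)\<^sup>2) / (2 * (\<tau> n)\<^sup>2)))"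
  proof (rule op0_dominated)
    show "op0 M (\<lambda>n \<omega>. 2 * \<bar>T3 n \<omega> / (\<tau> n * sqrt (P n)) + T3' n \<omega> / (\<tau> n * sqrt (P n))\<bar>
        + 20000 * (2304 * 2304) * (P n * sqrt (P n) / (\<tau> n)\<^sup>2)
        + 105 * 2304 * (sqrt (P n) / \<tau> n) * \<bar>\<zeta> n (0, 0, 0) \<omega>\<bar>)"
      by (intro op0_add op0_cmult abs_op0 T3 T3' op0_tendsto op0_mult_Op1 abs_Op1 O0)
         (use tendsto_mult_right_zero[OF rate(1)] tendsto_mult_right_zero[OF rate(2)] in auto)
    show "whp M (\<lambda>n \<omega>. \<bar>(\<tau> n)\<^sup>2 / sqrt (P n) * (inner_d (d1 n) (u n) (uh n \<omega>) - 1 + (\<Sum>s\<in>{1..<d1 n}. (\<zeta> n (s, 0, 0) \<omega>)\<^sup>2) / (2 * (\<tau> n)\<^sup>2))\<bar>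
       \<le> 2 * \<bar>T3 n \<omega> / (\<tau> n * sqrt (P n)) + T3' n \<omega> / (\<tau> n * sqrt (P n))\<bar>
        + 20000 * (2304 * 2304) * (P n * sqrt (P n) / (\<tau> n)\<^sup>2)
        + 105 * 2304 * (sqrt (P n) / \<tau> n) * \<bar>\<zeta> n (0, 0, 0) \<omega>\<bar>)"
    proof (rule whp_mono[OF rf], use key in \<open>rule eventually_mono\<close>, intro ballI impI)
      fix n \<omega>
      assume all: "\<forall>\<omega>\<in>space (M n). refined (d1 n) (d2 n) (d3 n) (noise (X n) (\<tau> n) \<omega>) (u n) (v n) (w n) (e n) (uh n \<omega>) \<longrightarrow>
      \<bar>inner_d (d1 n) (u n) (uh n \<omega>) - 1\<bar> \<le> 50 * (e n)\<^sup>2 \<and>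
      \<bar>inner_d (d1 n) (u n) (uh n \<omega>) - 1 + (\<Sum>s\<in>{1..<d1 n}. (\<zeta> n (s, 0, 0) \<omega>)\<^sup>2) / (2 * (\<tau> n)\<^sup>2)\<bar>
        \<le> 2 * \<bar>(T3 n \<omega> + T3' n \<omega>) / (\<tau> n)^3\<bar> + 20000 * (e n)^4 + 105 * (e n)\<^sup>2 * \<bar>\<zeta> n (0, 0, 0) \<omega> / \<tau> n\<bar> \<and>
      \<bar>inner_d (d1 n) (f n 1) (uh n \<omega>) - \<zeta> n (1, 0, 0) \<omega> / \<tau> n\<bar>
        \<le> 11 * e n * \<bar>\<zeta> n (1, 0, 0) \<omega> / \<tau> n\<bar> + 2 * \<bar>(T2 n \<omega> + T2' n \<omega>) / (\<tau> n)\<^sup>2\<bar> + 800 * (e n)^3"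
        and w: "\<omega> \<in> space (M n)" and r: "refined (d1 n) (d2 n) (d3 n) (noise (X n) (\<tau> n) \<omega>) (u n) (v n) (w n) (e n) (uh n \<omega>)"
      define S where "S = sqrt (P n)"
      have S: "S > 0" "P n = S * S" using sP[of n] PP[of n] by (auto simp: S_def)
      have t: "\<tau> n > 0" by (rule \<tau>)
      define Q where "Q = inner_d (d1 n) (u n) (uh n \<omega>) - 1 + (\<Sum>s\<in>{1..<d1 n}. (\<zeta> n (s, 0, 0) \<omega>)\<^sup>2) / (2 * (\<tau> n)\<^sup>2)"
      have "\<bar>(\<tau> n)\<^sup>2 / S * Q\<bar> = (\<tau> n)\<^sup>2 / S * \<bar>Q\<bar>" using S by (simp add: abs_mult)
      also have "\<dots> \<le> (\<tau> n)\<^sup>2 / S * (2 * \<bar>(T3 n \<omega> + T3' n \<omega>) / (\<tau> n)^3\<bar> + 20000 * (e n)^4 + 105 * (e n)\<^sup>2 * \<bar>\<zeta> n (0, 0, 0) \<omega> / \<tau> n\<bar>)"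
        using all w r S by (intro mult_left_mono) (auto simp: Q_def)
      also have "\<dots> = 2 * ((\<tau> n)\<^sup>2 / S * \<bar>(T3 n \<omega> + T3' n \<omega>) / (\<tau> n)^3\<bar>) + (\<tau> n)\<^sup>2 / S * (20000 * (e n)^4)
          + (\<tau> n)\<^sup>2 / S * (105 * (e n)\<^sup>2 * \<bar>\<zeta> n (0, 0, 0) \<omega> / \<tau> n\<bar>)"
        by (simp only: distrib_left mult.left_commute mult.commute)
      also have "(\<tau> n)\<^sup>2 / S * \<bar>(T3 n \<omega> + T3' n \<omega>) / (\<tau> n)^3\<bar> = \<bar>T3 n \<omega> / (\<tau> n * S) + T3' n \<omega> / (\<tau> n * S)\<bar>"
        using t S by (simp add: abs_mult power2_eq_square power3_eq_cube flip: add_divide_distrib)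
      also have "(\<tau> n)\<^sup>2 / S * (20000 * (e n)^4) = 20000 * (2304 * 2304) * (P n * S / (\<tau> n)\<^sup>2)"
        using t S by (simp add: e_def power4_eq_xxxx power2_eq_square flip: S_def)
      also have "(\<tau> n)\<^sup>2 / S * (105 * (e n)\<^sup>2 * \<bar>\<zeta> n (0, 0, 0) \<omega> / \<tau> n\<bar>) = 105 * 2304 * (S / \<tau> n) * \<bar>\<zeta> n (0, 0, 0) \<omega>\<bar>"
        using t S by (simp add: e_def power2_eq_square flip: S_def)
      finally show "\<bar>(\<tau> n)\<^sup>2 / sqrt (P n) * (inner_d (d1 n) (u n) (uh n \<omega>) - 1 + (\<Sum>s\<in>{1..<d1 n}. (\<zeta> n (s, 0, 0) \<omega>)\<^sup>2) / (2 * (\<tau> n)\<^sup>2))\<bar>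
       \<le> 2 * \<bar>T3 n \<omega> / (\<tau> n * sqrt (P n)) + T3' n \<omega> / (\<tau> n * sqrt (P n))\<bar>
        + 20000 * (2304 * 2304) * (P n * sqrt (P n) / (\<tau> n)\<^sup>2)
        + 105 * 2304 * (sqrt (P n) / \<tau> n) * \<bar>\<zeta> n (0, 0, 0) \<omega>\<bar>"
        by (simp only: S_def Q_def)
    qed
  qed
  show "op0 M (\<lambda>n \<omega>. \<tau> n * inner_d (d1 n) (f n 1) (uh n \<omega>) - \<zeta> n (1, 0, 0) \<omega>)"
  proof (rule op0_dominated)
    show "op0 M (\<lambda>n \<omega>. 528 * (sqrt (P n) / \<tau> n) * \<bar>\<zeta> n (1, 0, 0) \<omega>\<bar>
        + 2 * \<bar>T2 n \<omega> / \<tau> n + T2' n \<omega> / \<tau> n\<bar> + 800 * 110592 * (P n * sqrt (P n) / (\<tau> n)\<^sup>2))"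
      by (intro op0_add op0_cmult abs_op0 T2 T2' op0_tendsto op0_mult_Op1 abs_Op1 O1)
         (use tendsto_mult_right_zero[OF rate(1)] tendsto_mult_right_zero[OF rate(2)] in auto)
    show "whp M (\<lambda>n \<omega>. \<bar>\<tau> n * inner_d (d1 n) (f n 1) (uh n \<omega>) - \<zeta> n (1, 0, 0) \<omega>\<bar>
       \<le> 528 * (sqrt (P n) / \<tau> n) * \<bar>\<zeta> n (1, 0, 0) \<omega>\<bar>
        + 2 * \<bar>T2 n \<omega> / \<tau> n + T2' n \<omega> / \<tau> n\<bar> + 800 * 110592 * (P n * sqrt (P n) / (\<tau> n)\<^sup>2))"
    proof (rule whp_mono[OF rf], use key in \<open>rule eventually_mono\<close>, intro ballI impI)
      fix n \<omega>
      assume all: "\<forall>\<omega>\<in>space (M n). refined (d1 n) (d2 n) (d3 n) (noise (X n) (\<tau> n) \<omega>) (u n) (v n) (w n) (e n) (uh n \<omega>) \<longrightarrow>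
      \<bar>inner_d (d1 n) (u n) (uh n \<omega>) - 1\<bar> \<le> 50 * (e n)\<^sup>2 \<and>
      \<bar>inner_d (d1 n) (u n) (uh n \<omega>) - 1 + (\<Sum>s\<in>{1..<d1 n}. (\<zeta> n (s, 0, 0) \<omega>)\<^sup>2) / (2 * (\<tau> n)\<^sup>2)\<bar>
        \<le> 2 * \<bar>(T3 n \<omega> + T3' n \<omega>) / (\<tau> n)^3\<bar> + 20000 * (e n)^4 + 105 * (e n)\<^sup>2 * \<bar>\<zeta> n (0, 0, 0) \<omega> / \<tau> n\<bar> \<and>
      \<bar>inner_d (d1 n) (f n 1) (uh n \<omega>) - \<zeta> n (1, 0, 0) \<omega> / \<tau> n\<bar>
        \<le> 11 * e n * \<bar>\<zeta> n (1, 0, 0) \<omega> / \<tau> n\<bar> + 2 * \<bar>(T2 n \<omega> + T2' n \<omega>) / (\<tau> n)\<^sup>2\<bar> + 800 * (e n)^3"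
        and w: "\<omega> \<in> space (M n)" and r: "refined (d1 n) (d2 n) (d3 n) (noise (X n) (\<tau> n) \<omega>) (u n) (v n) (w n) (e n) (uh n \<omega>)"
      define S where "S = sqrt (P n)"
      have S: "S > 0" "P n = S * S" using sP[of n] PP[of n] by (auto simp: S_def)
      have t: "\<tau> n > 0" by (rule \<tau>)
      define Q where "Q = inner_d (d1 n) (f n 1) (uh n \<omega>) - \<zeta> n (1, 0, 0) \<omega> / \<tau> n"
      have "\<tau> n * inner_d (d1 n) (f n 1) (uh n \<omega>) - \<zeta> n (1, 0, 0) \<omega> = \<tau> n * Q" using t by (simp add: Q_def right_diff_distrib)
      then have "\<bar>\<tau> n * inner_d (d1 n) (f n 1) (uh n \<omega>) - \<zeta> n (1, 0, 0) \<omega>\<bar> = \<tau> n * \<bar>Q\<bar>" using t by (simp add: abs_mult)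
      also have "\<dots> \<le> \<tau> n * (11 * e n * \<bar>\<zeta> n (1, 0, 0) \<omega> / \<tau> n\<bar> + 2 * \<bar>(T2 n \<omega> + T2' n \<omega>) / (\<tau> n)\<^sup>2\<bar> + 800 * (e n)^3)"
        using all w r t by (intro mult_left_mono) (auto simp: Q_def)
      also have "\<dots> = \<tau> n * (11 * e n * \<bar>\<zeta> n (1, 0, 0) \<omega> / \<tau> n\<bar>) + 2 * (\<tau> n * \<bar>(T2 n \<omega> + T2' n \<omega>) / (\<tau> n)\<^sup>2\<bar>) + \<tau> n * (800 * (e n)^3)"
        by (simp only: distrib_left mult.left_commute mult.commute)
      also have "\<tau> n * (11 * e n * \<bar>\<zeta> n (1, 0, 0) \<omega> / \<tau> n\<bar>) = 528 * (S / \<tau> n) * \<bar>\<zeta> n (1, 0, 0) \<omega>\<bar>"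
        using t by (simp add: e_def flip: S_def)
      also have "\<tau> n * \<bar>(T2 n \<omega> + T2' n \<omega>) / (\<tau> n)\<^sup>2\<bar> = \<bar>T2 n \<omega> / \<tau> n + T2' n \<omega> / \<tau> n\<bar>"
        using t by (simp add: power2_eq_square flip: add_divide_distrib)
      also have "\<tau> n * (800 * (e n)^3) = 800 * 110592 * (P n * S / (\<tau> n)\<^sup>2)"
        using t S by (simp add: e_def power3_eq_cube power2_eq_square flip: S_def)
      finally show "\<bar>\<tau> n * inner_d (d1 n) (f n 1) (uh n \<omega>) - \<zeta> n (1, 0, 0) \<omega>\<bar>
       \<le> 528 * (sqrt (P n) / \<tau> n) * \<bar>\<zeta> n (1, 0, 0) \<omega>\<bar>
        + 2 * \<bar>T2 n \<omega> / \<tau> n + T2' n \<omega> / \<tau> n\<bar> + 800 * 110592 * (P n * sqrt (P n) / (\<tau> n)\<^sup>2)"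
        by (simp only: S_def)
    qed
  qed
qed

lemma whp_of_exists:
  assumes "\<forall>\<^sub>F n in sequentially. \<exists>A\<in>sets (M n). measure (M n) A \<le> b n \<and> (\<forall>\<omega>\<in>space (M n) - A. Q n \<omega>)" "b \<longlonglongrightarrow> 0"
  shows "whp M Q"
  unfolding whp_def
proof (intro allI impI)
  fix \<eta> :: real assume "\<eta> > 0"
  then have "\<forall>\<^sub>F n in sequentially. b n < \<eta>" using assms(2) by (simp add: order_tendstoD)
  with assms(1) show "\<forall>\<^sub>F n in sequentially. \<exists>A\<in>sets (M n). measure (M n) A \<le> \<eta> \<and> (\<forall>\<omega>\<in>space (M n) - A. Q n \<omega>)"
  proof eventually_elim
    case (elim n)
    then obtain A where "A \<in> sets (M n)" "measure (M n) A \<le> b n" "\<forall>\<omega>\<in>space (M n) - A. Q n \<omega>" by blast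
    with elim(2) show ?case by (intro bexI[of _ A]) auto
  qed
qed

section \<open>The spiked tensor model\<close>

text \<open>The first sequence is the inverse square of \<tau> / P^(3/4). Since P \<ge> 1, the
  second is at most the square root of the first.\<close>

lemma signal_rates:
  fixes P \<tau> :: "nat \<Rightarrow> real"
  assumes r: "filterlim (\<lambda>n. \<tau> n / P n powr (3/4)) at_top sequentially" and P: "\<And>n. 1 \<le> P n" and \<tau>: "\<And>n. 0 < \<tau> n"
  shows "(\<lambda>n. P n * sqrt (P n) / (\<tau> n)\<^sup>2) \<longlonglongrightarrow> 0" "(\<lambda>n. sqrt (P n) / \<tau> n) \<longlonglongrightarrow> 0"
proof -
  have "(\<lambda>n. (inverse (\<tau> n / P n powr (3/4)))\<^sup>2) \<longlonglongrightarrow> 0\<^sup>2"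
    by (intro tendsto_power tendsto_inverse_0_at_top r)
  moreover have eq: "(inverse (\<tau> n / P n powr (3/4)))\<^sup>2 = P n * sqrt (P n) / (\<tau> n)\<^sup>2" for n
  proof -
    have P0: "P n > 0" using P[of n] by linarith
    have "(P n powr (3/4))\<^sup>2 = P n powr (1 + 1/2)"
      using P0 by (simp add: power2_eq_square flip: powr_add)
    also have "\<dots> = P n * sqrt (P n)" unfolding powr_add using P0 by (simp add: powr_half_sqrt)
    finally show ?thesis by (simp add: power_divide)
  qed
  ultimately show 1: "(\<lambda>n. P n * sqrt (P n) / (\<tau> n)\<^sup>2) \<longlonglongrightarrow> 0" unfolding eq by simp
  have "(\<lambda>n. sqrt (P n * sqrt (P n) / (\<tau> n)\<^sup>2)) \<longlonglongrightarrow> 0" using tendsto_real_sqrt[OF 1] by simp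
  moreover have "sqrt (P n) / \<tau> n \<le> sqrt (P n * sqrt (P n) / (\<tau> n)\<^sup>2)" for n
  proof -
    have "P n * 1 \<le> P n * sqrt (P n)" using P[of n] by (intro mult_left_mono) auto
    then have "sqrt (P n) \<le> sqrt (P n * sqrt (P n))" by simp
    then have "sqrt (P n) / \<tau> n \<le> sqrt (P n * sqrt (P n)) / \<tau> n" using \<tau>[of n] by (intro divide_right_mono) auto
    then show ?thesis using \<tau>[of n] by (simp add: real_sqrt_divide)
  qed
  moreover have "0 \<le> sqrt (P n) / \<tau> n" for n using P[of n] \<tau>[of n] by (intro divide_nonneg_pos) auto
  ultimately show "(\<lambda>n. sqrt (P n) / \<tau> n) \<longlonglongrightarrow> 0"
    by (intro tendsto_sandwich[of "\<lambda>_. 0" "\<lambda>n. sqrt (P n) / \<tau> n" sequentially "\<lambda>n. sqrt (P n * sqrt (P n) / (\<tau> n)\<^sup>2)"]) auto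
qed

lemma exp_neg_tendsto:
  fixes P :: "nat \<Rightarrow> real"
  assumes "filterlim P at_top sequentially" "0 < c"
  shows "(\<lambda>n. exp (- c * P n)) \<longlonglongrightarrow> 0"
proof (rule filterlim_compose[OF exp_at_bot])
  have "filterlim (\<lambda>n. c * P n) at_top sequentially"
    by (rule filterlim_tendsto_pos_mult_at_top[OF tendsto_const assms(2,1)])
  then show "filterlim (\<lambda>n. - c * P n) at_bot sequentially" by (simp add: filterlim_uminus_at_bot)
qed

locale tpca =
  fixes c0 :: real and p1 p2 p3 :: "nat \<Rightarrow> nat" and lam sig :: "nat \<Rightarrow> real" and u v w :: "nat \<Rightarrow> vec"
    and M :: "nat \<Rightarrow> 'a measure" and Z :: "nat \<Rightarrow> 'a \<Rightarrow> tensor3" and g1 g2 g3 :: "nat \<Rightarrow> tensor3 \<Rightarrow> vec" and tmax :: "nat \<Rightarrow> nat"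
  assumes c0: "c0 > 0"
    and setting: "tpca_setting c0 p1 p2 p3 lam sig u v w M Z g1 g2 g3"
    and tmax3: "\<forall>\<^sub>F n in sequentially. 3 \<le> tmax n"
    and signal: "filterlim (\<lambda>n. (lam n / sig n) / pmax (p1 n) (p2 n) (p3 n) powr (3/4)) at_top sequentially"
begin

definition "\<tau> n = lam n / sig n"
definition "P n = pmax (p1 n) (p2 n) (p3 n)"
definition "X n = (\<lambda>(i, j, k) \<omega>. Z n \<omega> i j k / sig n)"
definition "e n = 48 * sqrt (P n) / \<tau> n"
definition "estimates = est p1 p2 p3 lam u v w Z g1 g2 g3 tmax"
definition "Uh n \<omega> = fst (estimates n \<omega>)"
definition "Vh n \<omega> = fst (snd (estimates n \<omega>))"
definition "Wh n \<omega> = snd (snd (estimates n \<omega>))"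
definition "A n \<omega> = obs (lam n) (u n) (v n) (w n) (Z n \<omega>)"
text \<open>The noise with mode 2, and in \<open>X3\<close> with mode 3, moved to the front. Results
  on a single mode are proved for mode 1 and applied to these.\<close>

definition "X2 n = (\<lambda>(j, i, k). X n (i, j, k))"
definition "X3 n = (\<lambda>(k, i, j). X n (i, j, k))"

lemma setting_facts:
  shows p_pos: "0 < p1 n" "0 < p2 n" "0 < p3 n"
    and p_lower: "c0 * P n \<le> real (p1 n)" "c0 * P n \<le> real (p2 n)" "c0 * P n \<le> real (p3 n)"
    and P_top: "filterlim P at_top sequentially"
    and lam_pos: "0 < lam n" and sig_pos: "0 < sig n"
    and units: "vnorm (p1 n) (u n) = 1" "vnorm (p2 n) (v n) = 1" "vnorm (p3 n) (w n) = 1"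
    and prob: "prob_space (M n)"
    and lead: "lead_lsv_mode1 (p1 n) (p2 n) (p3 n) B (g1 n B)" "lead_lsv_mode2 (p1 n) (p2 n) (p3 n) B (g2 n B)"
      "lead_lsv_mode3 (p1 n) (p2 n) (p3 n) B (g3 n B)"
    and init_meas: "i < p1 n \<Longrightarrow> (\<lambda>\<omega>. g1 n (A n \<omega>) i) \<in> borel_measurable (M n)"
      "i < p2 n \<Longrightarrow> (\<lambda>\<omega>. g2 n (A n \<omega>) i) \<in> borel_measurable (M n)"
      "i < p3 n \<Longrightarrow> (\<lambda>\<omega>. g3 n (A n \<omega>) i) \<in> borel_measurable (M n)"
  using setting unfolding tpca_setting_def P_def[abs_def] A_def by blast+

lemma p_le: "real (p1 n) \<le> P n" "real (p2 n) \<le> P n" "real (p3 n) \<le> P n"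
  by (auto simp: P_def pmax_def)

lemma P_ge1: "1 \<le> P n" using p_le(1)[of n] p_pos(1)[of n] by linarith
lemma tau_pos: "0 < \<tau> n" using lam_pos sig_pos by (simp add: \<tau>_def)
lemma e_nonneg: "0 \<le> e n" using P_ge1[of n] tau_pos[of n] by (simp add: e_def)

lemma rates: "(\<lambda>n. P n * sqrt (P n) / (\<tau> n)\<^sup>2) \<longlonglongrightarrow> 0" "(\<lambda>n. sqrt (P n) / \<tau> n) \<longlonglongrightarrow> 0"
  by (rule signal_rates[OF _ P_ge1 tau_pos], use signal in \<open>simp add: \<tau>_def P_def\<close>)+

lemma e_tendsto: "e \<longlonglongrightarrow> 0"
  using tendsto_mult_right_zero[OF rates(2), of 48] by (simp add: e_def[abs_def])

text \<open>Division by \<open>sig n\<close> keeps independence and standardizes the density. Images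
  in \<open>lborel\<close> and in \<open>borel\<close> agree because only the sigma-algebra of the
  target matters.\<close>

lemma iid_X: "iid_N01 (M n) (box (p1 n) (p2 n) (p3 n)) (X n)"
proof -
  interpret prob_space "M n" by (rule prob)
  have ind: "indep_vars (\<lambda>_. borel) (\<lambda>(i, j, k) \<omega>. Z n \<omega> i j k) (box (p1 n) (p2 n) (p3 n))"
    and dist: "\<And>i j k. i < p1 n \<Longrightarrow> j < p2 n \<Longrightarrow> k < p3 n \<Longrightarrow>
        distributed (M n) lborel (\<lambda>\<omega>. Z n \<omega> i j k) (\<lambda>x. ennreal (normal_density 0 (sig n) x))"
    using setting by (auto simp: tpca_setting_def box_def)
  have "indep_vars (\<lambda>_. borel) (\<lambda>x \<omega>. (\<lambda>(i, j, k) \<omega>. Z n \<omega> i j k) x \<omega> / sig n) (box (p1 n) (p2 n) (p3 n))"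
    by (rule indep_vars_compose2[OF ind]) simp
  then have "indep_vars (\<lambda>_. borel) (X n) (box (p1 n) (p2 n) (p3 n))"
    by (simp add: X_def split_def)
  moreover have "distr (M n) borel (X n x) = N01" if x: "x \<in> box (p1 n) (p2 n) (p3 n)" for x
  proof -
    obtain i j k where x: "x = (i, j, k)" "i < p1 n" "j < p2 n" "k < p3 n" using x by (cases x) (auto simp: box_def)
    have "distributed (M n) lborel (\<lambda>\<omega>. (Z n \<omega> i j k - 0) / sig n) (\<lambda>x. ennreal (std_normal_density x))"
      by (rule iffD1[OF normal_standard_normal_convert[OF sig_pos] dist[OF x(2-4)]])
    then have "distr (M n) lborel (X n x) = N01"
      by (simp add: distributed_def N01_def X_def x(1))
    moreover have "distr (M n) lborel (X n x) = distr (M n) borel (X n x)" by (rule distr_cong) auto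
    ultimately show ?thesis by simp
  qed
  ultimately show ?thesis using prob by (simp add: iid_N01_def)
qed

lemma iid_X2: "iid_N01 (M n) (box (p2 n) (p1 n) (p3 n)) (X2 n)"
  unfolding X2_def by (rule iid_N01_swap12[OF iid_X])
lemma iid_X3: "iid_N01 (M n) (box (p3 n) (p1 n) (p2 n)) (X3 n)"
  unfolding X3_def by (rule iid_N01_rotate_modes[OF iid_X])

lemma A_noise: "A n \<omega> i j k = lam n * (u n i * v n j * w n k + noise (X n) (\<tau> n) \<omega> i j k)"
  using lam_pos[of n] sig_pos[of n] by (simp add: A_def obs_def noise_def X_def \<tau>_def field_simps)

lemma noise_X2: "noise (X2 n) t \<omega> = (\<lambda>j i k. noise (X n) t \<omega> i j k)"
  and noise_X3: "noise (X3 n) t \<omega> = (\<lambda>k i j. noise (X n) t \<omega> i j k)"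
  by (simp_all add: noise_def X2_def X3_def)

text \<open>The event on which the estimates are controlled deterministically. The norm bound is
  recorded next to the three expansions because the estimate of \<lambda> uses it again.\<close>

definition good :: "nat \<Rightarrow> 'a \<Rightarrow> bool" where
  "good n \<omega> \<longleftrightarrow> tri_bound (p1 n) (p2 n) (p3 n) (noise (X n) (\<tau> n) \<omega>) (e n) \<and>
     refined (p1 n) (p2 n) (p3 n) (noise (X n) (\<tau> n) \<omega>) (u n) (v n) (w n) (e n) (Uh n \<omega>) \<and>
     refined (p2 n) (p1 n) (p3 n) (noise (X2 n) (\<tau> n) \<omega>) (v n) (u n) (w n) (e n) (Vh n \<omega>) \<and>
     refined (p3 n) (p1 n) (p2 n) (noise (X3 n) (\<tau> n) \<omega>) (w n) (u n) (v n) (e n) (Wh n \<omega>)"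

lemma whp_norm: "whp M (\<lambda>n \<omega>. tri_bound (p1 n) (p2 n) (p3 n) (noise (X n) (\<tau> n) \<omega>) (e n))"
proof (rule whp_of_exists)
  show "(\<lambda>n. exp (- 3 * P n)) \<longlonglongrightarrow> 0" by (rule exp_neg_tendsto[OF P_top]) simp
  show "\<forall>\<^sub>F n in sequentially. \<exists>A\<in>sets (M n). measure (M n) A \<le> exp (- 3 * P n) \<and>
      (\<forall>\<omega>\<in>space (M n) - A. tri_bound (p1 n) (p2 n) (p3 n) (noise (X n) (\<tau> n) \<omega>) (e n))"
  proof (rule always_eventually, rule allI)
    fix n
    obtain B where B: "B \<in> sets (M n)" "measure (M n) B \<le> exp (- 3 * P n)"
      "\<forall>\<omega>\<in>space (M n) - B. tri_bound (p1 n) (p2 n) (p3 n) (tens (X n) \<omega>) (48 * sqrt (P n))"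
      using tensor_norm_tail[OF iid_X p_pos p_le] by blast
    have "tri_bound (p1 n) (p2 n) (p3 n) (noise (X n) (\<tau> n) \<omega>) (e n)"
      if "tri_bound (p1 n) (p2 n) (p3 n) (tens (X n) \<omega>) (48 * sqrt (P n))" for \<omega>
      unfolding tri_bound_def
    proof (intro allI)
      fix a b c
      have "lam_hat (p1 n) (p2 n) (p3 n) (noise (X n) (\<tau> n) \<omega>) a b c = lam_hat (p1 n) (p2 n) (p3 n) (tens (X n) \<omega>) a b c / \<tau> n"
        using lam_hat_divide[of "p1 n" "p2 n" "p3 n" "tens (X n) \<omega>" "\<tau> n"] by (simp add: noise_def tens_def)
      then have "\<bar>lam_hat (p1 n) (p2 n) (p3 n) (noise (X n) (\<tau> n) \<omega>) a b c\<bar> = \<bar>lam_hat (p1 n) (p2 n) (p3 n) (tens (X n) \<omega>) a b c\<bar> / \<tau> n"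
        using tau_pos[of n] by simp
      also have "\<dots> \<le> 48 * sqrt (P n) * (vnorm (p1 n) a * vnorm (p2 n) b * vnorm (p3 n) c) / \<tau> n"
        using tri_boundD[OF that, of a b c] tau_pos[of n] by (intro divide_right_mono) auto
      finally show "\<bar>lam_hat (p1 n) (p2 n) (p3 n) (noise (X n) (\<tau> n) \<omega>) a b c\<bar> \<le> e n * (vnorm (p1 n) a * vnorm (p2 n) b * vnorm (p3 n) c)"
        by (simp add: e_def)
    qed
    with B show "\<exists>A\<in>sets (M n). measure (M n) A \<le> exp (- 3 * P n) \<and>
      (\<forall>\<omega>\<in>space (M n) - A. tri_bound (p1 n) (p2 n) (p3 n) (noise (X n) (\<tau> n) \<omega>) (e n))" by blast
  qed
qed

text \<open>Stated for an arbitrary family so that it applies to the three orientations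
  \<open>X\<close>, \<open>X2\<close>, \<open>X3\<close>. Division by \<tau>^2 turns the deviation
  into a quantity that tends to 0.\<close>

lemma whp_covariance:
  assumes iid: "\<And>n. iid_N01 (M n) (box (d1 n) (d2 n) (d3 n)) (Y n)"
    and d: "\<And>n. 0 < d1 n" "\<And>n. 0 < d2 n" "\<And>n. 0 < d3 n"
      "\<And>n. real (d1 n) \<le> P n" "\<And>n. real (d2 n) \<le> P n" "\<And>n. real (d3 n) \<le> P n"
  shows "whp M (\<lambda>n \<omega>. \<forall>y. vnorm (d1 n) y = 1 \<longrightarrow>
     \<bar>(\<Sum>j<d2 n. \<Sum>k<d3 n. (\<Sum>i<d1 n. y i * noise (Y n) (\<tau> n) \<omega> i j k)\<^sup>2) - real (d2 n * d3 n) / (\<tau> n)\<^sup>2\<bar>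
       \<le> 160 * (P n * sqrt (P n) / (\<tau> n)\<^sup>2))"
proof (rule whp_of_exists)
  show "(\<lambda>n. 4 * exp (- 6 * P n)) \<longlonglongrightarrow> 0"
    using tendsto_mult_right_zero[OF exp_neg_tendsto[OF P_top, of 6], of 4] by simp
  have "\<forall>\<^sub>F n in sequentially. 16 \<le> P n" using P_top by (simp add: filterlim_at_top)
  then show "\<forall>\<^sub>F n in sequentially. \<exists>A\<in>sets (M n). measure (M n) A \<le> 4 * exp (- 6 * P n) \<and>
      (\<forall>\<omega>\<in>space (M n) - A. \<forall>y. vnorm (d1 n) y = 1 \<longrightarrow>
     \<bar>(\<Sum>j<d2 n. \<Sum>k<d3 n. (\<Sum>i<d1 n. y i * noise (Y n) (\<tau> n) \<omega> i j k)\<^sup>2) - real (d2 n * d3 n) / (\<tau> n)\<^sup>2\<bar>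
       \<le> 160 * (P n * sqrt (P n) / (\<tau> n)\<^sup>2))"
  proof eventually_elim
    case (elim n)
    obtain B where B: "B \<in> sets (M n)" "measure (M n) B \<le> 4 * exp (- 6 * P n)" and
      bd: "\<And>\<omega> y. \<omega>\<in>space (M n) - B \<Longrightarrow> vnorm (d1 n) y = 1 \<Longrightarrow>
       \<bar>(\<Sum>j<d2 n. \<Sum>k<d3 n. (\<Sum>i<d1 n. y i * Y n (i, j, k) \<omega>)\<^sup>2) - real (d2 n * d3 n)\<bar> \<le> 160 * (P n * sqrt (P n))"
      using covariance_tail[OF iid d elim] by blast
    have "\<bar>(\<Sum>j<d2 n. \<Sum>k<d3 n. (\<Sum>i<d1 n. y i * noise (Y n) (\<tau> n) \<omega> i j k)\<^sup>2) - real (d2 n * d3 n) / (\<tau> n)\<^sup>2\<bar>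
       \<le> 160 * (P n * sqrt (P n) / (\<tau> n)\<^sup>2)" if w: "\<omega>\<in>space (M n) - B" "vnorm (d1 n) y = 1" for \<omega> y
    proof -
      have "(\<Sum>j<d2 n. \<Sum>k<d3 n. (\<Sum>i<d1 n. y i * noise (Y n) (\<tau> n) \<omega> i j k)\<^sup>2)
          = (\<Sum>j<d2 n. \<Sum>k<d3 n. (\<Sum>i<d1 n. y i * Y n (i, j, k) \<omega>)\<^sup>2) / (\<tau> n)\<^sup>2"
        by (simp add: noise_def sum_divide_distrib[symmetric] power_divide)
      then have "\<bar>(\<Sum>j<d2 n. \<Sum>k<d3 n. (\<Sum>i<d1 n. y i * noise (Y n) (\<tau> n) \<omega> i j k)\<^sup>2) - real (d2 n * d3 n) / (\<tau> n)\<^sup>2\<bar>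
        = \<bar>(\<Sum>j<d2 n. \<Sum>k<d3 n. (\<Sum>i<d1 n. y i * Y n (i, j, k) \<omega>)\<^sup>2) - real (d2 n * d3 n)\<bar> / (\<tau> n)\<^sup>2"
        by (simp add: diff_divide_distrib[symmetric])
      also have "\<dots> \<le> 160 * (P n * sqrt (P n)) / (\<tau> n)\<^sup>2" using bd[OF w] by (intro divide_right_mono) auto
      finally show ?thesis by simp
    qed
    with B show ?case by blast
  qed
qed

lemma whp_good: "whp M good"
proof -
  note c1 = whp_covariance[OF iid_X p_pos p_le]
  note c2 = whp_covariance[OF iid_X2 p_pos(2,1,3) p_le(2,1,3)]
  note c3 = whp_covariance[OF iid_X3 p_pos(3,1,2) p_le(3,1,2)]
  have "(\<lambda>n. 4 * e n + 2 * (160 * (P n * sqrt (P n) / (\<tau> n)\<^sup>2))) \<longlonglongrightarrow> 4 * 0 + 2 * (160 * 0)"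
    by (intro tendsto_intros rates e_tendsto)
  \<comment> \<open>3/100 serves two purposes: e \<le> 1/100 for the power iteration, and an
    alignment 1 - 4 e - 2 r of at least 1/4 for \<open>stage0\<close>.\<close>
  then have small: "\<forall>\<^sub>F n in sequentially. 4 * e n + 2 * (160 * (P n * sqrt (P n) / (\<tau> n)\<^sup>2)) < 3/100"
    by (intro order_tendstoD(2)) auto
  show ?thesis
  proof (rule whp_mono[OF whp_conj[OF whp_conj[OF whp_norm c1] whp_conj[OF c2 c3]]])
    show "\<forall>\<^sub>F n in sequentially. \<forall>\<omega>\<in>space (M n).
      (tri_bound (p1 n) (p2 n) (p3 n) (noise (X n) (\<tau> n) \<omega>) (e n) \<and>
       (\<forall>y. vnorm (p1 n) y = 1 \<longrightarrow> \<bar>(\<Sum>j<p2 n. \<Sum>k<p3 n. (\<Sum>i<p1 n. y i * noise (X n) (\<tau> n) \<omega> i j k)\<^sup>2) - real (p2 n * p3 n) / (\<tau> n)\<^sup>2\<bar>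
         \<le> 160 * (P n * sqrt (P n) / (\<tau> n)\<^sup>2))) \<and>
      (\<forall>y. vnorm (p2 n) y = 1 \<longrightarrow> \<bar>(\<Sum>j<p1 n. \<Sum>k<p3 n. (\<Sum>i<p2 n. y i * noise (X2 n) (\<tau> n) \<omega> i j k)\<^sup>2) - real (p1 n * p3 n) / (\<tau> n)\<^sup>2\<bar>
         \<le> 160 * (P n * sqrt (P n) / (\<tau> n)\<^sup>2)) \<and>
      (\<forall>y. vnorm (p3 n) y = 1 \<longrightarrow> \<bar>(\<Sum>j<p1 n. \<Sum>k<p2 n. (\<Sum>i<p3 n. y i * noise (X3 n) (\<tau> n) \<omega> i j k)\<^sup>2) - real (p1 n * p2 n) / (\<tau> n)\<^sup>2\<bar>
         \<le> 160 * (P n * sqrt (P n) / (\<tau> n)\<^sup>2)) \<longrightarrow> good n \<omega>"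
      using small tmax3
    proof eventually_elim
      case (elim n)
      define r where "r = 160 * (P n * sqrt (P n) / (\<tau> n)\<^sup>2)"
      have r0: "0 \<le> r" using P_ge1[of n] by (simp add: r_def)
      have e1: "e n \<le> 1/100" and al: "1/4 \<le> 1 - 4 * e n - 2 * r"
        using elim(1) e_nonneg[of n] r0 unfolding r_def[symmetric] by linarith+
      show ?case
      proof (intro ballI impI, elim conjE)
        fix \<omega>
        let ?E = "noise (X n) (\<tau> n) \<omega>"
        assume tb: "tri_bound (p1 n) (p2 n) (p3 n) ?E (e n)"
          and b1: "\<forall>y. vnorm (p1 n) y = 1 \<longrightarrow> \<bar>(\<Sum>j<p2 n. \<Sum>k<p3 n. (\<Sum>i<p1 n. y i * ?E i j k)\<^sup>2) - real (p2 n * p3 n) / (\<tau> n)\<^sup>2\<bar> \<le> 160 * (P n * sqrt (P n) / (\<tau> n)\<^sup>2)"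
          and b2: "\<forall>y. vnorm (p2 n) y = 1 \<longrightarrow> \<bar>(\<Sum>j<p1 n. \<Sum>k<p3 n. (\<Sum>i<p2 n. y i * noise (X2 n) (\<tau> n) \<omega> i j k)\<^sup>2) - real (p1 n * p3 n) / (\<tau> n)\<^sup>2\<bar> \<le> 160 * (P n * sqrt (P n) / (\<tau> n)\<^sup>2)"
          and b3: "\<forall>y. vnorm (p3 n) y = 1 \<longrightarrow> \<bar>(\<Sum>j<p1 n. \<Sum>k<p2 n. (\<Sum>i<p3 n. y i * noise (X3 n) (\<tau> n) \<omega> i j k)\<^sup>2) - real (p1 n * p2 n) / (\<tau> n)\<^sup>2\<bar> \<le> 160 * (P n * sqrt (P n) / (\<tau> n)\<^sup>2)"
        define A2 where "A2 = (\<lambda>j i k. A n \<omega> i j k)"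
        define A3 where "A3 = (\<lambda>k i j. A n \<omega> i j k)"
        have A2: "A2 j i k = lam n * (v n j * u n i * w n k + noise (X2 n) (\<tau> n) \<omega> j i k)" for j i k
          by (simp add: A2_def A_noise noise_X2)
        have A3: "A3 k i j = lam n * (w n k * u n i * v n j + noise (X3 n) (\<tau> n) \<omega> k i j)" for k i j
          by (simp add: A3_def A_noise noise_X3)
        have tb2: "tri_bound (p2 n) (p1 n) (p3 n) (noise (X2 n) (\<tau> n) \<omega>) (e n)"
          unfolding noise_X2 by (rule tri_bound_swap12[OF tb])
        have tb3: "tri_bound (p3 n) (p1 n) (p2 n) (noise (X3 n) (\<tau> n) \<omega>) (e n)"
          unfolding noise_X3 by (rule tri_bound_rotate[OF tb])
        have l1: "lead_lsv1 (p1 n) (p2 n) (p3 n) (A n \<omega>) (g1 n (A n \<omega>))"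
          using lead(1) by (simp add: lead_lsv_mode1_def)
        have l2: "lead_lsv1 (p2 n) (p1 n) (p3 n) A2 (g2 n (A n \<omega>))"
          using lead(2)[of n "A n \<omega>"] by (simp add: lead_lsv_mode2_def A2_def)
        have l3: "lead_lsv1 (p3 n) (p1 n) (p2 n) A3 (g3 n (A n \<omega>))"
          using lead(3)[of n "A n \<omega>"] by (simp add: lead_lsv_mode3_def A3_def)
        have s1: "stage0 (p1 n) (u n) (g1 n (A n \<omega>))"
          using leading_alignment[OF A_noise lam_pos units tb e_nonneg b1[rule_format] l1] al l1 units
          by (intro stage0_init) (auto simp: lead_lsv1_def r_def)
        have s2: "stage0 (p2 n) (v n) (g2 n (A n \<omega>))"
          using leading_alignment[OF A2 lam_pos units(2,1,3) tb2 e_nonneg b2[rule_format] l2] al l2 units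
          by (intro stage0_init) (auto simp: lead_lsv1_def r_def)
        have s3: "stage0 (p3 n) (w n) (g3 n (A n \<omega>))"
          using leading_alignment[OF A3 lam_pos units(3,1,2) tb3 e_nonneg b3[rule_format] l3] al l3 units
          by (intro stage0_init) (auto simp: lead_lsv1_def r_def)
        have out: "alg4_uvw (p1 n) (p2 n) (p3 n) (A n \<omega>) (g1 n (A n \<omega>)) (g2 n (A n \<omega>)) (g3 n (A n \<omega>)) (tmax n) (u n) (v n) (w n)
            = (Uh n \<omega>, Vh n \<omega>, Wh n \<omega>)"
          by (simp add: Uh_def Vh_def Wh_def estimates_def est_def Let_def A_def)
        show "good n \<omega>"
          unfolding good_def noise_X2 noise_X3
          using power_iter_refined[OF A_noise lam_pos tb e_nonneg e1 units s1 s2 s3 elim(2) out] tb by blast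
      qed
    qed
  qed
qed

end

lemma Op1_dominated:
  assumes Y: "Op1 M Y" and le: "whp M (\<lambda>n \<omega>. \<bar>X n \<omega>\<bar> \<le> \<bar>Y n \<omega>\<bar>)"
  shows "Op1 M X"
  unfolding Op1_def
proof (intro allI impI)
  fix \<eta> :: real assume "\<eta> > 0"
  then have h: "\<eta> / 2 > 0" by simp
  obtain K where K: "\<forall>\<^sub>F n in sequentially. \<exists>A\<in>sets (M n). measure (M n) A \<le> \<eta>/2 \<and> (\<forall>\<omega>\<in>space (M n) - A. \<bar>Y n \<omega>\<bar> \<le> K)"
    using Y h unfolding Op1_def by blast
  have "\<forall>\<^sub>F n in sequentially. \<exists>A\<in>sets (M n). measure (M n) A \<le> \<eta>/2 \<and> (\<forall>\<omega>\<in>space (M n) - A. \<bar>X n \<omega>\<bar> \<le> \<bar>Y n \<omega>\<bar>)"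
    using le h unfolding whp_def by blast
  with K show "\<exists>K. \<forall>\<^sub>F n in sequentially. \<exists>A\<in>sets (M n). measure (M n) A \<le> \<eta> \<and> (\<forall>\<omega>\<in>space (M n) - A. \<bar>X n \<omega>\<bar> \<le> K)"
  proof (intro exI[of _ K], eventually_elim)
    case (elim n)
    then obtain A B where A: "A \<in> sets (M n)" "measure (M n) A \<le> \<eta>/2" "\<forall>\<omega>\<in>space (M n) - A. \<bar>Y n \<omega>\<bar> \<le> K"
      and B: "B \<in> sets (M n)" "measure (M n) B \<le> \<eta>/2" "\<forall>\<omega>\<in>space (M n) - B. \<bar>X n \<omega>\<bar> \<le> \<bar>Y n \<omega>\<bar>" by blast
    have "measure (M n) (A \<union> B) \<le> \<eta>" using measure_Un_le[OF A(1) B(1)] A(2) B(2) by linarith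
    moreover have "\<bar>X n \<omega>\<bar> \<le> K" if w: "\<omega> \<in> space (M n) - (A \<union> B)" for \<omega>
      using A(3)[rule_format, of \<omega>] B(3)[rule_format, of \<omega>] w by simp
    ultimately show ?case using A(1) B(1) by (intro bexI[of _ "A \<union> B"]) auto
  qed
qed

lemma op0_abs: "op0 M Y \<Longrightarrow> op0 M (\<lambda>n \<omega>. \<bar>Y n \<omega>\<bar>)"
  by (simp add: op0_def)

lemma op0_dominated_ev:
  assumes "op0 M Y" "\<forall>\<^sub>F n in sequentially. \<forall>\<omega>\<in>space (M n). \<bar>X n \<omega>\<bar> \<le> \<bar>Y n \<omega>\<bar>"
  shows "op0 M X"
  by (rule op0_dominated[OF op0_abs[OF assms(1)] whp_eventually[OF assms(2)]])

lemma Op1_dominated_ev: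
  assumes "Op1 M Y" "\<forall>\<^sub>F n in sequentially. \<forall>\<omega>\<in>space (M n). \<bar>X n \<omega>\<bar> \<le> \<bar>Y n \<omega>\<bar>"
  shows "Op1 M X"
  by (rule Op1_dominated[OF assms(1) whp_eventually[OF assms(2)]])

lemma Op1_of_close:
  assumes "op0 M (\<lambda>n \<omega>. X n \<omega> - Y n \<omega>)" "Op1 M Y" shows "Op1 M X"
  using Op1_add[OF op0_imp_Op1[OF assms(1)] assms(2)] by simp

section \<open>Limit theorems\<close>

text \<open>q splits into its component along u and a residual of norm sqrt (1 - \<rho>^2), whose
  direction becomes \<open>f 1\<close>. When the residual vanishes, any unit vector orthogonal to u
  may take its place; 2 \<le> d ensures that one exists.\<close>

lemma unit_decomposition:
  assumes u: "vnorm d u = 1" and q: "vnorm d q = 1" and d: "2 \<le> d"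
  obtains f where "orthonormal d d f" "f 0 = u"
    "\<And>x. inner_d d q x = inner_d d q u * inner_d d u x + sqrt (1 - (inner_d d q u)\<^sup>2) * inner_d d (f 1) x"
proof -
  define \<rho> where "\<rho> = inner_d d q u"
  define r where "r = (\<lambda>i. q i - \<rho> * u i)"
  have uu: "inner_d d u u = 1" "inner_d d q q = 1" using u q vnorm_square[of d u] vnorm_square[of d q] by auto
  have ru: "inner_d d r u = 0" by (simp add: r_def inner_d_linear uu flip: \<rho>_def)
  have rr: "(vnorm d r)\<^sup>2 = 1 - \<rho>\<^sup>2"
    by (simp add: vnorm_square r_def inner_d_linear uu inner_d_commute[of d u q] flip: \<rho>_def) (simp add: power2_eq_square)
  then have s: "sqrt (1 - \<rho>\<^sup>2) = vnorm d r" by (metis real_sqrt_unique vnorm_nonneg)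
  have qx: "inner_d d q x = \<rho> * inner_d d u x + inner_d d r x" for x by (simp add: r_def inner_d_linear)
  show thesis
  proof (cases "vnorm d r = 0")
    case True
    obtain q' where q': "vnorm d q' = 1" "inner_d d q' u = 0" using exists_orthogonal_unit[OF u d] .
    obtain f where f: "orthonormal d d f" "f 0 = u" "f 1 = q'" using orthonormal_basis_pair[OF u q' d] .
    have z: "inner_d d r x = 0" for x using inner_d_CS[of d r x] True by simp
    show thesis
    proof (rule that[OF f(1,2)])
      fix x
      show "inner_d d q x = inner_d d q u * inner_d d u x + sqrt (1 - (inner_d d q u)\<^sup>2) * inner_d d (f 1) x"
        unfolding \<rho>_def[symmetric] s qx[of x] z by (simp add: True)
    qed
  next
    case False
    define q' where "q' = (\<lambda>i. (1 / vnorm d r) * r i)"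
    have n: "vnorm d q' = 1" unfolding q'_def vnorm_scale using False by simp
    have o: "inner_d d q' u = 0" unfolding q'_def inner_d_scale_left ru by simp
    obtain f where f: "orthonormal d d f" "f 0 = u" "f 1 = q'" using orthonormal_basis_pair[OF u n o d] .
    have z: "vnorm d r * inner_d d (f 1) x = inner_d d r x" for x
      unfolding f(3) q'_def inner_d_scale_left using False by simp
    show thesis
    proof (rule that[OF f(1,2)])
      fix x
      show "inner_d d q x = inner_d d q u * inner_d d u x + sqrt (1 - (inner_d d q u)\<^sup>2) * inner_d d (f 1) x"
        unfolding \<rho>_def[symmetric] s qx[of x] z ..
    qed
  qed
qed

section \<open>Standardized linear functionals of one mode\<close>

definition clt_denominator :: "nat \<Rightarrow> real \<Rightarrow> real \<Rightarrow> real" where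
  "clt_denominator d \<tau> \<rho> = sqrt (real d * \<rho>\<^sup>2 / (2 * \<tau>^4) + (1 - \<rho>\<^sup>2) / \<tau>\<^sup>2)"

text \<open>Coefficient of the normal part in the standardized statistic;
  \<open>clt_quadratic\<close> is that of the chi-square part, scaled to asymptotically unit
  variance. Either may dominate along the sequence, so neither part can be discarded.\<close>

definition clt_linear :: "nat \<Rightarrow> real \<Rightarrow> real \<Rightarrow> real" where
  "clt_linear d \<tau> \<rho> = sqrt (1 - \<rho>\<^sup>2) / (\<tau> * clt_denominator d \<tau> \<rho>)"

definition clt_quadratic :: "nat \<Rightarrow> real \<Rightarrow> real \<Rightarrow> real" where
  "clt_quadratic d \<tau> \<rho> = \<rho> * sqrt (real d / 2) / (\<tau>\<^sup>2 * clt_denominator d \<tau> \<rho>)"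

lemma clt_weights:
  assumes "\<bar>\<rho>\<bar> \<le> 1" "0 < \<tau>" "0 < d"
  shows "0 < clt_denominator d \<tau> \<rho>" "(clt_linear d \<tau> \<rho>)\<^sup>2 + (clt_quadratic d \<tau> \<rho>)\<^sup>2 = 1"
proof -
  have r1: "0 \<le> 1 - \<rho>\<^sup>2" using assms(1) by (simp add: abs_square_le_1)
  define D2 where "D2 = real d * \<rho>\<^sup>2 / (2 * \<tau>^4) + (1 - \<rho>\<^sup>2) / \<tau>\<^sup>2"
  have pos: "D2 > 0"
  proof (cases "\<rho> = 0")
    case True
    then show ?thesis using assms by (simp add: D2_def)
  next
    case False
    then have "0 < real d * \<rho>\<^sup>2 / (2 * \<tau>^4)" using assms by simp
    moreover have "0 \<le> (1 - \<rho>\<^sup>2) / \<tau>\<^sup>2" using r1 by simp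
    ultimately show ?thesis unfolding D2_def by linarith
  qed
  then show "0 < clt_denominator d \<tau> \<rho>" by (simp add: clt_denominator_def D2_def)
  have sq: "(clt_denominator d \<tau> \<rho>)\<^sup>2 = D2" using pos by (simp add: clt_denominator_def D2_def)
  have "(clt_linear d \<tau> \<rho>)\<^sup>2 + (clt_quadratic d \<tau> \<rho>)\<^sup>2 = ((1 - \<rho>\<^sup>2) / \<tau>\<^sup>2 + \<rho>\<^sup>2 * (real d / 2) / \<tau>^4) / D2"
    using r1 by (simp add: clt_linear_def clt_quadratic_def power_divide power_mult_distrib sq add_divide_distrib flip: power_mult)
  also have "(1 - \<rho>\<^sup>2) / \<tau>\<^sup>2 + \<rho>\<^sup>2 * (real d / 2) / \<tau>^4 = D2" by (simp add: D2_def)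
  finally show "(clt_linear d \<tau> \<rho>)\<^sup>2 + (clt_quadratic d \<tau> \<rho>)\<^sup>2 = 1" using pos by simp
qed

text \<open>Index 0 is absent because the slope is orthogonal to the true vector. The square of
  index 1 is left out of the chi-square sum so that the two parts are independent; its contribution
  is shown to be negligible in \<open>clt_mode\<close>.\<close>

definition mixture :: "nat \<Rightarrow> real \<Rightarrow> real \<Rightarrow> (nat \<Rightarrow> 'a \<Rightarrow> real) \<Rightarrow> 'a \<Rightarrow> real" where
  "mixture d c a Y \<omega> = c * Y 1 \<omega> - a / sqrt (2 * real d) * (\<Sum>i\<in>{2..<d}. (Y i \<omega>)\<^sup>2 - 1)"

text \<open>The denominator dominates both |\<rho>| sqrt (d/2) / \<tau>^2 and sqrt (1 - \<rho>^2) /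
  \<tau>; the first bound absorbs the radial error, the second the tangential one. The third term
  stems from the centring: the statistic is centred by d, the chi-square sum without index 1 by d -
  2, and this leaves y^2 - 2.\<close>

lemma clt_stat_error:
  assumes dec: "\<And>x. inner_d d q x = \<rho> * inner_d d u x + sqrt (1 - \<rho>\<^sup>2) * inner_d d f x"
    and \<rho>: "\<rho> = inner_d d q u" "\<bar>\<rho>\<bar> \<le> 1" and u: "inner_d d u u = 1" "inner_d d f u = 0" and \<tau>: "0 < \<tau>" and d: "2 \<le> d"
    and P: "0 < P" "c0 * P \<le> real d" "0 < c0"
  shows "\<bar>clt_stat d \<tau> q u uh - mixture d (clt_linear d \<tau> \<rho>) (clt_quadratic d \<tau> \<rho>) Y \<omega>\<bar>
     \<le> sqrt (2 / c0) * \<bar>\<tau>\<^sup>2 / sqrt P * (inner_d d u uh - 1 + (\<Sum>s\<in>{1..<d}. (Y s \<omega>)\<^sup>2) / (2 * \<tau>\<^sup>2))\<bar>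
       + \<bar>\<tau> * inner_d d f uh - Y 1 \<omega>\<bar> + 1 / sqrt (2 * c0) * (1 / sqrt P * \<bar>(Y 1 \<omega>)\<^sup>2 - 2\<bar>)"
proof -
  define D where "D = clt_denominator d \<tau> \<rho>"
  define s where "s = sqrt (1 - \<rho>\<^sup>2)"
  define A where "A = inner_d d u uh - 1 + (\<Sum>s\<in>{1..<d}. (Y s \<omega>)\<^sup>2) / (2 * \<tau>\<^sup>2)"
  define B where "B = \<tau> * inner_d d f uh - Y 1 \<omega>"
  define y where "y = Y 1 \<omega>"
  define S where "S = (\<Sum>i\<in>{2..<d}. (Y i \<omega>)\<^sup>2 - 1)"
  have r1: "0 \<le> 1 - \<rho>\<^sup>2" using \<rho>(2) by (simp add: abs_square_le_1)
  have D: "0 < D" using clt_weights(1)[OF \<rho>(2) \<tau>] d by (simp add: D_def)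
  have "{1..<d} = insert 1 {2..<d}" using d by auto
  then have sum: "(\<Sum>s\<in>{1..<d}. (Y s \<omega>)\<^sup>2) = y\<^sup>2 + S + (real d - 2)"
    using d by (simp add: S_def y_def sum_subtractf of_nat_diff)
  have quot: "clt_quadratic d \<tau> \<rho> / sqrt (2 * real d) = \<rho> / (2 * \<tau>\<^sup>2 * D)"
  proof -
    have "sqrt (real d / 2) / sqrt (2 * real d) = 1 / 2"
      using d by (simp flip: real_sqrt_divide) (simp add: real_sqrt_divide)
    then show ?thesis by (simp add: clt_quadratic_def D_def field_simps)
  qed
  have uh: "inner_d d f uh = (B + y) / \<tau>" using \<tau> by (simp add: B_def y_def)
  have al: "inner_d d u uh = A + 1 - (y\<^sup>2 + S + (real d - 2)) / (2 * \<tau>\<^sup>2)" by (simp only: A_def sum)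
  have "inner_d d q (\<lambda>i. uh i - u i) = \<rho> * inner_d d u uh + s * inner_d d f uh - \<rho>"
    using dec[of uh] by (simp add: inner_d_diff_right s_def \<rho>(1))
  then have num: "inner_d d q (\<lambda>i. uh i - u i) + real d * inner_d d q u / (2 * \<tau>\<^sup>2)
      = \<rho> * A + s / \<tau> * B + s / \<tau> * y - \<rho> / (2 * \<tau>\<^sup>2) * S - \<rho> / (2 * \<tau>\<^sup>2) * (y\<^sup>2 - 2)"
    unfolding uh al \<rho>(1)[symmetric] by (simp add: algebra_simps add_divide_distrib diff_divide_distrib)
  have stat: "clt_stat d \<tau> q u uh = (\<rho> * A + s / \<tau> * B + s / \<tau> * y - \<rho> / (2 * \<tau>\<^sup>2) * S - \<rho> / (2 * \<tau>\<^sup>2) * (y\<^sup>2 - 2)) / D"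
    unfolding clt_stat_def num by (simp add: D_def clt_denominator_def \<rho>(1))
  have mix: "mixture d (clt_linear d \<tau> \<rho>) (clt_quadratic d \<tau> \<rho>) Y \<omega> = (s / \<tau> * y - \<rho> / (2 * \<tau>\<^sup>2) * S) / D"
    unfolding mixture_def quot using \<tau> D by (simp add: clt_linear_def s_def y_def S_def diff_divide_distrib flip: D_def)
  have diff: "clt_stat d \<tau> q u uh - mixture d (clt_linear d \<tau> \<rho>) (clt_quadratic d \<tau> \<rho>) Y \<omega>
      = \<rho> / D * A + s / (\<tau> * D) * B - \<rho> / (2 * \<tau>\<^sup>2 * D) * (y\<^sup>2 - 2)"
    unfolding stat mix by (simp add: algebra_simps add_divide_distrib diff_divide_distrib)
  have D1: "\<bar>\<rho>\<bar> * sqrt (real d / 2) / \<tau>\<^sup>2 \<le> D"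
  proof -
    have "\<bar>\<rho>\<bar> * sqrt (real d / 2) / \<tau>\<^sup>2 = sqrt (real d * \<rho>\<^sup>2 / (2 * \<tau>^4))"
    proof -
      have "real d * \<rho>\<^sup>2 / (2 * \<tau>^4) = (\<bar>\<rho>\<bar> * sqrt (real d / 2) / \<tau>\<^sup>2)\<^sup>2"
        by (simp add: power_divide power_mult_distrib flip: power_mult)
      then show ?thesis by (simp add: real_sqrt_abs)
    qed
    also have "\<dots> \<le> D" unfolding D_def clt_denominator_def using r1 by simp
    finally show ?thesis .
  qed
  have D2: "s / \<tau> \<le> D"
  proof -
    have "s / \<tau> = sqrt ((1 - \<rho>\<^sup>2) / \<tau>\<^sup>2)" using \<tau> by (simp add: s_def real_sqrt_divide)
    also have "\<dots> \<le> D" unfolding D_def clt_denominator_def by simp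
    finally show ?thesis .
  qed
  have dP: "c0 * P > 0" using P by simp
  have q1: "\<bar>\<rho> / D\<bar> \<le> sqrt (2 / c0) * (\<tau>\<^sup>2 / sqrt P)"
  proof -
    have dpos: "sqrt (real d / 2) > 0" using d by simp
    have "\<bar>\<rho>\<bar> * sqrt (real d / 2) \<le> D * \<tau>\<^sup>2" using D1 \<tau> by (simp add: divide_le_eq)
    then have "\<bar>\<rho>\<bar> \<le> D * \<tau>\<^sup>2 / sqrt (real d / 2)" using dpos by (simp add: le_divide_eq)
    then have "\<bar>\<rho>\<bar> / D \<le> \<tau>\<^sup>2 / sqrt (real d / 2)" using D by (simp add: divide_le_eq mult_ac)
    also have "\<dots> \<le> \<tau>\<^sup>2 / sqrt (c0 * P / 2)"
    proof (rule divide_left_mono)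
      show "sqrt (c0 * P / 2) \<le> sqrt (real d / 2)" using P by simp
      have "0 < sqrt (c0 * P / 2)" by (rule real_sqrt_gt_zero) (use dP in linarith)
      then show "0 < sqrt (real d / 2) * sqrt (c0 * P / 2)" by (intro mult_pos_pos dpos)
    qed simp
    also have "\<dots> = sqrt (2 / c0) * (\<tau>\<^sup>2 / sqrt P)" using P by (simp add: real_sqrt_divide real_sqrt_mult)
    finally show ?thesis using D by simp
  qed
  have q2: "\<bar>s / (\<tau> * D)\<bar> \<le> 1"
  proof -
    have "0 \<le> s" using r1 by (simp add: s_def)
    moreover have "s \<le> \<tau> * D" using D2 \<tau> by (simp add: divide_le_eq mult.commute)
    ultimately show ?thesis using \<tau> D by simp
  qed
  have q3: "\<bar>\<rho> / (2 * \<tau>\<^sup>2 * D)\<bar> \<le> 1 / sqrt (2 * c0) * (1 / sqrt P)"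
  proof -
    have "\<bar>\<rho> / (2 * \<tau>\<^sup>2 * D)\<bar> = \<bar>\<rho> / D\<bar> / (2 * \<tau>\<^sup>2)" using \<tau> D by (simp add: abs_mult)
    also have "\<dots> \<le> sqrt (2 / c0) * (\<tau>\<^sup>2 / sqrt P) / (2 * \<tau>\<^sup>2)" by (intro divide_right_mono q1) simp
    also have "\<dots> = sqrt (2 / c0) / 2 * (1 / sqrt P)" using \<tau> by simp
    also have "sqrt (2 / c0) / 2 = 1 / sqrt (2 * c0)"
    proof -
      have "sqrt 2 * sqrt 2 = (2::real)" by simp
      then show ?thesis using P(3) by (simp add: real_sqrt_divide real_sqrt_mult field_simps)
    qed
    finally show ?thesis .
  qed
  have tri: "\<bar>x + y - z\<bar> \<le> \<bar>x\<bar> + \<bar>y\<bar> + \<bar>z\<bar>" for x y z :: real by linarith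
  have "\<bar>\<rho> / D * A + s / (\<tau> * D) * B - \<rho> / (2 * \<tau>\<^sup>2 * D) * (y\<^sup>2 - 2)\<bar>
     \<le> \<bar>\<rho> / D\<bar> * \<bar>A\<bar> + \<bar>s / (\<tau> * D)\<bar> * \<bar>B\<bar> + \<bar>\<rho> / (2 * \<tau>\<^sup>2 * D)\<bar> * \<bar>y\<^sup>2 - 2\<bar>"
    unfolding abs_mult[symmetric] by (rule tri)
  also have "\<dots> \<le> sqrt (2 / c0) * (\<tau>\<^sup>2 / sqrt P) * \<bar>A\<bar> + 1 * \<bar>B\<bar> + 1 / sqrt (2 * c0) * (1 / sqrt P) * \<bar>y\<^sup>2 - 2\<bar>"
    by (intro add_mono mult_right_mono q1 q2 q3) auto
  also have "sqrt (2 / c0) * (\<tau>\<^sup>2 / sqrt P) * \<bar>A\<bar> = sqrt (2 / c0) * \<bar>\<tau>\<^sup>2 / sqrt P * A\<bar>"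
    using P by (simp add: abs_mult)
  finally show ?thesis unfolding diff by (simp add: A_def B_def y_def mult.assoc)
qed

text \<open>All three error terms of \<open>clt_stat_error\<close> are o_P(1): two by the mode
  expansion, the third because a tight variable is divided by sqrt P.\<close>

lemma clt_mode:
  fixes d :: "nat \<Rightarrow> nat" and P \<tau> :: "nat \<Rightarrow> real" and Y :: "nat \<Rightarrow> nat \<Rightarrow> 'a \<Rightarrow> real"
  assumes P: "filterlim P at_top sequentially" "\<And>n. 1 \<le> P n" "\<And>n. c0 * P n \<le> real (d n)" "0 < c0" and \<tau>: "\<And>n. 0 < \<tau> n"
    and dec: "\<forall>\<^sub>F n in sequentially. 2 \<le> d n \<and> vnorm (d n) (u n) = 1 \<and> vnorm (d n) (q n) = 1 \<and> inner_d (d n) (f n) (u n) = 0 \<and>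
      (\<forall>x. inner_d (d n) (q n) x = inner_d (d n) (q n) (u n) * inner_d (d n) (u n) x
         + sqrt (1 - (inner_d (d n) (q n) (u n))\<^sup>2) * inner_d (d n) (f n) x)"
    and A: "op0 M (\<lambda>n \<omega>. (\<tau> n)\<^sup>2 / sqrt (P n) * (inner_d (d n) (u n) (uh n \<omega>) - 1 + (\<Sum>s\<in>{1..<d n}. (Y n s \<omega>)\<^sup>2) / (2 * (\<tau> n)\<^sup>2)))"
    and B: "op0 M (\<lambda>n \<omega>. \<tau> n * inner_d (d n) (f n) (uh n \<omega>) - Y n 1 \<omega>)"
    and C: "Op1 M (\<lambda>n. Y n 1)"
  shows "op0 M (\<lambda>n \<omega>. clt_stat (d n) (\<tau> n) (q n) (u n) (uh n \<omega>)
      - mixture (d n) (clt_linear (d n) (\<tau> n) (inner_d (d n) (q n) (u n))) (clt_quadratic (d n) (\<tau> n) (inner_d (d n) (q n) (u n))) (Y n) \<omega>)"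
    "\<forall>\<^sub>F n in sequentially. (clt_linear (d n) (\<tau> n) (inner_d (d n) (q n) (u n)))\<^sup>2 + (clt_quadratic (d n) (\<tau> n) (inner_d (d n) (q n) (u n)))\<^sup>2 = 1"
proof -
  have sq: "(\<lambda>n. 1 / sqrt (P n)) \<longlonglongrightarrow> 0"
    using tendsto_inverse_0_at_top[OF filterlim_compose[OF sqrt_at_top P(1)]] by (simp add: inverse_eq_divide)
  have c2: "op0 M (\<lambda>n \<omega>. 1 / sqrt (P n) * \<bar>(Y n 1 \<omega>)\<^sup>2 - 2\<bar>)"
  proof -
    have "op0 M (\<lambda>n \<omega>. 1 / sqrt (P n) * Y n 1 \<omega> * Y n 1 \<omega> - 1 / sqrt (P n) * 2)"
      by (intro op0_diff op0_mult_Op1 C op0_tendsto sq Op1_const)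
    then have "op0 M (\<lambda>n \<omega>. \<bar>1 / sqrt (P n) * Y n 1 \<omega> * Y n 1 \<omega> - 1 / sqrt (P n) * 2\<bar>)" by (rule op0_abs)
    moreover have "\<bar>1 / sqrt (P n) * Y n 1 \<omega> * Y n 1 \<omega> - 1 / sqrt (P n) * 2\<bar> = 1 / sqrt (P n) * \<bar>(Y n 1 \<omega>)\<^sup>2 - 2\<bar>" for n \<omega>
    proof -
      have "1 / sqrt (P n) * Y n 1 \<omega> * Y n 1 \<omega> - 1 / sqrt (P n) * 2 = 1 / sqrt (P n) * ((Y n 1 \<omega>)\<^sup>2 - 2)"
        by (simp add: power2_eq_square diff_divide_distrib)
      moreover have "0 < sqrt (P n)" using P(2)[of n] by simp
      ultimately show ?thesis by (simp only: abs_mult) simp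
    qed
    ultimately show ?thesis by simp
  qed
  have \<rho>1: "\<bar>inner_d (d n) (q n) (u n)\<bar> \<le> 1" if "vnorm (d n) (u n) = 1" "vnorm (d n) (q n) = 1" for n
    using inner_d_CS[of "d n" "q n" "u n"] that by simp
  show "op0 M (\<lambda>n \<omega>. clt_stat (d n) (\<tau> n) (q n) (u n) (uh n \<omega>)
      - mixture (d n) (clt_linear (d n) (\<tau> n) (inner_d (d n) (q n) (u n))) (clt_quadratic (d n) (\<tau> n) (inner_d (d n) (q n) (u n))) (Y n) \<omega>)"
  proof (rule op0_dominated)
    show "op0 M (\<lambda>n \<omega>. sqrt (2 / c0) * \<bar>(\<tau> n)\<^sup>2 / sqrt (P n) * (inner_d (d n) (u n) (uh n \<omega>) - 1 + (\<Sum>s\<in>{1..<d n}. (Y n s \<omega>)\<^sup>2) / (2 * (\<tau> n)\<^sup>2))\<bar>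
       + \<bar>\<tau> n * inner_d (d n) (f n) (uh n \<omega>) - Y n 1 \<omega>\<bar> + 1 / sqrt (2 * c0) * (1 / sqrt (P n) * \<bar>(Y n 1 \<omega>)\<^sup>2 - 2\<bar>))"
      by (intro op0_add op0_cmult op0_abs A B c2)
    show "whp M (\<lambda>n \<omega>. \<bar>clt_stat (d n) (\<tau> n) (q n) (u n) (uh n \<omega>)
      - mixture (d n) (clt_linear (d n) (\<tau> n) (inner_d (d n) (q n) (u n))) (clt_quadratic (d n) (\<tau> n) (inner_d (d n) (q n) (u n))) (Y n) \<omega>\<bar>
      \<le> sqrt (2 / c0) * \<bar>(\<tau> n)\<^sup>2 / sqrt (P n) * (inner_d (d n) (u n) (uh n \<omega>) - 1 + (\<Sum>s\<in>{1..<d n}. (Y n s \<omega>)\<^sup>2) / (2 * (\<tau> n)\<^sup>2))\<bar>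
       + \<bar>\<tau> n * inner_d (d n) (f n) (uh n \<omega>) - Y n 1 \<omega>\<bar> + 1 / sqrt (2 * c0) * (1 / sqrt (P n) * \<bar>(Y n 1 \<omega>)\<^sup>2 - 2\<bar>))"
    proof (rule whp_eventually, use dec in eventually_elim)
      case (elim n)
      have dn: "2 \<le> d n" "vnorm (d n) (u n) = 1" "vnorm (d n) (q n) = 1" "inner_d (d n) (f n) (u n) = 0"
        and dx: "\<And>x. inner_d (d n) (q n) x = inner_d (d n) (q n) (u n) * inner_d (d n) (u n) x
         + sqrt (1 - (inner_d (d n) (q n) (u n))\<^sup>2) * inner_d (d n) (f n) x"
        using elim by blast+
      have uu: "inner_d (d n) (u n) (u n) = 1" using dn(2) vnorm_square[of "d n" "u n"] by simp
      have Pn: "0 < P n" using P(2)[of n] by linarith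
      show ?case
      proof
        fix \<omega>
        show "\<bar>clt_stat (d n) (\<tau> n) (q n) (u n) (uh n \<omega>)
      - mixture (d n) (clt_linear (d n) (\<tau> n) (inner_d (d n) (q n) (u n))) (clt_quadratic (d n) (\<tau> n) (inner_d (d n) (q n) (u n))) (Y n) \<omega>\<bar>
      \<le> sqrt (2 / c0) * \<bar>(\<tau> n)\<^sup>2 / sqrt (P n) * (inner_d (d n) (u n) (uh n \<omega>) - 1 + (\<Sum>s\<in>{1..<d n}. (Y n s \<omega>)\<^sup>2) / (2 * (\<tau> n)\<^sup>2))\<bar>
       + \<bar>\<tau> n * inner_d (d n) (f n) (uh n \<omega>) - Y n 1 \<omega>\<bar> + 1 / sqrt (2 * c0) * (1 / sqrt (P n) * \<bar>(Y n 1 \<omega>)\<^sup>2 - 2\<bar>)"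
          by (rule clt_stat_error[OF dx refl \<rho>1[OF dn(2,3)] uu dn(4) \<tau> dn(1) Pn P(3) P(4)])
      qed
    qed
  qed
  show "\<forall>\<^sub>F n in sequentially. (clt_linear (d n) (\<tau> n) (inner_d (d n) (q n) (u n)))\<^sup>2 + (clt_quadratic (d n) (\<tau> n) (inner_d (d n) (q n) (u n)))\<^sup>2 = 1"
    using dec
  proof eventually_elim
    case (elim n)
    then have dn: "2 \<le> d n" "vnorm (d n) (u n) = 1" "vnorm (d n) (q n) = 1" by blast+
    show ?case by (rule clt_weights(2)[OF \<rho>1[OF dn(2,3)] \<tau>]) (use dn(1) in linarith)
  qed
qed

lemma mixture_char_tendsto:
  fixes X :: "nat \<Rightarrow> 'i \<Rightarrow> 'a \<Rightarrow> real"
  assumes ev: "\<forall>\<^sub>F n in sequentially. iid_N01 (M n) (I n) (X n) \<and> idx ` {1..<d n} \<subseteq> I n \<and> 2 \<le> d n \<and> (c n)\<^sup>2 + (a n)\<^sup>2 = 1"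
    and idx: "inj idx" and d: "filterlim (\<lambda>n. real (d n)) at_top sequentially"
  shows "(\<lambda>n. char (distr (M n) borel (mixture (d n) (c n) (a n) (\<lambda>i. X n (idx i)))) t) \<longlonglongrightarrow> char N01 t"
proof -
  obtain K where "0 \<le> K" and K: "\<And>(M :: 'a measure) I X j0 J d c a t. iid_N01 M (I :: 'i set) X \<Longrightarrow> finite J \<Longrightarrow> insert j0 J \<subseteq> I \<Longrightarrow> j0 \<notin> J \<Longrightarrow>
     card J + 2 = d \<Longrightarrow> c\<^sup>2 + a\<^sup>2 = 1 \<Longrightarrow>
     cmod (char (distr M borel (\<lambda>\<omega>. c * X j0 \<omega> - a / sqrt (2 * real d) * (\<Sum>j\<in>J. (X j \<omega>)\<^sup>2 - 1))) t
       - char N01 t) \<le> K * \<bar>t\<bar>^3 / sqrt (real d) + t^4 / real d + t\<^sup>2 / real d"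
  proof (rule mixed_char_bound[where 'a='a and 'i='i], goal_cases)
    case (1 K)
    show ?case by (rule 1(1); fact 1)
  qed
  have i1: "(\<lambda>n. 1 / sqrt (real (d n))) \<longlonglongrightarrow> 0" "(\<lambda>n. 1 / real (d n)) \<longlonglongrightarrow> 0"
    using tendsto_inverse_0_at_top[OF filterlim_compose[OF sqrt_at_top d]] tendsto_inverse_0_at_top[OF d]
    by (simp_all add: inverse_eq_divide)
  have b: "(\<lambda>n. K * \<bar>t\<bar>^3 / sqrt (real (d n)) + t^4 / real (d n) + t\<^sup>2 / real (d n)) \<longlonglongrightarrow> 0"
    using tendsto_add[OF tendsto_add[OF tendsto_mult_right_zero[OF i1(1), of "K * \<bar>t\<bar>^3"] tendsto_mult_right_zero[OF i1(2), of "t^4"]] tendsto_mult_right_zero[OF i1(2), of "t\<^sup>2"]]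
    by simp
  have "\<forall>\<^sub>F n in sequentially. norm (char (distr (M n) borel (mixture (d n) (c n) (a n) (\<lambda>i. X n (idx i)))) t - char N01 t)
      \<le> K * \<bar>t\<bar>^3 / sqrt (real (d n)) + t^4 / real (d n) + t\<^sup>2 / real (d n)"
    using ev
  proof eventually_elim
    case (elim n)
    have inj: "inj_on idx S" for S using idx by (rule inj_on_subset) simp
    have eq: "mixture (d n) (c n) (a n) (\<lambda>i. X n (idx i)) = (\<lambda>\<omega>. c n * X n (idx 1) \<omega> - a n / sqrt (2 * real (d n)) * (\<Sum>j\<in>idx ` {2..<d n}. (X n j \<omega>)\<^sup>2 - 1))"
      by (simp add: fun_eq_iff mixture_def sum.reindex[OF inj])
    have sub: "insert (idx 1) (idx ` {2..<d n}) \<subseteq> I n"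
    proof -
      have "insert (idx 1) (idx ` {2..<d n}) = idx ` insert 1 {2..<d n}" by simp
      also have "insert 1 {2..<d n} = {1..<d n}" using elim by auto
      finally show ?thesis using elim by simp
    qed
    show ?case unfolding eq
      using elim inj_eq[OF idx] by (intro K[OF _ _ sub]) (auto simp: card_image[OF inj])
  qed
  then have "(\<lambda>n. char (distr (M n) borel (mixture (d n) (c n) (a n) (\<lambda>i. X n (idx i)))) t - char N01 t) \<longlonglongrightarrow> 0"
    by (rule Lim_null_comparison[OF _ b])
  then show ?thesis by (simp add: LIM_zero_iff)
qed

text \<open>Exhibits a mixture as a function of the coordinates of one block, the form required for
  the independence of blocks.\<close>

lemma mixture_measurable_PiM:
  assumes "idx ` {1..<d} \<subseteq> K" "2 \<le> d"
  shows "(\<lambda>x. mixture d c a (\<lambda>i x. x (idx i)) x) \<in> borel_measurable (PiM K (\<lambda>_. borel))"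
proof -
  have m: "(\<lambda>x. x (idx i)) \<in> borel_measurable (PiM K (\<lambda>_. borel))" if "1 \<le> i" "i < d" for i
  proof (rule measurable_component_singleton)
    have "idx i \<in> idx ` {1..<d}" using that by simp
    then show "idx i \<in> K" using assms(1) by blast
  qed
  show ?thesis unfolding mixture_def using assms(2)
    by (intro borel_measurable_diff borel_measurable_times borel_measurable_sum borel_measurable_power borel_measurable_const m) auto
qed

text \<open>Starting each axis of the index box at 1 makes the three axes disjoint; their common
  point (0, 0, 0) enters none of the mixtures.\<close>

lemma triple_independent:
  fixes c1 c2 c3 a1 a2 a3 :: real
  assumes Z: "iid_N01 M (box d1 d2 d3) \<zeta>" and d: "2 \<le> d1" "2 \<le> d2" "2 \<le> d3"
  defines "W1 \<equiv> mixture d1 c1 a1 (\<lambda>i. \<zeta> (i, 0, 0))" and "W2 \<equiv> mixture d2 c2 a2 (\<lambda>i. \<zeta> (0, i, 0))"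
    and "W3 \<equiv> mixture d3 c3 a3 (\<lambda>i. \<zeta> (0, 0, i))"
  shows "W1 \<in> borel_measurable M \<and> W2 \<in> borel_measurable M \<and> W3 \<in> borel_measurable M \<and>
    distr M (borel \<Otimes>\<^sub>M (borel \<Otimes>\<^sub>M borel)) (\<lambda>\<omega>. (W1 \<omega>, W2 \<omega>, W3 \<omega>)) = distr M borel W1 \<Otimes>\<^sub>M (distr M borel W2 \<Otimes>\<^sub>M distr M borel W3)"
proof -
  let ?K1 = "(\<lambda>i. (i, 0, 0)) ` {1..<d1} :: (nat \<times> nat \<times> nat) set"
  let ?K2 = "(\<lambda>i. (0, i, 0)) ` {1..<d2} :: (nat \<times> nat \<times> nat) set"
  let ?K3 = "(\<lambda>i. (0, 0, i)) ` {1..<d3} :: (nat \<times> nat \<times> nat) set"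
  have K: "?K1 \<subseteq> box d1 d2 d3" "?K2 \<subseteq> box d1 d2 d3" "?K3 \<subseteq> box d1 d2 d3" "?K1 \<inter> ?K2 = {}" "?K1 \<inter> ?K3 = {}" "?K2 \<inter> ?K3 = {}"
    using d by (auto simp: box_def)
  have e: "mixture d c a (\<lambda>i x. x (idx i)) (restrict (\<lambda>i. \<zeta> i \<omega>) (idx ` {1..<d})) = mixture d c a (\<lambda>i. \<zeta> (idx i)) \<omega>"
    if "2 \<le> d" for d c a \<omega> and idx :: "nat \<Rightarrow> nat \<times> nat \<times> nat"
  proof -
    have r: "restrict (\<lambda>i. \<zeta> i \<omega>) (idx ` {1..<d}) (idx i) = \<zeta> (idx i) \<omega>" if "1 \<le> i" "i < d" for i
      using that by simp
    have "(\<Sum>i\<in>{2..<d}. (restrict (\<lambda>i. \<zeta> i \<omega>) (idx ` {1..<d}) (idx i))\<^sup>2 - 1) = (\<Sum>i\<in>{2..<d}. (\<zeta> (idx i) \<omega>)\<^sup>2 - 1)"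
      by (rule sum.cong[OF refl], subst r) auto
    moreover have "restrict (\<lambda>i. \<zeta> i \<omega>) (idx ` {1..<d}) (idx 1) = \<zeta> (idx 1) \<omega>" using that by (intro r) auto
    ultimately show ?thesis by (simp only: mixture_def)
  qed
  note B = indep_blocks_product[OF Z K
    mixture_measurable_PiM[of "\<lambda>i. (i, 0, 0)" d1, OF subset_refl d(1), of c1 a1]
    mixture_measurable_PiM[of "\<lambda>i. (0, i, 0)" d2, OF subset_refl d(2), of c2 a2]
    mixture_measurable_PiM[of "\<lambda>i. (0, 0, i)" d3, OF subset_refl d(3), of c3 a3], unfolded e[OF d(1)] e[OF d(2)] e[OF d(3)]]
  show ?thesis using B unfolding W1_def W2_def W3_def by blast
qed

section \<open>Joint limits and linearization of a product\<close>

lemma dist_triple_le: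
  fixes a b c a' b' c' :: real
  shows "dist (a, b, c) (a', b', c') \<le> \<bar>a - a'\<bar> + \<bar>b - b'\<bar> + \<bar>c - c'\<bar>"
proof -
  have "dist (a, b, c) (a', b', c') \<le> dist a a' + dist (b, c) (b', c')"
    unfolding dist_Pair_Pair by (rule sqrt_sum_squares_le_sum) auto
  also have "dist (b, c) (b', c') \<le> dist b b' + dist c c'"
    unfolding dist_Pair_Pair by (rule sqrt_sum_squares_le_sum) auto
  finally show ?thesis by (simp add: dist_real_def)
qed

lemma slutsky_triple:
  fixes X1 X2 X3 Y1 Y2 Y3 :: "nat \<Rightarrow> 'a \<Rightarrow> real"
  assumes M: "\<And>n. prob_space (M n)" and X: "conv_ev M (\<lambda>n \<omega>. (X1 n \<omega>, X2 n \<omega>, X3 n \<omega>)) N3"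
    and Y: "\<And>n. Y1 n \<in> borel_measurable (M n)" "\<And>n. Y2 n \<in> borel_measurable (M n)" "\<And>n. Y3 n \<in> borel_measurable (M n)"
    and o: "op0 M (\<lambda>n \<omega>. Y1 n \<omega> - X1 n \<omega>)" "op0 M (\<lambda>n \<omega>. Y2 n \<omega> - X2 n \<omega>)" "op0 M (\<lambda>n \<omega>. Y3 n \<omega> - X3 n \<omega>)"
  shows "conv_distr M (\<lambda>n \<omega>. (Y1 n \<omega>, Y2 n \<omega>, Y3 n \<omega>)) N3"
proof (rule slutsky[OF M X prob_space_N3 sets_N3])
  show "(\<lambda>\<omega>. (Y1 n \<omega>, Y2 n \<omega>, Y3 n \<omega>)) \<in> borel_measurable (M n)" for n using Y by (auto intro: borel_measurable_Pair)
  fix \<epsilon> :: real assume e: "\<epsilon> > 0"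
  have "op0 M (\<lambda>n \<omega>. \<bar>Y1 n \<omega> - X1 n \<omega>\<bar> + \<bar>Y2 n \<omega> - X2 n \<omega>\<bar> + \<bar>Y3 n \<omega> - X3 n \<omega>\<bar>)"
    by (intro op0_add op0_abs o)
  then have "whp M (\<lambda>n \<omega>. \<bar>\<bar>Y1 n \<omega> - X1 n \<omega>\<bar> + \<bar>Y2 n \<omega> - X2 n \<omega>\<bar> + \<bar>Y3 n \<omega> - X3 n \<omega>\<bar>\<bar> \<le> \<epsilon>)" using e by (simp add: op0_def)
  then show "whp M (\<lambda>n \<omega>. dist (X1 n \<omega>, X2 n \<omega>, X3 n \<omega>) (Y1 n \<omega>, Y2 n \<omega>, Y3 n \<omega>) \<le> \<epsilon>)"
    by (rule whp_mono) (intro always_eventually allI ballI impI order_trans[OF dist_triple_le], linarith)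
qed

text \<open>Since \<tau> |a|, \<tau> |b|, \<tau> |c| diverge, the relative errors tend to 0, and the
  product as well as the random denominator can be expanded multiplicatively. The weights have
  absolute value at most 1, so first-order terms stay tight and each further relative error makes a
  term negligible.\<close>

lemma product_delta:
  fixes a b c \<tau> :: "nat \<Rightarrow> real" and U V W Y1 Y2 Y3 \<kappa> :: "nat \<Rightarrow> 'a \<Rightarrow> real"
  assumes \<tau>: "\<And>n. 0 < \<tau> n"
    and big: "filterlim (\<lambda>n. \<tau> n * \<bar>a n\<bar>) at_top sequentially" "filterlim (\<lambda>n. \<tau> n * \<bar>b n\<bar>) at_top sequentially"
      "filterlim (\<lambda>n. \<tau> n * \<bar>c n\<bar>) at_top sequentially"
    and close: "op0 M (\<lambda>n \<omega>. \<tau> n * (U n \<omega> - a n) - Y1 n \<omega>)" "op0 M (\<lambda>n \<omega>. \<tau> n * (V n \<omega> - b n) - Y2 n \<omega>)"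
      "op0 M (\<lambda>n \<omega>. \<tau> n * (W n \<omega> - c n) - Y3 n \<omega>)"
    and Y: "Op1 M Y1" "Op1 M Y2" "Op1 M Y3"
    and \<kappa>: "op0 M (\<lambda>n \<omega>. \<tau> n * a n * \<kappa> n \<omega>)"
  defines "Den \<equiv> \<lambda>x y z :: real. sqrt (x\<^sup>2 * y\<^sup>2 + y\<^sup>2 * z\<^sup>2 + z\<^sup>2 * x\<^sup>2)"
  shows "op0 M (\<lambda>n \<omega>. \<tau> n * ((1 + \<kappa> n \<omega>) * U n \<omega> * V n \<omega> * W n \<omega> - a n * b n * c n) / Den (U n \<omega>) (V n \<omega>) (W n \<omega>)
    - (b n * c n / Den (a n) (b n) (c n) * Y1 n \<omega> + a n * c n / Den (a n) (b n) (c n) * Y2 n \<omega> + a n * b n / Den (a n) (b n) (c n) * Y3 n \<omega>))"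
proof -
  define D where "D n = Den (a n) (b n) (c n)" for n
  have nz: "\<forall>\<^sub>F n in sequentially. a n \<noteq> 0 \<and> b n \<noteq> 0 \<and> c n \<noteq> 0"
  proof -
    have "\<forall>\<^sub>F n in sequentially. 0 < \<tau> n * \<bar>a n\<bar>" "\<forall>\<^sub>F n in sequentially. 0 < \<tau> n * \<bar>b n\<bar>" "\<forall>\<^sub>F n in sequentially. 0 < \<tau> n * \<bar>c n\<bar>"
      using big by (simp_all add: filterlim_at_top_dense)
    then show ?thesis by eventually_elim auto
  qed
  have Dle: "\<bar>y * z\<bar> \<le> Den x y z" "\<bar>x * z\<bar> \<le> Den x y z" "\<bar>x * y\<bar> \<le> Den x y z" for x y z
    unfolding Den_def by (rule real_le_rsqrt, simp add: power_mult_distrib)+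
  have Dpos: "0 < D n" if "a n \<noteq> 0" "b n \<noteq> 0" "c n \<noteq> 0" for n
  proof -
    have "0 < \<bar>b n * c n\<bar>" using that by simp
    then show ?thesis using Dle(1)[of "b n" "c n" "a n"] unfolding D_def by linarith
  qed
  define X1 where "X1 n \<omega> = \<tau> n * (U n \<omega> - a n)" for n \<omega>
  define X2 where "X2 n \<omega> = \<tau> n * (V n \<omega> - b n)" for n \<omega>
  define X3 where "X3 n \<omega> = \<tau> n * (W n \<omega> - c n)" for n \<omega>
  have XO: "Op1 M X1" "Op1 M X2" "Op1 M X3"
    unfolding X1_def[abs_def] X2_def[abs_def] X3_def[abs_def] by (rule Op1_of_close, rule close, rule Y)+
  define r1 where "r1 n \<omega> = inverse (\<tau> n * a n) * X1 n \<omega>" for n \<omega>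
  define r2 where "r2 n \<omega> = inverse (\<tau> n * b n) * X2 n \<omega>" for n \<omega>
  define r3 where "r3 n \<omega> = inverse (\<tau> n * c n) * X3 n \<omega>" for n \<omega>
  have inv0: "(\<lambda>n. inverse (\<tau> n * z n)) \<longlonglongrightarrow> 0" if "filterlim (\<lambda>n. \<tau> n * \<bar>z n\<bar>) at_top sequentially" for z
  proof (rule Lim_null_comparison)
    show "(\<lambda>n. inverse (\<tau> n * \<bar>z n\<bar>)) \<longlonglongrightarrow> 0" by (rule tendsto_inverse_0_at_top[OF that])
    show "\<forall>\<^sub>F n in sequentially. norm (inverse (\<tau> n * z n)) \<le> inverse (\<tau> n * \<bar>z n\<bar>)"
      using \<tau> by (intro always_eventually allI) (simp add: abs_mult less_imp_le)
  qed
  have r0: "op0 M r1" "op0 M r2" "op0 M r3"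
    unfolding r1_def[abs_def] r2_def[abs_def] r3_def[abs_def]
    by (intro op0_mult_Op1 op0_tendsto inv0 big XO)+
  \<comment> \<open>The common factor \<tau> a b c / D. Times a relative error it gives a weight
    times the rescaled absolute error, and it is at most \<tau> |a| in absolute value, the factor
    for which \<open>\<kappa>\<close> is controlled.\<close>
  define m where "m n = \<tau> n * a n * (b n * c n / D n)" for n
  have frac: "\<bar>b n * c n / D n\<bar> \<le> 1" "\<bar>a n * c n / D n\<bar> \<le> 1" "\<bar>a n * b n / D n\<bar> \<le> 1"
    if "a n \<noteq> 0" "b n \<noteq> 0" "c n \<noteq> 0" for n
    using Dle[of "b n" "c n" "a n"] Dle(2)[of "a n" "c n" "b n"] Dle(3)[of "a n" "b n" "c n"] Dpos[OF that]
    by (simp_all add: D_def)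
  have le_mult: "\<bar>f * X\<bar> \<le> \<bar>X\<bar>" if "\<bar>f\<bar> \<le> 1" for f X :: real
    using mult_right_mono[OF that, of "\<bar>X\<bar>"] by (simp add: abs_mult)
  have mr: "m n * r1 n \<omega> = b n * c n / D n * X1 n \<omega>" "m n * r2 n \<omega> = a n * c n / D n * X2 n \<omega>"
    "m n * r3 n \<omega> = a n * b n / D n * X3 n \<omega>" if "a n \<noteq> 0" "b n \<noteq> 0" "c n \<noteq> 0" for n \<omega>
    using that \<tau>[of n] Dpos[OF that] by (simp_all add: m_def r1_def r2_def r3_def field_simps)
  have mrO: "Op1 M (\<lambda>n \<omega>. m n * r1 n \<omega>)" "Op1 M (\<lambda>n \<omega>. m n * r2 n \<omega>)" "Op1 M (\<lambda>n \<omega>. m n * r3 n \<omega>)"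
  proof -
    have le: "\<bar>m n * r1 n \<omega>\<bar> \<le> \<bar>X1 n \<omega>\<bar> \<and> \<bar>m n * r2 n \<omega>\<bar> \<le> \<bar>X2 n \<omega>\<bar> \<and> \<bar>m n * r3 n \<omega>\<bar> \<le> \<bar>X3 n \<omega>\<bar>"
      if "a n \<noteq> 0 \<and> b n \<noteq> 0 \<and> c n \<noteq> 0" for n \<omega>
    proof -
      have n: "a n \<noteq> 0" "b n \<noteq> 0" "c n \<noteq> 0" using that by auto
      show ?thesis unfolding mr[OF n] by (intro conjI le_mult frac n)
    qed
    have le': "\<forall>\<^sub>F n in sequentially. \<forall>\<omega>\<in>space (M n). \<bar>m n * r1 n \<omega>\<bar> \<le> \<bar>X1 n \<omega>\<bar>"
      "\<forall>\<^sub>F n in sequentially. \<forall>\<omega>\<in>space (M n). \<bar>m n * r2 n \<omega>\<bar> \<le> \<bar>X2 n \<omega>\<bar>"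
      "\<forall>\<^sub>F n in sequentially. \<forall>\<omega>\<in>space (M n). \<bar>m n * r3 n \<omega>\<bar> \<le> \<bar>X3 n \<omega>\<bar>"
      using nz by (eventually_elim, use le in blast)+
    show "Op1 M (\<lambda>n \<omega>. m n * r1 n \<omega>)" by (rule Op1_dominated_ev[OF XO(1) le'(1)])
    show "Op1 M (\<lambda>n \<omega>. m n * r2 n \<omega>)" by (rule Op1_dominated_ev[OF XO(2) le'(2)])
    show "Op1 M (\<lambda>n \<omega>. m n * r3 n \<omega>)" by (rule Op1_dominated_ev[OF XO(3) le'(3)])
  qed
  have m\<kappa>: "op0 M (\<lambda>n \<omega>. m n * \<kappa> n \<omega>)"
  proof (rule op0_dominated_ev[OF \<kappa>], use nz in eventually_elim, rule ballI)
    fix n \<omega> assume "a n \<noteq> 0 \<and> b n \<noteq> 0 \<and> c n \<noteq> 0"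
    then have "\<bar>(b n * c n / D n) * (\<tau> n * a n * \<kappa> n \<omega>)\<bar> \<le> \<bar>\<tau> n * a n * \<kappa> n \<omega>\<bar>" by (intro le_mult frac) auto
    then show "\<bar>m n * \<kappa> n \<omega>\<bar> \<le> \<bar>\<tau> n * a n * \<kappa> n \<omega>\<bar>" by (simp add: m_def mult_ac)
  qed
  have one: "Op1 M (\<lambda>n \<omega>. 1 + r1 n \<omega>)" "Op1 M (\<lambda>n \<omega>. 1 + r2 n \<omega>)" "Op1 M (\<lambda>n \<omega>. 1 + r3 n \<omega>)"
    by (intro Op1_add Op1_const op0_imp_Op1 r0)+
  define main where "main n \<omega> = m n * r1 n \<omega> + m n * r2 n \<omega> + m n * r3 n \<omega>" for n \<omega>
  \<comment> \<open>Everything in the expanded product beyond the three linear terms. Each summand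
    has a factor that is o_P(1), and its other factors are tight.\<close>
  define rest where "rest n \<omega> = m n * \<kappa> n \<omega> * (1 + r1 n \<omega>) * (1 + r2 n \<omega>) * (1 + r3 n \<omega>)
     + (r2 n \<omega> * (m n * r1 n \<omega>) + r3 n \<omega> * (m n * r1 n \<omega>) + r3 n \<omega> * (m n * r2 n \<omega>) + r3 n \<omega> * r2 n \<omega> * (m n * r1 n \<omega>))" for n \<omega>
  have rest0: "op0 M rest"
    unfolding rest_def[abs_def] by (intro op0_add op0_mult_Op1 m\<kappa> one r0 mrO op0_imp_Op1)
  have mainO: "Op1 M main" unfolding main_def[abs_def] by (intro Op1_add mrO)
  define ratio where "ratio n \<omega> = D n / Den (U n \<omega>) (V n \<omega>) (W n \<omega>)" for n \<omega>
  have hats: "U n \<omega> = a n * (1 + r1 n \<omega>)" "V n \<omega> = b n * (1 + r2 n \<omega>)" "W n \<omega> = c n * (1 + r3 n \<omega>)"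
    if "a n \<noteq> 0" "b n \<noteq> 0" "c n \<noteq> 0" for n \<omega>
    using that \<tau>[of n] by (simp_all add: r1_def r2_def r3_def X1_def X2_def X3_def field_simps)
  \<comment> \<open>Relative errors of at most \<delta> place the random denominator between (1 -
    \<delta>)^2 and (1 + \<delta>)^2 times \<open>D n\<close>. With \<delta> \<le> 1/2 the lower
    factor is at least 1/4, whence 2 \<delta> * 4 = 8 \<delta>.\<close>
  have ratio0: "op0 M (\<lambda>n \<omega>. ratio n \<omega> - 1)"
    unfolding op0_def
  proof (intro allI impI)
    fix \<epsilon> :: real assume e: "\<epsilon> > 0"
    define \<delta> where "\<delta> = min (1/2) (\<epsilon> / 8)"
    have d: "0 < \<delta>" "\<delta> \<le> 1/2" "8 * \<delta> \<le> \<epsilon>" using e by (auto simp: \<delta>_def)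
    have "whp M (\<lambda>n \<omega>. \<bar>r1 n \<omega>\<bar> \<le> \<delta>)" "whp M (\<lambda>n \<omega>. \<bar>r2 n \<omega>\<bar> \<le> \<delta>)" "whp M (\<lambda>n \<omega>. \<bar>r3 n \<omega>\<bar> \<le> \<delta>)"
      using r0 d(1) by (auto simp: op0_def)
    from whp_conj[OF this(1) whp_conj[OF this(2,3)]]
    show "whp M (\<lambda>n \<omega>. \<bar>ratio n \<omega> - 1\<bar> \<le> \<epsilon>)"
    proof (rule whp_mono, use nz in eventually_elim, intro ballI impI, elim conjE)
      fix n \<omega> assume n: "a n \<noteq> 0" "b n \<noteq> 0" "c n \<noteq> 0" and r: "\<bar>r1 n \<omega>\<bar> \<le> \<delta>" "\<bar>r2 n \<omega>\<bar> \<le> \<delta>" "\<bar>r3 n \<omega>\<bar> \<le> \<delta>"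
      define lo where "lo = (1 - \<delta>)\<^sup>2"
      define hi where "hi = (1 + \<delta>)\<^sup>2"
      have prod: "lo\<^sup>2 * (x\<^sup>2 * y\<^sup>2) \<le> (x * (1 + s))\<^sup>2 * (y * (1 + t))\<^sup>2" "(x * (1 + s))\<^sup>2 * (y * (1 + t))\<^sup>2 \<le> hi\<^sup>2 * (x\<^sup>2 * y\<^sup>2)"
        if "\<bar>s\<bar> \<le> \<delta>" "\<bar>t\<bar> \<le> \<delta>" for x y s t :: real
      proof -
        have st: "(1 - \<delta>)\<^sup>2 \<le> (1 + s)\<^sup>2" "(1 + s)\<^sup>2 \<le> (1 + \<delta>)\<^sup>2" "(1 - \<delta>)\<^sup>2 \<le> (1 + t)\<^sup>2" "(1 + t)\<^sup>2 \<le> (1 + \<delta>)\<^sup>2"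
          using that d by (auto intro!: power_mono)
        have "lo\<^sup>2 \<le> (1 + s)\<^sup>2 * (1 + t)\<^sup>2" unfolding lo_def power2_eq_square[of "(1 - \<delta>)\<^sup>2"] using st by (intro mult_mono) auto
        moreover have "(1 + s)\<^sup>2 * (1 + t)\<^sup>2 \<le> hi\<^sup>2" unfolding hi_def power2_eq_square[of "(1 + \<delta>)\<^sup>2"] using st by (intro mult_mono) auto
        moreover have "(x * (1 + s))\<^sup>2 * (y * (1 + t))\<^sup>2 = (1 + s)\<^sup>2 * (1 + t)\<^sup>2 * (x\<^sup>2 * y\<^sup>2)" by (simp add: power_mult_distrib mult_ac)
        ultimately show "lo\<^sup>2 * (x\<^sup>2 * y\<^sup>2) \<le> (x * (1 + s))\<^sup>2 * (y * (1 + t))\<^sup>2" "(x * (1 + s))\<^sup>2 * (y * (1 + t))\<^sup>2 \<le> hi\<^sup>2 * (x\<^sup>2 * y\<^sup>2)"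
          by (auto intro: mult_right_mono)
      qed
      define Dh where "Dh = Den (U n \<omega>) (V n \<omega>) (W n \<omega>)"
      have lo0: "0 \<le> lo" and hi0: "0 \<le> hi" by (auto simp: lo_def hi_def)
      have D0: "0 < D n" by (rule Dpos[OF n])
      have l: "lo * D n \<le> Dh"
      proof -
        have "lo * D n = sqrt (lo\<^sup>2 * (a n)\<^sup>2 * (b n)\<^sup>2 + lo\<^sup>2 * (b n)\<^sup>2 * (c n)\<^sup>2 + lo\<^sup>2 * (c n)\<^sup>2 * (a n)\<^sup>2)"
          using lo0 by (simp add: D_def Den_def mult.assoc real_sqrt_mult flip: distrib_left)
        also have "\<dots> \<le> Dh" unfolding Dh_def Den_def hats[OF n]
          using prod(1)[OF r(1,2), of "a n" "b n"] prod(1)[OF r(2,3), of "b n" "c n"] prod(1)[OF r(3,1), of "c n" "a n"]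
          by (simp add: mult.assoc)
        finally show ?thesis .
      qed
      have h: "Dh \<le> hi * D n"
      proof -
        have "Dh \<le> sqrt (hi\<^sup>2 * (a n)\<^sup>2 * (b n)\<^sup>2 + hi\<^sup>2 * (b n)\<^sup>2 * (c n)\<^sup>2 + hi\<^sup>2 * (c n)\<^sup>2 * (a n)\<^sup>2)"
          unfolding Dh_def Den_def hats[OF n]
          using prod(2)[OF r(1,2), of "a n" "b n"] prod(2)[OF r(2,3), of "b n" "c n"] prod(2)[OF r(3,1), of "c n" "a n"]
          by (simp add: mult.assoc)
        also have "\<dots> = hi * D n"
          using hi0 by (simp add: D_def Den_def mult.assoc real_sqrt_mult flip: distrib_left)
        finally show ?thesis .
      qed
      have lo_pos: "1/4 \<le> lo" unfolding lo_def using power_mono[of "1/2" "1 - \<delta>" 2] d by (simp add: power2_eq_square)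
      then have "1/4 * D n \<le> lo * D n" using D0 by (intro mult_right_mono) auto
      then have Dh0: "0 < Dh" using l D0 by linarith
      have "D n - Dh \<le> 8 * \<delta> * Dh"
      proof -
        have "1 - lo \<le> 2 * \<delta>" by (simp add: lo_def power2_eq_square algebra_simps)
        have "D n - Dh \<le> (1 - lo) * D n" using l by (simp add: algebra_simps)
        also have "\<dots> \<le> 2 * \<delta> * D n" using \<open>1 - lo \<le> 2 * \<delta>\<close> D0 by (intro mult_right_mono) auto
        also have "\<dots> \<le> 2 * \<delta> * (4 * Dh)"
        proof (rule mult_left_mono)
          have "1/4 * D n \<le> lo * D n" using lo_pos D0 by (intro mult_right_mono) auto
          then show "D n \<le> 4 * Dh" using l by linarith
        qed (use d in simp)
        finally show ?thesis by simp
      qed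
      \<comment> \<open>Rests on (1 - 2 \<delta>)(1 + \<delta>)^2 = 1 - 3 \<delta>^2 - 2 \<delta>^3
        \<le> 1.\<close>
      moreover have "Dh - D n \<le> 8 * \<delta> * Dh"
      proof -
        have "(1 - 2 * \<delta>) * hi \<le> 1"
        proof -
          have "(1 - 2 * \<delta>) * hi = 1 - 3 * \<delta>\<^sup>2 - 2 * \<delta>^3" by (simp add: hi_def power2_eq_square power3_eq_cube algebra_simps)
          moreover have "0 \<le> \<delta>\<^sup>2" "0 \<le> \<delta>^3" using d(1) by simp_all
          ultimately show ?thesis by linarith
        qed
        then have "(1 - 2 * \<delta>) * hi * D n \<le> 1 * D n" using D0 by (intro mult_right_mono) auto
        moreover have "(1 - 2 * \<delta>) * Dh \<le> (1 - 2 * \<delta>) * (hi * D n)" using h d by (intro mult_left_mono) auto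
        ultimately have "(1 - 2 * \<delta>) * Dh \<le> D n" by (simp add: mult.assoc)
        then have "Dh - D n \<le> 2 * \<delta> * Dh" by (simp add: algebra_simps)
        also have "\<dots> \<le> 8 * \<delta> * Dh" using d Dh0 by (intro mult_right_mono) auto
        finally show ?thesis .
      qed
      ultimately have "\<bar>D n - Dh\<bar> \<le> 8 * \<delta> * Dh" by linarith
      also have "\<dots> \<le> \<epsilon> * Dh" using d Dh0 by (intro mult_right_mono) auto
      finally have "\<bar>D n - Dh\<bar> / Dh \<le> \<epsilon>" using Dh0 by (simp add: divide_le_eq)
      moreover have "ratio n \<omega> - 1 = (D n - Dh) / Dh" using Dh0 by (simp add: ratio_def Dh_def diff_divide_distrib)
      ultimately show "\<bar>ratio n \<omega> - 1\<bar> \<le> \<epsilon>" using Dh0 by simp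
    qed
  qed
  have diff0: "op0 M (\<lambda>n \<omega>. (b n * c n / D n * (X1 n \<omega> - Y1 n \<omega>) + a n * c n / D n * (X2 n \<omega> - Y2 n \<omega>)) + a n * b n / D n * (X3 n \<omega> - Y3 n \<omega>))"
  proof (intro op0_add)
    have c: "op0 M (\<lambda>n \<omega>. X1 n \<omega> - Y1 n \<omega>)" "op0 M (\<lambda>n \<omega>. X2 n \<omega> - Y2 n \<omega>)" "op0 M (\<lambda>n \<omega>. X3 n \<omega> - Y3 n \<omega>)"
      using close by (simp_all add: X1_def X2_def X3_def)
    show "op0 M (\<lambda>n \<omega>. b n * c n / D n * (X1 n \<omega> - Y1 n \<omega>))"
      by (rule op0_dominated_ev[OF c(1)], use nz in eventually_elim) (blast intro: le_mult frac)
    show "op0 M (\<lambda>n \<omega>. a n * c n / D n * (X2 n \<omega> - Y2 n \<omega>))"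
      by (rule op0_dominated_ev[OF c(2)], use nz in eventually_elim) (blast intro: le_mult frac)
    show "op0 M (\<lambda>n \<omega>. a n * b n / D n * (X3 n \<omega> - Y3 n \<omega>))"
      by (rule op0_dominated_ev[OF c(3)], use nz in eventually_elim) (blast intro: le_mult frac)
  qed
  \<comment> \<open>Three sources of error: the random denominator, products of relative errors, and
    the difference between rescaled errors and the variables approximating them.\<close>
  have "op0 M (\<lambda>n \<omega>. (ratio n \<omega> - 1) * (main n \<omega> + rest n \<omega>) + rest n \<omega>
     + ((b n * c n / D n * (X1 n \<omega> - Y1 n \<omega>) + a n * c n / D n * (X2 n \<omega> - Y2 n \<omega>)) + a n * b n / D n * (X3 n \<omega> - Y3 n \<omega>)))"
    by (intro op0_add op0_mult_Op1 ratio0 Op1_add mainO op0_imp_Op1 rest0 diff0)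
  then show ?thesis
  proof (rule op0_whp_eq, intro whp_eventually, use nz in eventually_elim, intro ballI)
    fix n \<omega> assume n: "a n \<noteq> 0 \<and> b n \<noteq> 0 \<and> c n \<noteq> 0"
    then have n': "a n \<noteq> 0" "b n \<noteq> 0" "c n \<noteq> 0" by auto
    have D0: "0 < D n" by (rule Dpos[OF n'])
    have e1: "\<tau> n * ((1 + \<kappa> n \<omega>) * U n \<omega> * V n \<omega> * W n \<omega> - a n * b n * c n) / D n = main n \<omega> + rest n \<omega>"
      unfolding hats[OF n'] main_def rest_def using D0 by (simp add: m_def field_simps)
    have "\<tau> n * ((1 + \<kappa> n \<omega>) * U n \<omega> * V n \<omega> * W n \<omega> - a n * b n * c n) / Den (U n \<omega>) (V n \<omega>) (W n \<omega>)
       = ratio n \<omega> * (main n \<omega> + rest n \<omega>)"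
      unfolding e1[symmetric] using D0 by (simp add: ratio_def)
    moreover have "main n \<omega> = b n * c n / D n * X1 n \<omega> + a n * c n / D n * X2 n \<omega> + a n * b n / D n * X3 n \<omega>"
      by (simp only: main_def mr[OF n'])
    ultimately show "\<tau> n * ((1 + \<kappa> n \<omega>) * U n \<omega> * V n \<omega> * W n \<omega> - a n * b n * c n) / Den (U n \<omega>) (V n \<omega>) (W n \<omega>)
    - (b n * c n / Den (a n) (b n) (c n) * Y1 n \<omega> + a n * c n / Den (a n) (b n) (c n) * Y2 n \<omega> + a n * b n / Den (a n) (b n) (c n) * Y3 n \<omega>)
      = (ratio n \<omega> - 1) * (main n \<omega> + rest n \<omega>) + rest n \<omega>
     + ((b n * c n / D n * (X1 n \<omega> - Y1 n \<omega>) + a n * c n / D n * (X2 n \<omega> - Y2 n \<omega>)) + a n * b n / D n * (X3 n \<omega> - Y3 n \<omega>))"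
      unfolding D_def[symmetric] by (simp add: algebra_simps add_divide_distrib diff_divide_distrib)
  qed
qed

text \<open>The entry combines the radial and one tangential coordinate. The radial loss, of order
  P/\<tau>^2, contributes a multiple of |u_i| P/\<tau> after scaling, and the tangential factor sqrt
  (1 - u_i^2) tends to 1; these are the two limits assumed. 115200 is 50 * 48^2.\<close>

lemma coord_mode:
  fixes d i :: "nat \<Rightarrow> nat" and P \<tau> :: "nat \<Rightarrow> real" and Y :: "nat \<Rightarrow> 'a \<Rightarrow> real"
  assumes P: "\<And>n. 1 \<le> P n" and \<tau>: "\<And>n. 0 < \<tau> n"
    and dec: "\<forall>\<^sub>F n in sequentially. \<forall>x. x (i n) = u n (i n) * inner_d (d n) (u n) x
         + sqrt (1 - (u n (i n))\<^sup>2) * inner_d (d n) (f n) x"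
    and B: "op0 M (\<lambda>n \<omega>. \<tau> n * inner_d (d n) (f n) (uh n \<omega>) - Y n \<omega>)"
    and C: "Op1 M Y"
    and al: "whp M (\<lambda>n \<omega>. \<bar>inner_d (d n) (u n) (uh n \<omega>) - 1\<bar> \<le> 50 * (48 * sqrt (P n) / \<tau> n)\<^sup>2)"
    and lim: "(\<lambda>n. \<bar>u n (i n)\<bar> * (P n / \<tau> n)) \<longlonglongrightarrow> 0" "(\<lambda>n. u n (i n)) \<longlonglongrightarrow> 0"
  shows "op0 M (\<lambda>n \<omega>. \<tau> n * (uh n \<omega> (i n) - u n (i n)) - Y n \<omega>)"
proof -
  define s where "s n = sqrt (1 - (u n (i n))\<^sup>2)" for n
  have "(\<lambda>n. s n - 1) \<longlonglongrightarrow> sqrt (1 - 0\<^sup>2) - 1" unfolding s_def by (intro tendsto_intros lim)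
  then have s1: "(\<lambda>n. s n - 1) \<longlonglongrightarrow> 0" by simp
  have sO: "Op1 M (\<lambda>n \<omega>. s n)" using Op1_add[OF op0_imp_Op1[OF op0_tendsto[OF s1]] Op1_const[of M 1]] by simp
  have T: "op0 M (\<lambda>n \<omega>. \<tau> n * u n (i n) * (inner_d (d n) (u n) (uh n \<omega>) - 1))"
  proof (rule op0_dominated)
    show "op0 M (\<lambda>n \<omega>. 115200 * (\<bar>u n (i n)\<bar> * (P n / \<tau> n)))" by (intro op0_cmult op0_tendsto lim)
    show "whp M (\<lambda>n \<omega>. \<bar>\<tau> n * u n (i n) * (inner_d (d n) (u n) (uh n \<omega>) - 1)\<bar> \<le> 115200 * (\<bar>u n (i n)\<bar> * (P n / \<tau> n)))"
    proof (rule whp_mono[OF al], intro always_eventually allI ballI impI)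
      fix n \<omega> assume h: "\<bar>inner_d (d n) (u n) (uh n \<omega>) - 1\<bar> \<le> 50 * (48 * sqrt (P n) / \<tau> n)\<^sup>2"
      have "\<bar>\<tau> n * u n (i n) * (inner_d (d n) (u n) (uh n \<omega>) - 1)\<bar> = \<tau> n * \<bar>u n (i n)\<bar> * \<bar>inner_d (d n) (u n) (uh n \<omega>) - 1\<bar>"
        using \<tau>[of n] by (simp add: abs_mult)
      also have "\<dots> \<le> \<tau> n * \<bar>u n (i n)\<bar> * (50 * (48 * sqrt (P n) / \<tau> n)\<^sup>2)"
        using \<tau>[of n] by (intro mult_left_mono h) simp
      also have "\<dots> = 115200 * (\<bar>u n (i n)\<bar> * (P n / \<tau> n))"
      proof -
        have "(48 * sqrt (P n) / \<tau> n)\<^sup>2 = 2304 * P n / (\<tau> n * \<tau> n)" using P[of n] by (simp add: power2_eq_square)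
        then show ?thesis using \<tau>[of n] by (simp add: field_simps)
      qed
      finally show "\<bar>\<tau> n * u n (i n) * (inner_d (d n) (u n) (uh n \<omega>) - 1)\<bar> \<le> 115200 * (\<bar>u n (i n)\<bar> * (P n / \<tau> n))" .
    qed
  qed
  have "op0 M (\<lambda>n \<omega>. \<tau> n * u n (i n) * (inner_d (d n) (u n) (uh n \<omega>) - 1)
      + (\<tau> n * inner_d (d n) (f n) (uh n \<omega>) - Y n \<omega>) * s n + (s n - 1) * Y n \<omega>)"
    by (intro op0_add T op0_mult_Op1 B sO op0_tendsto s1 C)
  then show ?thesis
  proof (rule op0_whp_eq, intro whp_eventually, use dec in eventually_elim, intro ballI)
    fix n \<omega> assume "\<forall>x. x (i n) = u n (i n) * inner_d (d n) (u n) x + sqrt (1 - (u n (i n))\<^sup>2) * inner_d (d n) (f n) x"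
    then have "uh n \<omega> (i n) = u n (i n) * inner_d (d n) (u n) (uh n \<omega>) + s n * inner_d (d n) (f n) (uh n \<omega>)"
      unfolding s_def by (rule spec)
    then show "\<tau> n * (uh n \<omega> (i n) - u n (i n)) - Y n \<omega> = \<tau> n * u n (i n) * (inner_d (d n) (u n) (uh n \<omega>) - 1)
      + (\<tau> n * inner_d (d n) (f n) (uh n \<omega>) - Y n \<omega>) * s n + (s n - 1) * Y n \<omega>"
      by (simp add: algebra_simps)
  qed
qed

section \<open>Measurability of the estimates\<close>

lemma normalize_measurable:
  assumes x: "\<And>i. i < d \<Longrightarrow> (\<lambda>\<omega>. x \<omega> i) \<in> borel_measurable M" and i: "i < d"
  shows "(\<lambda>\<omega>. normalize_d d (x \<omega>) i) \<in> borel_measurable M"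
proof -
  have [measurable]: "(\<lambda>\<omega>. \<Sum>i<d. (x \<omega> i)\<^sup>2) \<in> borel_measurable M"
    by (intro borel_measurable_sum borel_measurable_power x) auto
  have [measurable]: "(\<lambda>\<omega>. x \<omega> i) \<in> borel_measurable M" by (rule x[OF i])
  show ?thesis unfolding normalize_d_def vnorm_def by measurable
qed

lemma inner_d_measurable:
  assumes "\<And>i. i < d \<Longrightarrow> (\<lambda>\<omega>. x \<omega> i) \<in> borel_measurable M" "\<And>i. i < d \<Longrightarrow> (\<lambda>\<omega>. y \<omega> i) \<in> borel_measurable M"
  shows "(\<lambda>\<omega>. inner_d d (x \<omega>) (y \<omega>)) \<in> borel_measurable M"
  unfolding inner_d_def by (intro borel_measurable_sum borel_measurable_times assms) auto

lemma sign_align_measurable: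
  assumes x: "\<And>i. i < d \<Longrightarrow> (\<lambda>\<omega>. x \<omega> i) \<in> borel_measurable M" and i: "i < d"
  shows "(\<lambda>\<omega>. sign_align d (x \<omega>) r i) \<in> borel_measurable M"
proof -
  have [measurable]: "(\<lambda>\<omega>. inner_d d (x \<omega>) r) \<in> borel_measurable M" by (rule inner_d_measurable[OF x]) auto
  have [measurable]: "(\<lambda>\<omega>. x \<omega> i) \<in> borel_measurable M" by (rule x[OF i])
  have "(\<lambda>\<omega>. sign_align d (x \<omega>) r i) = (\<lambda>\<omega>. if inner_d d (x \<omega>) r < 0 then - x \<omega> i else x \<omega> i)"
    by (auto simp: sign_align_def)
  then show ?thesis by simp
qed

lemma contr1_measurable:
  assumes "\<And>j k. j < d2 \<Longrightarrow> k < d3 \<Longrightarrow> (\<lambda>\<omega>. A \<omega> i j k) \<in> borel_measurable M"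
    "\<And>j. j < d2 \<Longrightarrow> (\<lambda>\<omega>. y \<omega> j) \<in> borel_measurable M" "\<And>k. k < d3 \<Longrightarrow> (\<lambda>\<omega>. z \<omega> k) \<in> borel_measurable M"
  shows "(\<lambda>\<omega>. contr1 d1 d2 d3 (A \<omega>) (y \<omega>) (z \<omega>) i) \<in> borel_measurable M"
  unfolding contr1_def by (intro borel_measurable_sum borel_measurable_times assms) auto

text \<open>Measurability is tracked entry by entry, and only below the dimension, since vectors are
  functions whose other values carry no information.\<close>

lemma power_iter_measurable:
  assumes A: "\<And>i j k. i < d1 \<Longrightarrow> j < d2 \<Longrightarrow> k < d3 \<Longrightarrow> (\<lambda>\<omega>. A \<omega> i j k) \<in> borel_measurable M"
    and init: "\<And>i. i < d1 \<Longrightarrow> (\<lambda>\<omega>. u0 \<omega> i) \<in> borel_measurable M" "\<And>i. i < d2 \<Longrightarrow> (\<lambda>\<omega>. v0 \<omega> i) \<in> borel_measurable M"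
      "\<And>i. i < d3 \<Longrightarrow> (\<lambda>\<omega>. w0 \<omega> i) \<in> borel_measurable M"
  shows "(\<forall>i<d1. (\<lambda>\<omega>. fst (power_iter d1 d2 d3 (A \<omega>) (u0 \<omega>) (v0 \<omega>) (w0 \<omega>) t) i) \<in> borel_measurable M) \<and>
    (\<forall>i<d2. (\<lambda>\<omega>. fst (snd (power_iter d1 d2 d3 (A \<omega>) (u0 \<omega>) (v0 \<omega>) (w0 \<omega>) t)) i) \<in> borel_measurable M) \<and>
    (\<forall>i<d3. (\<lambda>\<omega>. snd (snd (power_iter d1 d2 d3 (A \<omega>) (u0 \<omega>) (v0 \<omega>) (w0 \<omega>) t)) i) \<in> borel_measurable M)"
proof (induction t)
  case 0
  then show ?case using init by simp
next
  case (Suc t)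
  define a where "a \<omega> = fst (power_iter d1 d2 d3 (A \<omega>) (u0 \<omega>) (v0 \<omega>) (w0 \<omega>) t)" for \<omega>
  define b where "b \<omega> = fst (snd (power_iter d1 d2 d3 (A \<omega>) (u0 \<omega>) (v0 \<omega>) (w0 \<omega>) t))" for \<omega>
  define c where "c \<omega> = snd (snd (power_iter d1 d2 d3 (A \<omega>) (u0 \<omega>) (v0 \<omega>) (w0 \<omega>) t))" for \<omega>
  have m: "\<And>i. i < d1 \<Longrightarrow> (\<lambda>\<omega>. a \<omega> i) \<in> borel_measurable M" "\<And>i. i < d2 \<Longrightarrow> (\<lambda>\<omega>. b \<omega> i) \<in> borel_measurable M"
    "\<And>i. i < d3 \<Longrightarrow> (\<lambda>\<omega>. c \<omega> i) \<in> borel_measurable M"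
    using Suc.IH by (simp_all add: a_def b_def c_def)
  have eq: "power_iter d1 d2 d3 (A \<omega>) (u0 \<omega>) (v0 \<omega>) (w0 \<omega>) (Suc t) =
     (normalize_d d1 (contr1 d1 d2 d3 (A \<omega>) (b \<omega>) (c \<omega>)),
      normalize_d d2 (contr1 d2 d1 d3 (\<lambda>j i k. A \<omega> i j k) (a \<omega>) (c \<omega>)),
      normalize_d d3 (contr1 d3 d1 d2 (\<lambda>k i j. A \<omega> i j k) (a \<omega>) (b \<omega>)))" for \<omega>
    by (simp add: split_def a_def b_def c_def contr1_def contr2_def contr3_def)
  show ?case unfolding eq fst_conv snd_conv
    by (intro conjI allI impI normalize_measurable contr1_measurable) (simp_all add: A m)
qed

context tpca
begin

definition "last_iterate n \<omega> = power_iter (p1 n) (p2 n) (p3 n) (A n \<omega>) (g1 n (A n \<omega>)) (g2 n (A n \<omega>)) (g3 n (A n \<omega>)) (tmax n)"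

lemma A_measurable:
  assumes "i < p1 n" "j < p2 n" "k < p3 n" shows "(\<lambda>\<omega>. A n \<omega> i j k) \<in> borel_measurable (M n)"
proof -
  have "X n (i, j, k) \<in> borel_measurable (M n)"
    using assms by (intro iid_N01_measurable[OF iid_X]) (simp add: box_def)
  then show ?thesis unfolding A_noise noise_def by simp
qed

lemma hat_measurable:
  "i < p1 n \<Longrightarrow> (\<lambda>\<omega>. Uh n \<omega> i) \<in> borel_measurable (M n)"
  "i < p2 n \<Longrightarrow> (\<lambda>\<omega>. Vh n \<omega> i) \<in> borel_measurable (M n)"
  "i < p3 n \<Longrightarrow> (\<lambda>\<omega>. Wh n \<omega> i) \<in> borel_measurable (M n)"
proof -
  have h: "Uh n \<omega> = sign_align (p1 n) (fst (last_iterate n \<omega>)) (u n)" "Vh n \<omega> = sign_align (p2 n) (fst (snd (last_iterate n \<omega>))) (v n)"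
    "Wh n \<omega> = sign_align (p3 n) (snd (snd (last_iterate n \<omega>))) (w n)" for \<omega>
    by (simp_all add: Uh_def Vh_def Wh_def estimates_def est_def Let_def alg4_uvw_def split_def last_iterate_def A_def)
  have pm: "(\<forall>i<p1 n. (\<lambda>\<omega>. fst (last_iterate n \<omega>) i) \<in> borel_measurable (M n)) \<and> (\<forall>i<p2 n. (\<lambda>\<omega>. fst (snd (last_iterate n \<omega>)) i) \<in> borel_measurable (M n)) \<and>
    (\<forall>i<p3 n. (\<lambda>\<omega>. snd (snd (last_iterate n \<omega>)) i) \<in> borel_measurable (M n))"
    unfolding last_iterate_def by (rule power_iter_measurable) (rule A_measurable init_meas, assumption+)+
  show "i < p1 n \<Longrightarrow> (\<lambda>\<omega>. Uh n \<omega> i) \<in> borel_measurable (M n)"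
    "i < p2 n \<Longrightarrow> (\<lambda>\<omega>. Vh n \<omega> i) \<in> borel_measurable (M n)"
    "i < p3 n \<Longrightarrow> (\<lambda>\<omega>. Wh n \<omega> i) \<in> borel_measurable (M n)"
    unfolding h using pm by (auto intro: sign_align_measurable)
qed

lemma clt_stat_measurable:
  assumes "\<And>i. i < d \<Longrightarrow> (\<lambda>\<omega>. x \<omega> i) \<in> borel_measurable N"
  shows "(\<lambda>\<omega>. clt_stat d t q r (x \<omega>)) \<in> borel_measurable N"
proof -
  have [measurable]: "(\<lambda>\<omega>. inner_d d q (\<lambda>i. x \<omega> i - r i)) \<in> borel_measurable N"
    by (rule inner_d_measurable) (use assms in auto)
  show ?thesis unfolding clt_stat_def by measurable
qed

section \<open>The three modes in common coordinates\<close>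

lemma p_top: "filterlim (\<lambda>n. real (p1 n)) at_top sequentially" "filterlim (\<lambda>n. real (p2 n)) at_top sequentially"
    "filterlim (\<lambda>n. real (p3 n)) at_top sequentially"
proof -
  have "filterlim (\<lambda>n. c0 * P n) at_top sequentially"
    by (rule filterlim_tendsto_pos_mult_at_top[OF tendsto_const c0 P_top])
  then show "filterlim (\<lambda>n. real (p1 n)) at_top sequentially" "filterlim (\<lambda>n. real (p2 n)) at_top sequentially"
    "filterlim (\<lambda>n. real (p3 n)) at_top sequentially"
    by (rule filterlim_at_top_mono, use p_lower in simp)+
qed

lemma p_ge2: "\<forall>\<^sub>F n in sequentially. 2 \<le> p1 n \<and> 2 \<le> p2 n \<and> 2 \<le> p3 n"
proof -
  have "\<forall>\<^sub>F n in sequentially. 2 \<le> real (p1 n)" "\<forall>\<^sub>F n in sequentially. 2 \<le> real (p2 n)" "\<forall>\<^sub>F n in sequentially. 2 \<le> real (p3 n)"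
    using p_top unfolding filterlim_at_top by blast+
  then show ?thesis by eventually_elim auto
qed

text \<open>Bases adapted to the true vectors, required only eventually because in dimension 1 there
  is no tangential direction.\<close>

definition frame :: "(nat \<Rightarrow> nat \<Rightarrow> vec) \<Rightarrow> (nat \<Rightarrow> nat \<Rightarrow> vec) \<Rightarrow> (nat \<Rightarrow> nat \<Rightarrow> vec) \<Rightarrow> bool" where
  "frame f g h \<longleftrightarrow> (\<forall>\<^sub>F n in sequentially. orthonormal (p1 n) (p1 n) (f n) \<and> f n 0 = u n \<and>
     orthonormal (p2 n) (p2 n) (g n) \<and> g n 0 = v n \<and> orthonormal (p3 n) (p3 n) (h n) \<and> h n 0 = w n \<and>
     2 \<le> p1 n \<and> 2 \<le> p2 n \<and> 2 \<le> p3 n)"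

definition "zt f g h n = zeta (p1 n) (p2 n) (p3 n) (X n) (f n) (g n) (h n)"

text \<open>Permuting the modes merely permutes the indices of the rotated coordinates. The three
  expansions thereby refer to one family \<open>zt\<close>, as joint independence requires.\<close>

lemma zt_swap12: "zeta (p2 n) (p1 n) (p3 n) (X2 n) (g n) (f n) (h n) (b, a, c) = zt f g h n (a, b, c)"
proof -
  have "tens (X2 n) \<omega> = (\<lambda>j i k. tens (X n) \<omega> i j k)" for \<omega> by (simp add: tens_def X2_def)
  then show ?thesis
    by (simp add: zeta_def zt_def lam_hat_swap12[of "p2 n" "p1 n" "p3 n" "tens (X n) _"])
qed

lemma zt_rotate: "zeta (p3 n) (p1 n) (p2 n) (X3 n) (h n) (f n) (g n) (c, a, b) = zt f g h n (a, b, c)"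
proof -
  have "tens (X3 n) \<omega> = (\<lambda>k i j. tens (X n) \<omega> i j k)" for \<omega> by (simp add: tens_def X3_def)
  then show ?thesis
    by (simp add: zeta_def zt_def lam_hat_rotate[of "p3 n" "p1 n" "p2 n" "tens (X n) _"])
qed

lemma mode1:
  assumes "frame f g h"
  shows "op0 M (\<lambda>n \<omega>. (\<tau> n)\<^sup>2 / sqrt (P n) * (inner_d (p1 n) (u n) (Uh n \<omega>) - 1 + (\<Sum>s\<in>{1..<p1 n}. (zt f g h n (s, 0, 0) \<omega>)\<^sup>2) / (2 * (\<tau> n)\<^sup>2)))"
    "op0 M (\<lambda>n \<omega>. \<tau> n * inner_d (p1 n) (f n 1) (Uh n \<omega>) - zt f g h n (1, 0, 0) \<omega>)"
    "whp M (\<lambda>n \<omega>. \<bar>inner_d (p1 n) (u n) (Uh n \<omega>) - 1\<bar> \<le> 50 * (48 * sqrt (P n) / \<tau> n)\<^sup>2)"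
    "Op1 M (\<lambda>n. zt f g h n (0, 0, 0))" "Op1 M (\<lambda>n. zt f g h n (1, 0, 0))"
proof -
  have ev: "\<forall>\<^sub>F n in sequentially. orthonormal (p1 n) (p1 n) (f n) \<and> f n 0 = u n \<and> orthonormal (p2 n) (p2 n) (g n) \<and> g n 0 = v n \<and>
       orthonormal (p3 n) (p3 n) (h n) \<and> h n 0 = w n \<and> 2 \<le> p1 n"
    using assms unfolding frame_def by eventually_elim auto
  have d: "0 < p1 n \<and> 0 < p2 n \<and> 0 < p3 n \<and> real (p1 n) \<le> P n \<and> real (p2 n) \<le> P n \<and> real (p3 n) \<le> P n" for n
    using p_pos p_le by auto
  have ref: "whp M (\<lambda>n \<omega>. refined (p1 n) (p2 n) (p3 n) (noise (X n) (\<tau> n) \<omega>) (u n) (v n) (w n) (48 * sqrt (P n) / \<tau> n) (Uh n \<omega>))"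
    by (rule whp_mono[OF whp_good]) (simp add: good_def e_def)
  note R = mode_expansion[OF iid_X ev d tau_pos rates ref]
  show "op0 M (\<lambda>n \<omega>. (\<tau> n)\<^sup>2 / sqrt (P n) * (inner_d (p1 n) (u n) (Uh n \<omega>) - 1 + (\<Sum>s\<in>{1..<p1 n}. (zt f g h n (s, 0, 0) \<omega>)\<^sup>2) / (2 * (\<tau> n)\<^sup>2)))"
    "op0 M (\<lambda>n \<omega>. \<tau> n * inner_d (p1 n) (f n 1) (Uh n \<omega>) - zt f g h n (1, 0, 0) \<omega>)"
    "whp M (\<lambda>n \<omega>. \<bar>inner_d (p1 n) (u n) (Uh n \<omega>) - 1\<bar> \<le> 50 * (48 * sqrt (P n) / \<tau> n)\<^sup>2)"
    "Op1 M (\<lambda>n. zt f g h n (0, 0, 0))" "Op1 M (\<lambda>n. zt f g h n (1, 0, 0))"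
    using R unfolding zt_def by blast+
qed

lemma mode2:
  assumes "frame f g h"
  shows "op0 M (\<lambda>n \<omega>. (\<tau> n)\<^sup>2 / sqrt (P n) * (inner_d (p2 n) (v n) (Vh n \<omega>) - 1 + (\<Sum>s\<in>{1..<p2 n}. (zt f g h n (0, s, 0) \<omega>)\<^sup>2) / (2 * (\<tau> n)\<^sup>2)))"
    "op0 M (\<lambda>n \<omega>. \<tau> n * inner_d (p2 n) (g n 1) (Vh n \<omega>) - zt f g h n (0, 1, 0) \<omega>)"
    "whp M (\<lambda>n \<omega>. \<bar>inner_d (p2 n) (v n) (Vh n \<omega>) - 1\<bar> \<le> 50 * (48 * sqrt (P n) / \<tau> n)\<^sup>2)"
    "Op1 M (\<lambda>n. zt f g h n (0, 1, 0))"
proof -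
  have ev: "\<forall>\<^sub>F n in sequentially. orthonormal (p2 n) (p2 n) (g n) \<and> g n 0 = v n \<and> orthonormal (p1 n) (p1 n) (f n) \<and> f n 0 = u n \<and>
       orthonormal (p3 n) (p3 n) (h n) \<and> h n 0 = w n \<and> 2 \<le> p2 n"
    using assms unfolding frame_def by eventually_elim auto
  have d: "0 < p2 n \<and> 0 < p1 n \<and> 0 < p3 n \<and> real (p2 n) \<le> P n \<and> real (p1 n) \<le> P n \<and> real (p3 n) \<le> P n" for n
    using p_pos p_le by auto
  have ref: "whp M (\<lambda>n \<omega>. refined (p2 n) (p1 n) (p3 n) (noise (X2 n) (\<tau> n) \<omega>) (v n) (u n) (w n) (48 * sqrt (P n) / \<tau> n) (Vh n \<omega>))"
    by (rule whp_mono[OF whp_good]) (simp add: good_def e_def)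
  note R = mode_expansion[OF iid_X2 ev d tau_pos rates ref, unfolded zt_swap12]
  show "op0 M (\<lambda>n \<omega>. (\<tau> n)\<^sup>2 / sqrt (P n) * (inner_d (p2 n) (v n) (Vh n \<omega>) - 1 + (\<Sum>s\<in>{1..<p2 n}. (zt f g h n (0, s, 0) \<omega>)\<^sup>2) / (2 * (\<tau> n)\<^sup>2)))"
    "op0 M (\<lambda>n \<omega>. \<tau> n * inner_d (p2 n) (g n 1) (Vh n \<omega>) - zt f g h n (0, 1, 0) \<omega>)"
    "whp M (\<lambda>n \<omega>. \<bar>inner_d (p2 n) (v n) (Vh n \<omega>) - 1\<bar> \<le> 50 * (48 * sqrt (P n) / \<tau> n)\<^sup>2)"
    "Op1 M (\<lambda>n. zt f g h n (0, 1, 0))"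
    by (fact R)+
qed

lemma mode3:
  assumes "frame f g h"
  shows "op0 M (\<lambda>n \<omega>. (\<tau> n)\<^sup>2 / sqrt (P n) * (inner_d (p3 n) (w n) (Wh n \<omega>) - 1 + (\<Sum>s\<in>{1..<p3 n}. (zt f g h n (0, 0, s) \<omega>)\<^sup>2) / (2 * (\<tau> n)\<^sup>2)))"
    "op0 M (\<lambda>n \<omega>. \<tau> n * inner_d (p3 n) (h n 1) (Wh n \<omega>) - zt f g h n (0, 0, 1) \<omega>)"
    "whp M (\<lambda>n \<omega>. \<bar>inner_d (p3 n) (w n) (Wh n \<omega>) - 1\<bar> \<le> 50 * (48 * sqrt (P n) / \<tau> n)\<^sup>2)"
    "Op1 M (\<lambda>n. zt f g h n (0, 0, 1))"
proof -
  have ev: "\<forall>\<^sub>F n in sequentially. orthonormal (p3 n) (p3 n) (h n) \<and> h n 0 = w n \<and> orthonormal (p1 n) (p1 n) (f n) \<and> f n 0 = u n \<and>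
       orthonormal (p2 n) (p2 n) (g n) \<and> g n 0 = v n \<and> 2 \<le> p3 n"
    using assms unfolding frame_def by eventually_elim auto
  have d: "0 < p3 n \<and> 0 < p1 n \<and> 0 < p2 n \<and> real (p3 n) \<le> P n \<and> real (p1 n) \<le> P n \<and> real (p2 n) \<le> P n" for n
    using p_pos p_le by auto
  have ref: "whp M (\<lambda>n \<omega>. refined (p3 n) (p1 n) (p2 n) (noise (X3 n) (\<tau> n) \<omega>) (w n) (u n) (v n) (48 * sqrt (P n) / \<tau> n) (Wh n \<omega>))"
    by (rule whp_mono[OF whp_good]) (simp add: good_def e_def)
  note R = mode_expansion[OF iid_X3 ev d tau_pos rates ref, unfolded zt_rotate]
  show "op0 M (\<lambda>n \<omega>. (\<tau> n)\<^sup>2 / sqrt (P n) * (inner_d (p3 n) (w n) (Wh n \<omega>) - 1 + (\<Sum>s\<in>{1..<p3 n}. (zt f g h n (0, 0, s) \<omega>)\<^sup>2) / (2 * (\<tau> n)\<^sup>2)))"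
    "op0 M (\<lambda>n \<omega>. \<tau> n * inner_d (p3 n) (h n 1) (Wh n \<omega>) - zt f g h n (0, 0, 1) \<omega>)"
    "whp M (\<lambda>n \<omega>. \<bar>inner_d (p3 n) (w n) (Wh n \<omega>) - 1\<bar> \<le> 50 * (48 * sqrt (P n) / \<tau> n)\<^sup>2)"
    "Op1 M (\<lambda>n. zt f g h n (0, 0, 1))"
    by (fact R)+
qed

lemma iid_zt:
  assumes "frame f g h"
  shows "\<forall>\<^sub>F n in sequentially. iid_N01 (M n) (box (p1 n) (p2 n) (p3 n)) (zt f g h n) \<and> 2 \<le> p1 n \<and> 2 \<le> p2 n \<and> 2 \<le> p3 n"
  using assms unfolding frame_def by eventually_elim (use iid_N01_rotate[OF iid_X] in \<open>simp add: zt_def zeta_def\<close>)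

text \<open>The mixtures use disjoint axes, hence are independent, and each characteristic function
  converges. Only weights with unit square sum are asked for, so the result serves general linear
  functionals and single entries alike.\<close>

lemma mixture_triple_clt:
  assumes fr: "frame f g h"
    and w1: "\<forall>\<^sub>F n in sequentially. (c1 n)\<^sup>2 + (a1 n)\<^sup>2 = 1" and w2: "\<forall>\<^sub>F n in sequentially. (c2 n)\<^sup>2 + (a2 n)\<^sup>2 = 1"
    and w3: "\<forall>\<^sub>F n in sequentially. (c3 n)\<^sup>2 + (a3 n)\<^sup>2 = 1"
  shows "conv_ev M (\<lambda>n \<omega>. (mixture (p1 n) (c1 n) (a1 n) (\<lambda>i. zt f g h n (i, 0, 0)) \<omega>,
     mixture (p2 n) (c2 n) (a2 n) (\<lambda>i. zt f g h n (0, i, 0)) \<omega>, mixture (p3 n) (c3 n) (a3 n) (\<lambda>i. zt f g h n (0, 0, i)) \<omega>)) N3"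
proof (rule conv_ev_independent[OF prob])
  show "\<forall>\<^sub>F n in sequentially. mixture (p1 n) (c1 n) (a1 n) (\<lambda>i. zt f g h n (i, 0, 0)) \<in> borel_measurable (M n) \<and>
     mixture (p2 n) (c2 n) (a2 n) (\<lambda>i. zt f g h n (0, i, 0)) \<in> borel_measurable (M n) \<and> mixture (p3 n) (c3 n) (a3 n) (\<lambda>i. zt f g h n (0, 0, i)) \<in> borel_measurable (M n) \<and>
     distr (M n) (borel \<Otimes>\<^sub>M (borel \<Otimes>\<^sub>M borel)) (\<lambda>\<omega>. (mixture (p1 n) (c1 n) (a1 n) (\<lambda>i. zt f g h n (i, 0, 0)) \<omega>,
     mixture (p2 n) (c2 n) (a2 n) (\<lambda>i. zt f g h n (0, i, 0)) \<omega>, mixture (p3 n) (c3 n) (a3 n) (\<lambda>i. zt f g h n (0, 0, i)) \<omega>)) =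
     distr (M n) borel (mixture (p1 n) (c1 n) (a1 n) (\<lambda>i. zt f g h n (i, 0, 0))) \<Otimes>\<^sub>M
     (distr (M n) borel (mixture (p2 n) (c2 n) (a2 n) (\<lambda>i. zt f g h n (0, i, 0))) \<Otimes>\<^sub>M distr (M n) borel (mixture (p3 n) (c3 n) (a3 n) (\<lambda>i. zt f g h n (0, 0, i))))"
    using iid_zt[OF fr] by eventually_elim (rule triple_independent, auto)
  fix t
  have b1: "\<forall>\<^sub>F n in sequentially. iid_N01 (M n) (box (p1 n) (p2 n) (p3 n)) (zt f g h n) \<and> (\<lambda>i. (i, 0, 0)) ` {1..<p1 n} \<subseteq> box (p1 n) (p2 n) (p3 n) \<and> 2 \<le> p1 n \<and> (c1 n)\<^sup>2 + (a1 n)\<^sup>2 = 1"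
    using iid_zt[OF fr] w1 by eventually_elim (auto simp: box_def)
  show "(\<lambda>n. char (distr (M n) borel (mixture (p1 n) (c1 n) (a1 n) (\<lambda>i. zt f g h n (i, 0, 0)))) t) \<longlonglongrightarrow> char N01 t"
    by (rule mixture_char_tendsto[OF b1 _ p_top(1)]) (simp add: inj_def)
  have b2: "\<forall>\<^sub>F n in sequentially. iid_N01 (M n) (box (p1 n) (p2 n) (p3 n)) (zt f g h n) \<and> (\<lambda>i. (0, i, 0)) ` {1..<p2 n} \<subseteq> box (p1 n) (p2 n) (p3 n) \<and> 2 \<le> p2 n \<and> (c2 n)\<^sup>2 + (a2 n)\<^sup>2 = 1"
    using iid_zt[OF fr] w2 by eventually_elim (auto simp: box_def)
  show "(\<lambda>n. char (distr (M n) borel (mixture (p2 n) (c2 n) (a2 n) (\<lambda>i. zt f g h n (0, i, 0)))) t) \<longlonglongrightarrow> char N01 t"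
    by (rule mixture_char_tendsto[OF b2 _ p_top(2)]) (simp add: inj_def)
  have b3: "\<forall>\<^sub>F n in sequentially. iid_N01 (M n) (box (p1 n) (p2 n) (p3 n)) (zt f g h n) \<and> (\<lambda>i. (0, 0, i)) ` {1..<p3 n} \<subseteq> box (p1 n) (p2 n) (p3 n) \<and> 2 \<le> p3 n \<and> (c3 n)\<^sup>2 + (a3 n)\<^sup>2 = 1"
    using iid_zt[OF fr] w3 by eventually_elim (auto simp: box_def)
  show "(\<lambda>n. char (distr (M n) borel (mixture (p3 n) (c3 n) (a3 n) (\<lambda>i. zt f g h n (0, 0, i)))) t) \<longlonglongrightarrow> char N01 t"
    by (rule mixture_char_tendsto[OF b3 _ p_top(3)]) (simp add: inj_def)
qed

definition decomposes :: "nat \<Rightarrow> vec \<Rightarrow> vec \<Rightarrow> (nat \<Rightarrow> vec) \<Rightarrow> bool" where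
  "decomposes d r q f \<longleftrightarrow> orthonormal d d f \<and> f 0 = r \<and> 2 \<le> d \<and>
    (\<forall>x. inner_d d q x = inner_d d q r * inner_d d r x + sqrt (1 - (inner_d d q r)\<^sup>2) * inner_d d (f 1) x)"

text \<open>The condition 2 \<le> d n stands inside the conclusion so that choice can be applied
  over all n at once.\<close>

lemma exists_decomposition:
  assumes r: "\<And>n. vnorm (d n) (r n) = 1" and q: "\<And>n. vnorm (d n) (q n) = 1"
  shows "\<exists>f. \<forall>n. 2 \<le> d n \<longrightarrow> decomposes (d n) (r n) (q n) (f n)"
proof -
  have "\<forall>n. \<exists>f. 2 \<le> d n \<longrightarrow> decomposes (d n) (r n) (q n) f"
  proof
    fix n
    show "\<exists>f. 2 \<le> d n \<longrightarrow> decomposes (d n) (r n) (q n) f"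
    proof (cases "2 \<le> d n")
      case True
      obtain f where "orthonormal (d n) (d n) f" "f 0 = r n"
        "\<And>x. inner_d (d n) (q n) x = inner_d (d n) (q n) (r n) * inner_d (d n) (r n) x + sqrt (1 - (inner_d (d n) (q n) (r n))\<^sup>2) * inner_d (d n) (f 1) x"
        using unit_decomposition[OF r q True] by blast
      then show ?thesis using True unfolding decomposes_def by blast
    qed simp
  qed
  then show ?thesis by (rule choice)
qed

lemma frame_of_decompositions:
  assumes "\<forall>n. 2 \<le> p1 n \<longrightarrow> decomposes (p1 n) (u n) (q1 n) (f n)" "\<forall>n. 2 \<le> p2 n \<longrightarrow> decomposes (p2 n) (v n) (q2 n) (g n)"
    "\<forall>n. 2 \<le> p3 n \<longrightarrow> decomposes (p3 n) (w n) (q3 n) (h n)"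
  shows "frame f g h"
  unfolding frame_def using p_ge2
proof eventually_elim
  case (elim n)
  then have "decomposes (p1 n) (u n) (q1 n) (f n)" "decomposes (p2 n) (v n) (q2 n) (g n)" "decomposes (p3 n) (w n) (q3 n) (h n)"
    using assms by blast+
  then show ?case unfolding decomposes_def by blast
qed

lemma decomposition_clt_form:
  assumes "\<forall>n. 2 \<le> d n \<longrightarrow> decomposes (d n) (r n) (q n) (f n)" "\<And>n. vnorm (d n) (r n) = 1" "\<And>n. vnorm (d n) (q n) = 1"
    "\<forall>\<^sub>F n in sequentially. 2 \<le> d n"
  shows "\<forall>\<^sub>F n in sequentially. 2 \<le> d n \<and> vnorm (d n) (r n) = 1 \<and> vnorm (d n) (q n) = 1 \<and> inner_d (d n) (f n 1) (r n) = 0 \<and>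
      (\<forall>x. inner_d (d n) (q n) x = inner_d (d n) (q n) (r n) * inner_d (d n) (r n) x
         + sqrt (1 - (inner_d (d n) (q n) (r n))\<^sup>2) * inner_d (d n) (f n 1) x)"
  using assms(4)
proof eventually_elim
  case (elim n)
  then have dec: "decomposes (d n) (r n) (q n) (f n)" using assms(1) by simp
  then have on: "orthonormal (d n) (d n) (f n)" and f0: "f n 0 = r n" unfolding decomposes_def by blast+
  have "inner_d (d n) (f n 1) (f n 0) = 0" using on elim by (simp add: orthonormal_def)
  then show ?case using dec assms(2,3) elim unfolding decomposes_def f0 by blast
qed

text \<open>Slutsky's theorem with the mixtures as approximants. The bases are adapted to the given
  functionals, so that index 1 is the only tangential direction involved in each mode.\<close>

lemma linear_functionals_clt:
  assumes q: "\<And>n. vnorm (p1 n) (q1 n) = 1" "\<And>n. vnorm (p2 n) (q2 n) = 1" "\<And>n. vnorm (p3 n) (q3 n) = 1"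
  shows "conv_distr M (\<lambda>n \<omega>. (clt_stat (p1 n) (\<tau> n) (q1 n) (u n) (Uh n \<omega>), clt_stat (p2 n) (\<tau> n) (q2 n) (v n) (Vh n \<omega>),
     clt_stat (p3 n) (\<tau> n) (q3 n) (w n) (Wh n \<omega>))) N3"
proof -
  obtain f where f: "\<forall>n. 2 \<le> p1 n \<longrightarrow> decomposes (p1 n) (u n) (q1 n) (f n)" using exists_decomposition[of p1 u q1, OF units(1) q(1)] by blast
  obtain g where g: "\<forall>n. 2 \<le> p2 n \<longrightarrow> decomposes (p2 n) (v n) (q2 n) (g n)" using exists_decomposition[of p2 v q2, OF units(2) q(2)] by blast
  obtain h where h: "\<forall>n. 2 \<le> p3 n \<longrightarrow> decomposes (p3 n) (w n) (q3 n) (h n)" using exists_decomposition[of p3 w q3, OF units(3) q(3)] by blast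
  have fr: "frame f g h" by (rule frame_of_decompositions[OF f g h])
  have ge: "\<forall>\<^sub>F n in sequentially. 2 \<le> p1 n" "\<forall>\<^sub>F n in sequentially. 2 \<le> p2 n" "\<forall>\<^sub>F n in sequentially. 2 \<le> p3 n"
    using p_ge2 by (auto elim: eventually_mono)
  note R1 = clt_mode[OF P_top P_ge1 p_lower(1) c0 tau_pos decomposition_clt_form[OF f units(1) q(1) ge(1)] mode1(1,2,5)[OF fr]]
  note R2 = clt_mode[OF P_top P_ge1 p_lower(2) c0 tau_pos decomposition_clt_form[OF g units(2) q(2) ge(2)] mode2(1,2,4)[OF fr]]
  note R3 = clt_mode[OF P_top P_ge1 p_lower(3) c0 tau_pos decomposition_clt_form[OF h units(3) q(3) ge(3)] mode3(1,2,4)[OF fr]]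
  show ?thesis
    by (rule slutsky_triple[OF prob mixture_triple_clt[OF fr R1(2) R2(2) R3(2)] _ _ _ R1(1) R2(1) R3(1)])
       (auto intro!: clt_stat_measurable hat_measurable)
qed

end

section \<open>Entries of the singular vectors and of the tensor\<close>

definition coord_vec :: "nat \<Rightarrow> vec" where
  "coord_vec i = (\<lambda>x. if x = i then 1 else 0)"

lemma inner_coord_vec: "i < d \<Longrightarrow> inner_d d (coord_vec i) x = x i"
  by (simp add: inner_d_def coord_vec_def mult_delta_left)

lemma vnorm_coord_vec:
  assumes "i < d" shows "vnorm d (coord_vec i) = 1"
proof -
  have "(vnorm d (coord_vec i))\<^sup>2 = 1"
    unfolding vnorm_square inner_coord_vec[OF assms] by (simp add: coord_vec_def)
  then show ?thesis using vnorm_nonneg[of d "coord_vec i"] by (auto simp: power2_eq_1_iff)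
qed

lemma lam_hat_measurable:
  assumes "\<And>i j k. i < d1 \<Longrightarrow> j < d2 \<Longrightarrow> k < d3 \<Longrightarrow> (\<lambda>\<omega>. A \<omega> i j k) \<in> borel_measurable M"
    "\<And>i. i < d1 \<Longrightarrow> (\<lambda>\<omega>. x \<omega> i) \<in> borel_measurable M" "\<And>j. j < d2 \<Longrightarrow> (\<lambda>\<omega>. y \<omega> j) \<in> borel_measurable M"
    "\<And>k. k < d3 \<Longrightarrow> (\<lambda>\<omega>. z \<omega> k) \<in> borel_measurable M"
  shows "(\<lambda>\<omega>. lam_hat d1 d2 d3 (A \<omega>) (x \<omega>) (y \<omega>) (z \<omega>)) \<in> borel_measurable M"
  unfolding lam_hat_def by (intro borel_measurable_sum borel_measurable_times assms) auto

lemma weights_sum_squares: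
  fixes a b c :: real
  assumes "a \<noteq> 0" "b \<noteq> 0" "c \<noteq> 0"
  shows "(b * c / sqrt (a\<^sup>2 * b\<^sup>2 + b\<^sup>2 * c\<^sup>2 + c\<^sup>2 * a\<^sup>2))\<^sup>2 + (a * c / sqrt (a\<^sup>2 * b\<^sup>2 + b\<^sup>2 * c\<^sup>2 + c\<^sup>2 * a\<^sup>2))\<^sup>2
    + (a * b / sqrt (a\<^sup>2 * b\<^sup>2 + b\<^sup>2 * c\<^sup>2 + c\<^sup>2 * a\<^sup>2))\<^sup>2 = 1"
proof -
  define S where "S = a\<^sup>2 * b\<^sup>2 + b\<^sup>2 * c\<^sup>2 + c\<^sup>2 * a\<^sup>2"
  have "0 < a\<^sup>2 * b\<^sup>2" "0 \<le> b\<^sup>2 * c\<^sup>2" "0 \<le> c\<^sup>2 * a\<^sup>2" using assms by simp_all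
  then have S: "0 < S" unfolding S_def by linarith
  have "(b * c / sqrt S)\<^sup>2 + (a * c / sqrt S)\<^sup>2 + (a * b / sqrt S)\<^sup>2 = (b\<^sup>2 * c\<^sup>2 + a\<^sup>2 * c\<^sup>2 + a\<^sup>2 * b\<^sup>2) / S"
    using S by (simp add: power_divide power_mult_distrib add_divide_distrib)
  also have "b\<^sup>2 * c\<^sup>2 + a\<^sup>2 * c\<^sup>2 + a\<^sup>2 * b\<^sup>2 = S" by (simp add: S_def)
  finally show ?thesis using S by (simp flip: S_def)
qed

context tpca
begin

text \<open>Both limits come from comparing the minimum with a larger quantity: with \<tau>/P, which
  makes the radial bias negligible, and with 1, which makes the entry itself vanish. Here s is 1 for
  entries of vectors and 1/sqrt (ln P) for entries of the tensor.\<close>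

lemma small_coordinate:
  assumes lim: "(\<lambda>n. \<bar>x n\<bar> / min (\<tau> n / P n) (s n)) \<longlonglongrightarrow> 0" and s: "\<forall>\<^sub>F n in sequentially. 0 < s n \<and> s n \<le> 1"
  shows "(\<lambda>n. \<bar>x n\<bar> * (P n / \<tau> n)) \<longlonglongrightarrow> 0" "x \<longlonglongrightarrow> 0"
proof -
  have q: "0 < \<tau> n / P n" for n using tau_pos[of n] P_ge1[of n] by simp
  have le: "\<bar>x n\<bar> / y \<le> \<bar>x n\<bar> / min (\<tau> n / P n) (s n)" if "0 < s n" "min (\<tau> n / P n) (s n) \<le> y" for n y
  proof (rule divide_left_mono)
    have "0 < min (\<tau> n / P n) (s n)" using that(1) q by simp
    then show "0 < y * min (\<tau> n / P n) (s n)" using that(2) by (intro mult_pos_pos) linarith+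
  qed (use that in auto)
  show "(\<lambda>n. \<bar>x n\<bar> * (P n / \<tau> n)) \<longlonglongrightarrow> 0"
  proof (rule Lim_null_comparison[OF _ lim], use s in eventually_elim)
    case (elim n)
    have "norm (\<bar>x n\<bar> * (P n / \<tau> n)) = \<bar>x n\<bar> / (\<tau> n / P n)" using tau_pos[of n] P_ge1[of n] by (simp add: abs_mult)
    also have "\<dots> \<le> \<bar>x n\<bar> / min (\<tau> n / P n) (s n)" using elim by (intro le) auto
    finally show ?case .
  qed
  show "x \<longlonglongrightarrow> 0"
  proof (rule Lim_null_comparison[OF _ lim], use s in eventually_elim)
    case (elim n)
    have "min (\<tau> n / P n) (s n) \<le> 1" using elim by linarith
    then show ?case using le[of n 1] elim by simp
  qed
qed

lemma decomposition_coord: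
  assumes "\<forall>n. 2 \<le> d n \<longrightarrow> decomposes (d n) (r n) (coord_vec (i n)) (f n)" "\<And>n. i n < d n" "\<forall>\<^sub>F n in sequentially. 2 \<le> d n"
  shows "\<forall>\<^sub>F n in sequentially. \<forall>x. x (i n) = r n (i n) * inner_d (d n) (r n) x + sqrt (1 - (r n (i n))\<^sup>2) * inner_d (d n) (f n 1) x"
  using assms(3)
proof eventually_elim
  case (elim n)
  then have "decomposes (d n) (r n) (coord_vec (i n)) (f n)" using assms(1) by blast
  then have D: "\<forall>x. inner_d (d n) (coord_vec (i n)) x = inner_d (d n) (coord_vec (i n)) (r n) * inner_d (d n) (r n) x
      + sqrt (1 - (inner_d (d n) (coord_vec (i n)) (r n))\<^sup>2) * inner_d (d n) (f n 1) x"
    unfolding decomposes_def by blast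
  show ?case using D unfolding inner_coord_vec[OF assms(2)] .
qed

text \<open>Taking coordinate vectors as functionals places the tangential direction of each entry
  at index 1 of one common frame.\<close>

lemma coordinate_expansion:
  assumes ix: "\<And>n. i n < p1 n" "\<And>n. j n < p2 n" "\<And>n. k n < p3 n"
    and u: "(\<lambda>n. \<bar>u n (i n)\<bar> * (P n / \<tau> n)) \<longlonglongrightarrow> 0" "(\<lambda>n. u n (i n)) \<longlonglongrightarrow> 0"
    and v: "(\<lambda>n. \<bar>v n (j n)\<bar> * (P n / \<tau> n)) \<longlonglongrightarrow> 0" "(\<lambda>n. v n (j n)) \<longlonglongrightarrow> 0"
    and w: "(\<lambda>n. \<bar>w n (k n)\<bar> * (P n / \<tau> n)) \<longlonglongrightarrow> 0" "(\<lambda>n. w n (k n)) \<longlonglongrightarrow> 0"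
  obtains f g h where "frame f g h"
    "op0 M (\<lambda>n \<omega>. \<tau> n * (Uh n \<omega> (i n) - u n (i n)) - zt f g h n (1, 0, 0) \<omega>)"
    "op0 M (\<lambda>n \<omega>. \<tau> n * (Vh n \<omega> (j n) - v n (j n)) - zt f g h n (0, 1, 0) \<omega>)"
    "op0 M (\<lambda>n \<omega>. \<tau> n * (Wh n \<omega> (k n) - w n (k n)) - zt f g h n (0, 0, 1) \<omega>)"
proof -
  note q = vnorm_coord_vec[OF ix(1)] vnorm_coord_vec[OF ix(2)] vnorm_coord_vec[OF ix(3)]
  obtain f where f: "\<forall>n. 2 \<le> p1 n \<longrightarrow> decomposes (p1 n) (u n) (coord_vec (i n)) (f n)"
    using exists_decomposition[of p1 u "\<lambda>n. coord_vec (i n)", OF units(1) q(1)] by blast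
  obtain g where g: "\<forall>n. 2 \<le> p2 n \<longrightarrow> decomposes (p2 n) (v n) (coord_vec (j n)) (g n)"
    using exists_decomposition[of p2 v "\<lambda>n. coord_vec (j n)", OF units(2) q(2)] by blast
  obtain h where h: "\<forall>n. 2 \<le> p3 n \<longrightarrow> decomposes (p3 n) (w n) (coord_vec (k n)) (h n)"
    using exists_decomposition[of p3 w "\<lambda>n. coord_vec (k n)", OF units(3) q(3)] by blast
  have fr: "frame f g h" by (rule frame_of_decompositions[OF f g h])
  have ge: "\<forall>\<^sub>F n in sequentially. 2 \<le> p1 n" "\<forall>\<^sub>F n in sequentially. 2 \<le> p2 n" "\<forall>\<^sub>F n in sequentially. 2 \<le> p3 n"
    using p_ge2 by (auto elim: eventually_mono)
  show thesis
    by (rule that[OF fr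
      coord_mode[OF P_ge1 tau_pos decomposition_coord[OF f ix(1) ge(1)] mode1(2)[OF fr] mode1(5)[OF fr] mode1(3)[OF fr] u]
      coord_mode[OF P_ge1 tau_pos decomposition_coord[OF g ix(2) ge(2)] mode2(2)[OF fr] mode2(4)[OF fr] mode2(3)[OF fr] v]
      coord_mode[OF P_ge1 tau_pos decomposition_coord[OF h ix(3) ge(3)] mode3(2)[OF fr] mode3(4)[OF fr] mode3(3)[OF fr] w]])
qed

lemma entries_clt:
  assumes ix: "\<And>n. i n < p1 n" "\<And>n. j n < p2 n" "\<And>n. k n < p3 n"
    and "(\<lambda>n. \<bar>u n (i n)\<bar> / min (\<tau> n / P n) 1) \<longlonglongrightarrow> 0" "(\<lambda>n. \<bar>v n (j n)\<bar> / min (\<tau> n / P n) 1) \<longlonglongrightarrow> 0"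
      "(\<lambda>n. \<bar>w n (k n)\<bar> / min (\<tau> n / P n) 1) \<longlonglongrightarrow> 0"
  shows "conv_distr M (\<lambda>n \<omega>. (\<tau> n * (Uh n \<omega> (i n) - u n (i n)), \<tau> n * (Vh n \<omega> (j n) - v n (j n)), \<tau> n * (Wh n \<omega> (k n) - w n (k n)))) N3"
proof -
  note sm = assms(4-6)[THEN small_coordinate(1)] assms(4-6)[THEN small_coordinate(2)]
  obtain f g h where fr: "frame f g h"
    and o: "op0 M (\<lambda>n \<omega>. \<tau> n * (Uh n \<omega> (i n) - u n (i n)) - zt f g h n (1, 0, 0) \<omega>)"
    "op0 M (\<lambda>n \<omega>. \<tau> n * (Vh n \<omega> (j n) - v n (j n)) - zt f g h n (0, 1, 0) \<omega>)"
    "op0 M (\<lambda>n \<omega>. \<tau> n * (Wh n \<omega> (k n) - w n (k n)) - zt f g h n (0, 0, 1) \<omega>)"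
    by (rule coordinate_expansion[OF ix, of thesis]) (use sm in auto)
  \<comment> \<open>The mixture with weights 1 and 0 is the coordinate of index 1 itself.\<close>
  have "conv_ev M (\<lambda>n \<omega>. (zt f g h n (1, 0, 0) \<omega>, zt f g h n (0, 1, 0) \<omega>, zt f g h n (0, 0, 1) \<omega>)) N3"
    using mixture_triple_clt[OF fr, of "\<lambda>_. 1" "\<lambda>_. 0" "\<lambda>_. 1" "\<lambda>_. 0" "\<lambda>_. 1" "\<lambda>_. 0"] by (simp add: mixture_def)
  then show ?thesis
    by (rule slutsky_triple[OF prob _ _ _ _ o]) (use hat_measurable ix in auto)
qed

text \<open>A unit combination of three independent standard normals is exactly standard normal, so
  the integrals are eventually constant even though the weights vary with n.\<close>

lemma combination_clt:
  assumes fr: "frame f g h" and c: "\<forall>\<^sub>F n in sequentially. (c1 n)\<^sup>2 + (c2 n)\<^sup>2 + (c3 n)\<^sup>2 = 1"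
  shows "conv_ev M (\<lambda>n \<omega>. c1 n * zt f g h n (1, 0, 0) \<omega> + c2 n * zt f g h n (0, 1, 0) \<omega> + c3 n * zt f g h n (0, 0, 1) \<omega>) N01"
proof -
  let ?Y = "\<lambda>n \<omega>. c1 n * zt f g h n (1, 0, 0) \<omega> + c2 n * zt f g h n (0, 1, 0) \<omega> + c3 n * zt f g h n (0, 0, 1) \<omega>"
  have ev: "\<forall>\<^sub>F n in sequentially. ?Y n \<in> borel_measurable (M n) \<and> distr (M n) borel (?Y n) = N01"
    using iid_zt[OF fr] c
  proof eventually_elim
    case (elim n)
    let ?K = "{(1, 0, 0), (0, 1, 0), (0, 0, 1)} :: (nat \<times> nat \<times> nat) set"
    define c where "c x = (if x = (1, 0, 0) then c1 n else if x = (0, 1, 0) then c2 n else c3 n)" for x :: "nat \<times> nat \<times> nat"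
    have K: "iid_N01 (M n) ?K (zt f g h n)" by (rule iid_N01_subset) (use elim in \<open>auto simp: box_def\<close>)
    have "iid_N01 (M n) {()} (\<lambda>s \<omega>. \<Sum>x\<in>?K. c x * zt f g h n x \<omega>)"
      by (rule iid_N01_orthonormal[OF K, where c = "\<lambda>_. c"]) (use elim in \<open>auto simp: c_def power2_eq_square\<close>)
    then have "(\<lambda>\<omega>. \<Sum>x\<in>?K. c x * zt f g h n x \<omega>) \<in> borel_measurable (M n)" "distr (M n) borel (\<lambda>\<omega>. \<Sum>x\<in>?K. c x * zt f g h n x \<omega>) = N01"
      using iid_N01_measurable by (fastforce, simp add: iid_N01_def)
    moreover have "(\<lambda>\<omega>. \<Sum>x\<in>?K. c x * zt f g h n x \<omega>) = ?Y n" by (simp add: c_def add.assoc)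
    ultimately show ?case by simp
  qed
  have "(\<lambda>n. integral\<^sup>L (M n) (\<lambda>\<omega>. F (?Y n \<omega>))) \<longlonglongrightarrow> integral\<^sup>L N01 F" if F: "continuous_on UNIV F" for F :: "real \<Rightarrow> real"
  proof (rule tendsto_eventually, use ev in eventually_elim)
    case (elim n)
    have [measurable]: "F \<in> borel_measurable borel" by (rule borel_measurable_continuous_onI[OF F])
    have "integral\<^sup>L (distr (M n) borel (?Y n)) F = integral\<^sup>L (M n) (\<lambda>\<omega>. F (?Y n \<omega>))"
      by (rule integral_distr) (use elim in auto)
    then show ?case using elim by simp
  qed
  then show ?thesis unfolding conv_ev_def using ev by (auto elim: eventually_mono)
qed

text \<open>Relative error of the estimated \<lambda>; it enters a tensor entry as the factor 1 +
  \<kappa>.\<close>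

definition "\<kappa> n \<omega> = lam_hat (p1 n) (p2 n) (p3 n) (A n \<omega>) (Uh n \<omega>) (Vh n \<omega>) (Wh n \<omega>) / lam n - 1"

text \<open>The slopes of all three modes are needed at once, since the estimated \<lambda>
  contracts the observation in every mode. The first-order term E(u, v, w) is the rotated coordinate
  (0, 0, 0) over \<tau>.\<close>

lemma whp_eigenvalue:
  assumes fr: "frame f g h"
  shows "whp M (\<lambda>n \<omega>. \<bar>\<kappa> n \<omega>\<bar> \<le> 2 * (\<bar>zt f g h n (0, 0, 0) \<omega>\<bar> / \<tau> n) + 1000 * (e n)\<^sup>2)"
proof (rule whp_mono[OF whp_good])
  have "\<forall>\<^sub>F n in sequentially. e n < 1/100" by (rule order_tendstoD(2)[OF e_tendsto]) simp
  then show "\<forall>\<^sub>F n in sequentially. \<forall>\<omega>\<in>space (M n). good n \<omega> \<longrightarrow> \<bar>\<kappa> n \<omega>\<bar> \<le> 2 * (\<bar>zt f g h n (0, 0, 0) \<omega>\<bar> / \<tau> n) + 1000 * (e n)\<^sup>2"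
    using fr[unfolded frame_def]
  proof eventually_elim
    case (elim n)
    show ?case
    proof (intro ballI impI)
      fix \<omega> assume G: "good n \<omega>"
      obtain x \<alpha> where x: "inner_d (p1 n) (u n) x = 0" "vnorm (p1 n) x \<le> 10 * e n" "\<forall>i<p1 n. Uh n \<omega> i = \<alpha> * (u n i + x i)" "\<bar>\<alpha> - 1\<bar> \<le> 50 * (e n)\<^sup>2"
        using G unfolding good_def refined_def by blast
      obtain y \<beta> where y: "inner_d (p2 n) (v n) y = 0" "vnorm (p2 n) y \<le> 10 * e n" "\<forall>i<p2 n. Vh n \<omega> i = \<beta> * (v n i + y i)" "\<bar>\<beta> - 1\<bar> \<le> 50 * (e n)\<^sup>2"
        using G unfolding good_def refined_def by blast
      obtain z \<gamma> where z: "inner_d (p3 n) (w n) z = 0" "vnorm (p3 n) z \<le> 10 * e n" "\<forall>i<p3 n. Wh n \<omega> i = \<gamma> * (w n i + z i)" "\<bar>\<gamma> - 1\<bar> \<le> 50 * (e n)\<^sup>2"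
        using G unfolding good_def refined_def by blast
      have tb: "tri_bound (p1 n) (p2 n) (p3 n) (noise (X n) (\<tau> n) \<omega>) (e n)" using G by (simp add: good_def)
      have e1: "e n \<le> 1/100" using elim by simp
      have "\<bar>\<kappa> n \<omega>\<bar> \<le> 2 * \<bar>lam_hat (p1 n) (p2 n) (p3 n) (noise (X n) (\<tau> n) \<omega>) (u n) (v n) (w n)\<bar> + 1000 * (e n)\<^sup>2"
        unfolding \<kappa>_def by (rule lam_hat_error[OF A_noise lam_pos tb e_nonneg e1 units x y z])
      also have "lam_hat (p1 n) (p2 n) (p3 n) (noise (X n) (\<tau> n) \<omega>) (u n) (v n) (w n) = zt f g h n (0, 0, 0) \<omega> / \<tau> n"
        using lam_hat_noise[of "p1 n" "p2 n" "p3 n" "X n" "\<tau> n" \<omega> "f n" 0 "g n" 0 "h n" 0] elim by (simp add: zt_def)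
      finally show "\<bar>\<kappa> n \<omega>\<bar> \<le> 2 * (\<bar>zt f g h n (0, 0, 0) \<omega>\<bar> / \<tau> n) + 1000 * (e n)\<^sup>2" using tau_pos[of n] by simp
    qed
  qed
qed

text \<open>The error is of order 1/\<tau> + P/\<tau>^2: one normal variable over \<tau>, plus e^2.
  Multiplied by \<tau> a, the first part vanishes because a tends to 0 and the second because |a|
  P/\<tau> does. 2304000 is 1000 * 48^2.\<close>

lemma eigenvalue_negligible:
  assumes fr: "frame f g h" and a: "(\<lambda>n. \<bar>a n\<bar> * (P n / \<tau> n)) \<longlonglongrightarrow> 0" "a \<longlonglongrightarrow> 0"
  shows "op0 M (\<lambda>n \<omega>. \<tau> n * a n * \<kappa> n \<omega>)"
proof (rule op0_dominated)
  show "op0 M (\<lambda>n \<omega>. 2 * \<bar>a n * zt f g h n (0, 0, 0) \<omega>\<bar> + 2304000 * (\<bar>a n\<bar> * (P n / \<tau> n)))"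
    by (intro op0_add op0_cmult op0_abs op0_mult_Op1 op0_tendsto a mode1(4)[OF fr])
  show "whp M (\<lambda>n \<omega>. \<bar>\<tau> n * a n * \<kappa> n \<omega>\<bar> \<le> 2 * \<bar>a n * zt f g h n (0, 0, 0) \<omega>\<bar> + 2304000 * (\<bar>a n\<bar> * (P n / \<tau> n)))"
  proof (rule whp_mono[OF whp_eigenvalue[OF fr]], intro always_eventually allI ballI impI)
    fix n \<omega> assume h: "\<bar>\<kappa> n \<omega>\<bar> \<le> 2 * (\<bar>zt f g h n (0, 0, 0) \<omega>\<bar> / \<tau> n) + 1000 * (e n)\<^sup>2"
    note t = tau_pos[of n]
    have "\<bar>\<tau> n * a n * \<kappa> n \<omega>\<bar> = \<tau> n * \<bar>a n\<bar> * \<bar>\<kappa> n \<omega>\<bar>" using t by (simp add: abs_mult)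
    also have "\<dots> \<le> \<tau> n * \<bar>a n\<bar> * (2 * (\<bar>zt f g h n (0, 0, 0) \<omega>\<bar> / \<tau> n) + 1000 * (e n)\<^sup>2)"
      using t by (intro mult_left_mono h) simp
    also have "\<dots> = 2 * \<bar>a n * zt f g h n (0, 0, 0) \<omega>\<bar> + 2304000 * (\<bar>a n\<bar> * (P n / \<tau> n))"
    proof -
      have "(e n)\<^sup>2 = 2304 * P n / (\<tau> n * \<tau> n)" using P_ge1[of n] by (simp add: e_def power2_eq_square)
      then show ?thesis using t by (simp add: abs_mult field_simps)
    qed
    finally show "\<bar>\<tau> n * a n * \<kappa> n \<omega>\<bar> \<le> 2 * \<bar>a n * zt f g h n (0, 0, 0) \<omega>\<bar> + 2304000 * (\<bar>a n\<bar> * (P n / \<tau> n))" .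
  qed
qed

text \<open>The lower bounds on the entries make the relative errors vanish; the upper bounds remove
  the radial bias and the error of \<lambda>. What remains is a unit combination of the three
  index-1 coordinates, with weights taken at the true entries.\<close>

lemma tensor_entry_clt:
  assumes ix: "\<And>n. i n < p1 n" "\<And>n. j n < p2 n" "\<And>n. k n < p3 n"
    and large: "filterlim (\<lambda>n. \<bar>u n (i n)\<bar> / (sig n / lam n)) at_top sequentially"
      "filterlim (\<lambda>n. \<bar>v n (j n)\<bar> / (sig n / lam n)) at_top sequentially"
      "filterlim (\<lambda>n. \<bar>w n (k n)\<bar> / (sig n / lam n)) at_top sequentially"
    and small: "(\<lambda>n. \<bar>u n (i n)\<bar> / min (\<tau> n / P n) (1 / sqrt (ln (P n)))) \<longlonglongrightarrow> 0"
      "(\<lambda>n. \<bar>v n (j n)\<bar> / min (\<tau> n / P n) (1 / sqrt (ln (P n)))) \<longlonglongrightarrow> 0"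
      "(\<lambda>n. \<bar>w n (k n)\<bar> / min (\<tau> n / P n) (1 / sqrt (ln (P n)))) \<longlonglongrightarrow> 0"
  shows "conv_distr M (\<lambda>n \<omega>.
      (lam_hat (p1 n) (p2 n) (p3 n) (A n \<omega>) (Uh n \<omega>) (Vh n \<omega>) (Wh n \<omega>)
         * Uh n \<omega> (i n) * Vh n \<omega> (j n) * Wh n \<omega> (k n)
       - lam n * u n (i n) * v n (j n) * w n (k n)) /
      (sig n * sqrt ((Uh n \<omega> (i n))^2 * (Vh n \<omega> (j n))^2 + (Vh n \<omega> (j n))^2 * (Wh n \<omega> (k n))^2
                     + (Wh n \<omega> (k n))^2 * (Uh n \<omega> (i n))^2))) N01" (is "conv_distr M ?T N01")
proof -
  \<comment> \<open>From exp 1 on, ln P is at least 1, so 1/sqrt (ln P) lies in (0, 1] and division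
    by zero is excluded.\<close>
  have "\<forall>\<^sub>F n in sequentially. exp 1 \<le> P n" using P_top by (simp add: filterlim_at_top)
  then have s: "\<forall>\<^sub>F n in sequentially. 0 < 1 / sqrt (ln (P n)) \<and> 1 / sqrt (ln (P n)) \<le> 1"
  proof eventually_elim
    case (elim n)
    then have "ln (exp 1) \<le> ln (P n)" using P_ge1[of n] by (subst ln_le_cancel_iff) auto
    then show ?case by simp
  qed
  note sm1 = small_coordinate[OF small(1) s] and sm2 = small_coordinate[OF small(2) s] and sm3 = small_coordinate[OF small(3) s]
  obtain f g h where fr: "frame f g h"
    and o: "op0 M (\<lambda>n \<omega>. \<tau> n * (Uh n \<omega> (i n) - u n (i n)) - zt f g h n (1, 0, 0) \<omega>)"
    "op0 M (\<lambda>n \<omega>. \<tau> n * (Vh n \<omega> (j n) - v n (j n)) - zt f g h n (0, 1, 0) \<omega>)"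
    "op0 M (\<lambda>n \<omega>. \<tau> n * (Wh n \<omega> (k n) - w n (k n)) - zt f g h n (0, 0, 1) \<omega>)"
    by (rule coordinate_expansion[OF ix sm1 sm2 sm3])
  have big: "filterlim (\<lambda>n. \<tau> n * \<bar>x n\<bar>) at_top sequentially" if "filterlim (\<lambda>n. \<bar>x n\<bar> / (sig n / lam n)) at_top sequentially" for x
    using that by (simp add: \<tau>_def mult.commute)
  define Den where "Den x y z = sqrt (x\<^sup>2 * y\<^sup>2 + y\<^sup>2 * z\<^sup>2 + z\<^sup>2 * x\<^sup>2)" for x y z :: real
  define D where "D n = Den (u n (i n)) (v n (j n)) (w n (k n))" for n
  define c1 where "c1 n = v n (j n) * w n (k n) / D n" for n
  define c2 where "c2 n = u n (i n) * w n (k n) / D n" for n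
  define c3 where "c3 n = u n (i n) * v n (j n) / D n" for n
  let ?Y = "\<lambda>n \<omega>. c1 n * zt f g h n (1, 0, 0) \<omega> + c2 n * zt f g h n (0, 1, 0) \<omega> + c3 n * zt f g h n (0, 0, 1) \<omega>"
  have "\<forall>\<^sub>F n in sequentially. (c1 n)\<^sup>2 + (c2 n)\<^sup>2 + (c3 n)\<^sup>2 = 1"
  proof -
    have "\<forall>\<^sub>F n in sequentially. 0 < \<tau> n * \<bar>u n (i n)\<bar>" "\<forall>\<^sub>F n in sequentially. 0 < \<tau> n * \<bar>v n (j n)\<bar>" "\<forall>\<^sub>F n in sequentially. 0 < \<tau> n * \<bar>w n (k n)\<bar>"
      using large[THEN big] by (simp_all add: filterlim_at_top_dense)
    then show ?thesis
    proof eventually_elim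
      case (elim n)
      then have "u n (i n) \<noteq> 0" "v n (j n) \<noteq> 0" "w n (k n) \<noteq> 0" by auto
      from weights_sum_squares[OF this] show ?case by (simp add: c1_def c2_def c3_def D_def Den_def)
    qed
  qed
  note conv = combination_clt[OF fr this]
  \<comment> \<open>Dividing by \<open>sig n\<close> and pulling out \<open>lam n\<close> puts the
    statistic into the form treated by \<open>product_delta\<close>.\<close>
  have T: "?T n \<omega> = \<tau> n * ((1 + \<kappa> n \<omega>) * Uh n \<omega> (i n) * Vh n \<omega> (j n) * Wh n \<omega> (k n) - u n (i n) * v n (j n) * w n (k n))
      / Den (Uh n \<omega> (i n)) (Vh n \<omega> (j n)) (Wh n \<omega> (k n))" for n \<omega>
  proof -
    have "lam_hat (p1 n) (p2 n) (p3 n) (A n \<omega>) (Uh n \<omega>) (Vh n \<omega>) (Wh n \<omega>) = lam n * (1 + \<kappa> n \<omega>)"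
      using lam_pos[of n] by (simp add: \<kappa>_def)
    then show ?thesis unfolding Den_def[symmetric] by (simp add: \<tau>_def algebra_simps add_divide_distrib diff_divide_distrib)
  qed
  have op: "op0 M (\<lambda>n \<omega>. ?T n \<omega> - ?Y n \<omega>)"
    unfolding T c1_def c2_def c3_def D_def unfolding Den_def
    by (rule product_delta[OF tau_pos large[THEN big] o mode1(5)[OF fr] mode2(4)[OF fr] mode3(4)[OF fr] eigenvalue_negligible[OF fr sm1]])
  show ?thesis
  proof (rule slutsky[OF prob conv prob_space_N01 sets_N01])
    fix n
    have [measurable]: "(\<lambda>\<omega>. Uh n \<omega> (i n)) \<in> borel_measurable (M n)" "(\<lambda>\<omega>. Vh n \<omega> (j n)) \<in> borel_measurable (M n)"
      "(\<lambda>\<omega>. Wh n \<omega> (k n)) \<in> borel_measurable (M n)"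
      by (intro hat_measurable ix)+
    have [measurable]: "(\<lambda>\<omega>. lam_hat (p1 n) (p2 n) (p3 n) (A n \<omega>) (Uh n \<omega>) (Vh n \<omega>) (Wh n \<omega>)) \<in> borel_measurable (M n)"
      by (intro lam_hat_measurable A_measurable hat_measurable)
    show "?T n \<in> borel_measurable (M n)" by measurable
  next
    fix \<epsilon> :: real assume "\<epsilon> > 0"
    then have "whp M (\<lambda>n \<omega>. \<bar>?T n \<omega> - ?Y n \<omega>\<bar> \<le> \<epsilon>)" using op by (simp only: op0_def)
    then show "whp M (\<lambda>n \<omega>. dist (?Y n \<omega>) (?T n \<omega>) \<le> \<epsilon>)" by (simp only: dist_real_def abs_minus_commute)
  qed
qed

end

theorem theorem7:
  fixes c0 :: real
  assumes "c0 > 0"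
  shows "\<exists>C1>0. \<forall>(p1::nat\<Rightarrow>nat) (p2::nat\<Rightarrow>nat) (p3::nat\<Rightarrow>nat) (lam::nat\<Rightarrow>real) (sig::nat\<Rightarrow>real)
           (u::nat\<Rightarrow>vec) (v::nat\<Rightarrow>vec) (w::nat\<Rightarrow>vec) (M::nat\<Rightarrow>'a measure) (Z::nat\<Rightarrow>'a\<Rightarrow>tensor3)
           (g1::nat\<Rightarrow>tensor3\<Rightarrow>vec) (g2::nat\<Rightarrow>tensor3\<Rightarrow>vec) (g3::nat\<Rightarrow>tensor3\<Rightarrow>vec) (tmax::nat\<Rightarrow>nat).
     tpca_setting c0 p1 p2 p3 lam sig u v w M Z g1 g2 g3 \<and>
     (\<forall>n. C1 * ln (pmax (p1 n) (p2 n) (p3 n)) \<le> real (tmax n)) \<and>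
     filterlim (\<lambda>n. (lam n / sig n) / pmax (p1 n) (p2 n) (p3 n) powr (3/4)) at_top sequentially
     \<longrightarrow>
     (let E = est p1 p2 p3 lam u v w Z g1 g2 g3 tmax;
          Uh = (\<lambda>n \<omega>. fst (E n \<omega>));
          Vh = (\<lambda>n \<omega>. fst (snd (E n \<omega>)));
          Wh = (\<lambda>n \<omega>. snd (snd (E n \<omega>)));
          A = (\<lambda>n \<omega>. obs (lam n) (u n) (v n) (w n) (Z n \<omega>));
          tau = (\<lambda>n. lam n / sig n);
          P = (\<lambda>n. pmax (p1 n) (p2 n) (p3 n))
      in
      (\<forall>q1 q2 q3 :: nat \<Rightarrow> vec.
         (\<forall>n. vnorm (p1 n) (q1 n) = 1 \<and> vnorm (p2 n) (q2 n) = 1 \<and> vnorm (p3 n) (q3 n) = 1) \<longrightarrow>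
         conv_distr M (\<lambda>n \<omega>. (clt_stat (p1 n) (tau n) (q1 n) (u n) (Uh n \<omega>),
                               clt_stat (p2 n) (tau n) (q2 n) (v n) (Vh n \<omega>),
                               clt_stat (p3 n) (tau n) (q3 n) (w n) (Wh n \<omega>))) N3) \<and>
      (\<forall>i j k :: nat \<Rightarrow> nat.
         (\<forall>n. i n < p1 n \<and> j n < p2 n \<and> k n < p3 n) \<longrightarrow>
         (((\<lambda>n. \<bar>u n (i n)\<bar> / min (tau n / P n) 1) \<longlonglongrightarrow> 0) \<and>
          ((\<lambda>n. \<bar>v n (j n)\<bar> / min (tau n / P n) 1) \<longlonglongrightarrow> 0) \<and>
          ((\<lambda>n. \<bar>w n (k n)\<bar> / min (tau n / P n) 1) \<longlonglongrightarrow> 0)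
          \<longrightarrow> conv_distr M (\<lambda>n \<omega>. (tau n * (Uh n \<omega> (i n) - u n (i n)),
                                     tau n * (Vh n \<omega> (j n) - v n (j n)),
                                     tau n * (Wh n \<omega> (k n) - w n (k n)))) N3) \<and>
         (filterlim (\<lambda>n. \<bar>u n (i n)\<bar> / (sig n / lam n)) at_top sequentially \<and>
          filterlim (\<lambda>n. \<bar>v n (j n)\<bar> / (sig n / lam n)) at_top sequentially \<and>
          filterlim (\<lambda>n. \<bar>w n (k n)\<bar> / (sig n / lam n)) at_top sequentially \<and>
          ((\<lambda>n. \<bar>u n (i n)\<bar> / min (tau n / P n) (1 / sqrt (ln (P n)))) \<longlonglongrightarrow> 0) \<and>
          ((\<lambda>n. \<bar>v n (j n)\<bar> / min (tau n / P n) (1 / sqrt (ln (P n)))) \<longlonglongrightarrow> 0) \<and>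
          ((\<lambda>n. \<bar>w n (k n)\<bar> / min (tau n / P n) (1 / sqrt (ln (P n)))) \<longlonglongrightarrow> 0)
          \<longrightarrow> conv_distr M (\<lambda>n \<omega>.
                (lam_hat (p1 n) (p2 n) (p3 n) (A n \<omega>) (Uh n \<omega>) (Vh n \<omega>) (Wh n \<omega>)
                   * Uh n \<omega> (i n) * Vh n \<omega> (j n) * Wh n \<omega> (k n)
                 - lam n * u n (i n) * v n (j n) * w n (k n)) /
                (sig n * sqrt ((Uh n \<omega> (i n))^2 * (Vh n \<omega> (j n))^2 + (Vh n \<omega> (j n))^2 * (Wh n \<omega> (k n))^2
                               + (Wh n \<omega> (k n))^2 * (Uh n \<omega> (i n))^2))) N01)))"
\<comment> \<open>C1 = 1 suffices: ln P tends to infinity, so the assumed bound forces at least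
  three sweeps eventually. The constant depends neither on c0 nor on the sequence.\<close>
proof (rule exI[of _ 1], intro conjI allI impI, simp, elim conjE)
  fix p1 p2 p3 :: "nat \<Rightarrow> nat" and lam sig :: "nat \<Rightarrow> real" and u v w :: "nat \<Rightarrow> vec"
    and M :: "nat \<Rightarrow> 'a measure" and Z :: "nat \<Rightarrow> 'a \<Rightarrow> tensor3" and g1 g2 g3 :: "nat \<Rightarrow> tensor3 \<Rightarrow> vec" and tmax :: "nat \<Rightarrow> nat"
  assume setting: "tpca_setting c0 p1 p2 p3 lam sig u v w M Z g1 g2 g3"
    and tm: "\<forall>n. 1 * ln (pmax (p1 n) (p2 n) (p3 n)) \<le> real (tmax n)"
    and signal: "filterlim (\<lambda>n. (lam n / sig n) / pmax (p1 n) (p2 n) (p3 n) powr (3/4)) at_top sequentially"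
  have top: "filterlim (\<lambda>n. pmax (p1 n) (p2 n) (p3 n)) at_top sequentially"
    using setting unfolding tpca_setting_def by blast
  have "\<forall>\<^sub>F n in sequentially. 3 \<le> ln (pmax (p1 n) (p2 n) (p3 n))"
    using filterlim_compose[OF ln_at_top top] by (simp add: filterlim_at_top)
  then have tmax3: "\<forall>\<^sub>F n in sequentially. 3 \<le> tmax n"
  proof eventually_elim
    case (elim n)
    then have "3 \<le> real (tmax n)" using tm[rule_format, of n] by linarith
    then show ?case by simp
  qed
  interpret tpca c0 p1 p2 p3 lam sig u v w M Z g1 g2 g3 tmax
    by unfold_locales (fact assms setting tmax3 signal)+
  note defs = estimates_def[symmetric] Uh_def[symmetric] Vh_def[symmetric] Wh_def[symmetric] A_def[symmetric] \<tau>_def[symmetric] P_def[symmetric]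
  show "let E = est p1 p2 p3 lam u v w Z g1 g2 g3 tmax;
          Uh = (\<lambda>n \<omega>. fst (E n \<omega>));
          Vh = (\<lambda>n \<omega>. fst (snd (E n \<omega>)));
          Wh = (\<lambda>n \<omega>. snd (snd (E n \<omega>)));
          A = (\<lambda>n \<omega>. obs (lam n) (u n) (v n) (w n) (Z n \<omega>));
          tau = (\<lambda>n. lam n / sig n);
          P = (\<lambda>n. pmax (p1 n) (p2 n) (p3 n))
      in
      (\<forall>q1 q2 q3 :: nat \<Rightarrow> vec.
         (\<forall>n. vnorm (p1 n) (q1 n) = 1 \<and> vnorm (p2 n) (q2 n) = 1 \<and> vnorm (p3 n) (q3 n) = 1) \<longrightarrow>
         conv_distr M (\<lambda>n \<omega>. (clt_stat (p1 n) (tau n) (q1 n) (u n) (Uh n \<omega>),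
                               clt_stat (p2 n) (tau n) (q2 n) (v n) (Vh n \<omega>),
                               clt_stat (p3 n) (tau n) (q3 n) (w n) (Wh n \<omega>))) N3) \<and>
      (\<forall>i j k :: nat \<Rightarrow> nat.
         (\<forall>n. i n < p1 n \<and> j n < p2 n \<and> k n < p3 n) \<longrightarrow>
         (((\<lambda>n. \<bar>u n (i n)\<bar> / min (tau n / P n) 1) \<longlonglongrightarrow> 0) \<and>
          ((\<lambda>n. \<bar>v n (j n)\<bar> / min (tau n / P n) 1) \<longlonglongrightarrow> 0) \<and>
          ((\<lambda>n. \<bar>w n (k n)\<bar> / min (tau n / P n) 1) \<longlonglongrightarrow> 0)
          \<longrightarrow> conv_distr M (\<lambda>n \<omega>. (tau n * (Uh n \<omega> (i n) - u n (i n)),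
                                     tau n * (Vh n \<omega> (j n) - v n (j n)),
                                     tau n * (Wh n \<omega> (k n) - w n (k n)))) N3) \<and>
         (filterlim (\<lambda>n. \<bar>u n (i n)\<bar> / (sig n / lam n)) at_top sequentially \<and>
          filterlim (\<lambda>n. \<bar>v n (j n)\<bar> / (sig n / lam n)) at_top sequentially \<and>
          filterlim (\<lambda>n. \<bar>w n (k n)\<bar> / (sig n / lam n)) at_top sequentially \<and>
          ((\<lambda>n. \<bar>u n (i n)\<bar> / min (tau n / P n) (1 / sqrt (ln (P n)))) \<longlonglongrightarrow> 0) \<and>
          ((\<lambda>n. \<bar>v n (j n)\<bar> / min (tau n / P n) (1 / sqrt (ln (P n)))) \<longlonglongrightarrow> 0) \<and>
          ((\<lambda>n. \<bar>w n (k n)\<bar> / min (tau n / P n) (1 / sqrt (ln (P n)))) \<longlonglongrightarrow> 0)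
          \<longrightarrow> conv_distr M (\<lambda>n \<omega>.
                (lam_hat (p1 n) (p2 n) (p3 n) (A n \<omega>) (Uh n \<omega>) (Vh n \<omega>) (Wh n \<omega>)
                   * Uh n \<omega> (i n) * Vh n \<omega> (j n) * Wh n \<omega> (k n)
                 - lam n * u n (i n) * v n (j n) * w n (k n)) /
                (sig n * sqrt ((Uh n \<omega> (i n))^2 * (Vh n \<omega> (j n))^2 + (Vh n \<omega> (j n))^2 * (Wh n \<omega> (k n))^2
                               + (Wh n \<omega> (k n))^2 * (Uh n \<omega> (i n))^2))) N01))"
    unfolding Let_def defs
  proof (intro conjI allI impI; (elim conjE)?)
    fix q1 q2 q3 :: "nat \<Rightarrow> vec"
    assume "\<forall>n. vnorm (p1 n) (q1 n) = 1 \<and> vnorm (p2 n) (q2 n) = 1 \<and> vnorm (p3 n) (q3 n) = 1"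
    then show "conv_distr M (\<lambda>n \<omega>. (clt_stat (p1 n) (\<tau> n) (q1 n) (u n) (Uh n \<omega>), clt_stat (p2 n) (\<tau> n) (q2 n) (v n) (Vh n \<omega>),
       clt_stat (p3 n) (\<tau> n) (q3 n) (w n) (Wh n \<omega>))) N3"
      by (intro linear_functionals_clt) auto
  next
    fix i j k :: "nat \<Rightarrow> nat"
    assume ix: "\<forall>n. i n < p1 n \<and> j n < p2 n \<and> k n < p3 n"
      and lim: "(\<lambda>n. \<bar>u n (i n)\<bar> / min (\<tau> n / P n) 1) \<longlonglongrightarrow> 0" "(\<lambda>n. \<bar>v n (j n)\<bar> / min (\<tau> n / P n) 1) \<longlonglongrightarrow> 0"
        "(\<lambda>n. \<bar>w n (k n)\<bar> / min (\<tau> n / P n) 1) \<longlonglongrightarrow> 0"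
    show "conv_distr M (\<lambda>n \<omega>. (\<tau> n * (Uh n \<omega> (i n) - u n (i n)), \<tau> n * (Vh n \<omega> (j n) - v n (j n)), \<tau> n * (Wh n \<omega> (k n) - w n (k n)))) N3"
      by (rule entries_clt[OF _ _ _ lim]) (use ix in auto)
  next
    fix i j k :: "nat \<Rightarrow> nat"
    assume ix: "\<forall>n. i n < p1 n \<and> j n < p2 n \<and> k n < p3 n"
      and large: "filterlim (\<lambda>n. \<bar>u n (i n)\<bar> / (sig n / lam n)) at_top sequentially"
      "filterlim (\<lambda>n. \<bar>v n (j n)\<bar> / (sig n / lam n)) at_top sequentially"
      "filterlim (\<lambda>n. \<bar>w n (k n)\<bar> / (sig n / lam n)) at_top sequentially"
      and small: "(\<lambda>n. \<bar>u n (i n)\<bar> / min (\<tau> n / P n) (1 / sqrt (ln (P n)))) \<longlonglongrightarrow> 0"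
      "(\<lambda>n. \<bar>v n (j n)\<bar> / min (\<tau> n / P n) (1 / sqrt (ln (P n)))) \<longlonglongrightarrow> 0"
      "(\<lambda>n. \<bar>w n (k n)\<bar> / min (\<tau> n / P n) (1 / sqrt (ln (P n)))) \<longlonglongrightarrow> 0"
    show "conv_distr M (\<lambda>n \<omega>.
      (lam_hat (p1 n) (p2 n) (p3 n) (A n \<omega>) (Uh n \<omega>) (Vh n \<omega>) (Wh n \<omega>)
         * Uh n \<omega> (i n) * Vh n \<omega> (j n) * Wh n \<omega> (k n)
       - lam n * u n (i n) * v n (j n) * w n (k n)) /
      (sig n * sqrt ((Uh n \<omega> (i n))^2 * (Vh n \<omega> (j n))^2 + (Vh n \<omega> (j n))^2 * (Wh n \<omega> (k n))^2
                     + (Wh n \<omega> (k n))^2 * (Uh n \<omega> (i n))^2))) N01"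
      by (rule tensor_entry_clt[OF _ _ _ large small]) (use ix in auto)
  qed
qed

end
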